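(* Let $1\le p\le n$ and let $\{B_{uv}(t)\}_{1\le u\le n,\,1\le v\le p}$ be independent one-dimensional standard Brownian motions. Suppose that $W(t)$ is the $\mathcal{M}_{n,p}$-valued solution of the Stratonovich SDE $$\mathrm{d}W(t)=\sum_{u=1}^n\sum_{v=1}^p\bigl(E_{uv}-\alpha WE_{uv}^\top W-\beta WW^\top E_{uv}\bigr)\circ\mathrm{d}B_{uv}(t).$$ Then $W(t)$ is driven by half of the Laplace–Beltrami operator $\Delta_{\mathcal{M}_{n,p}}$ of the Stiefel manifold with the canonical metric; that is, for every smooth function $\varphi$ on $\mathcal{M}_{n,p}$ and every $w_0\in\mathcal{M}_{n,p}$, $$\frac12\Delta_{\mathcal{M}_{n,p}}\varphi(w_0)=\mathcal{L}\varphi(w_0):=\lim_{t\to0+}\frac{\mathbb{E}[\varphi(W(t))\mid W(0)=w_0]-\varphi(w_0)}{t}.$$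
   Context: $\mathcal{M}_{n,p}=\{X\in\mathbb{R}^{n\times p}: X^\top X=I_p\}$ is the Stiefel manifold, with tangent space $\mathcal{T}_X\mathcal{M}_{n,p}=\{Z\in\mathbb{R}^{n\times p}: Z^\top X+X^\top Z=0\}$ and canonical Riemannian metric $g^c(Z_1,Z_2)=\mathrm{tr}\bigl(Z_1^\top(I-\tfrac12XX^\top)Z_2\bigr)$. $E_{uv}\in\mathbb{R}^{n\times p}$ is the matrix with $(u,v)$ entry equal to $1$ and all other entries $0$. The constants are $\alpha=\sqrt2/2$ and $\beta=1-\sqrt2/2$. The symbol $\circ\,\mathrm{d}B$ denotes the Stratonovich differential. The SDE is considered with initial point $W(0)\in\mathcal{M}_{n,p}$; the solution then stays on $\mathcal{M}_{n,p}$ almost surely. Off the manifold the coefficients may be replaced by smooth globally Lipschitz extensions of their restrictions to $\mathcal{M}_{n,p}$; the solution does not depend on that choice. *)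

theory Defs
  imports "HOL-Probability.Probability"
begin

section \<open>Smoothness\<close>

text \<open>\<open>Ck_on k U f\<close> is meant for open \<open>U\<close>; in finite dimension it says that all iterated
  directional derivatives of order at most \<open>k\<close> exist and are continuous on \<open>U\<close>.\<close>

primrec Ck_on ::
  "nat \<Rightarrow> 'a::real_normed_vector set \<Rightarrow> ('a \<Rightarrow> 'b::real_normed_vector) \<Rightarrow> bool"
where
  "Ck_on 0 = (\<lambda>U f. continuous_on U f)"
| "Ck_on (Suc k) = (\<lambda>U f. (\<forall>x\<in>U. f differentiable (at x)) \<and>
     (\<forall>v. Ck_on k U (\<lambda>x. frechet_derivative f (at x) v)))"

definition smooth_on ::
  "'a::real_normed_vector set \<Rightarrow> ('a \<Rightarrow> 'b::real_normed_vector) \<Rightarrow> bool"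
where "smooth_on U f \<longleftrightarrow> (\<forall>k. Ck_on k U f)"

text \<open>A function on an embedded submanifold \<open>M\<close> is a total function whose values off \<open>M\<close> are
  ignored. It is smooth iff it extends locally to a smooth function on the ambient space.\<close>

definition smooth_on_submanifold ::
  "'a::real_normed_vector set \<Rightarrow> ('a \<Rightarrow> 'b::real_normed_vector) \<Rightarrow> bool"
where "smooth_on_submanifold M f \<longleftrightarrow>
  (\<forall>x\<in>M. \<exists>U h. open U \<and> x \<in> U \<and> smooth_on U h \<and> (\<forall>y\<in>U \<inter> M. h y = f y))"

section \<open>Riemannian geometry of embedded submanifolds\<close>

text \<open>Throughout, \<open>M\<close> is the submanifold, \<open>T x\<close> its tangent space at \<open>x\<close> (as a subspace of the
  ambient space) and \<open>g x\<close> the metric on \<open>T x\<close>.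

  Derivatives are taken within \<open>M\<close>. A derivative within \<open>M\<close> is in general not unique as a linear
  map on the ambient space, but its values on tangent vectors are; \<open>mderiv M f x v\<close> is only used
  for \<open>v \<in> T x\<close>.\<close>

definition mderiv ::
  "'a::real_normed_vector set \<Rightarrow> ('a \<Rightarrow> 'b::real_normed_vector) \<Rightarrow> 'a \<Rightarrow> 'a \<Rightarrow> 'b"
where "mderiv M f x v = frechet_derivative f (at x within M) v"

definition smooth_vector_field ::
  "'a::real_normed_vector set \<Rightarrow> ('a \<Rightarrow> 'a set) \<Rightarrow> ('a \<Rightarrow> 'a) \<Rightarrow> bool"
where "smooth_vector_field M T X \<longleftrightarrow>
  smooth_on_submanifold M X \<and> (\<forall>x\<in>M. X x \<in> T x)"

definition lie_bracket ::
  "'a::real_normed_vector set \<Rightarrow> ('a \<Rightarrow> 'a) \<Rightarrow> ('a \<Rightarrow> 'a) \<Rightarrow> 'a \<Rightarrow> 'a"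
where "lie_bracket M X Y x = mderiv M Y x (X x) - mderiv M X x (Y x)"

text \<open>\<open>D x v Y\<close> stands for the covariant derivative of the vector field \<open>Y\<close> at \<open>x\<close> in the
  direction \<open>v \<in> T x\<close>.\<close>

definition affine_connection ::
  "'a::real_normed_vector set \<Rightarrow> ('a \<Rightarrow> 'a set) \<Rightarrow> ('a \<Rightarrow> 'a \<Rightarrow> ('a \<Rightarrow> 'a) \<Rightarrow> 'a) \<Rightarrow> bool"
where "affine_connection M T D \<longleftrightarrow>
  (\<forall>X Y. smooth_vector_field M T X \<longrightarrow> smooth_vector_field M T Y \<longrightarrow>
     smooth_vector_field M T (\<lambda>x. D x (X x) Y)) \<and>
  (\<forall>Y. smooth_vector_field M T Y \<longrightarrow>
     (\<forall>x\<in>M. \<forall>u\<in>T x. \<forall>v\<in>T x. \<forall>a b.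
        D x (a *\<^sub>R u + b *\<^sub>R v) Y = a *\<^sub>R D x u Y + b *\<^sub>R D x v Y)) \<and>
  (\<forall>Y Z. smooth_vector_field M T Y \<longrightarrow> smooth_vector_field M T Z \<longrightarrow>
     (\<forall>x\<in>M. \<forall>v\<in>T x. D x v (\<lambda>y. Y y + Z y) = D x v Y + D x v Z)) \<and>
  (\<forall>(f::'a \<Rightarrow> real) Y. smooth_on_submanifold M f \<longrightarrow> smooth_vector_field M T Y \<longrightarrow>
     (\<forall>x\<in>M. \<forall>v\<in>T x. D x v (\<lambda>y. f y *\<^sub>R Y y) = mderiv M f x v *\<^sub>R Y x + f x *\<^sub>R D x v Y))"

definition is_levi_civita ::
  "'a::real_normed_vector set \<Rightarrow> ('a \<Rightarrow> 'a set) \<Rightarrow> ('a \<Rightarrow> 'a \<Rightarrow> 'a \<Rightarrow> real) \<Rightarrow>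
   ('a \<Rightarrow> 'a \<Rightarrow> ('a \<Rightarrow> 'a) \<Rightarrow> 'a) \<Rightarrow> bool"
where "is_levi_civita M T g D \<longleftrightarrow> affine_connection M T D \<and>
  (\<forall>X Y. smooth_vector_field M T X \<longrightarrow> smooth_vector_field M T Y \<longrightarrow>
     (\<forall>x\<in>M. D x (X x) Y - D x (Y x) X = lie_bracket M X Y x)) \<and>
  (\<forall>Y Z. smooth_vector_field M T Y \<longrightarrow> smooth_vector_field M T Z \<longrightarrow>
     (\<forall>x\<in>M. \<forall>v\<in>T x.
        mderiv M (\<lambda>y. g y (Y y) (Z y)) x v = g x (D x v Y) (Z x) + g x (Y x) (D x v Z)))"

text \<open>By the fundamental theorem of Riemannian geometry, on tangent vectors at points of \<open>M\<close> and
  smooth vector fields the following choice is determined by \<open>M\<close>, \<open>T\<close> and \<open>g\<close>.\<close>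

definition levi_civita ::
  "'a::real_normed_vector set \<Rightarrow> ('a \<Rightarrow> 'a set) \<Rightarrow> ('a \<Rightarrow> 'a \<Rightarrow> 'a \<Rightarrow> real) \<Rightarrow>
   'a \<Rightarrow> 'a \<Rightarrow> ('a \<Rightarrow> 'a) \<Rightarrow> 'a"
where "levi_civita M T g = (SOME D. is_levi_civita M T g D)"

definition riemannian_gradient ::
  "'a::real_normed_vector set \<Rightarrow> ('a \<Rightarrow> 'a set) \<Rightarrow> ('a \<Rightarrow> 'a \<Rightarrow> 'a \<Rightarrow> real) \<Rightarrow>
   ('a \<Rightarrow> real) \<Rightarrow> 'a \<Rightarrow> 'a"
where "riemannian_gradient M T g f x =
  (THE v. v \<in> T x \<and> (\<forall>u\<in>T x. g x v u = mderiv M f x u))"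

definition orthonormal_basis ::
  "'a::real_vector set \<Rightarrow> ('a \<Rightarrow> 'a \<Rightarrow> real) \<Rightarrow> 'a set \<Rightarrow> bool"
where "orthonormal_basis V h E \<longleftrightarrow>
  finite E \<and> span E = V \<and> (\<forall>e\<in>E. \<forall>e'\<in>E. h e e' = (if e = e' then 1 else 0))"

text \<open>The divergence is the trace of \<open>v \<mapsto> D x v Y\<close> on \<open>T x\<close>, which does not depend on the
  orthonormal basis.\<close>

definition riemannian_divergence ::
  "'a::real_normed_vector set \<Rightarrow> ('a \<Rightarrow> 'a set) \<Rightarrow> ('a \<Rightarrow> 'a \<Rightarrow> 'a \<Rightarrow> real) \<Rightarrow>
   ('a \<Rightarrow> 'a) \<Rightarrow> 'a \<Rightarrow> real"
where "riemannian_divergence M T g Y x =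
  (\<Sum>e\<in>(SOME E. orthonormal_basis (T x) (g x) E). g x (levi_civita M T g x e Y) e)"

definition laplace_beltrami ::
  "'a::real_normed_vector set \<Rightarrow> ('a \<Rightarrow> 'a set) \<Rightarrow> ('a \<Rightarrow> 'a \<Rightarrow> 'a \<Rightarrow> real) \<Rightarrow>
   ('a \<Rightarrow> real) \<Rightarrow> 'a \<Rightarrow> real"
where "laplace_beltrami M T g f = riemannian_divergence M T g (riemannian_gradient M T g f)"

section \<open>The Stiefel manifold\<close>

definition stiefel :: "(real^'p^'n) set"
where "stiefel = {X. transpose X ** X = mat 1}"

definition stiefel_tangent :: "real^'p^'n \<Rightarrow> (real^'p^'n) set"
where "stiefel_tangent X = {Z. transpose Z ** X + transpose X ** Z = 0}"

definition canonical_metric :: "real^'p^'n \<Rightarrow> real^'p^'n \<Rightarrow> real^'p^'n \<Rightarrow> real"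
where "canonical_metric X Z1 Z2 =
  trace (transpose Z1 ** (mat 1 - (1/2) *\<^sub>R (X ** transpose X)) ** Z2)"

section \<open>Stochastic processes\<close>

text \<open>Processes and filtrations have time parameter in \<open>real\<close>; only times \<open>t \<ge> 0\<close> matter.\<close>

definition standard_brownian_motion ::
  "'w measure \<Rightarrow> (real \<Rightarrow> 'w \<Rightarrow> real) \<Rightarrow> bool"
where "standard_brownian_motion M B \<longleftrightarrow>
  (\<forall>t\<ge>0. B t \<in> borel_measurable M) \<and>
  (AE \<omega> in M. B 0 \<omega> = 0) \<and>
  (AE \<omega> in M. continuous_on {0..} (\<lambda>t. B t \<omega>)) \<and>
  (\<forall>s t. 0 \<le> s \<longrightarrow> s < t \<longrightarrow>
     distributed M lborel (\<lambda>\<omega>. B t \<omega> - B s \<omega>) (normal_density 0 (sqrt (t - s)))) \<and>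
  (\<forall>(k::nat) \<tau>. 0 \<le> \<tau> 0 \<longrightarrow> (\<forall>i<k. \<tau> i \<le> \<tau> (Suc i)) \<longrightarrow>
     prob_space.indep_vars M (\<lambda>_. borel) (\<lambda>i \<omega>. B (\<tau> (Suc i)) \<omega> - B (\<tau> i) \<omega>) {..<k})"

text \<open>A finite family of independent (as random paths) standard Brownian motions, relative to the
  filtration \<open>F\<close>: the family is adapted, and its joint increments after time \<open>s\<close> are independent
  of \<open>F s\<close>.\<close>

definition independent_brownian_motions ::
  "'w measure \<Rightarrow> (real \<Rightarrow> 'w measure) \<Rightarrow> ('i::finite \<Rightarrow> real \<Rightarrow> 'w \<Rightarrow> real) \<Rightarrow> bool"
where "independent_brownian_motions M F B \<longleftrightarrow>
  (\<forall>i. standard_brownian_motion M (B i)) \<and>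
  prob_space.indep_vars M (\<lambda>_. PiM {0..} (\<lambda>_. borel)) (\<lambda>i \<omega>. \<lambda>t\<in>{0..}. B i t \<omega>) UNIV \<and>
  (\<forall>i. \<forall>t\<ge>0. B i t \<in> borel_measurable (F t)) \<and>
  (\<forall>s t. 0 \<le> s \<longrightarrow> s \<le> t \<longrightarrow>
     prob_space.indep_set M (sets (F s))
       (sets (vimage_algebra (space M) (\<lambda>\<omega>. (\<chi> i. B i t \<omega> - B i s \<omega>) :: real^'i) borel)))"

definition is_partition :: "real \<Rightarrow> nat \<Rightarrow> (nat \<Rightarrow> real) \<Rightarrow> bool"
where "is_partition t N \<pi> \<longleftrightarrow> \<pi> 0 = 0 \<and> \<pi> N = t \<and> (\<forall>k<N. \<pi> k \<le> \<pi> (Suc k))"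

definition locally_bounded_variation :: "(real \<Rightarrow> real) \<Rightarrow> bool"
where "locally_bounded_variation a \<longleftrightarrow>
  (\<forall>t\<ge>0. \<exists>K. \<forall>N \<pi>. is_partition t N \<pi> \<longrightarrow> (\<Sum>k<N. \<bar>a (\<pi> (Suc k)) - a (\<pi> k)\<bar>) \<le> K)"

definition martingale ::
  "'w measure \<Rightarrow> (real \<Rightarrow> 'w measure) \<Rightarrow> (real \<Rightarrow> 'w \<Rightarrow> real) \<Rightarrow> bool"
where "martingale M F X \<longleftrightarrow>
  (\<forall>t\<ge>0. X t \<in> borel_measurable (F t) \<and> integrable M (X t)) \<and>
  (\<forall>s t. 0 \<le> s \<longrightarrow> s \<le> t \<longrightarrow> (AE \<omega> in M. real_cond_exp M (F s) (X t) \<omega> = X s \<omega>))"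

definition continuous_adapted ::
  "'w measure \<Rightarrow> (real \<Rightarrow> 'w measure) \<Rightarrow> (real \<Rightarrow> 'w \<Rightarrow> 'a::topological_space) \<Rightarrow> bool"
where "continuous_adapted M F X \<longleftrightarrow>
  (\<forall>t\<ge>0. X t \<in> borel_measurable (F t)) \<and>
  (AE \<omega> in M. continuous_on {0..} (\<lambda>t. X t \<omega>))"

definition continuous_local_martingale ::
  "'w measure \<Rightarrow> (real \<Rightarrow> 'w measure) \<Rightarrow> (real \<Rightarrow> 'w \<Rightarrow> real) \<Rightarrow> bool"
where "continuous_local_martingale M F X \<longleftrightarrow> continuous_adapted M F X \<and>
  (\<exists>\<tau>::nat \<Rightarrow> 'w \<Rightarrow> real.
     (\<forall>n. stopping_time F (\<tau> n) \<and> (\<forall>\<omega>\<in>space M. 0 \<le> \<tau> n \<omega>)) \<and>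
     (AE \<omega> in M. incseq (\<lambda>n. \<tau> n \<omega>) \<and> filterlim (\<lambda>n. \<tau> n \<omega>) at_top sequentially) \<and>
     (\<forall>n. martingale M F (\<lambda>t \<omega>. X (min t (\<tau> n \<omega>)) \<omega>)))"

definition continuous_semimartingale ::
  "'w measure \<Rightarrow> (real \<Rightarrow> 'w measure) \<Rightarrow> (real \<Rightarrow> 'w \<Rightarrow> real) \<Rightarrow> bool"
where "continuous_semimartingale M F X \<longleftrightarrow> continuous_adapted M F X \<and>
  (\<exists>L A. continuous_local_martingale M F L \<and> (AE \<omega> in M. L 0 \<omega> = 0) \<and>
     continuous_adapted M F A \<and> (AE \<omega> in M. locally_bounded_variation (\<lambda>t. A t \<omega>)) \<and>
     (AE \<omega> in M. \<forall>t\<ge>0. X t \<omega> = L t \<omega> + A t \<omega>))"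

section \<open>Stratonovich integrals and equations\<close>

text \<open>The random variable \<open>I\<close> is the Stratonovich integral of \<open>Y\<close> against \<open>B\<close> over \<open>[0, t]\<close>: the
  limit in probability of the trapezoidal sums as the mesh of the partition tends to 0.\<close>

definition trapezoidal_sum ::
  "(real \<Rightarrow> 'w \<Rightarrow> 'a::real_vector) \<Rightarrow> (real \<Rightarrow> 'w \<Rightarrow> real) \<Rightarrow> nat \<Rightarrow> (nat \<Rightarrow> real) \<Rightarrow> 'w \<Rightarrow> 'a"
where "trapezoidal_sum Y B N \<pi> \<omega> =
  (\<Sum>k<N. (B (\<pi> (Suc k)) \<omega> - B (\<pi> k) \<omega>) *\<^sub>R ((1/2) *\<^sub>R (Y (\<pi> k) \<omega> + Y (\<pi> (Suc k)) \<omega>)))"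

definition has_stratonovich_integral ::
  "'w measure \<Rightarrow> (real \<Rightarrow> 'w \<Rightarrow> 'a::euclidean_space) \<Rightarrow> (real \<Rightarrow> 'w \<Rightarrow> real) \<Rightarrow> real \<Rightarrow>
   ('w \<Rightarrow> 'a) \<Rightarrow> bool"
where "has_stratonovich_integral M Y B t I \<longleftrightarrow>
  (\<forall>s\<ge>0. Y s \<in> borel_measurable M \<and> B s \<in> borel_measurable M) \<and>
  I \<in> borel_measurable M \<and>
  (\<forall>\<epsilon>>0. \<exists>\<delta>>0. \<forall>N \<pi>. is_partition t N \<pi> \<longrightarrow> (\<forall>k<N. \<pi> (Suc k) - \<pi> k < \<delta>) \<longrightarrow>
     measure M {\<omega> \<in> space M. \<epsilon> < dist (trapezoidal_sum Y B N \<pi> \<omega>) (I \<omega>)} < \<epsilon>)"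

text \<open>\<open>X\<close> is a semimartingale solution of the equation with diffusion fields \<open>\<sigma> i\<close>, no drift and
  driving Brownian motions \<open>B i\<close>.\<close>

definition stratonovich_solution ::
  "'w measure \<Rightarrow> (real \<Rightarrow> 'w measure) \<Rightarrow> ('i::finite \<Rightarrow> real \<Rightarrow> 'w \<Rightarrow> real) \<Rightarrow>
   ('i \<Rightarrow> 'a::euclidean_space \<Rightarrow> 'a) \<Rightarrow> (real \<Rightarrow> 'w \<Rightarrow> 'a) \<Rightarrow> bool"
where "stratonovich_solution M F B \<sigma> X \<longleftrightarrow>
  continuous_adapted M F X \<and>
  (\<forall>b\<in>Basis. continuous_semimartingale M F (\<lambda>t \<omega>. X t \<omega> \<bullet> b)) \<and>
  (\<forall>t\<ge>0. \<exists>I. (\<forall>i. has_stratonovich_integral M (\<lambda>s \<omega>. \<sigma> i (X s \<omega>)) (B i) t (I i)) \<and>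
     (AE \<omega> in M. X t \<omega> = X 0 \<omega> + (\<Sum>i\<in>UNIV. I i \<omega>)))"

section \<open>The equation on the Stiefel manifold\<close>

definition matrix_unit :: "'n \<Rightarrow> 'p \<Rightarrow> real^'p^'n"
where "matrix_unit u v = (\<chi> i j. if i = u \<and> j = v then 1 else 0)"

definition stiefel_alpha :: real where "stiefel_alpha = sqrt 2 / 2"

definition stiefel_beta :: real where "stiefel_beta = 1 - sqrt 2 / 2"

definition stiefel_field :: "'n \<times> 'p \<Rightarrow> real^'p^'n \<Rightarrow> real^'p^'n"
where "stiefel_field = (\<lambda>(u, v) W. matrix_unit u v
   - stiefel_alpha *\<^sub>R (W ** transpose (matrix_unit u v) ** W)
   - stiefel_beta *\<^sub>R (W ** transpose W ** matrix_unit u v))"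

end

theory Submission
  imports Defs
begin

text \<open>
  The solution \<open>W\<close> is only known as a limit in probability of trapezoidal sums. Such a sum is the
  sum of the left-point steps \<open>\<sigma>\<^sub>i(W\<^sub>k) \<Delta>B\<^sub>i\<close>, which are orthogonal in \<open>L\<^sup>2\<close>, and of the corrections
  \<open>(1/2) \<Delta>\<sigma>\<^sub>i \<Delta>B\<^sub>i\<close>. The semimartingale property is needed for one thing: up to a small event, the
  expected square variation of \<open>W\<close> is bounded uniformly in the grid. Hence, comparing a grid with a
  refinement of it, \<open>\<Delta>W\<close> may be replaced by its left-point step inside the corrections, and
  \<open>W(t) - W(0)\<close> minus the left-point sum converges in probability to the integral of the drift
  \<open>(1/2) \<Sum>\<^sub>i D\<sigma>\<^sub>i[\<sigma>\<^sub>i]\<close>. Consequently \<open>W(t) - w\<^sub>0\<close> is \<open>\<Sum>\<^sub>i \<sigma>\<^sub>i(w\<^sub>0) B\<^sub>i(t)\<close> up to \<open>o(t)\<close> in mean square, its mean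
  is \<open>t\<close> times the drift up to \<open>o(t)\<close>, and a second-order Taylor expansion of \<open>\<phi>\<close> shows that the
  generator is \<open>(1/2) \<Sum>\<^sub>i \<sigma>\<^sub>i \<sigma>\<^sub>i \<phi>\<close>; no Ito formula is used.

  On the geometric side the fields satisfy \<open>\<Sum>\<^sub>i \<sigma>\<^sub>i \<otimes> \<sigma>\<^sub>i = g\<^sup>-\<^sup>1\<close>, so \<open>\<Delta>\<phi>\<close> is \<open>\<Sum>\<^sub>i \<sigma>\<^sub>i \<sigma>\<^sub>i \<phi>\<close> minus the derivative of
  \<open>\<phi>\<close> along \<open>\<Sum>\<^sub>i \<nabla>\<sigma>\<^sub>i[\<sigma>\<^sub>i]\<close>, and that sum of accelerations vanishes for this choice of \<open>\<alpha>\<close> and \<open>\<beta>\<close>.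
\<close>

section \<open>Brownian increments\<close>

text \<open>The square variation of \<open>W\<close> is bounded but does not tend to 0, so the fine
  corrections inside a coarse cell are not small by themselves. What removes them is the extra
  factor \<Delta>B of the coarse cell, uniformly small outside an event of small probability. The
  refinement is chosen after the coarse grid, so that the defects of all its cells can be added up.

  Convergence in probability says nothing about expectations. These come from compactness:
  \<open>W\<close> is bounded, the sums have second moments bounded uniformly in the grid, and
  truncation does the rest.

  The constants enter through \<alpha> + \<beta> = 1 and \<open>\<alpha>\<^sup>2 = 1/2\<close>. They
  make \<open>I - \<beta> x x\<^sup>T\<close> a square root of the metric tensor, which gives the
  frame identity, and they reduce each acceleration to terms that depend linearly on
  \<open>E x\<^sup>T E\<close>, where E is a matrix unit. The sum of these products over all matrix
  units is \<open>x\<close>.\<close>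

locale filtered_prob_space = prob_space P + filtration "space P" F
  for P :: "'w measure" and F :: "real \<Rightarrow> 'w measure" +
  assumes subalg: "\<And>t. subalgebra P (F t)"
begin

lemma F_mono_measurable:
  assumes "f \<in> measurable (F a) N" "a \<le> b" shows "f \<in> measurable (F b) N"
  using assms sets_F_mono[of a b] space_F unfolding measurable_def by auto

lemma F_measurable: "f \<in> measurable (F a) N \<Longrightarrow> f \<in> measurable P N"
  using subalg measurable_from_subalg by blast

end

locale brownian_family = filtered_prob_space P F
  for P :: "'w measure" and F :: "real \<Rightarrow> 'w measure" +
  fixes B :: "'i::finite \<Rightarrow> real \<Rightarrow> 'w \<Rightarrow> real"
  assumes ibm: "independent_brownian_motions P F B"
begin

text \<open>Independence of the past is assumed for the joint increment of the family, and products
  of two coordinates need it jointly; hence one vector instead of separate scalars.\<close>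

definition incr :: "real \<Rightarrow> real \<Rightarrow> 'w \<Rightarrow> real^'i"
  where "incr a b \<omega> = (\<chi> i. B i b \<omega> - B i a \<omega>)"

lemma incr_nth [simp]: "incr a b \<omega> $ i = B i b \<omega> - B i a \<omega>"
  by (simp add: incr_def)

lemma B_F [measurable (raw)]: "0 \<le> t \<Longrightarrow> B i t \<in> borel_measurable (F t)"
  using ibm unfolding independent_brownian_motions_def by auto

lemma B_meas: "0 \<le> t \<Longrightarrow> B i t \<in> borel_measurable P"
  using B_F F_measurable by blast

lemma incr_F: 
  assumes "0 \<le> a" "a \<le> b" shows "incr a b \<in> borel_measurable (F b)"
proof -
  have [measurable]: "B i b \<in> borel_measurable (F b)" "B i a \<in> borel_measurable (F b)" for i
    using assms B_F F_mono_measurable[OF B_F, of a b] by auto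
  have "(\<lambda>\<omega>. incr a b \<omega> \<bullet> e) \<in> borel_measurable (F b)" if "e \<in> Basis" for e
    unfolding inner_vec_def by simp
  then show ?thesis by (subst borel_measurable_euclidean_space) auto
qed

lemma incr_meas: "0 \<le> a \<Longrightarrow> a \<le> b \<Longrightarrow> incr a b \<in> borel_measurable P"
  using incr_F F_measurable by blast

text \<open>Both generated \<sigma>-algebras lie in algebras that are assumed independent: that of
  \<open>c\<close> in \<open>F a\<close>, that of \<open>g\<close> of the increment in the one
  generated by the increment itself.\<close>

lemma indep_var_incr:
  assumes ab: "0 \<le> a" "a \<le> b" and c: "c \<in> borel_measurable (F a)"
    and g: "g \<in> borel_measurable borel"
  shows "indep_var borel c borel (\<lambda>\<omega>. g (incr a b \<omega>))"
proof -
  have i: "indep_set (sets (F a)) (sets (vimage_algebra (space P) (incr a b) borel))"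
    using ibm ab unfolding independent_brownian_motions_def incr_def by blast
  have m: "incr a b \<in> measurable (vimage_algebra (space P) (incr a b) borel) borel"
    by (rule measurable_vimage_algebra1) auto
  have 1: "{c -` A \<inter> space P |A. A \<in> sets borel} \<subseteq> sets (F a)"
    using c unfolding measurable_def space_F by auto
  have "(\<lambda>\<omega>. g (incr a b \<omega>)) \<in> borel_measurable (vimage_algebra (space P) (incr a b) borel)"
    using measurable_compose[OF m g] .
  then have 2: "{(\<lambda>\<omega>. g (incr a b \<omega>)) -` A \<inter> space P |A. A \<in> sets borel} 
      \<subseteq> sets (vimage_algebra (space P) (incr a b) borel)"
    unfolding measurable_def by auto
  have 3: "sigma_sets (space P) {c -` A \<inter> space P |A. A \<in> sets borel} \<subseteq> sets (F a)"
    using sets.sigma_sets_subset[OF 1] by (simp add: space_F)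
  have 4: "sigma_sets (space P) {(\<lambda>\<omega>. g (incr a b \<omega>)) -` A \<inter> space P |A. A \<in> sets borel}
      \<subseteq> sets (vimage_algebra (space P) (incr a b) borel)"
    using sets.sigma_sets_subset[OF 2] by simp
  have "indep_set (sigma_sets (space P) {c -` A \<inter> space P |A. A \<in> sets borel})
    (sigma_sets (space P) {(\<lambda>\<omega>. g (incr a b \<omega>)) -` A \<inter> space P |A. A \<in> sets borel})"
    using i 3 4 unfolding indep_set_def
    by (elim indep_sets_mono_sets) (auto split: bool.splits)
  then show ?thesis
    using F_measurable[OF c] measurable_compose[OF incr_meas[OF ab] g] by (simp add: indep_var_eq)
qed

lemma
  fixes c :: "'w \<Rightarrow> real" and g :: "real^'i \<Rightarrow> real"
  assumes ab: "0 \<le> a" "a \<le> b" and c: "c \<in> borel_measurable (F a)" "integrable P c"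
    and g: "g \<in> borel_measurable borel" "integrable P (\<lambda>\<omega>. g (incr a b \<omega>))"
  shows integrable_mult_incr: "integrable P (\<lambda>\<omega>. c \<omega> * g (incr a b \<omega>))"
    and expectation_mult_incr:
      "expectation (\<lambda>\<omega>. c \<omega> * g (incr a b \<omega>)) = expectation c * expectation (\<lambda>\<omega>. g (incr a b \<omega>))"
  using indep_var_integrable[OF indep_var_incr[OF ab c(1) g(1)] c(2) g(2)]
    indep_var_lebesgue_integral[OF indep_var_incr[OF ab c(1) g(1)] c(2) g(2)] by auto

lemma incr_normal:
  assumes "0 \<le> a" "a < b"
  shows "distributed P lborel (\<lambda>\<omega>. B i b \<omega> - B i a \<omega>) (normal_density 0 (sqrt (b - a)))"
  using ibm assms unfolding independent_brownian_motions_def standard_brownian_motion_def by blast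

text \<open>The moments are those of a centred normal law with variance b - a. That law is assumed
  for \<open>a < b\<close>; for \<open>a = b\<close> the increment is 0 and the formulas are checked
  directly.\<close>

lemma
  assumes ab: "0 \<le> a" "a \<le> b"
  shows incr_integrable_pow: "integrable P (\<lambda>\<omega>. (B i b \<omega> - B i a \<omega>) ^ k)"
    and incr_expectation: "expectation (\<lambda>\<omega>. B i b \<omega> - B i a \<omega>) = 0"
    and incr_expectation2: "expectation (\<lambda>\<omega>. (B i b \<omega> - B i a \<omega>)\<^sup>2) = b - a"
    and incr_expectation4: "expectation (\<lambda>\<omega>. (B i b \<omega> - B i a \<omega>)^4) = 3 * (b - a)\<^sup>2"
proof -
  consider "a = b" | "a < b" using ab by linarith
  then have *: "integrable P (\<lambda>\<omega>. (B i b \<omega> - B i a \<omega>) ^ k) \<and> 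
    expectation (\<lambda>\<omega>. B i b \<omega> - B i a \<omega>) = 0 \<and>
    expectation (\<lambda>\<omega>. (B i b \<omega> - B i a \<omega>)\<^sup>2) = b - a \<and> 
    expectation (\<lambda>\<omega>. (B i b \<omega> - B i a \<omega>)^4) = 3 * (b - a)\<^sup>2"
  proof cases
    case 1 then show ?thesis by (cases k) auto
  next
    case 2
    then have s: "0 < sqrt (b - a)" by simp
    note D = incr_normal[OF ab(1) 2, of i]
    have "integrable P (\<lambda>\<omega>. (B i b \<omega> - B i a \<omega>) ^ k)"
      using integrable_normal_moment[OF s, of 0 k]
      by (subst distributed_integrable[OF D, symmetric]) auto
    moreover have "expectation (\<lambda>\<omega>. (B i b \<omega> - B i a \<omega>)) = 0"
      using integral_normal_moment_odd[OF s, of 0 0]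
      by (subst distributed_integral[OF D, symmetric]) auto
    moreover have "expectation (\<lambda>\<omega>. (B i b \<omega> - B i a \<omega>)^2) = b - a"
      using integral_normal_moment_even[OF s, of 0 1] 2
      by (subst distributed_integral[OF D, symmetric]) (auto simp: eval_nat_numeral)
    moreover have "expectation (\<lambda>\<omega>. (B i b \<omega> - B i a \<omega>)^4) = 3 * (b - a)\<^sup>2"
      using integral_normal_moment_even[OF s, of 0 2] 2
      by (subst distributed_integral[OF D, symmetric]) (auto simp: fact_numeral power2_eq_square field_simps)
    ultimately show ?thesis by blast
  qed
  from * show "integrable P (\<lambda>\<omega>. (B i b \<omega> - B i a \<omega>) ^ k)"
    "expectation (\<lambda>\<omega>. B i b \<omega> - B i a \<omega>) = 0"
    "expectation (\<lambda>\<omega>. (B i b \<omega> - B i a \<omega>)\<^sup>2) = b - a" 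
    "expectation (\<lambda>\<omega>. (B i b \<omega> - B i a \<omega>)^4) = 3 * (b - a)\<^sup>2" by auto
qed

text \<open>Independence of the family is assumed for whole paths. The increment over [a, b] is a
  measurable function of a path, through its coordinates at \<open>a\<close> and \<open>b\<close>,
  so increments of different motions are independent and centred.\<close>

lemma
  assumes ab: "0 \<le> a" "a \<le> b" and ij: "i \<noteq> j"
  shows incr_cross_integrable': "integrable P (\<lambda>\<omega>. (B i b \<omega> - B i a \<omega>) * (B j b \<omega> - B j a \<omega>))"
    and incr_cross_expectation': "expectation (\<lambda>\<omega>. (B i b \<omega> - B i a \<omega>) * (B j b \<omega> - B j a \<omega>)) = 0"
proof -
  have "indep_vars (\<lambda>_. PiM {0..} (\<lambda>_. borel)) (\<lambda>i \<omega>. \<lambda>t\<in>{0..}. B i t \<omega>) UNIV"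
    using ibm unfolding independent_brownian_motions_def by blast
  then have "indep_vars (\<lambda>_. borel) (\<lambda>i \<omega>. (\<lambda>f. f b - f a :: real) (\<lambda>t\<in>{0..}. B i t \<omega>)) UNIV"
    by (rule indep_vars_compose2) (use ab in \<open>auto intro!: borel_measurable_diff measurable_component_singleton\<close>)
  then have "indep_vars (\<lambda>_. borel) (\<lambda>i \<omega>. B i b \<omega> - B i a \<omega>) UNIV"
    using ab by simp
  then have iv: "indep_vars (\<lambda>_. borel) (\<lambda>i \<omega>. B i b \<omega> - B i a \<omega>) {i, j}"
    by (rule indep_vars_subset) auto
  have int: "integrable P (\<lambda>\<omega>. (B i b \<omega> - B i a \<omega>))" for i
    using incr_integrable_pow[OF ab, of i 1] by simp
  show "integrable P (\<lambda>\<omega>. (B i b \<omega> - B i a \<omega>) * (B j b \<omega> - B j a \<omega>))"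
   "expectation (\<lambda>\<omega>. (B i b \<omega> - B i a \<omega>) * (B j b \<omega> - B j a \<omega>)) = 0"
    using indep_vars_integrable[OF _ iv int] indep_vars_lebesgue_integral[OF _ iv int]
      incr_expectation[OF ab] ij by auto
qed

lemma
  assumes ab: "0 \<le> a" "a \<le> b"
  shows incr_cross_integrable: "integrable P (\<lambda>\<omega>. (B i b \<omega> - B i a \<omega>) * (B j b \<omega> - B j a \<omega>))"
    and incr_cross_expectation: "expectation (\<lambda>\<omega>. (B i b \<omega> - B i a \<omega>) * (B j b \<omega> - B j a \<omega>)) = (if i = j then b - a else 0)"
  using incr_cross_integrable'[OF ab, of i j] incr_cross_expectation'[OF ab, of i j]
    incr_integrable_pow[OF ab, of i 2] incr_expectation2[OF ab, of i]
  by (auto simp: power2_eq_square)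

text \<open>The constant is 3 + 3 + 2: two fourth moments of normal increments, and twice the square
  of the possible mean \<open>b - a\<close>. The square of the cell length is what makes sums over N
  cells vanish.\<close>

lemma
  fixes i j :: 'i
  assumes ab: "0 \<le> a" "a \<le> b"
  defines "\<xi> \<equiv> \<lambda>\<omega>. (B i b \<omega> - B i a \<omega>) * (B j b \<omega> - B j a \<omega>) - (if i = j then b - a else 0)"
  shows incr_cross_sq_integrable: "integrable P (\<lambda>\<omega>. (\<xi> \<omega>)\<^sup>2)"
    and incr_cross_sq_expectation: "expectation (\<lambda>\<omega>. (\<xi> \<omega>)\<^sup>2) \<le> 8 * (b - a)\<^sup>2"
proof -
  have [measurable]: "B i a \<in> borel_measurable P" "B i b \<in> borel_measurable P" for i using B_meas ab by auto
  let ?h = "\<lambda>\<omega>. (B i b \<omega> - B i a \<omega>)^4 + (B j b \<omega> - B j a \<omega>)^4 + 2 * (b - a)\<^sup>2"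
  have I: "integrable P ?h"
    using incr_integrable_pow[OF ab] by auto
  have aux: "(x * y - d)\<^sup>2 \<le> x^4 + y^4 + 2 * e\<^sup>2" if "d = 0 \<or> d = e" for x y d e :: real
  proof -
    have "(x * y - d)\<^sup>2 \<le> 2 * (x\<^sup>2 * y\<^sup>2) + 2 * d\<^sup>2"
      using sum_squares_ge_zero[of "x*y+d" 0] by (simp add: power2_eq_square algebra_simps)
    moreover have "2 * (x\<^sup>2 * y\<^sup>2) \<le> x^4+y^4"
      using sum_squares_ge_zero[of "x^2-y^2" 0] by (simp add: power2_eq_square power4_eq_xxxx algebra_simps)
    moreover have "d\<^sup>2 \<le> e\<^sup>2" using that by auto
    ultimately show ?thesis by linarith
  qed
  have le: "(\<xi> \<omega>)\<^sup>2 \<le> ?h \<omega>" for \<omega> unfolding \<xi>_def by (rule aux) auto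
  show i2: "integrable P (\<lambda>\<omega>. (\<xi> \<omega>)\<^sup>2)"
    by (rule Bochner_Integration.integrable_bound[OF I]) (use le in \<open>auto simp: \<xi>_def intro!: AE_I2 intro: order_trans\<close>)
  have "expectation (\<lambda>\<omega>. (\<xi> \<omega>)\<^sup>2) \<le> expectation ?h"
    by (rule integral_mono[OF i2 I]) (rule le)
  also have "\<dots> = 8 * (b - a)\<^sup>2"
    using incr_integrable_pow[OF ab] incr_expectation4[OF ab] by (simp add: prob_space)
  finally show "expectation (\<lambda>\<omega>. (\<xi> \<omega>)\<^sup>2) \<le> 8 * (b - a)\<^sup>2" .
qed

text \<open>A discrete Ito isometry. The cross term of a partial sum with the next summand contains
  an increment term that is centred and independent of everything known at the left end of the cell;
  so it has mean 0 and only the squares survive.\<close>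

lemma
  fixes c :: "nat \<Rightarrow> 'w \<Rightarrow> real" and g :: "nat \<Rightarrow> real^'i \<Rightarrow> real"
  assumes \<tau>: "0 \<le> \<tau> 0" "\<And>k. k < N \<Longrightarrow> \<tau> k \<le> \<tau> (Suc k)"
    and c: "\<And>k. k < N \<Longrightarrow> c k \<in> borel_measurable (F (\<tau> k))" "\<And>k \<omega>. k < N \<Longrightarrow> \<omega> \<in> space P \<Longrightarrow> \<bar>c k \<omega>\<bar> \<le> K"
    and g: "\<And>k. k < N \<Longrightarrow> g k \<in> borel_measurable borel"
      "\<And>k. k < N \<Longrightarrow> integrable P (\<lambda>\<omega>. (g k (incr (\<tau> k) (\<tau> (Suc k)) \<omega>))\<^sup>2)"
      "\<And>k. k < N \<Longrightarrow> expectation (\<lambda>\<omega>. g k (incr (\<tau> k) (\<tau> (Suc k)) \<omega>)) = 0"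
  shows orthogonal_sum_integrable:
      "integrable P (\<lambda>\<omega>. (\<Sum>k<N. c k \<omega> * g k (incr (\<tau> k) (\<tau> (Suc k)) \<omega>))\<^sup>2)"
    and orthogonal_sum_expectation:
      "expectation (\<lambda>\<omega>. (\<Sum>k<N. c k \<omega> * g k (incr (\<tau> k) (\<tau> (Suc k)) \<omega>))\<^sup>2) =
       (\<Sum>k<N. expectation (\<lambda>\<omega>. (c k \<omega>)\<^sup>2) * expectation (\<lambda>\<omega>. (g k (incr (\<tau> k) (\<tau> (Suc k)) \<omega>))\<^sup>2))"
    and orthogonal_sum_mean:
      "integrable P (\<lambda>\<omega>. (\<Sum>k<N. c k \<omega> * g k (incr (\<tau> k) (\<tau> (Suc k)) \<omega>)))"
      "expectation (\<lambda>\<omega>. (\<Sum>k<N. c k \<omega> * g k (incr (\<tau> k) (\<tau> (Suc k)) \<omega>))) = 0"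
proof -
  define \<xi> where "\<xi> k \<omega> = g k (incr (\<tau> k) (\<tau> (Suc k)) \<omega>)" for k \<omega>
  define S where "S n \<omega> = (\<Sum>k<n. c k \<omega> * \<xi> k \<omega>)" for n \<omega>
  have \<tau>0: "0 \<le> \<tau> k" if "k \<le> N" for k
    using that by (induction k) (use \<tau> in \<open>auto intro: order_trans dest: Suc_le_lessD\<close>)
  \<comment> \<open>Measurability of the partial sum at its own end time belongs to the induction
    hypothesis: it lets \<open>S n * c n\<close> be the factor that is known before the next
    increment.\<close>
  have "n \<le> N \<Longrightarrow> S n \<in> borel_measurable (F (\<tau> n)) \<and> integrable P (\<lambda>\<omega>. (S n \<omega>)\<^sup>2) \<and>
     expectation (\<lambda>\<omega>. (S n \<omega>)\<^sup>2) = (\<Sum>k<n. expectation (\<lambda>\<omega>. (c k \<omega>)\<^sup>2) * expectation (\<lambda>\<omega>. (\<xi> k \<omega>)\<^sup>2))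
     \<and> integrable P (S n) \<and> expectation (S n) = 0" for n
  proof (induction n)
    case 0 then show ?case by (simp add: S_def)
  next
    case (Suc n)
    then have n: "n < N" and nn: "n \<le> N" by auto
    note IH = Suc.IH[OF nn]
    note le = \<tau>(2)[OF n]
    note 0 = \<tau>0[OF nn]
    have \<xi>F: "\<xi> n \<in> borel_measurable (F (\<tau> (Suc n)))"
      unfolding \<xi>_def using measurable_compose[OF incr_F[OF 0 le] g(1)[OF n]] .
    have [measurable]: "\<xi> n \<in> borel_measurable P" "c n \<in> borel_measurable P" "S n \<in> borel_measurable P"
      using F_measurable[OF \<xi>F] F_measurable[OF c(1)[OF n]] F_measurable IH by auto
    have [measurable]: "c n \<in> borel_measurable (F (\<tau> n))" "S n \<in> borel_measurable (F (\<tau> n))"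
      using c n IH by auto
    have \<xi>2: "integrable P (\<lambda>\<omega>. (\<xi> n \<omega>)\<^sup>2)" using g(2)[OF n] by (simp add: \<xi>_def)
    have "integrable P (\<xi> n)" by (rule square_integrable_imp_integrable[OF _ \<xi>2]) simp
    then have \<xi>1: "integrable P (\<lambda>\<omega>. g n (incr (\<tau> n) (\<tau> (Suc n)) \<omega>))" by (simp add: \<xi>_def[abs_def])
    have c1: "integrable P (c n)" 
      by (rule integrable_const_bound[where B=K]) (use c(2)[OF n] in auto)
    have c2: "integrable P (\<lambda>\<omega>. (c n \<omega>)\<^sup>2)" 
    proof (rule integrable_const_bound[where B="K\<^sup>2"])
      show "AE \<omega> in P. norm ((c n \<omega>)\<^sup>2) \<le> K\<^sup>2"
        using c(2)[OF n] by (auto intro!: AE_I2 abs_le_square_iff[THEN iffD1] order_trans[OF _ abs_ge_self])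
    qed simp
    have Sc: "integrable P (\<lambda>\<omega>. S n \<omega> * c n \<omega>)"
    proof (rule Bochner_Integration.integrable_bound[of P "\<lambda>\<omega>. K * \<bar>S n \<omega>\<bar>"])
      show "integrable P (\<lambda>\<omega>. K * \<bar>S n \<omega>\<bar>)" using IH by auto
      show "AE \<omega> in P. norm (S n \<omega> * c n \<omega>) \<le> norm (K * \<bar>S n \<omega>\<bar>)"
      proof (rule AE_I2)
        fix \<omega> assume "\<omega> \<in> space P"
        then have "\<bar>c n \<omega>\<bar> \<le> \<bar>K\<bar>" using c(2)[OF n, of \<omega>] by auto
        then show "norm (S n \<omega> * c n \<omega>) \<le> norm (K * \<bar>S n \<omega>\<bar>)"
          by (simp add: abs_mult mult.commute[of "\<bar>K\<bar>"] mult_left_mono)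
      qed
    qed simp
    have Sc\<xi>: "integrable P (\<lambda>\<omega>. (S n \<omega> * c n \<omega>) * \<xi> n \<omega>)"
      "expectation (\<lambda>\<omega>. (S n \<omega> * c n \<omega>) * \<xi> n \<omega>) = 0"
      using integrable_mult_incr[OF 0 le _ Sc g(1)[OF n]] expectation_mult_incr[OF 0 le _ Sc g(1)[OF n]]
         \<xi>1 g(3)[OF n] by (auto simp: \<xi>_def)
    have c2\<xi>2: "integrable P (\<lambda>\<omega>. (c n \<omega>)\<^sup>2 * (\<xi> n \<omega>)\<^sup>2)"
      "expectation (\<lambda>\<omega>. (c n \<omega>)\<^sup>2 * (\<xi> n \<omega>)\<^sup>2) = expectation (\<lambda>\<omega>. (c n \<omega>)\<^sup>2) * expectation (\<lambda>\<omega>. (\<xi> n \<omega>)\<^sup>2)"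
      using integrable_mult_incr[OF 0 le _ c2, of "\<lambda>x. (g n x)\<^sup>2"] expectation_mult_incr[OF 0 le _ c2, of "\<lambda>x. (g n x)\<^sup>2"]
         g(1)[OF n] \<xi>2 by (auto simp: \<xi>_def)
    have c\<xi>: "integrable P (\<lambda>\<omega>. c n \<omega> * \<xi> n \<omega>)" "expectation (\<lambda>\<omega>. c n \<omega> * \<xi> n \<omega>) = 0"
      using integrable_mult_incr[OF 0 le _ c1 g(1)[OF n]] expectation_mult_incr[OF 0 le _ c1 g(1)[OF n]]
         \<xi>1 g(3)[OF n] by (auto simp: \<xi>_def)
    have eq: "S (Suc n) = (\<lambda>\<omega>. S n \<omega> + c n \<omega> * \<xi> n \<omega>)" by (auto simp: S_def)
    have eq2: "(\<lambda>\<omega>. (S (Suc n) \<omega>)\<^sup>2) = (\<lambda>\<omega>. (S n \<omega>)\<^sup>2 + 2 * (S n \<omega> * c n \<omega> * \<xi> n \<omega>) + (c n \<omega>)\<^sup>2 * (\<xi> n \<omega>)\<^sup>2)"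
      by (auto simp: eq power2_eq_square algebra_simps)
    have "S n \<in> borel_measurable (F (\<tau> (Suc n)))" "c n \<in> borel_measurable (F (\<tau> (Suc n)))"
      by (auto intro: F_mono_measurable[OF _ le])
    then have "S (Suc n) \<in> borel_measurable (F (\<tau> (Suc n)))"
      unfolding eq using \<xi>F by measurable
    moreover have "integrable P (\<lambda>\<omega>. (S (Suc n) \<omega>)\<^sup>2)"
      unfolding eq2 using IH Sc\<xi> c2\<xi>2 by auto
    moreover have "expectation (\<lambda>\<omega>. (S (Suc n) \<omega>)\<^sup>2) = expectation (\<lambda>\<omega>. (S n \<omega>)\<^sup>2) + expectation (\<lambda>\<omega>. (c n \<omega>)\<^sup>2) * expectation (\<lambda>\<omega>. (\<xi> n \<omega>)\<^sup>2)"
      unfolding eq2 using IH Sc\<xi> c2\<xi>2 by simp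
    moreover have "integrable P (S (Suc n))" "expectation (S (Suc n)) = 0"
      unfolding eq using IH c\<xi> by auto
    ultimately show ?case using IH by simp
  qed
  from this[of N] show
    "integrable P (\<lambda>\<omega>. (\<Sum>k<N. c k \<omega> * g k (incr (\<tau> k) (\<tau> (Suc k)) \<omega>))\<^sup>2)"
    "expectation (\<lambda>\<omega>. (\<Sum>k<N. c k \<omega> * g k (incr (\<tau> k) (\<tau> (Suc k)) \<omega>))\<^sup>2) =
       (\<Sum>k<N. expectation (\<lambda>\<omega>. (c k \<omega>)\<^sup>2) * expectation (\<lambda>\<omega>. (g k (incr (\<tau> k) (\<tau> (Suc k)) \<omega>))\<^sup>2))"
    "integrable P (\<lambda>\<omega>. (\<Sum>k<N. c k \<omega> * g k (incr (\<tau> k) (\<tau> (Suc k)) \<omega>)))"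
    "expectation (\<lambda>\<omega>. (\<Sum>k<N. c k \<omega> * g k (incr (\<tau> k) (\<tau> (Suc k)) \<omega>))) = 0"
    unfolding S_def \<xi>_def by auto
qed

text \<open>The scalar case is applied to every coordinate: the squared norm is the sum of their
  squares, and the coordinates of a bounded coefficient obey the same bound
  \<open>K\<close>.\<close>

lemma
  fixes c :: "nat \<Rightarrow> 'w \<Rightarrow> 'a::euclidean_space" and g :: "nat \<Rightarrow> real^'i \<Rightarrow> real"
  assumes \<tau>: "0 \<le> \<tau> 0" "\<And>k. k < N \<Longrightarrow> \<tau> k \<le> \<tau> (Suc k)"
    and c: "\<And>k. k < N \<Longrightarrow> c k \<in> borel_measurable (F (\<tau> k))" "\<And>k \<omega>. k < N \<Longrightarrow> \<omega> \<in> space P \<Longrightarrow> norm (c k \<omega>) \<le> K"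
    and g: "\<And>k. k < N \<Longrightarrow> g k \<in> borel_measurable borel"
      "\<And>k. k < N \<Longrightarrow> integrable P (\<lambda>\<omega>. (g k (incr (\<tau> k) (\<tau> (Suc k)) \<omega>))\<^sup>2)"
      "\<And>k. k < N \<Longrightarrow> expectation (\<lambda>\<omega>. g k (incr (\<tau> k) (\<tau> (Suc k)) \<omega>)) = 0"
  shows orthogonal_vsum_integrable:
      "integrable P (\<lambda>\<omega>. (norm (\<Sum>k<N. g k (incr (\<tau> k) (\<tau> (Suc k)) \<omega>) *\<^sub>R c k \<omega>))\<^sup>2)"
    and orthogonal_vsum_expectation:
      "expectation (\<lambda>\<omega>. (norm (\<Sum>k<N. g k (incr (\<tau> k) (\<tau> (Suc k)) \<omega>) *\<^sub>R c k \<omega>))\<^sup>2) =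
       (\<Sum>k<N. expectation (\<lambda>\<omega>. (norm (c k \<omega>))\<^sup>2) * expectation (\<lambda>\<omega>. (g k (incr (\<tau> k) (\<tau> (Suc k)) \<omega>))\<^sup>2))"
    and orthogonal_vsum_mean:
      "integrable P (\<lambda>\<omega>. \<Sum>k<N. g k (incr (\<tau> k) (\<tau> (Suc k)) \<omega>) *\<^sub>R c k \<omega>)"
      "expectation (\<lambda>\<omega>. \<Sum>k<N. g k (incr (\<tau> k) (\<tau> (Suc k)) \<omega>) *\<^sub>R c k \<omega>) = 0"
proof -
  define \<xi> where "\<xi> k \<omega> = g k (incr (\<tau> k) (\<tau> (Suc k)) \<omega>)" for k \<omega>
  define Z where "Z \<omega> = (\<Sum>k<N. \<xi> k \<omega> *\<^sub>R c k \<omega>)" for \<omega>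
  have Zb: "Z \<omega> \<bullet> b = (\<Sum>k<N. (c k \<omega> \<bullet> b) * \<xi> k \<omega>)" for \<omega> b
    unfolding Z_def inner_sum_left by (simp add: mult.commute)
  have norm_eq: "(norm x)\<^sup>2 = (\<Sum>b\<in>Basis. (x \<bullet> b)\<^sup>2)" for x :: 'a
    by (subst power2_norm_eq_inner, subst euclidean_inner) (simp add: power2_eq_square)
  have cb: "(\<lambda>\<omega>. c k \<omega> \<bullet> b) \<in> borel_measurable (F (\<tau> k))" if "k < N" for k b
    using c(1)[OF that] by simp
  have cK: "\<bar>c k \<omega> \<bullet> b\<bar> \<le> K" if "k < N" "\<omega> \<in> space P" "b \<in> Basis" for k \<omega> b
    using c(2)[OF that(1,2)] Basis_le_norm[OF that(3), of "c k \<omega>"] by linarith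
  note * = orthogonal_sum_integrable[OF \<tau> cb cK g] orthogonal_sum_expectation[OF \<tau> cb cK g] 
    orthogonal_sum_mean[OF \<tau> cb cK g]
  have cP: "c k \<in> borel_measurable P" if "k < N" for k using F_measurable[OF c(1)[OF that]] .
  have c2: "integrable P (\<lambda>\<omega>. (c k \<omega> \<bullet> b)\<^sup>2)" if "k < N" "b \<in> Basis" for k b
  proof (rule integrable_const_bound[where B="K\<^sup>2"])
    show "AE \<omega> in P. norm ((c k \<omega> \<bullet> b)\<^sup>2) \<le> K\<^sup>2"
      using cK[OF that(1) _ that(2)] by (auto intro!: AE_I2 abs_le_square_iff[THEN iffD1] order_trans[OF _ abs_ge_self])
  qed (use cP that in simp)
  show "integrable P (\<lambda>\<omega>. (norm (\<Sum>k<N. g k (incr (\<tau> k) (\<tau> (Suc k)) \<omega>) *\<^sub>R c k \<omega>))\<^sup>2)"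
    unfolding \<xi>_def[symmetric] Z_def[symmetric] norm_eq Zb
    by (intro Bochner_Integration.integrable_sum) (use * in \<open>auto simp: \<xi>_def\<close>)
  have "expectation (\<lambda>\<omega>. (norm (Z \<omega>))\<^sup>2) = (\<Sum>b\<in>Basis. expectation (\<lambda>\<omega>. (\<Sum>k<N. (c k \<omega> \<bullet> b) * \<xi> k \<omega>)\<^sup>2))"
    unfolding norm_eq Zb
    by (intro Bochner_Integration.integral_sum) (use * in \<open>auto simp: \<xi>_def\<close>)
  also have "\<dots> = (\<Sum>b\<in>Basis. \<Sum>k<N. expectation (\<lambda>\<omega>. (c k \<omega> \<bullet> b)\<^sup>2) * expectation (\<lambda>\<omega>. (\<xi> k \<omega>)\<^sup>2))"
    by (intro sum.cong) (use * in \<open>auto simp: \<xi>_def\<close>)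
  also have "\<dots> = (\<Sum>k<N. expectation (\<lambda>\<omega>. (norm (c k \<omega>))\<^sup>2) * expectation (\<lambda>\<omega>. (\<xi> k \<omega>)\<^sup>2))"
    unfolding norm_eq using c2
    by (subst sum.swap) (auto intro!: sum.cong simp: sum_distrib_right)
  finally show "expectation (\<lambda>\<omega>. (norm (\<Sum>k<N. g k (incr (\<tau> k) (\<tau> (Suc k)) \<omega>) *\<^sub>R c k \<omega>))\<^sup>2) =
       (\<Sum>k<N. expectation (\<lambda>\<omega>. (norm (c k \<omega>))\<^sup>2) * expectation (\<lambda>\<omega>. (g k (incr (\<tau> k) (\<tau> (Suc k)) \<omega>))\<^sup>2))"
    unfolding Z_def \<xi>_def .
  have Zint: "integrable P (\<lambda>\<omega>. Z \<omega> \<bullet> b)" "expectation (\<lambda>\<omega>. Z \<omega> \<bullet> b) = 0" if "b \<in> Basis" for b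
    unfolding Zb using * that by (auto simp: \<xi>_def)
  have Zsum: "Z = (\<lambda>\<omega>. \<Sum>b\<in>Basis. (Z \<omega> \<bullet> b) *\<^sub>R b)" by (auto simp: euclidean_representation)
  have Zi: "integrable P Z"
    by (subst Zsum) (intro Bochner_Integration.integrable_sum integrable_scaleR_left Zint)
  then show "integrable P (\<lambda>\<omega>. \<Sum>k<N. g k (incr (\<tau> k) (\<tau> (Suc k)) \<omega>) *\<^sub>R c k \<omega>)"
    unfolding Z_def \<xi>_def .
  have "expectation Z \<bullet> b = 0" if "b \<in> Basis" for b
    using Zint[OF that] Zi by simp
  then have "expectation Z = 0" by (simp add: euclidean_eq_iff[of _ "0::'a"])
  then show "expectation (\<lambda>\<omega>. \<Sum>k<N. g k (incr (\<tau> k) (\<tau> (Suc k)) \<omega>) *\<^sub>R c k \<omega>) = 0"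
    unfolding Z_def \<xi>_def .
qed

end

section \<open>Square variation of semimartingales\<close>

text \<open>Along a martingale the convex Huber function controls the square variation of the part that
  stays below the level \<open>c\<close>, and it only needs first moments; this avoids stopping at a random time.\<close>

definition huber :: "real \<Rightarrow> real \<Rightarrow> real"
  where "huber c x = (if \<bar>x\<bar> \<le> c then x\<^sup>2 else 2 * c * \<bar>x\<bar> - c\<^sup>2)"

text \<open>The derivative of \<open>huber c\<close>. It is bounded by 2 c, so its product with an
  increment of a merely integrable martingale is still integrable.\<close>

definition huber' :: "real \<Rightarrow> real \<Rightarrow> real"
  where "huber' c x = 2 * max (- c) (min c x)"

text \<open>Tangent inequality of a convex function, with the exact remainder
  \<open>(y - x)\<^sup>2\<close> kept where both points lie in the quadratic part. The nine cases
  are the positions of \<open>x\<close> and \<open>y\<close> relative to -c and c.\<close>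

lemma huber_convex:
  assumes c: "0 \<le> c"
  shows "huber c x + huber' c x * (y - x) + (if \<bar>x\<bar> \<le> c \<and> \<bar>y\<bar> \<le> c then (y - x)\<^sup>2 else 0) \<le> huber c y"
proof -
  consider "\<bar>x\<bar> \<le> c" "\<bar>y\<bar> \<le> c" | "\<bar>x\<bar> \<le> c" "y > c" | "\<bar>x\<bar> \<le> c" "y < -c" | "x > c" "\<bar>y\<bar> \<le> c" 
    | "x > c" "y > c" | "x > c" "y < -c" | "x < -c" "\<bar>y\<bar> \<le> c" | "x < -c" "y > c" | "x < -c" "y < -c"
    by linarith
  then show ?thesis
  proof cases
    case 2
    then have "0 \<le> (c - x) * (2 * y - c - x)" by (intro mult_nonneg_nonneg) auto
    then show ?thesis using 2 by (auto simp: huber_def huber'_def power2_eq_square algebra_simps)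
  next
    case 3
    then have "0 \<le> (c + x) * (- 2 * y - c + x)" by (intro mult_nonneg_nonneg) auto
    then show ?thesis using 3 by (auto simp: huber_def huber'_def power2_eq_square algebra_simps)
  next
    case 4
    have "0 \<le> (y - c)\<^sup>2" by simp
    then show ?thesis using 4 by (auto simp: huber_def huber'_def power2_eq_square algebra_simps)
  next
    case 6
    have "c * y \<le> 0" using 6 c by (auto simp: mult_nonneg_nonpos)
    then show ?thesis using 6 c by (auto simp: huber_def huber'_def power2_eq_square algebra_simps)
  next
    case 7
    have "0 \<le> (y + c)\<^sup>2" by simp
    then show ?thesis using 7 by (auto simp: huber_def huber'_def power2_eq_square algebra_simps)
  next
    case 8
    have "c * y \<ge> 0" using 8 c by (auto)
    then show ?thesis using 8 c by (auto simp: huber_def huber'_def power2_eq_square algebra_simps)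
  qed (use c in \<open>auto simp: huber_def huber'_def power2_eq_square algebra_simps\<close>)
qed

lemma huber_bounds: "0 \<le> c \<Longrightarrow> 0 \<le> huber c x" "0 \<le> c \<Longrightarrow> huber c x \<le> 2 * c * \<bar>x\<bar>"
proof -
  assume c: "0 \<le> c"
  have "c\<^sup>2 \<le> 2 * c * \<bar>x\<bar>" if "c < \<bar>x\<bar>"
  proof -
    have "c * c \<le> c * \<bar>x\<bar>" using that c by (intro mult_left_mono) auto
    moreover have "0 \<le> c * \<bar>x\<bar>" using c by simp
    ultimately show ?thesis unfolding power2_eq_square by linarith
  qed
  then show "0 \<le> huber c x" by (auto simp: huber_def)
  have "x\<^sup>2 \<le> 2 * c * \<bar>x\<bar>" if "\<bar>x\<bar> \<le> c"
  proof -
    have "x\<^sup>2 = \<bar>x\<bar> * \<bar>x\<bar>" by (simp add: power2_eq_square)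
    also have "\<dots> \<le> (2 * c) * \<bar>x\<bar>" using that c by (intro mult_right_mono) auto
    finally show ?thesis .
  qed
  then show "huber c x \<le> 2 * c * \<bar>x\<bar>" by (auto simp: huber_def)
qed

context filtered_prob_space
begin

lemma martingale_increment:
  assumes X: "martingale P F X" and st: "0 \<le> s" "s \<le> t"
    and f: "f \<in> borel_measurable (F s)" "\<And>\<omega>. \<bar>f \<omega>\<bar> \<le> K"
  shows "integrable P (\<lambda>\<omega>. f \<omega> * (X t \<omega> - X s \<omega>))" 
    and "expectation (\<lambda>\<omega>. f \<omega> * (X t \<omega> - X s \<omega>)) = 0"
proof -
  interpret sub: sigma_finite_subalgebra P "F s"
    using subalg by (simp add: finite_measure_subalgebra.intro finite_measure_axioms finite_measure_subalgebra_axioms.intro finite_measure_subalgebra_is_sigma_finite)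
  have X': "X r \<in> borel_measurable (F r)" "integrable P (X r)" if "0 \<le> r" for r
    using X that unfolding martingale_def by auto
  have ce: "AE \<omega> in P. real_cond_exp P (F s) (X t) \<omega> = X s \<omega>"
    using X st unfolding martingale_def by auto
  have fP[measurable]: "f \<in> borel_measurable P" using F_measurable[OF f(1)] .
  have int: "integrable P (\<lambda>\<omega>. f \<omega> * X r \<omega>)" if "0 \<le> r" for r
  proof (rule Bochner_Integration.integrable_bound[of P "\<lambda>\<omega>. K * X r \<omega>"])
    show "integrable P (\<lambda>\<omega>. K * X r \<omega>)" using X'[OF that] by auto
    show "AE \<omega> in P. norm (f \<omega> * X r \<omega>) \<le> norm (K * X r \<omega>)"
    proof (rule AE_I2)
      fix \<omega>
      have "\<bar>f \<omega>\<bar> \<le> \<bar>K\<bar>" using f(2)[of \<omega>] by linarith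
      then show "norm (f \<omega> * X r \<omega>) \<le> norm (K * X r \<omega>)"
        by (simp add: abs_mult mult_right_mono)
    qed
  qed (use X'[OF that] in \<open>auto\<close>)
  have "expectation (\<lambda>\<omega>. f \<omega> * X t \<omega>) = expectation (\<lambda>\<omega>. f \<omega> * real_cond_exp P (F s) (X t) \<omega>)"
    by (rule sub.real_cond_exp_intg(2)[symmetric]) (use int[of t] f X'[of t] st in auto)
  also have "\<dots> = expectation (\<lambda>\<omega>. f \<omega> * X s \<omega>)"
    using X'(2)[of s] st ce by (intro integral_cong_AE) (auto elim: eventually_mono)
  finally have eq: "expectation (\<lambda>\<omega>. f \<omega> * X t \<omega>) = expectation (\<lambda>\<omega>. f \<omega> * X s \<omega>)" .
  show "integrable P (\<lambda>\<omega>. f \<omega> * (X t \<omega> - X s \<omega>))" 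
     "expectation (\<lambda>\<omega>. f \<omega> * (X t \<omega> - X s \<omega>)) = 0"
    unfolding right_diff_distrib using int[of t] int[of s] eq st by simp_all
qed

text \<open>Sum the sharpened tangent inequality along the grid: the first-order terms are
  martingale increments with bounded known factors and have mean 0, the values of
  \<open>huber\<close> telescope, and the last one grows only linearly. The bound depends on the
  grid through its last point only.\<close>

lemma martingale_square_variation:
  assumes X: "martingale P F X" and c: "0 \<le> c"
    and \<tau>: "0 \<le> \<tau> 0" "\<And>k. k < N \<Longrightarrow> \<tau> k \<le> \<tau> (Suc k)"
  defines "D \<equiv> \<lambda>\<omega>. \<Sum>k<N. if \<bar>X (\<tau> k) \<omega>\<bar> \<le> c \<and> \<bar>X (\<tau> (Suc k)) \<omega>\<bar> \<le> c
                then (X (\<tau> (Suc k)) \<omega> - X (\<tau> k) \<omega>)\<^sup>2 else (0::real)"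
  shows "integrable P D" and "expectation D \<le> 2 * c * expectation (\<lambda>\<omega>. \<bar>X (\<tau> N) \<omega>\<bar>)"
proof -
  have \<tau>0: "0 \<le> \<tau> k" if "k \<le> N" for k
    using that by (induction k) (use \<tau> in \<open>auto simp: Suc_le_eq intro: order_trans[of 0 "\<tau> _"]\<close>)
  have XF: "X (\<tau> k) \<in> borel_measurable (F (\<tau> k))" and Xint: "integrable P (X (\<tau> k))" if "k \<le> N" for k
    using X \<tau>0[OF that] unfolding martingale_def by auto
  define H where "H \<omega> = (\<Sum>k<N. huber' c (X (\<tau> k) \<omega>) * (X (\<tau> (Suc k)) \<omega> - X (\<tau> k) \<omega>))" for \<omega>
  have h'm: "huber' c \<in> borel_measurable borel" unfolding huber'_def[abs_def] by measurable
  have hm: "huber c \<in> borel_measurable borel" unfolding huber_def[abs_def] by measurable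
  have h'b: "\<bar>huber' c x\<bar> \<le> 2 * c" for x using c by (auto simp: huber'_def max_def min_def)
  have H1: "integrable P (\<lambda>\<omega>. huber' c (X (\<tau> k) \<omega>) * (X (\<tau> (Suc k)) \<omega> - X (\<tau> k) \<omega>))"
       "expectation (\<lambda>\<omega>. huber' c (X (\<tau> k) \<omega>) * (X (\<tau> (Suc k)) \<omega> - X (\<tau> k) \<omega>)) = 0" if "k < N" for k
    using martingale_increment[OF X \<tau>0 \<tau>(2)[OF that] measurable_compose[OF XF h'm] h'b] that by auto
  have Hi: "integrable P H" "expectation H = 0"
    unfolding H_def using H1 by auto
  have tel: "D \<omega> \<le> huber c (X (\<tau> N) \<omega>) - huber c (X (\<tau> 0) \<omega>) - H \<omega>" for \<omega>
  proof -
    have "D \<omega> \<le> (\<Sum>k<N. huber c (X (\<tau> (Suc k)) \<omega>) - huber c (X (\<tau> k) \<omega>) - huber' c (X (\<tau> k) \<omega>) * (X (\<tau> (Suc k)) \<omega> - X (\<tau> k) \<omega>))"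
      unfolding D_def using huber_convex[OF c] by (intro sum_mono) (simp add: algebra_simps)
    also have "\<dots> = (\<Sum>k<N. huber c (X (\<tau> (Suc k)) \<omega>) - huber c (X (\<tau> k) \<omega>)) - H \<omega>"
      by (simp add: H_def sum_subtractf)
    also have "(\<Sum>k<N. huber c (X (\<tau> (Suc k)) \<omega>) - huber c (X (\<tau> k) \<omega>)) = huber c (X (\<tau> N) \<omega>) - huber c (X (\<tau> 0) \<omega>)"
      by (rule sum_lessThan_telescope)
    finally show ?thesis .
  qed
  have le: "D \<omega> \<le> 2 * c * \<bar>X (\<tau> N) \<omega>\<bar> - H \<omega>" for \<omega>
    using tel[of \<omega>] huber_bounds[OF c, of "X (\<tau> N) \<omega>"] huber_bounds[OF c, of "X (\<tau> 0) \<omega>"] by linarith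
  have D0: "0 \<le> D \<omega>" for \<omega> unfolding D_def by (intro sum_nonneg) auto
  have Dm: "D \<in> borel_measurable P" unfolding D_def
  proof (rule borel_measurable_sum)
    fix k assume "k \<in> {..<N}"
    then have [measurable]: "X (\<tau> k) \<in> borel_measurable P" "X (\<tau> (Suc k)) \<in> borel_measurable P"
      using Xint[of k] Xint[of "Suc k"] by auto
    show "(\<lambda>\<omega>. if \<bar>X (\<tau> k) \<omega>\<bar> \<le> c \<and> \<bar>X (\<tau> (Suc k)) \<omega>\<bar> \<le> c then (X (\<tau> (Suc k)) \<omega> - X (\<tau> k) \<omega>)\<^sup>2 else 0) \<in> borel_measurable P"
      by measurable
  qed
  have i: "integrable P (\<lambda>\<omega>. 2 * c * \<bar>X (\<tau> N) \<omega>\<bar> - H \<omega>)" using Xint[of N] Hi by auto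
  show "integrable P D"
  proof (rule Bochner_Integration.integrable_bound[OF i Dm], intro AE_I2)
    fix \<omega> show "norm (D \<omega>) \<le> norm (2 * c * \<bar>X (\<tau> N) \<omega>\<bar> - H \<omega>)"
      using le[of \<omega>] D0[of \<omega>] by simp
  qed
  then have "expectation D \<le> expectation (\<lambda>\<omega>. 2 * c * \<bar>X (\<tau> N) \<omega>\<bar> - H \<omega>)"
    by (intro integral_mono i le)
  also have "\<dots> = 2 * c * expectation (\<lambda>\<omega>. \<bar>X (\<tau> N) \<omega>\<bar>)" using Xint[of N] Hi by simp
  finally show "expectation D \<le> 2 * c * expectation (\<lambda>\<omega>. \<bar>X (\<tau> N) \<omega>\<bar>)" .
qed

text \<open>Localisation by an event instead of a random time. The quantities to be controlled are
  finite for almost every path, so for large \<open>m\<close> the event where all of them are at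
  most \<open>m\<close> has probability close to 1.\<close>

lemma semimartingale_good_event:
  assumes X: "continuous_semimartingale P F X" and t: "0 < t" and \<epsilon>: "0 < \<epsilon>"
  obtains G K where "G \<in> events" "prob (space P - G) \<le> \<epsilon>"
    "\<And>N. 0 < N \<Longrightarrow> integrable P (\<lambda>\<omega>. indicator G \<omega> * (\<Sum>k<N. (X (t * real (Suc k) / real N) \<omega> - X (t * real k / real N) \<omega>)\<^sup>2))"
    "\<And>N. 0 < N \<Longrightarrow> expectation (\<lambda>\<omega>. indicator G \<omega> * (\<Sum>k<N. (X (t * real (Suc k) / real N) \<omega> - X (t * real k / real N) \<omega>)\<^sup>2)) \<le> K"
proof -
  obtain L A where L: "continuous_local_martingale P F L" and A: "continuous_adapted P F A" 
      "AE \<omega> in P. locally_bounded_variation (\<lambda>t. A t \<omega>)"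
    and XLA: "AE \<omega> in P. \<forall>t\<ge>0. X t \<omega> = L t \<omega> + A t \<omega>" and Xc: "continuous_adapted P F X"
    using X unfolding continuous_semimartingale_def by auto
  obtain \<tau> :: "nat \<Rightarrow> 'w \<Rightarrow> real" where
     \<tau>: "\<And>n. stopping_time F (\<tau> n)" "AE \<omega> in P. incseq (\<lambda>n. \<tau> n \<omega>) \<and> filterlim (\<lambda>n. \<tau> n \<omega>) at_top sequentially"
     "\<And>n. martingale P F (\<lambda>t \<omega>. L (min t (\<tau> n \<omega>)) \<omega>)" and Lc: "continuous_adapted P F L"
    using L unfolding continuous_local_martingale_def by auto
  define p where "p N k = t * real k / real N" for N k :: nat
  have p0: "0 \<le> p N k" for N k using t by (simp add: p_def)
  have pt: "p N k \<le> t" if "k \<le> N" for N k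
  proof (cases "N = 0")
    case False
    then have "t * real k \<le> t * real N" using that t by simp
    then show ?thesis using False by (simp add: p_def divide_le_eq)
  qed (use t in \<open>simp add: p_def\<close>)
  have pmono: "p N k \<le> p N (Suc k)" for N k using t by (simp add: p_def divide_right_mono)
  have [measurable]: "L (p N k) \<in> borel_measurable P" "A (p N k) \<in> borel_measurable P" "X (p N k) \<in> borel_measurable P" for N k
    using Lc A(1) Xc p0[of N k] F_measurable unfolding continuous_adapted_def by blast+
  have [measurable]: "\<tau> n \<in> borel_measurable P" for n
    by (rule measurable_stopping_time[OF \<tau>(1)]) (use subalg in \<open>auto simp: subalgebra_def\<close>)
  \<comment> \<open>The conditions concern the points of the uniform grids only and are countably
    many, so that \<open>G m\<close> is measurable.\<close>
  define G where "G m = {\<omega> \<in> space P. t < \<tau> m \<omega> \<and> (\<forall>N k. k \<le> N \<longrightarrow> \<bar>L (p N k) \<omega>\<bar> \<le> real m) \<and>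
     (\<forall>N. (\<Sum>k<N. \<bar>A (p N (Suc k)) \<omega> - A (p N k) \<omega>\<bar>) \<le> real m)}" for m
  have G_ev[measurable]: "G m \<in> events" for m unfolding G_def by measurable
  have ev: "AE \<omega> in P. eventually (\<lambda>m. \<omega> \<in> G m) sequentially"
  proof -
    have cL: "AE \<omega> in P. continuous_on {0..} (\<lambda>s. L s \<omega>)" using Lc unfolding continuous_adapted_def by auto
    show ?thesis
      using cL A(2) \<tau>(2) AE_space
    proof eventually_elim
      case (elim \<omega>)
      have 1: "eventually (\<lambda>m. t < \<tau> m \<omega>) sequentially"
        using elim(3) by (simp add: filterlim_at_top_dense)
      have "bounded ((\<lambda>s. L s \<omega>) ` {0..t})"
        by (intro compact_imp_bounded compact_continuous_image continuous_on_subset[OF elim(1)]) auto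
      then obtain b where b: "\<forall>s\<in>{0..t}. \<bar>L s \<omega>\<bar> \<le> b"
        unfolding bounded_iff by auto
      have 2: "eventually (\<lambda>m. b \<le> real m) sequentially" 
        using eventually_ge_at_top[of "nat \<lceil>b\<rceil>"] by (rule eventually_mono) linarith
      obtain K where K: "\<And>N \<pi>. is_partition t N \<pi> \<Longrightarrow> (\<Sum>k<N. \<bar>A (\<pi> (Suc k)) \<omega> - A (\<pi> k) \<omega>\<bar>) \<le> K"
        using elim(2) t unfolding locally_bounded_variation_def by (meson less_imp_le)
      have part: "is_partition t N (p N)" if "N > 0" for N
        using that pmono by (auto simp: is_partition_def p_def)
      have 3: "eventually (\<lambda>m. K \<le> real m) sequentially" 
        using eventually_ge_at_top[of "nat \<lceil>K\<rceil>"] by (rule eventually_mono) linarith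
      from 1 2 3 show ?case
      proof eventually_elim
        case (elim m)
        have "\<bar>L (p N k) \<omega>\<bar> \<le> real m" if "k \<le> N" for N k
          using bspec[OF b, of "p N k"] p0[of N k] pt[OF that] elim(2) by auto
        moreover have "(\<Sum>k<N. \<bar>A (p N (Suc k)) \<omega> - A (p N k) \<omega>\<bar>) \<le> real m" for N
          using K[OF part, of N] elim(3) by (cases "N = 0") auto
        ultimately show ?case using elim(1) \<open>\<omega> \<in> space P\<close> by (auto simp: G_def)
      qed
    qed
  qed
  have "(\<lambda>m. expectation (indicator (G m))) \<longlonglongrightarrow> expectation (\<lambda>_. 1 :: real)"
  proof (rule integral_dominated_convergence[where w="\<lambda>_. 1"])
    show "AE \<omega> in P. (\<lambda>m. indicator (G m) \<omega> :: real) \<longlonglongrightarrow> 1"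
      using ev
    proof eventually_elim
      case (elim \<omega>)
      show ?case
        by (rule tendsto_eventually) (use elim in \<open>auto elim!: eventually_mono simp: indicator_def\<close>)
    qed
  qed (auto simp: indicator_def)
  then have "(\<lambda>m. prob (G m)) \<longlonglongrightarrow> 1" by (simp add: prob_space)
  then have "eventually (\<lambda>m. 1 - \<epsilon> < prob (G m)) sequentially"
    using \<epsilon> by (intro order_tendstoD) auto
  then obtain m where m: "1 - \<epsilon> < prob (G m)" using eventually_happens by force
  \<comment> \<open>On \<open>G m\<close> the localising time exceeds \<open>t\<close>, so the
    stopped martingale agrees with \<open>L\<close> at all grid points.\<close>
  define Y where "Y s \<omega> = L (min s (\<tau> m \<omega>)) \<omega>" for s \<omega>
  have Y: "martingale P F Y" using \<tau>(3)[of m] by (simp add: Y_def[abs_def])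
  define D where "D N \<omega> = (\<Sum>k<N. if \<bar>Y (p N k) \<omega>\<bar> \<le> real m \<and> \<bar>Y (p N (Suc k)) \<omega>\<bar> \<le> real m
                then (Y (p N (Suc k)) \<omega> - Y (p N k) \<omega>)\<^sup>2 else 0)" for N \<omega>
  have D: "integrable P (D N)" "expectation (D N) \<le> 2 * real m * expectation (\<lambda>\<omega>. \<bar>Y t \<omega>\<bar>)" if "0 < N" for N
    using martingale_square_variation[OF Y, of "real m" "p N" N] p0 pmono that
    unfolding D_def[abs_def] by (auto simp: p_def)
  define V where "V N \<omega> = indicator (G m) \<omega> * (\<Sum>k<N. (X (p N (Suc k)) \<omega> - X (p N k) \<omega>)\<^sup>2)" for N \<omega>
  have V0: "0 \<le> V N \<omega>" for N \<omega> unfolding V_def by (intro mult_nonneg_nonneg sum_nonneg) auto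
  have D0: "0 \<le> D N \<omega>" for N \<omega> unfolding D_def by (intro sum_nonneg) auto
  \<comment> \<open>The martingale part contributes at most twice \<open>D\<close>. In the part of
    bounded variation each increment is at most \<open>m\<close> and their absolute sum is at most
    \<open>m\<close>, so the squares add up to at most \<open>m\<^sup>2\<close>.\<close>
  have VD: "AE \<omega> in P. V N \<omega> \<le> 2 * D N \<omega> + 2 * (real m)\<^sup>2" for N
    using XLA
  proof eventually_elim
    case (elim \<omega>)
    show ?case
    proof (cases "\<omega> \<in> G m")
      case True
      have YL: "Y (p N k) \<omega> = L (p N k) \<omega>" if "k \<le> N" for k
        using True pt[OF that] by (simp add: Y_def G_def min_def)
      have "V N \<omega> = (\<Sum>k<N. (X (p N (Suc k)) \<omega> - X (p N k) \<omega>)\<^sup>2)" using True by (simp add: V_def)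
      also have "\<dots> \<le> (\<Sum>k<N. 2 * (L (p N (Suc k)) \<omega> - L (p N k) \<omega>)\<^sup>2 + 2 * \<bar>A (p N (Suc k)) \<omega> - A (p N k) \<omega>\<bar>\<^sup>2)"
      proof (rule sum_mono)
        fix k
        have "(a + b - (c + d))\<^sup>2 \<le> 2 * (a - c)\<^sup>2 + 2 * \<bar>b - d\<bar>\<^sup>2" for a b c d :: real
          using zero_le_power2[of "(a - c) - (b - d)"] by (simp add: power2_eq_square algebra_simps)
        then show "(X (p N (Suc k)) \<omega> - X (p N k) \<omega>)\<^sup>2 \<le> 2 * (L (p N (Suc k)) \<omega> - L (p N k) \<omega>)\<^sup>2 + 2 * \<bar>A (p N (Suc k)) \<omega> - A (p N k) \<omega>\<bar>\<^sup>2"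
          using elim p0 by simp
      qed
      also have "\<dots> = 2 * (\<Sum>k<N. (L (p N (Suc k)) \<omega> - L (p N k) \<omega>)\<^sup>2) + 2 * (\<Sum>k<N. \<bar>A (p N (Suc k)) \<omega> - A (p N k) \<omega>\<bar>\<^sup>2)"
        by (simp add: sum.distrib sum_distrib_left)
      also have "(\<Sum>k<N. (L (p N (Suc k)) \<omega> - L (p N k) \<omega>)\<^sup>2) = D N \<omega>"
        unfolding D_def using True by (intro sum.cong refl) (auto simp: YL G_def)
      also have "(\<Sum>k<N. \<bar>A (p N (Suc k)) \<omega> - A (p N k) \<omega>\<bar>\<^sup>2) \<le> (\<Sum>k<N. real m * \<bar>A (p N (Suc k)) \<omega> - A (p N k) \<omega>\<bar>)"
      proof (rule sum_mono)
        fix k assume "k \<in> {..<N}"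
        then have "\<bar>A (p N (Suc k)) \<omega> - A (p N k) \<omega>\<bar> \<le> (\<Sum>k<N. \<bar>A (p N (Suc k)) \<omega> - A (p N k) \<omega>\<bar>)"
          by (intro member_le_sum) auto
        also have "\<dots> \<le> real m" using True by (auto simp: G_def)
        finally show "\<bar>A (p N (Suc k)) \<omega> - A (p N k) \<omega>\<bar>\<^sup>2 \<le> real m * \<bar>A (p N (Suc k)) \<omega> - A (p N k) \<omega>\<bar>"
          unfolding power2_eq_square by (intro mult_right_mono) auto
      qed
      also have "\<dots> = real m * (\<Sum>k<N. \<bar>A (p N (Suc k)) \<omega> - A (p N k) \<omega>\<bar>)" by (simp add: sum_distrib_left)
      also have "\<dots> \<le> real m * real m" using True by (intro mult_left_mono) (auto simp: G_def)
      finally show ?thesis by (simp add: power2_eq_square)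
    qed (use D0[of N \<omega>] in \<open>simp add: V_def\<close>)
  qed
  have Vm: "V N \<in> borel_measurable P" for N unfolding V_def[abs_def] by measurable
  have Vi: "integrable P (V N)" if "0 < N" for N
  proof (rule Bochner_Integration.integrable_bound[OF _ Vm])
    show "integrable P (\<lambda>\<omega>. 2 * D N \<omega> + 2 * (real m)\<^sup>2)" using D[OF that] by auto
    show "AE \<omega> in P. norm (V N \<omega>) \<le> norm (2 * D N \<omega> + 2 * (real m)\<^sup>2)"
      using VD[of N] V0[of N] by (auto elim!: eventually_mono)
  qed
  have VE: "expectation (V N) \<le> 4 * real m * expectation (\<lambda>\<omega>. \<bar>Y t \<omega>\<bar>) + 2 * (real m)\<^sup>2" if "0 < N" for N
  proof -
    have "expectation (V N) \<le> expectation (\<lambda>\<omega>. 2 * D N \<omega> + 2 * (real m)\<^sup>2)"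
      by (intro integral_mono_AE Vi that VD) (use D[OF that] in auto)
    also have "\<dots> = 2 * expectation (D N) + 2 * (real m)\<^sup>2" using D[OF that] by (simp add: prob_space)
    finally show ?thesis using D(2)[OF that] by linarith
  qed
  show ?thesis
  proof (rule that)
    show "G m \<in> events" by (rule G_ev)
    show "prob (space P - G m) \<le> \<epsilon>" using m prob_compl[OF G_ev[of m]] by simp
  qed (use Vi VE in \<open>simp_all add: V_def[abs_def] p_def\<close>)
qed

end

section \<open>Stratonovich solutions on a compact set\<close>

context prob_space
begin

text \<open>A subadditive gauge of convergence in probability.\<close>

definition epm :: "('a \<Rightarrow> 'b::euclidean_space) \<Rightarrow> real"
  where "epm X = expectation (\<lambda>\<omega>. min 1 (norm (X \<omega>)))"

lemma epm_integrable: "X \<in> borel_measurable M \<Longrightarrow> integrable M (\<lambda>\<omega>. min 1 (norm (X \<omega>)))"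
  by (rule integrable_const_bound[where B=1]) auto

lemma epm_mono:
  assumes "X \<in> borel_measurable M" "Y \<in> borel_measurable M" "AE \<omega> in M. norm (X \<omega>) \<le> norm (Y \<omega>)"
  shows "epm X \<le> epm Y"
  unfolding epm_def
  by (rule integral_mono_AE) (use assms epm_integrable in \<open>auto elim!: eventually_mono\<close>)

lemma epm_add:
  fixes X Y :: "'a \<Rightarrow> 'b::euclidean_space"
  assumes [measurable]: "X \<in> borel_measurable M" "Y \<in> borel_measurable M"
  shows "epm (\<lambda>\<omega>. X \<omega> + Y \<omega>) \<le> epm X + epm Y"
proof -
  have "epm (\<lambda>\<omega>. X \<omega> + Y \<omega>) \<le> expectation (\<lambda>\<omega>. min 1 (norm (X \<omega>)) + min 1 (norm (Y \<omega>)))"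
    unfolding epm_def
  proof (rule integral_mono)
    fix \<omega> show "min 1 (norm (X \<omega> + Y \<omega>)) \<le> min 1 (norm (X \<omega>)) + min 1 (norm (Y \<omega>))"
      using norm_triangle_ineq[of "X \<omega>" "Y \<omega>"] norm_ge_zero[of "X \<omega>"] norm_ge_zero[of "Y \<omega>"] by linarith
  qed (use assms in \<open>auto intro!: epm_integrable\<close>)
  also have "\<dots> = epm X + epm Y"
    unfolding epm_def using assms by (intro Bochner_Integration.integral_add epm_integrable)
  finally show ?thesis .
qed

lemma epm_sum:
  fixes X :: "'i \<Rightarrow> 'a \<Rightarrow> 'b::euclidean_space"
  assumes "finite I" "\<And>i. i \<in> I \<Longrightarrow> X i \<in> borel_measurable M"
  shows "epm (\<lambda>\<omega>. \<Sum>i\<in>I. X i \<omega>) \<le> (\<Sum>i\<in>I. epm (X i))"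
  using assms
proof (induction I)
  case empty then show ?case by (simp add: epm_def)
next
  case (insert i I)
  then have "epm (\<lambda>\<omega>. X i \<omega> + (\<Sum>i\<in>I. X i \<omega>)) \<le> epm (X i) + epm (\<lambda>\<omega>. \<Sum>i\<in>I. X i \<omega>)"
    by (intro epm_add) auto
  with insert show ?case by simp
qed

lemma epm_le_expectation:
  assumes "integrable M (\<lambda>\<omega>. norm (X \<omega>))" "X \<in> borel_measurable M"
  shows "epm X \<le> expectation (\<lambda>\<omega>. norm (X \<omega>))"
  unfolding epm_def by (rule integral_mono) (use assms epm_integrable in auto)

text \<open>The bridge to the gauge from the definition of the integral, which bounds the
  probability of a large distance.\<close>

lemma epm_le_prob:
  fixes X :: "'a \<Rightarrow> 'b::euclidean_space"
  assumes [measurable]: "X \<in> borel_measurable M" and \<epsilon>: "0 \<le> \<epsilon>"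
  shows "epm X \<le> \<epsilon> + prob {\<omega> \<in> space M. \<epsilon> < norm (X \<omega>)}"
proof -
  let ?A = "{\<omega> \<in> space M. \<epsilon> < norm (X \<omega>)}"
  have "epm X \<le> expectation (\<lambda>\<omega>. \<epsilon> + indicator ?A \<omega>)"
    unfolding epm_def
  proof (rule integral_mono)
    show "integrable M (\<lambda>\<omega>. \<epsilon> + indicator ?A \<omega>)"
      by (intro Bochner_Integration.integrable_add integrable_const integrable_real_indicator) (auto simp: emeasure_eq_measure)
    show "min 1 (norm (X \<omega>)) \<le> \<epsilon> + indicator ?A \<omega>" if "\<omega> \<in> space M" for \<omega>
      using \<epsilon> that by (auto simp: indicator_def)
  qed (rule epm_integrable[OF assms(1)])
  also have "\<dots> = \<epsilon> + prob ?A"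
    by (subst Bochner_Integration.integral_add) (auto simp: emeasure_eq_measure prob_space intro!: integrable_real_indicator)
  finally show ?thesis .
qed

text \<open>Outside \<open>G\<close> the truncation at 1 costs at most the probability of the
  complement. Moments then have to be estimated on \<open>G\<close> only.\<close>

lemma epm_split:
  fixes X :: "'a \<Rightarrow> 'b::euclidean_space"
  assumes [measurable]: "X \<in> borel_measurable M" "G \<in> events"
  shows "epm X \<le> prob (space M - G) + epm (\<lambda>\<omega>. indicator G \<omega> *\<^sub>R X \<omega>)"
proof -
  have "epm X \<le> expectation (\<lambda>\<omega>. indicator (space M - G) \<omega> + min 1 (norm (indicator G \<omega> *\<^sub>R X \<omega>)))"
    unfolding epm_def
  proof (rule integral_mono)
    show "integrable M (\<lambda>\<omega>. indicator (space M - G) \<omega> + min 1 (norm (indicator G \<omega> *\<^sub>R X \<omega>)))"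
      by (intro Bochner_Integration.integrable_add epm_integrable integrable_real_indicator) (auto simp: emeasure_eq_measure)
  next
    show "min 1 (norm (X \<omega>)) \<le> indicator (space M - G) \<omega> + min 1 (norm (indicator G \<omega> *\<^sub>R X \<omega>))" if "\<omega> \<in> space M" for \<omega>
      using that by (auto simp: indicator_def)
  qed (rule epm_integrable[OF assms(1)])
  also have "\<dots> = prob (space M - G) + epm (\<lambda>\<omega>. indicator G \<omega> *\<^sub>R X \<omega>)"
    unfolding epm_def
  proof (subst Bochner_Integration.integral_add)
    show "integrable M (indicat_real (space M - G))"
      by (rule integrable_real_indicator) (auto simp: emeasure_eq_measure)
    show "integrable M (\<lambda>\<omega>. min 1 (norm (indicator G \<omega> *\<^sub>R X \<omega>)))"
      by (rule epm_integrable) measurable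
  qed simp
  finally show ?thesis .
qed

end

text \<open>An abstract version of the equation on a compact set \<open>M\<close>:
  \<open>S i x\<close> stands for the derivative of \<open>\<sigma> i\<close> at \<open>x\<close>,
  with a Taylor estimate between points of \<open>M\<close>. One constant \<open>C\<close> serves
  all bounds; \<open>1 \<le> C\<close> lets lower powers of it be absorbed into higher ones and lets
  it be pulled out of a truncated mean.\<close>

locale stratonovich_flow = brownian_family P F B
  for P :: "'w measure" and F :: "real \<Rightarrow> 'w measure" and B :: "'i::finite \<Rightarrow> real \<Rightarrow> 'w \<Rightarrow> real" +
  fixes W :: "real \<Rightarrow> 'w \<Rightarrow> 'a::euclidean_space" and \<sigma> :: "'i \<Rightarrow> 'a \<Rightarrow> 'a" 
    and S :: "'i \<Rightarrow> 'a \<Rightarrow> 'a \<Rightarrow> 'a" and M :: "'a set" and C :: real and w0 :: 'a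
  assumes sol: "stratonovich_solution P F B \<sigma> W"
    and W_M: "\<And>t \<omega>. 0 \<le> t \<Longrightarrow> \<omega> \<in> space P \<Longrightarrow> W t \<omega> \<in> M"
    and M_compact: "compact M"
    and W_0: "AE \<omega> in P. W 0 \<omega> = w0" and w0: "w0 \<in> M"
    and C: "1 \<le> C"
    and M_bound: "\<And>x. x \<in> M \<Longrightarrow> norm x \<le> C"
    and \<sigma>_bound: "\<And>i x. x \<in> M \<Longrightarrow> norm (\<sigma> i x) \<le> C"
    and \<sigma>_lipschitz: "\<And>i x y. x \<in> M \<Longrightarrow> y \<in> M \<Longrightarrow> norm (\<sigma> i y - \<sigma> i x) \<le> C * norm (y - x)"
    and S_linear: "\<And>i x. x \<in> M \<Longrightarrow> linear (S i x)"
    and S_bound: "\<And>i x v. x \<in> M \<Longrightarrow> norm (S i x v) \<le> C * norm v"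
    and \<sigma>_taylor: "\<And>i x y. x \<in> M \<Longrightarrow> y \<in> M \<Longrightarrow> norm (\<sigma> i y - \<sigma> i x - S i x (y - x)) \<le> C * (norm (y - x))\<^sup>2"
    and S\<sigma>_continuous: "\<And>i j. continuous_on M (\<lambda>x. S i x (\<sigma> j x))"
begin

section \<open>Measurability and mean-square continuity of the solution\<close>

lemma W_F: "0 \<le> t \<Longrightarrow> W t \<in> borel_measurable (F t)"
  and W_continuous: "AE \<omega> in P. continuous_on {0..} (\<lambda>t. W t \<omega>)"
  using sol unfolding stratonovich_solution_def continuous_adapted_def by auto

lemma \<sigma>_continuous: "continuous_on M (\<sigma> i)"
proof (rule continuous_on_iff[THEN iffD2], intro ballI allI impI)
  fix x e assume x: "x \<in> M" and e: "0 < (e::real)"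
  show "\<exists>d>0. \<forall>x'\<in>M. dist x' x < d \<longrightarrow> dist (\<sigma> i x') (\<sigma> i x) < e"
  proof (intro exI[of _ "e / C"] conjI ballI impI)
    fix y assume y: "y \<in> M" "dist y x < e / C"
    have "dist (\<sigma> i y) (\<sigma> i x) \<le> C * dist y x" using \<sigma>_lipschitz[OF x y(1)] by (simp add: dist_norm)
    also have "\<dots> < e" using y(2) C by (simp add: field_simps)
    finally show "dist (\<sigma> i y) (\<sigma> i x) < e" .
  qed (use e C in auto)
qed

text \<open>\<open>f\<close> is controlled on \<open>M\<close> alone, so \<open>W t\<close> is
  regarded as a map into the Borel space restricted to \<open>M\<close>, where a continuous function
  is measurable.\<close>

lemma cont_F:
  fixes f :: "'a \<Rightarrow> 'b::topological_space"
  assumes f: "continuous_on M f" and t: "0 \<le> t"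
  shows "(\<lambda>\<omega>. f (W t \<omega>)) \<in> borel_measurable (F t)"
proof -
  have "W t \<in> measurable (F t) (restrict_space borel M)"
    using W_F[OF t] W_M[OF t] space_F by (intro measurable_restrict_space2) auto
  from measurable_compose[OF this borel_measurable_continuous_on_restrict[OF f]] show ?thesis .
qed

lemma cont_P: "continuous_on M f \<Longrightarrow> 0 \<le> t \<Longrightarrow> (\<lambda>\<omega>. f (W t \<omega>)) \<in> borel_measurable P"
  using cont_F F_measurable by blast

lemmas W_P = cont_P[OF continuous_on_id] and \<sigma>_F = cont_F[OF \<sigma>_continuous] and \<sigma>_P = cont_P[OF \<sigma>_continuous]

text \<open>Continuity in both times at once, by dominated convergence: almost every path is
  continuous, and \<open>f\<close> is bounded on the compact set \<open>M\<close>.\<close>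

lemma continuous_expectation:
  fixes f :: "'a \<Rightarrow> 'b::euclidean_space"
  assumes f: "continuous_on M f"
  shows "continuous_on ({0..} \<times> {0..}) (\<lambda>(a, b). expectation (\<lambda>\<omega>. (norm (f (W b \<omega>) - f (W a \<omega>)))\<^sup>2))"
  unfolding continuous_on_sequentially
proof (intro allI ballI impI, clarsimp simp: comp_def case_prod_unfold)
  fix a b :: real and x :: "nat \<Rightarrow> real \<times> real"
  assume ab: "0 \<le> a" "0 \<le> b" and x: "\<forall>n. x n \<in> {0..} \<times> {0..}" "x \<longlonglongrightarrow> (a, b)"
  have x0: "0 \<le> fst (x n)" "0 \<le> snd (x n)" for n using x(1)[rule_format, of n] by (auto simp: mem_Times_iff)
  have lim: "(\<lambda>n. fst (x n)) \<longlonglongrightarrow> a" "(\<lambda>n. snd (x n)) \<longlonglongrightarrow> b"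
    using tendsto_fst[OF x(2)] tendsto_snd[OF x(2)] by auto
  have "bounded (f ` M)" by (intro compact_imp_bounded compact_continuous_image f M_compact)
  then obtain K where K: "\<forall>y\<in>M. norm (f y) \<le> K" unfolding bounded_iff by auto
  have meas: "(\<lambda>\<omega>. (norm (f (W b \<omega>) - f (W a \<omega>)))\<^sup>2) \<in> borel_measurable P" if "0 \<le> a" "0 \<le> b" for a b
  proof -
    have [measurable]: "(\<lambda>\<omega>. f (W a \<omega>)) \<in> borel_measurable P" "(\<lambda>\<omega>. f (W b \<omega>)) \<in> borel_measurable P"
      using cont_P[OF f] that by auto
    show ?thesis by measurable
  qed
  show "(\<lambda>n. expectation (\<lambda>\<omega>. (norm (f (W (snd (x n)) \<omega>) - f (W (fst (x n)) \<omega>)))\<^sup>2)) \<longlonglongrightarrow>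
          expectation (\<lambda>\<omega>. (norm (f (W b \<omega>) - f (W a \<omega>)))\<^sup>2)"
  proof (rule integral_dominated_convergence[where w="\<lambda>_. (2 * K)\<^sup>2"])
    show "AE \<omega> in P. (\<lambda>n. (norm (f (W (snd (x n)) \<omega>) - f (W (fst (x n)) \<omega>)))\<^sup>2) \<longlonglongrightarrow> (norm (f (W b \<omega>) - f (W a \<omega>)))\<^sup>2"
      using W_continuous AE_space
    proof eventually_elim
      case (elim \<omega>)
      have "continuous_on {0..} (\<lambda>t. f (W t \<omega>))"
        by (rule continuous_on_compose2[OF f elim(1)]) (use W_M elim(2) in auto)
      then have *: "(\<lambda>n. f (W (y n) \<omega>)) \<longlonglongrightarrow> f (W c \<omega>)" if "y \<longlonglongrightarrow> c" "0 \<le> c" "\<And>n. 0 \<le> y n" for y c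
        using that unfolding continuous_on_sequentially comp_def by (metis atLeast_iff)
      show ?case
        by (rule tendsto_power[OF tendsto_norm[OF tendsto_diff[OF *[OF lim(2) ab(2) x0(2)] *[OF lim(1) ab(1) x0(1)]]]])
    qed
    show "AE \<omega> in P. norm ((norm (f (W (snd (x n)) \<omega>) - f (W (fst (x n)) \<omega>)))\<^sup>2) \<le> (2 * K)\<^sup>2" for n
    proof (rule AE_I2)
      fix \<omega> assume \<omega>: "\<omega> \<in> space P"
      have le: "norm (f (W (snd (x n)) \<omega>) - f (W (fst (x n)) \<omega>)) \<le> 2 * K"
        using norm_triangle_ineq4[of "f (W (snd (x n)) \<omega>)" "f (W (fst (x n)) \<omega>)"] 
          K[rule_format, OF W_M[OF x0(1)[of n] \<omega>]] K[rule_format, OF W_M[OF x0(2)[of n] \<omega>]] by linarith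
      show "norm ((norm (f (W (snd (x n)) \<omega>) - f (W (fst (x n)) \<omega>)))\<^sup>2) \<le> (2 * K)\<^sup>2"
        using power_mono[OF le norm_ge_zero, of 2] by (simp only: real_norm_def abs_power2)
    qed
  qed (use ab x0 in \<open>auto intro!: meas\<close>)
qed

text \<open>The mean-square displacement is continuous in the two times and vanishes on the
  diagonal; uniform continuity on the compact square gives one \<delta> for all cells of a fine
  grid.\<close>

lemma mean_square_continuity:
  fixes f :: "'a \<Rightarrow> 'b::euclidean_space"
  assumes f: "continuous_on M f" and "0 \<le> t" "0 < \<epsilon>"
  obtains \<delta> where "0 < \<delta>" 
    "\<And>a b. 0 \<le> a \<Longrightarrow> a \<le> t \<Longrightarrow> 0 \<le> b \<Longrightarrow> b \<le> t \<Longrightarrow> \<bar>b - a\<bar> < \<delta> \<Longrightarrow> expectation (\<lambda>\<omega>. (norm (f (W b \<omega>) - f (W a \<omega>)))\<^sup>2) < \<epsilon>"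
proof -
  let ?h = "\<lambda>(a, b). expectation (\<lambda>\<omega>. (norm (f (W b \<omega>) - f (W a \<omega>)))\<^sup>2)"
  have "uniformly_continuous_on ({0..t} \<times> {0..t}) ?h"
    by (intro compact_uniformly_continuous continuous_on_subset[OF continuous_expectation[OF f]] compact_Times) auto
  from this[unfolded uniformly_continuous_on_def, rule_format, OF \<open>0 < \<epsilon>\<close>]
  obtain \<delta> where \<delta>: "\<delta> > 0" "\<forall>x\<in>{0..t} \<times> {0..t}. \<forall>x'\<in>{0..t} \<times> {0..t}. dist x' x < \<delta> \<longrightarrow> dist (?h x') (?h x) < \<epsilon>"
    by blast
  show thesis
  proof (rule that[OF \<delta>(1)])
    fix a b :: real assume ab: "0 \<le> a" "a \<le> t" "0 \<le> b" "b \<le> t" "\<bar>b - a\<bar> < \<delta>"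
    then have "dist (?h (a, b)) (?h (a, a)) < \<epsilon>" by (intro \<delta>(2)[rule_format]) (auto simp: dist_Pair_Pair dist_real_def)
    then show "expectation (\<lambda>\<omega>. (norm (f (W b \<omega>) - f (W a \<omega>)))\<^sup>2) < \<epsilon>" by (simp add: dist_real_def)
  qed
qed

section \<open>Left-point steps and trapezoidal corrections\<close>

definition ito_step :: "real \<Rightarrow> real \<Rightarrow> 'w \<Rightarrow> 'a"
  where "ito_step a b \<omega> = (\<Sum>i\<in>UNIV. (B i b \<omega> - B i a \<omega>) *\<^sub>R \<sigma> i (W a \<omega>))"

definition corr_step :: "real \<Rightarrow> real \<Rightarrow> 'w \<Rightarrow> 'a"
  where "corr_step a b \<omega> = (\<Sum>i\<in>UNIV. ((B i b \<omega> - B i a \<omega>) / 2) *\<^sub>R (\<sigma> i (W b \<omega>) - \<sigma> i (W a \<omega>)))"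

lemma ito_step_P: "0 \<le> a \<Longrightarrow> 0 \<le> b \<Longrightarrow> ito_step a b \<in> borel_measurable P"
  unfolding ito_step_def by (intro borel_measurable_sum borel_measurable_scaleR borel_measurable_diff B_meas \<sigma>_P) 

lemma corr_step_P: "0 \<le> a \<Longrightarrow> 0 \<le> b \<Longrightarrow> corr_step a b \<in> borel_measurable P"
  unfolding corr_step_def by (intro borel_measurable_sum borel_measurable_scaleR borel_measurable_diff borel_measurable_divide borel_measurable_const B_meas \<sigma>_P)

lemma trapezoidal_sum_eq:
  "(\<Sum>i\<in>UNIV. trapezoidal_sum (\<lambda>s \<omega>. \<sigma> i (W s \<omega>)) (B i) N \<pi> \<omega>) =
   (\<Sum>k<N. ito_step (\<pi> k) (\<pi> (Suc k)) \<omega> + corr_step (\<pi> k) (\<pi> (Suc k)) \<omega>)"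
proof -
  have *: "d *\<^sub>R ((1/2) *\<^sub>R (x + y)) = d *\<^sub>R x + (d / 2) *\<^sub>R (y - x)" for d and x y :: 'a
  proof -
    have "d *\<^sub>R x = (d / 2) *\<^sub>R x + (d / 2) *\<^sub>R x" by (simp flip: scaleR_add_left)
    then show ?thesis by (simp add: scaleR_add_right scaleR_diff_right)
  qed
  show ?thesis
    unfolding trapezoidal_sum_def ito_step_def corr_step_def sum.distrib[symmetric] *
    by (rule sum.swap)
qed

lemma stratonovich_convergence:
  assumes s: "0 \<le> s" and \<epsilon>: "0 < \<epsilon>"
  obtains \<delta> where "0 < \<delta>" "\<And>N \<pi>. is_partition s N \<pi> \<Longrightarrow> (\<And>k. k < N \<Longrightarrow> \<pi> (Suc k) - \<pi> k < \<delta>) \<Longrightarrow>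
     epm (\<lambda>\<omega>. W s \<omega> - W 0 \<omega> - (\<Sum>k<N. ito_step (\<pi> k) (\<pi> (Suc k)) \<omega> + corr_step (\<pi> k) (\<pi> (Suc k)) \<omega>)) \<le> \<epsilon>"
proof -
  obtain I where I: "\<And>i. has_stratonovich_integral P (\<lambda>s \<omega>. \<sigma> i (W s \<omega>)) (B i) s (I i)"
     and WI: "AE \<omega> in P. W s \<omega> = W 0 \<omega> + (\<Sum>i\<in>UNIV. I i \<omega>)"
    using sol s unfolding stratonovich_solution_def by blast
  \<comment> \<open>Each index costs \<epsilon>' twice, once as a distance and once as the
    probability of exceeding it. The smallest of the finitely many mesh bounds then serves all
    indices.\<close>
  define \<epsilon>' where "\<epsilon>' = \<epsilon> / (2 * CARD('i))"
  have \<epsilon>': "0 < \<epsilon>'" using \<epsilon> by (simp add: \<epsilon>'_def)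
  define Q where "Q i \<delta> \<longleftrightarrow> (\<forall>N \<pi>. is_partition s N \<pi> \<longrightarrow> (\<forall>k<N. \<pi> (Suc k) - \<pi> k < \<delta>) \<longrightarrow>
     measure P {\<omega> \<in> space P. \<epsilon>' < dist (trapezoidal_sum (\<lambda>s \<omega>. \<sigma> i (W s \<omega>)) (B i) N \<pi> \<omega>) (I i \<omega>)} < \<epsilon>')" for i \<delta>
  have "\<exists>\<delta>>0. Q i \<delta>" for i
    using I[of i] \<epsilon>' unfolding has_stratonovich_integral_def Q_def by blast
  then obtain \<delta> where \<delta>: "\<And>i. 0 < \<delta> i" "\<And>i. Q i (\<delta> i)"
    by metis
  have I_P: "I i \<in> borel_measurable P" for i using I[of i] unfolding has_stratonovich_integral_def by auto
  show thesis
  proof (rule that[of "Min (range \<delta>)"])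
    show "0 < Min (range \<delta>)" using \<delta>(1) by auto
    fix N \<pi> assume \<pi>: "is_partition s N \<pi>" and mesh: "\<And>k. k < N \<Longrightarrow> \<pi> (Suc k) - \<pi> k < Min (range \<delta>)"
    let ?T = "\<lambda>i. trapezoidal_sum (\<lambda>s \<omega>. \<sigma> i (W s \<omega>)) (B i) N \<pi>"
    have \<pi>0: "0 \<le> \<pi> k" if "k \<le> N" for k
      using that by (induction k) (use \<pi> in \<open>auto simp: is_partition_def Suc_le_eq intro: order_trans[of 0 "\<pi> _"]\<close>)
    have T_P: "?T i \<in> borel_measurable P" for i
      unfolding trapezoidal_sum_def using \<pi>0
      by (intro borel_measurable_sum borel_measurable_scaleR borel_measurable_diff borel_measurable_add borel_measurable_const B_meas \<sigma>_P) auto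
    have le: "epm (\<lambda>\<omega>. I i \<omega> - ?T i \<omega>) \<le> \<epsilon>' + \<epsilon>'" for i
    proof -
      have "epm (\<lambda>\<omega>. I i \<omega> - ?T i \<omega>) \<le> \<epsilon>' + prob {\<omega> \<in> space P. \<epsilon>' < norm (I i \<omega> - ?T i \<omega>)}"
        using \<epsilon>' by (intro epm_le_prob borel_measurable_diff I_P T_P) auto
      also have "prob {\<omega> \<in> space P. \<epsilon>' < norm (I i \<omega> - ?T i \<omega>)} \<le> \<epsilon>'"
      proof -
        have "\<pi> (Suc k) - \<pi> k < \<delta> i" if "k < N" for k
          using mesh[OF that] Min_le[of "range \<delta>" "\<delta> i"] by simp
        from \<delta>(2)[of i, unfolded Q_def, rule_format, OF \<pi> this]
        show ?thesis by (simp add: dist_norm norm_minus_commute)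
      qed
      finally show ?thesis by simp
    qed
    have "epm (\<lambda>\<omega>. W s \<omega> - W 0 \<omega> - (\<Sum>i\<in>UNIV. ?T i \<omega>)) \<le> epm (\<lambda>\<omega>. \<Sum>i\<in>UNIV. I i \<omega> - ?T i \<omega>)"
    proof (rule epm_mono)
      show "(\<lambda>\<omega>. W s \<omega> - W 0 \<omega> - (\<Sum>i\<in>UNIV. ?T i \<omega>)) \<in> borel_measurable P"
        by (intro borel_measurable_diff borel_measurable_sum W_P T_P s order_refl)
      show "(\<lambda>\<omega>. \<Sum>i\<in>UNIV. I i \<omega> - ?T i \<omega>) \<in> borel_measurable P"
        by (intro borel_measurable_diff borel_measurable_sum I_P T_P)
      show "AE \<omega> in P. norm (W s \<omega> - W 0 \<omega> - (\<Sum>i\<in>UNIV. ?T i \<omega>)) \<le> norm (\<Sum>i\<in>UNIV. I i \<omega> - ?T i \<omega>)"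
        using WI
      proof eventually_elim
        case (elim \<omega>)
        then have "W s \<omega> - W 0 \<omega> - (\<Sum>i\<in>UNIV. ?T i \<omega>) = (\<Sum>i\<in>UNIV. I i \<omega> - ?T i \<omega>)"
          by (simp only: sum_subtractf add_diff_cancel_left')
        then show ?case by simp
      qed
    qed
    also have "\<dots> \<le> (\<Sum>i\<in>UNIV. epm (\<lambda>\<omega>. I i \<omega> - ?T i \<omega>))"
      by (intro epm_sum borel_measurable_diff I_P T_P) auto
    also have "\<dots> \<le> (\<Sum>i\<in>(UNIV::'i set). \<epsilon>' + \<epsilon>')" by (intro sum_mono le)
    also have "\<dots> = \<epsilon>" by (simp add: \<epsilon>'_def)
    finally show "epm (\<lambda>\<omega>. W s \<omega> - W 0 \<omega> - (\<Sum>k<N. ito_step (\<pi> k) (\<pi> (Suc k)) \<omega> + corr_step (\<pi> k) (\<pi> (Suc k)) \<omega>)) \<le> \<epsilon>"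
      unfolding trapezoidal_sum_eq .
  qed
qed

end

section \<open>Uniform grids and their refinements\<close>

definition grid :: "real \<Rightarrow> nat \<Rightarrow> nat \<Rightarrow> real"
  where "grid t N k = t * real k / real N"

lemma grid_0 [simp]: "grid t N 0 = 0" by (simp add: grid_def)

lemma grid_refl [simp]: "0 < N \<Longrightarrow> grid t N N = t" by (simp add: grid_def)

lemma grid_nonneg: "0 \<le> t \<Longrightarrow> 0 \<le> grid t N k" by (simp add: grid_def)

lemma grid_mono: "0 \<le> t \<Longrightarrow> k \<le> l \<Longrightarrow> grid t N k \<le> grid t N l"
  by (simp add: grid_def divide_right_mono mult_left_mono)

lemma grid_le: "0 \<le> t \<Longrightarrow> 0 < N \<Longrightarrow> k \<le> N \<Longrightarrow> grid t N k \<le> t"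
  using grid_mono[of t k N N] by simp

lemma grid_step: "0 < N \<Longrightarrow> grid t N (Suc k) - grid t N k = t / real N"
  by (simp add: grid_def field_simps)

lemma grid_refine: "0 < r \<Longrightarrow> grid t (N * r) (k * r) = grid t N k"
  by (simp add: grid_def)

text \<open>The first \<open>k\<close> cells partition the initial interval up to a grid point; in
  this form the integral is applied at intermediate times.\<close>

lemma grid_partition: "0 \<le> t \<Longrightarrow> is_partition (grid t N k) k (grid t N)"
  by (simp add: is_partition_def grid_mono)

lemma sum_blocks: "(\<Sum>l<(N::nat) * r. f l) = (\<Sum>k<N. \<Sum>l<r. f (k * r + l))"
  for f :: "nat \<Rightarrow> 'b::comm_monoid_add"
proof (induction N)
  case (Suc N)
  have "(\<Sum>l<m + r. f l) = (\<Sum>l<m. f l) + (\<Sum>l<r. f (m + l))" for m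
    by (induction r) (auto simp: add.assoc)
  from this[of "N * r"] show ?case using Suc by (simp add: add.commute)
qed simp

lemma eventually_small_mesh:
  fixes d :: real assumes "0 < d" shows "\<forall>\<^sub>F r in sequentially. t / real r < d"
proof -
  have "(\<lambda>r. t / real r) \<longlonglongrightarrow> 0" by (rule lim_const_over_n)
  then show ?thesis using assms by (rule order_tendstoD)
qed

section \<open>Limits along uniform grids\<close>

context stratonovich_flow
begin

lemma trapezoidal_limit:
  assumes t: "0 < t" and \<epsilon>: "0 < \<epsilon>"
  shows "\<forall>\<^sub>F N in sequentially. epm (\<lambda>\<omega>. W t \<omega> - W 0 \<omega> - 
    (\<Sum>k<N. ito_step (grid t N k) (grid t N (Suc k)) \<omega> + corr_step (grid t N k) (grid t N (Suc k)) \<omega>)) \<le> \<epsilon>"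
proof -
  obtain \<delta> where \<delta>: "0 < \<delta>" "\<And>N \<pi>. is_partition t N \<pi> \<Longrightarrow> (\<And>k. k < N \<Longrightarrow> \<pi> (Suc k) - \<pi> k < \<delta>) \<Longrightarrow>
     epm (\<lambda>\<omega>. W t \<omega> - W 0 \<omega> - (\<Sum>k<N. ito_step (\<pi> k) (\<pi> (Suc k)) \<omega> + corr_step (\<pi> k) (\<pi> (Suc k)) \<omega>)) \<le> \<epsilon>"
    using stratonovich_convergence[of t \<epsilon>] t \<epsilon> by (auto intro: less_imp_le)
  show ?thesis
    using eventually_small_mesh[OF \<delta>(1), of t] eventually_gt_at_top[of 0]
  proof eventually_elim
    case (elim N)
    show ?case by (rule \<delta>(2)) (use grid_partition[of t N N] grid_step[of N t] elim t in auto)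
  qed
qed

text \<open>The integral is a statement on intervals that start at 0. For a coarse cell, subtract
  the statements at its two ends, both taken along the refined grid, which contains these ends. As
  there are finitely many coarse points, one refinement serves all cells.\<close>

lemma grid_limit:
  assumes t: "0 < t" and \<epsilon>: "0 < \<epsilon>" and N: "0 < N"
  shows "\<forall>\<^sub>F r in sequentially. \<forall>k<N. epm (\<lambda>\<omega>. W (grid t N (Suc k)) \<omega> - W (grid t N k) \<omega> - 
    (\<Sum>l<r. ito_step (grid t (N * r) (k * r + l)) (grid t (N * r) (k * r + Suc l)) \<omega> 
          + corr_step (grid t (N * r) (k * r + l)) (grid t (N * r) (k * r + Suc l)) \<omega>)) \<le> \<epsilon>"
proof -
  define Z where "Z r k \<omega> = W (grid t N k) \<omega> - W 0 \<omega> - (\<Sum>l<k * r. ito_step (grid t (N * r) l) (grid t (N * r) (Suc l)) \<omega> 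
          + corr_step (grid t (N * r) l) (grid t (N * r) (Suc l)) \<omega>)" for r k \<omega>
  have Z_P: "Z r k \<in> borel_measurable P" for r k
    unfolding Z_def using grid_nonneg[of t] t
    by (intro borel_measurable_diff borel_measurable_sum borel_measurable_add ito_step_P corr_step_P W_P) auto
  have "\<forall>\<^sub>F r in sequentially. epm (Z r k) \<le> \<epsilon> / 2" for k
  proof -
    obtain \<delta> where \<delta>: "0 < \<delta>" "\<And>n \<pi>. is_partition (grid t N k) n \<pi> \<Longrightarrow> (\<And>k. k < n \<Longrightarrow> \<pi> (Suc k) - \<pi> k < \<delta>) \<Longrightarrow>
       epm (\<lambda>\<omega>. W (grid t N k) \<omega> - W 0 \<omega> - (\<Sum>k<n. ito_step (\<pi> k) (\<pi> (Suc k)) \<omega> + corr_step (\<pi> k) (\<pi> (Suc k)) \<omega>)) \<le> \<epsilon> / 2"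
      using stratonovich_convergence[of "grid t N k" "\<epsilon> / 2"] grid_nonneg[of t N k] t \<epsilon> by auto
    show ?thesis
      using eventually_small_mesh[OF \<delta>(1), of "t / real N"] eventually_gt_at_top[of 0]
    proof eventually_elim
      case (elim r)
      then have Nr: "0 < N * r" using N by simp
      show ?case unfolding Z_def
        by (rule \<delta>(2)) (use grid_partition[of t "N * r" "k * r"] grid_step[OF Nr, of t] elim t grid_refine[of r t N k] in auto)
    qed
  qed
  then have "\<forall>\<^sub>F r in sequentially. \<forall>k\<in>{..N}. epm (Z r k) \<le> \<epsilon> / 2"
    by (intro eventually_ball_finite) auto
  then show ?thesis
  proof eventually_elim
    case (elim r)
    show ?case
    proof (intro allI impI)
      fix k assume k: "k < N"
      let ?f = "\<lambda>l \<omega>. ito_step (grid t (N * r) l) (grid t (N * r) (Suc l)) \<omega> + corr_step (grid t (N * r) l) (grid t (N * r) (Suc l)) \<omega>"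
      have "(\<Sum>l<Suc k * r. ?f l \<omega>) = (\<Sum>l<k * r. ?f l \<omega>) + (\<Sum>l<r. ?f (k * r + l) \<omega>)" for \<omega>
        unfolding sum_blocks by simp
      then have "(\<lambda>\<omega>. W (grid t N (Suc k)) \<omega> - W (grid t N k) \<omega> - (\<Sum>l<r. ?f (k * r + l) \<omega>)) = (\<lambda>\<omega>. Z r (Suc k) \<omega> + (- 1) *\<^sub>R Z r k \<omega>)"
        by (auto simp: Z_def algebra_simps)
      then have "epm (\<lambda>\<omega>. W (grid t N (Suc k)) \<omega> - W (grid t N k) \<omega> - (\<Sum>l<r. ?f (k * r + l) \<omega>)) = epm (\<lambda>\<omega>. Z r (Suc k) \<omega> + (- 1) *\<^sub>R Z r k \<omega>)"
        by simp
      also have "\<dots> \<le> epm (Z r (Suc k)) + epm (\<lambda>\<omega>. (- 1) *\<^sub>R Z r k \<omega>)"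
        by (intro epm_add Z_P borel_measurable_scaleR borel_measurable_const)
      also have "epm (\<lambda>\<omega>. (- 1) *\<^sub>R Z r k \<omega>) = epm (Z r k)" by (simp add: epm_def)
      also have "epm (Z r (Suc k)) + epm (Z r k) \<le> \<epsilon> / 2 + \<epsilon> / 2" using elim k by (intro add_mono) auto
      finally show "epm (\<lambda>\<omega>. W (grid t N (Suc k)) \<omega> - W (grid t N k) \<omega> - 
        (\<Sum>l<r. ito_step (grid t (N * r) (k * r + l)) (grid t (N * r) (k * r + Suc l)) \<omega> 
          + corr_step (grid t (N * r) (k * r + l)) (grid t (N * r) (k * r + Suc l)) \<omega>)) \<le> \<epsilon>"
        by simp
    qed
  qed
qed

text \<open>Each coordinate of \<open>W\<close> is a semimartingale with its own good event, whose
  complement has probability at most \<epsilon> / DIM; on the intersection the square variations of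
  the coordinates add up.\<close>

lemma variation_event:
  assumes t: "0 < t" and \<epsilon>: "0 < \<epsilon>"
  obtains G K where "G \<in> events" "prob (space P - G) \<le> \<epsilon>" "0 \<le> K"
    "\<And>N. 0 < N \<Longrightarrow> integrable P (\<lambda>\<omega>. indicator G \<omega> * (\<Sum>k<N. (norm (W (grid t N (Suc k)) \<omega> - W (grid t N k) \<omega>))\<^sup>2))"
    "\<And>N. 0 < N \<Longrightarrow> expectation (\<lambda>\<omega>. indicator G \<omega> * (\<Sum>k<N. (norm (W (grid t N (Suc k)) \<omega> - W (grid t N k) \<omega>))\<^sup>2)) \<le> K"
proof -
  define v where "v b N \<omega> = (\<Sum>k<N. (W (grid t N (Suc k)) \<omega> \<bullet> b - W (grid t N k) \<omega> \<bullet> b)\<^sup>2)" for b N \<omega>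
  define Q where "Q b G K \<longleftrightarrow> G \<in> events \<and> prob (space P - G) \<le> \<epsilon> / DIM('a) \<and> 
    (\<forall>N>0. integrable P (\<lambda>\<omega>. indicator G \<omega> * v b N \<omega>) \<and> expectation (\<lambda>\<omega>. indicator G \<omega> * v b N \<omega>) \<le> K)" for b G K
  have e: "0 < \<epsilon> / DIM('a)" using \<epsilon> by simp
  have "\<exists>G K. Q b G K" if "b \<in> Basis" for b
  proof -
    have "continuous_semimartingale P F (\<lambda>t \<omega>. W t \<omega> \<bullet> b)"
      using sol that unfolding stratonovich_solution_def by auto
    then show ?thesis
    proof (rule semimartingale_good_event[OF _ t e])
      fix G K assume "G \<in> events" "prob (space P - G) \<le> \<epsilon> / DIM('a)"
        "\<And>N. 0 < N \<Longrightarrow> integrable P (\<lambda>\<omega>. indicator G \<omega> * (\<Sum>k<N. (W (t * real (Suc k) / real N) \<omega> \<bullet> b - W (t * real k / real N) \<omega> \<bullet> b)\<^sup>2))"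
        "\<And>N. 0 < N \<Longrightarrow> expectation (\<lambda>\<omega>. indicator G \<omega> * (\<Sum>k<N. (W (t * real (Suc k) / real N) \<omega> \<bullet> b - W (t * real k / real N) \<omega> \<bullet> b)\<^sup>2)) \<le> K"
      then have "Q b G K" unfolding Q_def v_def grid_def by blast
      then show ?thesis by blast
    qed
  qed
  then obtain G K where GK: "\<And>b. b \<in> Basis \<Longrightarrow> Q b (G b) (K b)" by metis
  define H where "H = (\<Inter>b\<in>Basis. G b)"
  have G_ev: "G b \<in> events" if "b \<in> Basis" for b using GK[OF that] by (simp add: Q_def)
  have H_ev[measurable]: "H \<in> events" unfolding H_def using G_ev by (intro sets.finite_INT) auto
  have W_meas[measurable]: "W (grid t N k) \<in> borel_measurable P" for N k using W_P grid_nonneg t by auto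
  have Pv: "prob (space P - H) \<le> \<epsilon>"
  proof -
    have "prob (space P - H) \<le> prob (\<Union>b\<in>Basis. space P - G b)"
    proof (rule finite_measure_mono)
      show "(\<Union>b\<in>Basis. space P - G b) \<in> events" by (intro sets.finite_UN sets.compl_sets G_ev) auto
    qed (auto simp: H_def)
    also have "\<dots> \<le> (\<Sum>b\<in>Basis. prob (space P - G b))"
      by (rule finite_measure_subadditive_finite) (use G_ev in auto)
    also have "\<dots> \<le> (\<Sum>b\<in>(Basis::'a set). \<epsilon> / DIM('a))" by (intro sum_mono) (use GK in \<open>auto simp: Q_def\<close>)
    finally show ?thesis by simp
  qed
  have norm_eq: "(norm x)\<^sup>2 = (\<Sum>b\<in>Basis. (x \<bullet> b)\<^sup>2)" for x :: 'a
    by (subst power2_norm_eq_inner, subst euclidean_inner) (simp add: power2_eq_square)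
  have eq: "(\<Sum>k<N. (norm (W (grid t N (Suc k)) \<omega> - W (grid t N k) \<omega>))\<^sup>2) = (\<Sum>b\<in>Basis. v b N \<omega>)" for N \<omega>
    unfolding norm_eq v_def inner_diff_left by (rule sum.swap)
  have v0: "0 \<le> v b N \<omega>" for b N \<omega> unfolding v_def by (intro sum_nonneg) auto
  have vm[measurable]: "v b N \<in> borel_measurable P" for b N unfolding v_def by measurable
  have i: "integrable P (\<lambda>\<omega>. indicator (G b) \<omega> * v b N \<omega>)" if "b \<in> Basis" "0 < N" for b N
    using GK[OF that(1)] that(2) by (simp add: Q_def)
  have iH: "integrable P (\<lambda>\<omega>. indicator H \<omega> * v b N \<omega>)" if "b \<in> Basis" "0 < N" for b N
  proof (rule Bochner_Integration.integrable_bound[OF i[OF that]])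
    show "(\<lambda>\<omega>. indicator H \<omega> * v b N \<omega>) \<in> borel_measurable P" by measurable
  qed (use v0 that in \<open>auto intro!: AE_I2 simp: indicator_def H_def\<close>)
  have eH: "expectation (\<lambda>\<omega>. indicator H \<omega> * v b N \<omega>) \<le> \<bar>K b\<bar>" if "b \<in> Basis" "0 < N" for b N
  proof -
    have "expectation (\<lambda>\<omega>. indicator H \<omega> * v b N \<omega>) \<le> expectation (\<lambda>\<omega>. indicator (G b) \<omega> * v b N \<omega>)"
      by (intro integral_mono i iH that mult_right_mono v0) (use that in \<open>auto simp: indicator_def H_def\<close>)
    also have "\<dots> \<le> K b" using GK[OF that(1)] that(2) by (simp add: Q_def)
    finally show ?thesis by linarith
  qed
  show thesis
  proof (rule that[of H "\<Sum>b\<in>Basis. \<bar>K b\<bar>"])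
    show "H \<in> events" by (rule H_ev)
    show "prob (space P - H) \<le> \<epsilon>" by (rule Pv)
    show "0 \<le> (\<Sum>b\<in>Basis. \<bar>K b\<bar>)" by (intro sum_nonneg) auto
    fix N :: nat assume N: "0 < N"
    show "integrable P (\<lambda>\<omega>. indicator H \<omega> * (\<Sum>k<N. (norm (W (grid t N (Suc k)) \<omega> - W (grid t N k) \<omega>))\<^sup>2))"
      unfolding eq sum_distrib_left by (rule Bochner_Integration.integrable_sum) (rule iH[OF _ N])
    have "expectation (\<lambda>\<omega>. indicator H \<omega> * (\<Sum>k<N. (norm (W (grid t N (Suc k)) \<omega> - W (grid t N k) \<omega>))\<^sup>2)) = 
       (\<Sum>b\<in>Basis. expectation (\<lambda>\<omega>. indicator H \<omega> * v b N \<omega>))"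
      unfolding eq sum_distrib_left using iH N by (intro Bochner_Integration.integral_sum) auto
    also have "\<dots> \<le> (\<Sum>b\<in>Basis. \<bar>K b\<bar>)" by (intro sum_mono eH N)
    finally show "expectation (\<lambda>\<omega>. indicator H \<omega> * (\<Sum>k<N. (norm (W (grid t N (Suc k)) \<omega> - W (grid t N k) \<omega>))\<^sup>2)) \<le> (\<Sum>b\<in>Basis. \<bar>K b\<bar>)" .
  qed
qed

end

lemma norm_sum_power2_le:
  fixes f :: "'b \<Rightarrow> 'c::real_normed_vector"
  shows "(norm (\<Sum>i\<in>A. f i))\<^sup>2 \<le> real (card A) * (\<Sum>i\<in>A. (norm (f i))\<^sup>2)"
proof -
  have "(norm (\<Sum>i\<in>A. f i))\<^sup>2 \<le> (\<Sum>i\<in>A. norm (f i))\<^sup>2"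
    by (intro power_mono norm_sum norm_ge_zero)
  also have "\<dots> \<le> (\<Sum>i\<in>A. (norm (f i))\<^sup>2) * real (card A)"
    by (rule sum_squared_le_sum_of_squares)
  finally show ?thesis by (simp add: mult.commute)
qed

text \<open>Young's inequality; the weight is chosen at each use to balance two factors of different
  size.\<close>

lemma mult_le_weighted_squares:
  fixes x y \<kappa> :: real
  assumes "0 < \<kappa>" shows "x * y \<le> (x\<^sup>2 / \<kappa> + \<kappa> * y\<^sup>2) / 2"
proof -
  have "0 \<le> (x - \<kappa> * y)\<^sup>2 / \<kappa>" using assms by simp
  also have "\<dots> = x\<^sup>2 / \<kappa> + \<kappa> * y\<^sup>2 - 2 * (x * y)" using assms by (simp add: field_simps power2_eq_square)
  finally show ?thesis by simp
qed

context prob_space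
begin

lemma epm_scale:
  fixes X :: "'a \<Rightarrow> 'b::euclidean_space"
  assumes "X \<in> borel_measurable M" "1 \<le> c"
  shows "epm (\<lambda>\<omega>. c *\<^sub>R X \<omega>) \<le> c * epm X"
proof -
  have "epm (\<lambda>\<omega>. c *\<^sub>R X \<omega>) \<le> expectation (\<lambda>\<omega>. c * min 1 (norm (X \<omega>)))"
    unfolding epm_def
  proof (rule integral_mono)
    show "integrable M (\<lambda>\<omega>. min 1 (norm (c *\<^sub>R X \<omega>)))"
      by (rule epm_integrable) (use assms in auto)
    show "integrable M (\<lambda>\<omega>. c * min 1 (norm (X \<omega>)))"
      by (intro integrable_mult_right epm_integrable assms)
    show "min 1 (norm (c *\<^sub>R X \<omega>)) \<le> c * min 1 (norm (X \<omega>))" for \<omega>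
      using assms(2) mult_mono[of 1 c 1 "norm (X \<omega>)"] by (auto simp: min_def)
  qed
  also have "\<dots> = c * epm X" unfolding epm_def by simp
  finally show ?thesis .
qed

lemma epm_le_square:
  fixes X :: "'a \<Rightarrow> 'b::euclidean_space"
  assumes X: "X \<in> borel_measurable M" "integrable M (\<lambda>\<omega>. (norm (X \<omega>))\<^sup>2)" and \<kappa>: "0 < \<kappa>"
  shows "epm X \<le> \<kappa> + expectation (\<lambda>\<omega>. (norm (X \<omega>))\<^sup>2) / \<kappa>"
proof -
  have "epm X \<le> expectation (\<lambda>\<omega>. \<kappa> + (norm (X \<omega>))\<^sup>2 / \<kappa>)"
    unfolding epm_def
  proof (rule integral_mono)
    fix \<omega>
    have "norm (X \<omega>) \<le> ((norm (X \<omega>))\<^sup>2 / \<kappa> + \<kappa>) / 2" 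
      using mult_le_weighted_squares[OF \<kappa>, of "norm (X \<omega>)" 1] by simp
    moreover have "0 \<le> (norm (X \<omega>))\<^sup>2 / \<kappa>" using \<kappa> by simp
    moreover have "min 1 x \<le> \<kappa> + q" if "x \<le> (q + \<kappa>) / 2" "0 \<le> q" for x q using \<kappa> that by argo
    ultimately show "min 1 (norm (X \<omega>)) \<le> \<kappa> + (norm (X \<omega>))\<^sup>2 / \<kappa>" by blast
  qed (use X epm_integrable in auto)
  also have "\<dots> = \<kappa> + expectation (\<lambda>\<omega>. (norm (X \<omega>))\<^sup>2) / \<kappa>" using X by (simp add: prob_space)
  finally show ?thesis .
qed

end

section \<open>Comparison of a coarse step with its refinement\<close>

context stratonovich_flow
begin

lemma W_diff_sq_integrable:
  assumes "0 \<le> a" "0 \<le> b" shows "integrable P (\<lambda>\<omega>. (norm (W b \<omega> - W a \<omega>))\<^sup>2)"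
proof (rule integrable_const_bound[where B="(2 * C)\<^sup>2"])
  have [measurable]: "W a \<in> borel_measurable P" "W b \<in> borel_measurable P" using assms W_P by auto
  show "(\<lambda>\<omega>. (norm (W b \<omega> - W a \<omega>))\<^sup>2) \<in> borel_measurable P" by measurable
  show "AE \<omega> in P. norm ((norm (W b \<omega> - W a \<omega>))\<^sup>2) \<le> (2 * C)\<^sup>2"
  proof (rule AE_I2)
    fix \<omega> assume \<omega>: "\<omega> \<in> space P"
    have "norm (W b \<omega> - W a \<omega>) \<le> 2 * C"
      using norm_triangle_ineq4[of "W b \<omega>" "W a \<omega>"] M_bound[OF W_M[OF assms(1) \<omega>]] M_bound[OF W_M[OF assms(2) \<omega>]] by linarith
    from power_mono[OF this norm_ge_zero, of 2] show "norm ((norm (W b \<omega> - W a \<omega>))\<^sup>2) \<le> (2 * C)\<^sup>2" 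
      by (simp only: real_norm_def abs_power2)
  qed
qed

text \<open>A crude bound, by the Lipschitz estimate and Young's inequality. It serves for the fine
  corrections, whose total only has to stay bounded.\<close>

lemma norm_corr_step:
  assumes "0 \<le> a" "0 \<le> b" "\<omega> \<in> space P"
  shows "norm (corr_step a b \<omega>) \<le> C * ((\<Sum>i\<in>UNIV. (B i b \<omega> - B i a \<omega>)\<^sup>2) + CARD('i) * (norm (W b \<omega> - W a \<omega>))\<^sup>2)"
proof -
  have "norm (corr_step a b \<omega>) \<le> (\<Sum>i\<in>UNIV. norm (((B i b \<omega> - B i a \<omega>) / 2) *\<^sub>R (\<sigma> i (W b \<omega>) - \<sigma> i (W a \<omega>))))"
    unfolding corr_step_def by (rule norm_sum)
  also have "\<dots> \<le> (\<Sum>i\<in>(UNIV::'i set). C * ((B i b \<omega> - B i a \<omega>)\<^sup>2 + (norm (W b \<omega> - W a \<omega>))\<^sup>2))"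
  proof (rule sum_mono)
    fix i
    let ?d = "B i b \<omega> - B i a \<omega>" and ?w = "norm (W b \<omega> - W a \<omega>)"
    have "norm ((?d / 2) *\<^sub>R (\<sigma> i (W b \<omega>) - \<sigma> i (W a \<omega>))) \<le> (\<bar>?d\<bar> / 2) * (C * ?w)"
      using \<sigma>_lipschitz[OF W_M[OF assms(1,3)] W_M[OF assms(2,3)], of i] by (simp add: mult_left_mono)
    also have "\<dots> = C * ((\<bar>?d\<bar> * ?w) / 2)" by simp
    also have "\<dots> \<le> C * (?d\<^sup>2 + ?w\<^sup>2)"
    proof (rule mult_left_mono)
      have "\<bar>?d\<bar> * ?w \<le> (?d\<^sup>2 + ?w\<^sup>2) / 2" using mult_le_weighted_squares[of 1 "\<bar>?d\<bar>" ?w] by simp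
      moreover have "x / 2 \<le> a + b" if "x \<le> (a + b) / 2" "0 \<le> a" "0 \<le> b" for x a b :: real using that by argo
      ultimately show "(\<bar>?d\<bar> * ?w) / 2 \<le> ?d\<^sup>2 + ?w\<^sup>2" by (meson zero_le_power2)
    qed (use C in simp)
    finally show "norm ((?d / 2) *\<^sub>R (\<sigma> i (W b \<omega>) - \<sigma> i (W a \<omega>))) \<le> C * (?d\<^sup>2 + ?w\<^sup>2)" .
  qed
  also have "\<dots> = C * ((\<Sum>i\<in>UNIV. (B i b \<omega> - B i a \<omega>)\<^sup>2) + CARD('i) * (norm (W b \<omega> - W a \<omega>))\<^sup>2)"
    by (simp add: sum_distrib_left[symmetric] sum.distrib)
  finally show ?thesis .
qed

text \<open>Inside a coarse cell the two left-point sums differ by fine Brownian increments times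
  \<sigma> at the fine point minus \<sigma> at the start of the cell. These terms are orthogonal, so
  the Lipschitz estimate gives the oscillation \<open>h\<close> times the length of the cell. One
  factor \<open>CARD('i)\<close> comes from squaring a sum over the motions, the other from adding
  up its terms.\<close>

lemma
  assumes t: "0 < t" and N: "0 < N" and r: "0 < r"
    and h: "\<And>l. l < r \<Longrightarrow> expectation (\<lambda>\<omega>. (norm (W (grid t (N * r) (k * r + l)) \<omega> - W (grid t N k) \<omega>))\<^sup>2) \<le> h"
  defines "D \<equiv> \<lambda>\<omega>. (\<Sum>l<r. ito_step (grid t (N * r) (k * r + l)) (grid t (N * r) (k * r + Suc l)) \<omega>)
        - ito_step (grid t N k) (grid t N (Suc k)) \<omega>"
  shows ito_refinement_integrable: "integrable P (\<lambda>\<omega>. (norm (D \<omega>))\<^sup>2)"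
    and ito_refinement: "expectation (\<lambda>\<omega>. (norm (D \<omega>))\<^sup>2) \<le> (real CARD('i))\<^sup>2 * C\<^sup>2 * h * (t / real N)"
proof -
  define \<tau> where "\<tau> l = grid t (N * r) (k * r + l)" for l
  have \<tau>0: "0 \<le> \<tau> l" for l using t by (simp add: \<tau>_def grid_nonneg)
  have \<tau>mono: "\<tau> l \<le> \<tau> (Suc l)" for l using t by (simp add: \<tau>_def grid_mono)
  have \<tau>step: "\<tau> (Suc l) - \<tau> l = t / real (N * r)" for l using grid_step[of "N * r" t "k * r + l"] N r by (simp add: \<tau>_def)
  have \<tau>_0: "\<tau> 0 = grid t N k" using grid_refine[OF r, of t N k] by (simp add: \<tau>_def)
  have \<tau>_r: "\<tau> r = grid t N (Suc k)" using grid_refine[OF r, of t N "Suc k"] by (simp add: \<tau>_def add.commute)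
  have \<tau>le: "\<tau> 0 \<le> \<tau> l" for l using t by (simp add: \<tau>_def grid_mono)
  define c where "c i l \<omega> = \<sigma> i (W (\<tau> l) \<omega>) - \<sigma> i (W (\<tau> 0) \<omega>)" for i l \<omega>
  define Z where "Z i \<omega> = (\<Sum>l<r. incr (\<tau> l) (\<tau> (Suc l)) \<omega> $ i *\<^sub>R c i l \<omega>)" for i \<omega>
  have cF: "c i l \<in> borel_measurable (F (\<tau> l))" for i l
    unfolding c_def using \<tau>0 F_mono_measurable[OF \<sigma>_F[OF \<tau>0] \<tau>le] by (intro borel_measurable_diff \<sigma>_F) auto
  have cK: "norm (c i l \<omega>) \<le> 2 * C" if "\<omega> \<in> space P" for i l \<omega>
    using norm_triangle_ineq4[of "\<sigma> i (W (\<tau> l) \<omega>)" "\<sigma> i (W (\<tau> 0) \<omega>)"] \<sigma>_bound[OF W_M[OF \<tau>0 that], of i l] \<sigma>_bound[OF W_M[OF \<tau>0 that], of i 0]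
    unfolding c_def by linarith
  have cP: "c i l \<in> borel_measurable P" for i l by (rule F_measurable[OF cF])
  have g: "integrable P (\<lambda>\<omega>. (incr (\<tau> l) (\<tau> (Suc l)) \<omega> $ i)\<^sup>2)" "expectation (\<lambda>\<omega>. incr (\<tau> l) (\<tau> (Suc l)) \<omega> $ i) = 0"
     "expectation (\<lambda>\<omega>. (incr (\<tau> l) (\<tau> (Suc l)) \<omega> $ i)\<^sup>2) = t / real (N * r)" for l i
    using incr_integrable_pow[OF \<tau>0 \<tau>mono] incr_expectation[OF \<tau>0 \<tau>mono] incr_expectation2[OF \<tau>0 \<tau>mono] \<tau>step by auto
  have Z2: "integrable P (\<lambda>\<omega>. (norm (Z i \<omega>))\<^sup>2)" for i
    unfolding Z_def
    by (rule orthogonal_vsum_integrable[where c="c i" and g="\<lambda>_ x. x $ i" and K="2 * C"]) (use \<tau>0 \<tau>mono cF cK g in auto)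
  have EZ: "expectation (\<lambda>\<omega>. (norm (Z i \<omega>))\<^sup>2) = (\<Sum>l<r. expectation (\<lambda>\<omega>. (norm (c i l \<omega>))\<^sup>2) * (t / real (N * r)))" for i
    unfolding Z_def
    by (subst orthogonal_vsum_expectation[where c="c i" and g="\<lambda>_ x. x $ i" and K="2 * C"]) (use \<tau>0 \<tau>mono cF cK g in auto)
  have Ec: "expectation (\<lambda>\<omega>. (norm (c i l \<omega>))\<^sup>2) \<le> C\<^sup>2 * h" if "l < r" for i l
  proof -
    have "expectation (\<lambda>\<omega>. (norm (c i l \<omega>))\<^sup>2) \<le> expectation (\<lambda>\<omega>. C\<^sup>2 * (norm (W (\<tau> l) \<omega> - W (\<tau> 0) \<omega>))\<^sup>2)"
    proof (rule integral_mono)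
      show "integrable P (\<lambda>\<omega>. (norm (c i l \<omega>))\<^sup>2)"
      proof (rule integrable_const_bound[where B="(2 * C)\<^sup>2"])
        show "AE \<omega> in P. norm ((norm (c i l \<omega>))\<^sup>2) \<le> (2 * C)\<^sup>2"
          using power_mono[OF cK norm_ge_zero, where n=2] by (intro AE_I2) (simp only: real_norm_def abs_power2)
      qed (use cP in auto)
      show "integrable P (\<lambda>\<omega>. C\<^sup>2 * (norm (W (\<tau> l) \<omega> - W (\<tau> 0) \<omega>))\<^sup>2)"
        by (intro integrable_mult_right W_diff_sq_integrable \<tau>0)
      show "(norm (c i l \<omega>))\<^sup>2 \<le> C\<^sup>2 * (norm (W (\<tau> l) \<omega> - W (\<tau> 0) \<omega>))\<^sup>2" if "\<omega> \<in> space P" for \<omega>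
        using power_mono[OF \<sigma>_lipschitz[OF W_M[OF \<tau>0 that] W_M[OF \<tau>0 that]] norm_ge_zero, where n=2] 
        by (simp add: c_def power_mult_distrib)
    qed
    also have "\<dots> \<le> C\<^sup>2 * h" using h[OF that] by (simp add: \<tau>_def[symmetric] \<tau>_0[symmetric] mult_left_mono)
    finally show ?thesis .
  qed
  have "(\<Sum>l<n. d l) *\<^sub>R y + (\<Sum>l<n. d l *\<^sub>R (x l - y)) = (\<Sum>l<n. d l *\<^sub>R x l)" for d and x :: "nat \<Rightarrow> 'a" and y n
    by (simp add: scaleR_sum_left scaleR_diff_right sum_subtractf)
  note * = this[of _ r]
  have DZ: "D \<omega> = (\<Sum>i\<in>UNIV. Z i \<omega>)" for \<omega>
  proof -
    have tel: "B i (\<tau> r) \<omega> - B i (\<tau> 0) \<omega> = (\<Sum>l<r. B i (\<tau> (Suc l)) \<omega> - B i (\<tau> l) \<omega>)" for i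
      by (rule sum_lessThan_telescope[symmetric])
    have "(\<Sum>l<r. ito_step (\<tau> l) (\<tau> (Suc l)) \<omega>) = (\<Sum>i\<in>UNIV. \<Sum>l<r. (B i (\<tau> (Suc l)) \<omega> - B i (\<tau> l) \<omega>) *\<^sub>R \<sigma> i (W (\<tau> l) \<omega>))"
      unfolding ito_step_def by (rule sum.swap)
    also have "\<dots> = (\<Sum>i\<in>UNIV. (B i (\<tau> r) \<omega> - B i (\<tau> 0) \<omega>) *\<^sub>R \<sigma> i (W (\<tau> 0) \<omega>) + Z i \<omega>)"
      unfolding tel Z_def c_def incr_nth * by (rule refl)
    also have "\<dots> = ito_step (\<tau> 0) (\<tau> r) \<omega> + (\<Sum>i\<in>UNIV. Z i \<omega>)"
      by (simp add: sum.distrib ito_step_def)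
    finally have "(\<Sum>l<r. ito_step (\<tau> l) (\<tau> (Suc l)) \<omega>) - ito_step (\<tau> 0) (\<tau> r) \<omega> = (\<Sum>i\<in>UNIV. Z i \<omega>)" by simp
    then show ?thesis unfolding D_def \<tau>_0 \<tau>_r unfolding \<tau>_def .
  qed
  have le: "(norm (D \<omega>))\<^sup>2 \<le> CARD('i) * (\<Sum>i\<in>UNIV. (norm (Z i \<omega>))\<^sup>2)" for \<omega>
    unfolding DZ using norm_sum_power2_le[of "\<lambda>i. Z i \<omega>" UNIV] by simp
  have bi: "integrable P (\<lambda>\<omega>. CARD('i) * (\<Sum>i\<in>UNIV. (norm (Z i \<omega>))\<^sup>2))" using Z2 by auto
  have Dm: "D \<in> borel_measurable P"
    unfolding D_def using grid_nonneg[of t] t by (intro borel_measurable_diff borel_measurable_sum ito_step_P) auto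
  show Di: "integrable P (\<lambda>\<omega>. (norm (D \<omega>))\<^sup>2)"
    by (rule Bochner_Integration.integrable_bound[OF bi]) (use le Dm in \<open>auto intro!: AE_I2 simp: sum_nonneg\<close>)
  have "expectation (\<lambda>\<omega>. (norm (D \<omega>))\<^sup>2) \<le> expectation (\<lambda>\<omega>. CARD('i) * (\<Sum>i\<in>UNIV. (norm (Z i \<omega>))\<^sup>2))"
    by (rule integral_mono[OF Di bi]) (rule le)
  also have "\<dots> = CARD('i) * (\<Sum>i\<in>UNIV. expectation (\<lambda>\<omega>. (norm (Z i \<omega>))\<^sup>2))"
    using Z2 by simp
  also have "\<dots> \<le> CARD('i) * (\<Sum>i\<in>(UNIV::'i set). \<Sum>l<r. (C\<^sup>2 * h) * (t / real (N * r)))"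
    unfolding EZ using t Ec by (intro mult_left_mono sum_mono mult_right_mono) auto
  also have "\<dots> = (real CARD('i))\<^sup>2 * C\<^sup>2 * h * (t / real N)" using r N by (simp add: power2_eq_square)
  finally show "expectation (\<lambda>\<omega>. (norm (D \<omega>))\<^sup>2) \<le> (real CARD('i))\<^sup>2 * C\<^sup>2 * h * (t / real N)" .
qed

text \<open>Fourth moments are used because each of the N cells then contributes a probability of
  order \<open>N\<^sup>-\<^sup>2\<close>, and the union over the cells still tends to 0. With second
  moments the order per cell would be 1 / N and the sum would not decay.\<close>

lemma grid_incr_fourth_moment:
  assumes t: "0 < t" and N: "0 < N" and \<eta>: "0 < \<eta>"
  shows "prob (space P - {\<omega> \<in> space P. \<forall>k<N. \<forall>i. \<bar>B i (grid t N (Suc k)) \<omega> - B i (grid t N k) \<omega>\<bar> \<le> \<eta>})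
    \<le> 3 * real CARD('i) * t\<^sup>2 / (real N * \<eta>^4)"
proof -
  have [measurable]: "B i (grid t N k) \<in> borel_measurable P" for i k using B_meas grid_nonneg[of t N k] t by auto
  define d where "d i k \<omega> = B i (grid t N (Suc k)) \<omega> - B i (grid t N k) \<omega>" for i k \<omega>
  have [measurable]: "d i k \<in> borel_measurable P" for i k unfolding d_def by measurable
  have g: "0 \<le> grid t N k" "grid t N k \<le> grid t N (Suc k)" for k using t by (auto simp: grid_nonneg grid_mono)
  have 4: "integrable P (\<lambda>\<omega>. (d i k \<omega>)^4)" "expectation (\<lambda>\<omega>. (d i k \<omega>)^4) = 3 * (t / real N)\<^sup>2" for i k
    using incr_integrable_pow[OF g] incr_expectation4[OF g] grid_step[OF N, of t k] by (auto simp: d_def)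
  have p: "prob {\<omega> \<in> space P. \<not> \<bar>d i k \<omega>\<bar> \<le> \<eta>} \<le> 3 * (t / real N)\<^sup>2 / \<eta>^4" for i k
  proof -
    have "{\<omega> \<in> space P. \<not> \<bar>d i k \<omega>\<bar> \<le> \<eta>} \<subseteq> {\<omega> \<in> space P. \<eta>^4 \<le> (d i k \<omega>)^4}"
    proof safe
      fix \<omega> assume "\<not> \<bar>d i k \<omega>\<bar> \<le> \<eta>"
      then have "\<eta>^4 \<le> \<bar>d i k \<omega>\<bar>^4" using \<eta> by (intro power_mono) auto
      then show "\<eta>^4 \<le> (d i k \<omega>)^4" by simp
    qed
    then have "prob {\<omega> \<in> space P. \<not> \<bar>d i k \<omega>\<bar> \<le> \<eta>} \<le> prob {\<omega> \<in> space P. \<eta>^4 \<le> (d i k \<omega>)^4}"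
      by (intro finite_measure_mono) auto
    also have "\<dots> \<le> expectation (\<lambda>\<omega>. (d i k \<omega>)^4) / \<eta>^4"
      using integral_Markov_inequality_measure[OF 4(1)[of i k], of "{}" "\<eta>^4"] \<eta> by auto
    finally show ?thesis using 4(2) by simp
  qed
  have "prob (space P - {\<omega> \<in> space P. \<forall>k<N. \<forall>i. \<bar>d i k \<omega>\<bar> \<le> \<eta>}) \<le> prob (\<Union>(k, i)\<in>{..<N} \<times> UNIV. {\<omega> \<in> space P. \<not> \<bar>d i k \<omega>\<bar> \<le> \<eta>})"
    by (rule finite_measure_mono) auto
  also have "\<dots> \<le> (\<Sum>(k, i)\<in>{..<N} \<times> UNIV. prob {\<omega> \<in> space P. \<not> \<bar>d i k \<omega>\<bar> \<le> \<eta>})"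
  proof -
    have "{\<omega> \<in> space P. \<not> \<bar>d i k \<omega>\<bar> \<le> \<eta>} \<in> events" for i k by measurable
    then show ?thesis unfolding case_prod_unfold by (intro finite_measure_subadditive_finite) auto
  qed
  also have "\<dots> \<le> (\<Sum>(k, i)\<in>{..<N} \<times> (UNIV :: 'i set). 3 * (t / real N)\<^sup>2 / \<eta>^4)"
    using p by (intro sum_mono) auto
  also have "\<dots> = 3 * real CARD('i) * t\<^sup>2 / (real N * \<eta>^4)"
    using N by (simp add: power2_eq_square field_simps)
  finally show ?thesis unfolding d_def .
qed

text \<open>This controls the error of inserting the left-point step for \<Delta>W in the
  corrections. On a coarse cell, \<Delta>W minus the left-point step splits by a refinement into the
  defect \<open>E1\<close> of the trapezoidal limit, the difference \<open>D\<close> of left-point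
  sums and the fine corrections \<open>U\<close>. Each is multiplied by a coarse \<Delta>B:
  \<open>E1\<close> is as small as desired, \<open>D\<close> is small in mean square, and
  \<open>U\<close> together with the squares of \<Delta>W has a bounded sum while \<Delta>B is
  uniformly small. These three parts and the two exceptional events take a fifth of \<epsilon>
  each.\<close>

lemma remainder_limit:
  assumes t: "0 < t" and \<epsilon>: "0 < \<epsilon>"
  shows "\<forall>\<^sub>F N in sequentially. epm (\<lambda>\<omega>. \<Sum>k<N. 
     (norm (W (grid t N (Suc k)) \<omega> - W (grid t N k) \<omega> - ito_step (grid t N k) (grid t N (Suc k)) \<omega>) 
       + (norm (W (grid t N (Suc k)) \<omega> - W (grid t N k) \<omega>))\<^sup>2) * 
     (\<Sum>i\<in>UNIV. \<bar>B i (grid t N (Suc k)) \<omega> - B i (grid t N k) \<omega>\<bar>)) \<le> \<epsilon>"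
proof -
  define n where "n = real CARD('i)"
  have n: "1 \<le> n" unfolding n_def using zero_less_card_finite[where 'a='i] by (metis One_nat_def Suc_leI of_nat_1 of_nat_le_iff)
  have C0: "0 < C" using C by simp
  obtain G K where G[measurable]: "G \<in> events" and PG: "prob (space P - G) \<le> \<epsilon> / 5" and K0: "0 \<le> K"
    and Ki: "\<And>N. 0 < N \<Longrightarrow> integrable P (\<lambda>\<omega>. indicator G \<omega> * (\<Sum>k<N. (norm (W (grid t N (Suc k)) \<omega> - W (grid t N k) \<omega>))\<^sup>2))"
    and KE: "\<And>N. 0 < N \<Longrightarrow> expectation (\<lambda>\<omega>. indicator G \<omega> * (\<Sum>k<N. (norm (W (grid t N (Suc k)) \<omega> - W (grid t N k) \<omega>))\<^sup>2)) \<le> K"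
    using variation_event[OF t, of "\<epsilon> / 5"] \<epsilon> by auto
  \<comment> \<open>Chosen so that the products of \<open>D\<close> with the increments, estimated
    by Young's inequality with this weight, sum up to at most \<epsilon> / 5. The mean-square
    oscillation of \<open>W\<close> within a cell is kept below \<open>\<kappa>\<^sup>2\<close> for
    this.\<close>
  define \<kappa> where "\<kappa> = \<epsilon> / (5 * (n\<^sup>2 * C\<^sup>2 * t))"
  have \<kappa>: "0 < \<kappa>" "n\<^sup>2 * C\<^sup>2 * t * \<kappa> = \<epsilon> / 5" using \<epsilon> n C0 t by (auto simp: \<kappa>_def field_simps)
  \<comment> \<open>\<open>n\<close> times the bound for the mean of the majorant \<open>q\<close>
    below; the part with the uniformly small factor is then at most \<eta> L.\<close>
  define L where "L = n * (C * (n * t + n * K) + K)"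
  have L0: "0 \<le> L" using n C0 t K0 by (auto simp: L_def)
  define \<eta> where "\<eta> = min 1 (\<epsilon> / 5 / (L + 1))"
  have \<eta>: "0 < \<eta>" "\<eta> \<le> 1" "\<eta> * L \<le> \<epsilon> / 5"
  proof -
    show "0 < \<eta>" "\<eta> \<le> 1" using \<epsilon> L0 by (auto simp: \<eta>_def)
    have "\<eta> * L \<le> (\<epsilon> / 5 / (L + 1)) * L" using L0 by (intro mult_right_mono) (auto simp: \<eta>_def)
    also have "\<dots> \<le> \<epsilon> / 5" using L0 \<epsilon> by (simp add: field_simps)
    finally show "\<eta> * L \<le> \<epsilon> / 5" .
  qed
  obtain \<delta> where \<delta>: "0 < \<delta>" 
    "\<And>a b. 0 \<le> a \<Longrightarrow> a \<le> t \<Longrightarrow> 0 \<le> b \<Longrightarrow> b \<le> t \<Longrightarrow> \<bar>b - a\<bar> < \<delta> \<Longrightarrow> expectation (\<lambda>\<omega>. (norm (W b \<omega> - W a \<omega>))\<^sup>2) < \<kappa>\<^sup>2"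
    using mean_square_continuity[OF continuous_on_id, of t "\<kappa>\<^sup>2"] t \<kappa>(1) by auto
  have ev1: "\<forall>\<^sub>F N in sequentially. (3 * n * t\<^sup>2 / \<eta>^4) / real N < \<epsilon> / 5"
    by (rule eventually_small_mesh) (use \<epsilon> in simp)
  show ?thesis
    using ev1 eventually_small_mesh[OF \<delta>(1), of t] eventually_gt_at_top[of 0]
  proof eventually_elim
    case (elim N)
    note N = elim(3)
    define s where "s = grid t N"
    have s: "0 \<le> s k" "s k \<le> s (Suc k)" for k using t by (auto simp: s_def grid_nonneg grid_mono)
    have sstep: "s (Suc k) - s k = t / real N" for k using grid_step[OF N] by (simp add: s_def)
    have [measurable]: "B i (s k) \<in> borel_measurable P" "W (s k) \<in> borel_measurable P"
      "ito_step (s k) (s l) \<in> borel_measurable P" for i k l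
      using B_meas W_P ito_step_P s by auto
    define dW where "dW k \<omega> = W (s (Suc k)) \<omega> - W (s k) \<omega>" for k \<omega>
    define R where "R k \<omega> = dW k \<omega> - ito_step (s k) (s (Suc k)) \<omega>" for k \<omega>
    define b where "b k \<omega> = (\<Sum>i\<in>UNIV. \<bar>B i (s (Suc k)) \<omega> - B i (s k) \<omega>\<bar>)" for k \<omega>
    have [measurable]: "dW k \<in> borel_measurable P" "R k \<in> borel_measurable P" "b k \<in> borel_measurable P" for k
      unfolding dW_def R_def b_def by measurable
    have b0: "0 \<le> b k \<omega>" for k \<omega> unfolding b_def by (intro sum_nonneg) auto
    define Y where "Y \<omega> = (\<Sum>k<N. (norm (R k \<omega>) + (norm (dW k \<omega>))\<^sup>2) * b k \<omega>)" for \<omega>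
    have Ym[measurable]: "Y \<in> borel_measurable P" unfolding Y_def by measurable
    define H where "H = {\<omega> \<in> space P. \<forall>k<N. \<forall>i. \<bar>B i (s (Suc k)) \<omega> - B i (s k) \<omega>\<bar> \<le> \<eta>}"
    have H[measurable]: "H \<in> events" unfolding H_def by measurable
    have PH: "prob (space P - H) \<le> \<epsilon> / 5"
    proof -
      have "prob (space P - H) \<le> 3 * n * t\<^sup>2 / (real N * \<eta>^4)"
        using grid_incr_fourth_moment[OF t N \<eta>(1)] by (simp only: H_def s_def n_def)
      also have "\<dots> = (3 * n * t\<^sup>2 / \<eta>^4) / real N" by (simp add: mult.commute)
      also have "\<dots> \<le> \<epsilon> / 5" using elim(1) by simp
      finally show ?thesis .
    qed
    have bH: "b k \<omega> \<le> n * \<eta>" if "\<omega> \<in> H" "k < N" for k \<omega>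
    proof -
      have "b k \<omega> \<le> (\<Sum>i\<in>(UNIV::'i set). \<eta>)" unfolding b_def using that by (intro sum_mono) (auto simp: H_def)
      then show ?thesis by (simp add: n_def)
    qed
    \<comment> \<open>There are N cells, and on \<open>H\<close> each weight \<open>b k\<close> is
      at most n because \<eta> is at most 1. The refinement factor \<open>r\<close> is chosen for
      this N.\<close>
    define \<epsilon>' where "\<epsilon>' = \<epsilon> / (5 * n * real N)"
    have \<epsilon>': "0 < \<epsilon>'" using \<epsilon> n N by (simp add: \<epsilon>'_def)
    obtain r where r0: "0 < r" and r: "\<forall>k<N. epm (\<lambda>\<omega>. W (grid t N (Suc k)) \<omega> - W (grid t N k) \<omega> - 
      (\<Sum>l<r. ito_step (grid t (N * r) (k * r + l)) (grid t (N * r) (k * r + Suc l)) \<omega> 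
          + corr_step (grid t (N * r) (k * r + l)) (grid t (N * r) (k * r + Suc l)) \<omega>)) \<le> \<epsilon>'"
      using eventually_happens[OF eventually_conj[OF eventually_gt_at_top[of 0] grid_limit[OF t \<epsilon>' N]]] by auto
    define f where "f = grid t (N * r)"
    have Nr: "0 < N * r" using N r0 by simp
    have f0: "0 \<le> f l" for l using t by (simp add: f_def grid_nonneg)
    have fmono: "f l \<le> f (Suc l)" for l using t by (simp add: f_def grid_mono)
    have [measurable]: "B i (f k) \<in> borel_measurable P" "W (f k) \<in> borel_measurable P"
      "ito_step (f k) (f l) \<in> borel_measurable P" "corr_step (f k) (f l) \<in> borel_measurable P" for i k l
      using B_meas W_P ito_step_P corr_step_P f0 by auto
    define U where "U k \<omega> = (\<Sum>l<r. corr_step (f (k * r + l)) (f (Suc (k * r + l))) \<omega>)" for k \<omega>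
    define D where "D k \<omega> = (\<Sum>l<r. ito_step (f (k * r + l)) (f (Suc (k * r + l))) \<omega>) - ito_step (s k) (s (Suc k)) \<omega>" for k \<omega>
    define E1 where "E1 k \<omega> = R k \<omega> - D k \<omega> - U k \<omega>" for k \<omega>
    have [measurable]: "U k \<in> borel_measurable P" "D k \<in> borel_measurable P" "E1 k \<in> borel_measurable P" for k
      unfolding U_def D_def E1_def by measurable
    have E1: "epm (E1 k) \<le> \<epsilon>'" if "k < N" for k
    proof -
      have "E1 k = (\<lambda>\<omega>. W (grid t N (Suc k)) \<omega> - W (grid t N k) \<omega> - 
      (\<Sum>l<r. ito_step (grid t (N * r) (k * r + l)) (grid t (N * r) (k * r + Suc l)) \<omega> 
          + corr_step (grid t (N * r) (k * r + l)) (grid t (N * r) (k * r + Suc l)) \<omega>))"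
        by (auto simp: E1_def R_def dW_def D_def U_def f_def s_def sum.distrib)
      with r that show ?thesis by simp
    qed
    define X1 where "X1 \<omega> = (\<Sum>k<N. n *\<^sub>R norm (E1 k \<omega>))" for \<omega>
    define X2 where "X2 \<omega> = (\<Sum>k<N. norm (D k \<omega>) * b k \<omega>)" for \<omega>
    \<comment> \<open>A majorant of the fine corrections plus the coarse square variation. The
      indicator of \<open>G\<close> is attached to the terms in \<open>W\<close> only: the Brownian
      sum has the exact mean n t.\<close>
    define q where "q \<omega> = C * ((\<Sum>l<N * r. \<Sum>i\<in>UNIV. (B i (f (Suc l)) \<omega> - B i (f l) \<omega>)\<^sup>2) 
         + n * (indicator G \<omega> * (\<Sum>l<N * r. (norm (W (f (Suc l)) \<omega> - W (f l) \<omega>))\<^sup>2))) 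
         + indicator G \<omega> * (\<Sum>k<N. (norm (dW k \<omega>))\<^sup>2)" for \<omega>
    define X3 where "X3 \<omega> = n * \<eta> * q \<omega>" for \<omega>
    have Xm[measurable]: "X1 \<in> borel_measurable P" "X2 \<in> borel_measurable P" "X3 \<in> borel_measurable P"
      unfolding X1_def X2_def X3_def q_def by measurable
    have q0: "0 \<le> q \<omega>" for \<omega> unfolding q_def using C0 n by (intro add_nonneg_nonneg mult_nonneg_nonneg sum_nonneg) auto
    have X0: "0 \<le> X1 \<omega>" "0 \<le> X2 \<omega>" "0 \<le> X3 \<omega>" for \<omega>
      unfolding X1_def X2_def X3_def using n b0 q0 \<eta> by (auto intro!: sum_nonneg mult_nonneg_nonneg)
    have dom: "Y \<omega> \<le> X1 \<omega> + X2 \<omega> + X3 \<omega>" if \<omega>: "\<omega> \<in> G" "\<omega> \<in> H" for \<omega>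
    proof -
      have sp: "\<omega> \<in> space P" using \<omega> by (simp add: H_def)
      have "Y \<omega> \<le> (\<Sum>k<N. n *\<^sub>R norm (E1 k \<omega>) + norm (D k \<omega>) * b k \<omega> + n * \<eta> * (norm (U k \<omega>) + (norm (dW k \<omega>))\<^sup>2))"
        unfolding Y_def
      proof (rule sum_mono)
        fix k assume "k \<in> {..<N}"
        then have bk: "b k \<omega> \<le> n * \<eta>" using bH \<omega> by auto
        have bk': "b k \<omega> \<le> n" using bk mult_left_le[of \<eta> n] \<eta> n by linarith
        have R_eq: "R k \<omega> = E1 k \<omega> + (D k \<omega> + U k \<omega>)" by (simp add: E1_def)
        have "norm (R k \<omega>) \<le> norm (E1 k \<omega>) + norm (D k \<omega>) + norm (U k \<omega>)"
          unfolding R_eq using norm_triangle_ineq[of "E1 k \<omega>" "D k \<omega> + U k \<omega>"] norm_triangle_ineq[of "D k \<omega>" "U k \<omega>"] by linarith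
        then have "(norm (R k \<omega>) + (norm (dW k \<omega>))\<^sup>2) * b k \<omega> \<le> (norm (E1 k \<omega>) + norm (D k \<omega>) + norm (U k \<omega>) + (norm (dW k \<omega>))\<^sup>2) * b k \<omega>"
          by (intro mult_right_mono b0) auto
        also have "\<dots> = norm (E1 k \<omega>) * b k \<omega> + norm (D k \<omega>) * b k \<omega> + (norm (U k \<omega>) + (norm (dW k \<omega>))\<^sup>2) * b k \<omega>"
          by (simp add: algebra_simps)
        also have "\<dots> \<le> norm (E1 k \<omega>) * n + norm (D k \<omega>) * b k \<omega> + (norm (U k \<omega>) + (norm (dW k \<omega>))\<^sup>2) * (n * \<eta>)"
          using bk bk' by (intro add_mono mult_left_mono order_refl) auto
        finally show "(norm (R k \<omega>) + (norm (dW k \<omega>))\<^sup>2) * b k \<omega> \<le> n *\<^sub>R norm (E1 k \<omega>) + norm (D k \<omega>) * b k \<omega> + n * \<eta> * (norm (U k \<omega>) + (norm (dW k \<omega>))\<^sup>2)"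
          by (simp add: mult.commute)
      qed
      also have "\<dots> = X1 \<omega> + X2 \<omega> + n * \<eta> * ((\<Sum>k<N. norm (U k \<omega>)) + (\<Sum>k<N. (norm (dW k \<omega>))\<^sup>2))"
        by (simp add: X1_def X2_def sum.distrib sum_distrib_left distrib_left)
      also have "(\<Sum>k<N. norm (U k \<omega>)) + (\<Sum>k<N. (norm (dW k \<omega>))\<^sup>2) \<le> q \<omega>"
      proof -
        have "(\<Sum>k<N. norm (U k \<omega>)) \<le> (\<Sum>k<N. \<Sum>l<r. norm (corr_step (f (k * r + l)) (f (Suc (k * r + l))) \<omega>))"
          unfolding U_def by (intro sum_mono norm_sum)
        also have "\<dots> = (\<Sum>l<N * r. norm (corr_step (f l) (f (Suc l)) \<omega>))"
          by (rule sum_blocks[symmetric])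
        also have "\<dots> \<le> (\<Sum>l<N * r. C * ((\<Sum>i\<in>UNIV. (B i (f (Suc l)) \<omega> - B i (f l) \<omega>)\<^sup>2) + CARD('i) * (norm (W (f (Suc l)) \<omega> - W (f l) \<omega>))\<^sup>2))"
          by (intro sum_mono norm_corr_step f0 sp)
        also have "\<dots> = C * ((\<Sum>l<N * r. \<Sum>i\<in>UNIV. (B i (f (Suc l)) \<omega> - B i (f l) \<omega>)\<^sup>2) + n * (\<Sum>l<N * r. (norm (W (f (Suc l)) \<omega> - W (f l) \<omega>))\<^sup>2))"
          by (simp add: n_def sum_distrib_left[symmetric] sum.distrib)
        finally show ?thesis using \<omega>(1) by (simp add: q_def)
      qed
      finally show ?thesis using n \<eta> by (simp add: X3_def mult_left_mono)
    qed
    have eX1: "epm X1 \<le> \<epsilon> / 5"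
    proof -
      have "epm X1 \<le> (\<Sum>k<N. epm (\<lambda>\<omega>. n *\<^sub>R norm (E1 k \<omega>)))"
        unfolding X1_def[abs_def] by (rule epm_sum) auto
      also have "\<dots> \<le> (\<Sum>k<N. n * \<epsilon>')"
      proof (rule sum_mono)
        fix k assume k: "k \<in> {..<N}"
        have "epm (\<lambda>\<omega>. n *\<^sub>R norm (E1 k \<omega>)) \<le> n * epm (\<lambda>\<omega>. norm (E1 k \<omega>))" by (rule epm_scale) (use n in auto)
        also have "epm (\<lambda>\<omega>. norm (E1 k \<omega>)) = epm (E1 k)" by (simp add: epm_def)
        also have "n * epm (E1 k) \<le> n * \<epsilon>'" using E1 k n by (intro mult_left_mono) auto
        finally show "epm (\<lambda>\<omega>. n *\<^sub>R norm (E1 k \<omega>)) \<le> n * \<epsilon>'" .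
      qed
      also have "\<dots> = \<epsilon> / 5" using n N by (simp add: \<epsilon>'_def)
      finally show ?thesis .
    qed
    have eX2: "epm X2 \<le> \<epsilon> / 5"
    proof -
      have D2: "integrable P (\<lambda>\<omega>. (norm (D k \<omega>))\<^sup>2)" "expectation (\<lambda>\<omega>. (norm (D k \<omega>))\<^sup>2) \<le> n\<^sup>2 * C\<^sup>2 * \<kappa>\<^sup>2 * (t / real N)" if k: "k < N" for k
      proof -
        have h: "expectation (\<lambda>\<omega>. (norm (W (grid t (N * r) (k * r + l)) \<omega> - W (grid t N k) \<omega>))\<^sup>2) \<le> \<kappa>\<^sup>2" if l: "l < r" for l
        proof (rule less_imp_le, rule \<delta>(2))
          have kl: "k * r + l \<le> N * r" using mult_le_mono1[of "Suc k" N r] k l by simp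
          show "grid t (N * r) (k * r + l) \<le> t" using grid_le[OF _ Nr kl] t by simp
          show "grid t N k \<le> t" using grid_le[OF _ N] t k by simp
          have 1: "grid t N k \<le> grid t (N * r) (k * r + l)" 
            using grid_mono[of t "k * r" "k * r + l" "N * r"] t grid_refine[OF r0, of t N k] by simp
          have 2: "grid t (N * r) (k * r + l) \<le> grid t N (Suc k)" 
            using grid_mono[of t "k * r + l" "Suc k * r" "N * r"] t l grid_refine[OF r0, of t N "Suc k"] by simp
          show "\<bar>grid t (N * r) (k * r + l) - grid t N k\<bar> < \<delta>"
            using 1 2 grid_step[OF N, of t k] elim(2) by linarith
        qed (use t grid_nonneg in auto)
        show "integrable P (\<lambda>\<omega>. (norm (D k \<omega>))\<^sup>2)" "expectation (\<lambda>\<omega>. (norm (D k \<omega>))\<^sup>2) \<le> n\<^sup>2 * C\<^sup>2 * \<kappa>\<^sup>2 * (t / real N)"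
          using ito_refinement_integrable[OF t N r0 h] ito_refinement[OF t N r0 h] by (auto simp: D_def f_def s_def n_def)
      qed
      have b2: "integrable P (\<lambda>\<omega>. (b k \<omega>)\<^sup>2)" "expectation (\<lambda>\<omega>. (b k \<omega>)\<^sup>2) \<le> n\<^sup>2 * (t / real N)" for k
      proof -
        have le: "(b k \<omega>)\<^sup>2 \<le> n * (\<Sum>i\<in>UNIV. (B i (s (Suc k)) \<omega> - B i (s k) \<omega>)\<^sup>2)" for \<omega>
          using norm_sum_power2_le[of "\<lambda>i. \<bar>B i (s (Suc k)) \<omega> - B i (s k) \<omega>\<bar>" UNIV] by (simp add: b_def n_def)
        have i: "integrable P (\<lambda>\<omega>. n * (\<Sum>i\<in>UNIV. (B i (s (Suc k)) \<omega> - B i (s k) \<omega>)\<^sup>2))"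
          using incr_integrable_pow[OF s] by auto
        show bi: "integrable P (\<lambda>\<omega>. (b k \<omega>)\<^sup>2)"
          by (rule Bochner_Integration.integrable_bound[OF i]) (use le n in \<open>auto intro!: AE_I2 simp: sum_nonneg\<close>)
        have "expectation (\<lambda>\<omega>. (b k \<omega>)\<^sup>2) \<le> expectation (\<lambda>\<omega>. n * (\<Sum>i\<in>UNIV. (B i (s (Suc k)) \<omega> - B i (s k) \<omega>)\<^sup>2))"
          by (rule integral_mono[OF bi i le])
        also have "\<dots> = n * (\<Sum>i\<in>(UNIV::'i set). t / real N)"
          using incr_integrable_pow[OF s] incr_expectation2[OF s] by (simp add: sstep)
        also have "\<dots> = n\<^sup>2 * (t / real N)" by (simp add: n_def power2_eq_square)
        finally show "expectation (\<lambda>\<omega>. (b k \<omega>)\<^sup>2) \<le> n\<^sup>2 * (t / real N)" .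
      qed
      \<comment> \<open>The squares of \<open>D\<close> have means of order
        \<open>\<kappa>\<^sup>2 / N\<close>, those of \<open>b\<close> of order 1 / N; the weight
        brings both to order \<kappa> / N, and N cells give order \<kappa>.\<close>
      define Z where "Z \<omega> = (\<Sum>k<N. ((norm (D k \<omega>))\<^sup>2 / \<kappa> + \<kappa> * (b k \<omega>)\<^sup>2) / 2)" for \<omega>
      have Zi: "integrable P Z" unfolding Z_def using D2 b2 by auto
      have XZ: "X2 \<omega> \<le> Z \<omega>" for \<omega>
        unfolding X2_def Z_def by (intro sum_mono mult_le_weighted_squares \<kappa>)
      have X2i: "integrable P X2"
        by (rule Bochner_Integration.integrable_bound[OF Zi]) (use XZ X0 in \<open>auto intro!: AE_I2 intro: order_trans[OF XZ abs_ge_self]\<close>)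
      have "epm X2 \<le> expectation (\<lambda>\<omega>. norm (X2 \<omega>))" by (rule epm_le_expectation) (use X2i in auto)
      also have "\<dots> = expectation X2" using X0 by simp
      also have "\<dots> \<le> expectation Z" by (rule integral_mono[OF X2i Zi XZ])
      also have "\<dots> = (\<Sum>k<N. (expectation (\<lambda>\<omega>. (norm (D k \<omega>))\<^sup>2) / \<kappa> + \<kappa> * expectation (\<lambda>\<omega>. (b k \<omega>)\<^sup>2)) / 2)"
        unfolding Z_def using D2 b2 by (subst Bochner_Integration.integral_sum) auto
      also have "\<dots> \<le> (\<Sum>k<N. (n\<^sup>2 * C\<^sup>2 * \<kappa>\<^sup>2 * (t / real N) / \<kappa> + \<kappa> * (n\<^sup>2 * (t / real N))) / 2)"
        using D2 b2 \<kappa>(1) by (intro sum_mono divide_right_mono add_mono mult_left_mono) auto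
      \<comment> \<open>The factor 1 is written out so that the next line can raise it to
        \<open>C\<^sup>2\<close>, which makes both halves equal.\<close>
      also have "\<dots> = (n\<^sup>2 * C\<^sup>2 * t * \<kappa> + n\<^sup>2 * 1 * t * \<kappa>) / 2"
        using N \<kappa>(1) by (simp add: field_simps power2_eq_square)
      also have "\<dots> \<le> (n\<^sup>2 * C\<^sup>2 * t * \<kappa> + n\<^sup>2 * C\<^sup>2 * t * \<kappa>) / 2"
        using C t \<kappa>(1) by (intro divide_right_mono add_mono mult_right_mono mult_left_mono) auto
      also have "\<dots> = n\<^sup>2 * C\<^sup>2 * t * \<kappa>" by (rule field_sum_of_halves[folded add_divide_distrib])
      also have "\<dots> = \<epsilon> / 5" by (rule \<kappa>(2))
      finally show ?thesis .
    qed
    have eX3: "epm X3 \<le> \<epsilon> / 5"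
    proof -
      have B2: "integrable P (\<lambda>\<omega>. (B i (f (Suc l)) \<omega> - B i (f l) \<omega>)\<^sup>2)" 
        "expectation (\<lambda>\<omega>. (B i (f (Suc l)) \<omega> - B i (f l) \<omega>)\<^sup>2) = t / real (N * r)" for i l
        using incr_integrable_pow[OF f0 fmono] incr_expectation2[OF f0 fmono] grid_step[OF Nr, of t l] by (auto simp: f_def)
      have q_eq: "expectation q \<le> C * (n * t + n * K) + K" and q_int: "integrable P q"
      proof -
        have i1: "integrable P (\<lambda>\<omega>. \<Sum>l<N * r. \<Sum>i\<in>UNIV. (B i (f (Suc l)) \<omega> - B i (f l) \<omega>)\<^sup>2)" using B2 by auto
        have i2: "integrable P (\<lambda>\<omega>. indicator G \<omega> * (\<Sum>l<N * r. (norm (W (f (Suc l)) \<omega> - W (f l) \<omega>))\<^sup>2))" 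
          "expectation (\<lambda>\<omega>. indicator G \<omega> * (\<Sum>l<N * r. (norm (W (f (Suc l)) \<omega> - W (f l) \<omega>))\<^sup>2)) \<le> K"
          unfolding f_def by (rule Ki[OF Nr], rule KE[OF Nr])
        have i3: "integrable P (\<lambda>\<omega>. indicator G \<omega> * (\<Sum>k<N. (norm (dW k \<omega>))\<^sup>2))" 
          "expectation (\<lambda>\<omega>. indicator G \<omega> * (\<Sum>k<N. (norm (dW k \<omega>))\<^sup>2)) \<le> K"
          unfolding dW_def s_def by (rule Ki[OF N], rule KE[OF N])
        show "integrable P q" unfolding q_def
          by (intro Bochner_Integration.integrable_add integrable_mult_right i1 i2 i3)
        have "expectation q = C * (expectation (\<lambda>\<omega>. \<Sum>l<N * r. \<Sum>i\<in>UNIV. (B i (f (Suc l)) \<omega> - B i (f l) \<omega>)\<^sup>2)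
            + n * expectation (\<lambda>\<omega>. indicator G \<omega> * (\<Sum>l<N * r. (norm (W (f (Suc l)) \<omega> - W (f l) \<omega>))\<^sup>2)))
            + expectation (\<lambda>\<omega>. indicator G \<omega> * (\<Sum>k<N. (norm (dW k \<omega>))\<^sup>2))"
          unfolding q_def by (simp only: Bochner_Integration.integral_add Bochner_Integration.integrable_add integrable_mult_right integral_mult_right_zero i1 i2(1) i3(1))
        also have "expectation (\<lambda>\<omega>. \<Sum>l<N * r. \<Sum>i\<in>UNIV. (B i (f (Suc l)) \<omega> - B i (f l) \<omega>)\<^sup>2) = n * t"
          using B2 N r0 by (simp add: n_def)
        finally have "expectation q = C * (n * t + n * expectation (\<lambda>\<omega>. indicator G \<omega> * (\<Sum>l<N * r. (norm (W (f (Suc l)) \<omega> - W (f l) \<omega>))\<^sup>2))) + expectation (\<lambda>\<omega>. indicator G \<omega> * (\<Sum>k<N. (norm (dW k \<omega>))\<^sup>2))" .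
        also have "\<dots> \<le> C * (n * t + n * K) + K"
          using C0 n i2(2) i3(2) by (intro add_mono mult_left_mono order_refl) auto
        finally show "expectation q \<le> C * (n * t + n * K) + K" .
      qed
      have "epm X3 \<le> expectation (\<lambda>\<omega>. norm (X3 \<omega>))" 
        by (rule epm_le_expectation) (use q_int in \<open>auto simp: X3_def intro!: integrable_norm\<close>)
      also have "\<dots> = n * \<eta> * expectation q" using X0 by (simp add: X3_def)
      also have "\<dots> \<le> n * \<eta> * (C * (n * t + n * K) + K)" using n \<eta> q_eq by (intro mult_left_mono) auto
      also have "\<dots> = \<eta> * L" by (simp add: L_def)
      also have "\<dots> \<le> \<epsilon> / 5" by (rule \<eta>)
      finally show ?thesis .
    qed
    have "epm Y \<le> prob (space P - H) + epm (\<lambda>\<omega>. indicator H \<omega> *\<^sub>R Y \<omega>)" by (rule epm_split) auto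
    also have "epm (\<lambda>\<omega>. indicator H \<omega> *\<^sub>R Y \<omega>) \<le> prob (space P - G) + epm (\<lambda>\<omega>. indicator G \<omega> *\<^sub>R (indicator H \<omega> *\<^sub>R Y \<omega>))" by (rule epm_split) auto
    also have "epm (\<lambda>\<omega>. indicator G \<omega> *\<^sub>R (indicator H \<omega> *\<^sub>R Y \<omega>)) \<le> epm (\<lambda>\<omega>. (X1 \<omega> + X2 \<omega>) + X3 \<omega>)"
    proof (rule epm_mono)
      have Y0: "0 \<le> Y \<omega>" for \<omega> unfolding Y_def using b0 by (intro sum_nonneg mult_nonneg_nonneg) auto
      show "AE \<omega> in P. norm (indicator G \<omega> *\<^sub>R (indicator H \<omega> *\<^sub>R Y \<omega>)) \<le> norm ((X1 \<omega> + X2 \<omega>) + X3 \<omega>)"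
      proof (rule AE_I2)
        fix \<omega> 
        have "norm ((X1 \<omega> + X2 \<omega>) + X3 \<omega>) = X1 \<omega> + X2 \<omega> + X3 \<omega>" using X0[of \<omega>] by simp
        then show "norm (indicator G \<omega> *\<^sub>R (indicator H \<omega> *\<^sub>R Y \<omega>)) \<le> norm ((X1 \<omega> + X2 \<omega>) + X3 \<omega>)"
          using dom[of \<omega>] Y0[of \<omega>] by (auto simp: indicator_def)
      qed
    qed auto
    also have "\<dots> \<le> epm X1 + epm X2 + epm X3"
      using epm_add[of "\<lambda>\<omega>. X1 \<omega> + X2 \<omega>" X3] epm_add[of X1 X2] by simp
    also have "prob (space P - H) + (prob (space P - G) + (epm X1 + epm X2 + epm X3)) \<le> \<epsilon>"
      using PG PH eX1 eX2 eX3 by linarith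
    finally show ?case unfolding Y_def R_def dW_def b_def s_def by simp
  qed
qed

end

section \<open>The drift as the limit of the corrections\<close>

context stratonovich_flow
begin

definition drift :: "'a \<Rightarrow> 'a"
  where "drift x = (1/2) *\<^sub>R (\<Sum>i\<in>UNIV. S i x (\<sigma> i x))"

lemma drift_continuous: "continuous_on M drift"
  unfolding drift_def by (intro continuous_intros S\<sigma>_continuous)

lemma S\<sigma>_bound: "x \<in> M \<Longrightarrow> norm (S i x (\<sigma> j x)) \<le> C\<^sup>2"
proof -
  assume x: "x \<in> M"
  have "norm (S i x (\<sigma> j x)) \<le> C * norm (\<sigma> j x)" by (rule S_bound[OF x])
  also have "\<dots> \<le> C * C" using \<sigma>_bound[OF x] C by (intro mult_left_mono) auto
  finally show ?thesis by (simp add: power2_eq_square)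
qed

lemma drift_bound: "x \<in> M \<Longrightarrow> norm (drift x) \<le> real CARD('i) * C\<^sup>2"
proof -
  assume x: "x \<in> M"
  have "norm (\<Sum>i\<in>UNIV. S i x (\<sigma> i x)) \<le> (\<Sum>i\<in>(UNIV::'i set). C\<^sup>2)"
    by (intro sum_norm_le S\<sigma>_bound x)
  then have "norm (\<Sum>i\<in>UNIV. S i x (\<sigma> i x)) \<le> real CARD('i) * C\<^sup>2" by simp
  moreover have "0 \<le> real CARD('i) * C\<^sup>2" by simp
  moreover have "norm (drift x) = norm (\<Sum>i\<in>UNIV. S i x (\<sigma> i x)) / 2" by (simp add: drift_def)
  moreover have "a \<le> c" if "a = b / 2" "b \<le> c" "0 \<le> c" for a b c :: real using that by simp
  ultimately show ?thesis by blast
qed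

text \<open>Two replacements are made: the increment of \<sigma> by its linear part, at the price of
  the square of \<Delta>W, and \<Delta>W by its left-point step, at the price of their difference.
  Multiplied by the size of \<Delta>B, these two errors form a summand of
  \<open>remainder_limit\<close>.\<close>

lemma corr_step_expansion:
  assumes "0 \<le> a" "0 \<le> b" "\<omega> \<in> space P"
  shows "norm (corr_step a b \<omega> - (1/2) *\<^sub>R (\<Sum>i\<in>UNIV. \<Sum>j\<in>UNIV. ((B i b \<omega> - B i a \<omega>) * (B j b \<omega> - B j a \<omega>)) *\<^sub>R S i (W a \<omega>) (\<sigma> j (W a \<omega>))))
    \<le> C * ((norm (W b \<omega> - W a \<omega> - ito_step a b \<omega>) + (norm (W b \<omega> - W a \<omega>))\<^sup>2) * (\<Sum>i\<in>UNIV. \<bar>B i b \<omega> - B i a \<omega>\<bar>))"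
proof -
  let ?d = "\<lambda>i. B i b \<omega> - B i a \<omega>" and ?x = "W a \<omega>" and ?y = "W b \<omega>"
  let ?R = "norm (?y - ?x - ito_step a b \<omega>)"
  have x: "?x \<in> M" and y: "?y \<in> M" using W_M assms by auto
  have telescope: "u - w = (u - v) + (v - w)" for u v w :: 'a by simp
  have S_ito: "S i ?x (ito_step a b \<omega>) = (\<Sum>j\<in>UNIV. ?d j *\<^sub>R S i ?x (\<sigma> j ?x))" for i
    unfolding ito_step_def using S_linear[OF x, of i] by (simp add: linear_sum linear_cmul)
  have "(1/2) *\<^sub>R (\<Sum>i\<in>UNIV. \<Sum>j\<in>UNIV. (?d i * ?d j) *\<^sub>R S i ?x (\<sigma> j ?x)) = (\<Sum>i\<in>UNIV. (?d i / 2) *\<^sub>R S i ?x (ito_step a b \<omega>))"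
    unfolding S_ito by (simp add: scaleR_sum_right)
  then have eq: "corr_step a b \<omega> - (1/2) *\<^sub>R (\<Sum>i\<in>UNIV. \<Sum>j\<in>UNIV. (?d i * ?d j) *\<^sub>R S i ?x (\<sigma> j ?x)) =
     (\<Sum>i\<in>UNIV. (?d i / 2) *\<^sub>R (\<sigma> i ?y - \<sigma> i ?x - S i ?x (ito_step a b \<omega>)))"
    by (simp only: corr_step_def sum_subtractf scaleR_diff_right)
  have "norm (\<Sum>i\<in>UNIV. (?d i / 2) *\<^sub>R (\<sigma> i ?y - \<sigma> i ?x - S i ?x (ito_step a b \<omega>))) \<le>
      (\<Sum>i\<in>UNIV. norm ((?d i / 2) *\<^sub>R (\<sigma> i ?y - \<sigma> i ?x - S i ?x (ito_step a b \<omega>))))"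
    by (rule norm_sum)
  also have "\<dots> \<le> (\<Sum>i\<in>UNIV. \<bar>?d i\<bar> * (C * (?R + (norm (?y - ?x))\<^sup>2)))"
  proof (rule sum_mono)
    fix i
    have eq1: "\<sigma> i ?y - \<sigma> i ?x - S i ?x (ito_step a b \<omega>) = (\<sigma> i ?y - \<sigma> i ?x - S i ?x (?y - ?x)) + S i ?x (?y - ?x - ito_step a b \<omega>)"
      unfolding linear_diff[OF S_linear[OF x, of i], of "?y - ?x" "ito_step a b \<omega>"] by (rule telescope)
    have "norm (\<sigma> i ?y - \<sigma> i ?x - S i ?x (ito_step a b \<omega>)) \<le> C * (norm (?y - ?x))\<^sup>2 + C * ?R"
      unfolding eq1 using norm_triangle_ineq[of "\<sigma> i ?y - \<sigma> i ?x - S i ?x (?y - ?x)" "S i ?x (?y - ?x - ito_step a b \<omega>)"]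
        \<sigma>_taylor[OF x y, of i] S_bound[OF x, of i "?y - ?x - ito_step a b \<omega>"] by linarith
    then have "norm (\<sigma> i ?y - \<sigma> i ?x - S i ?x (ito_step a b \<omega>)) \<le> C * (?R + (norm (?y - ?x))\<^sup>2)"
      by (simp only: distrib_left add.commute)
    then have "(\<bar>?d i\<bar> / 2) * norm (\<sigma> i ?y - \<sigma> i ?x - S i ?x (ito_step a b \<omega>)) \<le> \<bar>?d i\<bar> * (C * (?R + (norm (?y - ?x))\<^sup>2))"
      by (intro mult_mono) auto
    then show "norm ((?d i / 2) *\<^sub>R (\<sigma> i ?y - \<sigma> i ?x - S i ?x (ito_step a b \<omega>))) \<le> \<bar>?d i\<bar> * (C * (?R + (norm (?y - ?x))\<^sup>2))"
      by (simp only: norm_scaleR abs_divide abs_numeral)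
  qed
  also have "\<dots> = C * ((?R + (norm (?y - ?x))\<^sup>2) * (\<Sum>i\<in>UNIV. \<bar>?d i\<bar>))"
    unfolding sum_distrib_right[symmetric] by (simp only: mult_ac)
  finally show ?thesis unfolding eq .
qed

text \<open>A product of two increments minus its mean is centred and independent of the past, so
  the sum is orthogonal. Each of the N terms has a second moment of order
  \<open>(t / N)\<^sup>2\<close>, the whole one of order 1 / N.\<close>

lemma bracket_limit:
  assumes t: "0 < t" and \<epsilon>: "0 < \<epsilon>"
  shows "\<forall>\<^sub>F N in sequentially. epm (\<lambda>\<omega>. \<Sum>k<N. ((B i (grid t N (Suc k)) \<omega> - B i (grid t N k) \<omega>) * (B j (grid t N (Suc k)) \<omega> - B j (grid t N k) \<omega>) 
      - (if i = j then t / real N else 0)) *\<^sub>R S i (W (grid t N k) \<omega>) (\<sigma> j (W (grid t N k) \<omega>))) \<le> \<epsilon>"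
proof -
  have "\<forall>\<^sub>F N in sequentially. (16 * C^4 * t\<^sup>2 / \<epsilon>) / real N < \<epsilon> / 2"
    by (rule eventually_small_mesh) (use \<epsilon> in simp)
  then show ?thesis
    using eventually_gt_at_top[of 0]
  proof eventually_elim
    case (elim N)
    note N = elim(2)
    define s where "s = grid t N"
    have s: "0 \<le> s k" "s k \<le> s (Suc k)" for k using t by (auto simp: s_def grid_nonneg grid_mono)
    have sstep: "s (Suc k) - s k = t / real N" for k using grid_step[OF N] by (simp add: s_def)
    define g :: "nat \<Rightarrow> real^'i \<Rightarrow> real" where "g k x = x $ i * x $ j - (if i = j then t / real N else 0)" for k x
    define c where "c k \<omega> = S i (W (s k) \<omega>) (\<sigma> j (W (s k) \<omega>))" for k \<omega>
    define V where "V \<omega> = (\<Sum>k<N. g k (incr (s k) (s (Suc k)) \<omega>) *\<^sub>R c k \<omega>)" for \<omega>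
    have gm: "g k \<in> borel_measurable borel" for k unfolding g_def by measurable
    have cF: "c k \<in> borel_measurable (F (s k))" for k unfolding c_def by (rule cont_F[OF S\<sigma>_continuous s(1)])
    have cb: "norm (c k \<omega>) \<le> C\<^sup>2" if "\<omega> \<in> space P" for k \<omega>
      unfolding c_def by (rule S\<sigma>_bound[OF W_M[OF s(1) that]])
    have g2: "integrable P (\<lambda>\<omega>. (g k (incr (s k) (s (Suc k)) \<omega>))\<^sup>2)"
       "expectation (\<lambda>\<omega>. (g k (incr (s k) (s (Suc k)) \<omega>))\<^sup>2) \<le> 8 * (t / real N)\<^sup>2" for k
      using incr_cross_sq_integrable[OF s(1)[of k] s(2)[of k], of i j] incr_cross_sq_expectation[OF s(1)[of k] s(2)[of k], of i j] unfolding g_def incr_nth sstep by auto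
    have g1: "expectation (\<lambda>\<omega>. g k (incr (s k) (s (Suc k)) \<omega>)) = 0" for k
      using incr_cross_expectation[OF s(1)[of k] s(2)[of k], of i j] incr_cross_integrable[OF s(1)[of k] s(2)[of k], of i j] unfolding g_def incr_nth sstep
      by (simp add: prob_space)
    have Vi: "integrable P (\<lambda>\<omega>. (norm (V \<omega>))\<^sup>2)"
      unfolding V_def by (rule orthogonal_vsum_integrable[where c=c and g=g and K="C\<^sup>2"]) (use s cF cb gm g2 g1 in auto)
    have "expectation (\<lambda>\<omega>. (norm (V \<omega>))\<^sup>2) = (\<Sum>k<N. expectation (\<lambda>\<omega>. (norm (c k \<omega>))\<^sup>2) * expectation (\<lambda>\<omega>. (g k (incr (s k) (s (Suc k)) \<omega>))\<^sup>2))"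
      unfolding V_def by (rule orthogonal_vsum_expectation[where c=c and g=g and K="C\<^sup>2"]) (use s cF cb gm g2 g1 in auto)
    also have "\<dots> \<le> (\<Sum>k<N. (C\<^sup>2)\<^sup>2 * (8 * (t / real N)\<^sup>2))"
    proof (intro sum_mono mult_mono g2)
      fix k
      have "integrable P (\<lambda>\<omega>. (norm (c k \<omega>))\<^sup>2)"
      proof (rule integrable_const_bound[where B="(C\<^sup>2)\<^sup>2"])
        show "AE \<omega> in P. norm ((norm (c k \<omega>))\<^sup>2) \<le> (C\<^sup>2)\<^sup>2"
          using power_mono[OF cb norm_ge_zero, where n=2] by (intro AE_I2) (simp only: real_norm_def abs_power2)
      qed (use F_measurable[OF cF[of k]] in auto)
      then have "expectation (\<lambda>\<omega>. (norm (c k \<omega>))\<^sup>2) \<le> expectation (\<lambda>\<omega>. (C\<^sup>2)\<^sup>2)"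
        using power_mono[OF cb norm_ge_zero, where n=2] by (intro integral_mono) auto
      then show "expectation (\<lambda>\<omega>. (norm (c k \<omega>))\<^sup>2) \<le> (C\<^sup>2)\<^sup>2" by (simp add: prob_space)
    qed (auto intro!: integral_nonneg_AE)
    also have "\<dots> = 8 * C^4 * t\<^sup>2 / real N" using N by (simp add: field_simps power2_eq_square power4_eq_xxxx)
    finally have EV: "expectation (\<lambda>\<omega>. (norm (V \<omega>))\<^sup>2) \<le> 8 * C^4 * t\<^sup>2 / real N" .
    have [measurable]: "incr (s k) (s (Suc k)) \<in> borel_measurable P" "c k \<in> borel_measurable P" for k 
      using incr_meas[OF s] F_measurable[OF cF] by auto
    have Vm: "V \<in> borel_measurable P" unfolding V_def using gm by measurable
    have "epm V \<le> \<epsilon> / 2 + expectation (\<lambda>\<omega>. (norm (V \<omega>))\<^sup>2) / (\<epsilon> / 2)"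
      by (rule epm_le_square[OF Vm Vi]) (use \<epsilon> in simp)
    also have "\<dots> \<le> \<epsilon> / 2 + (8 * C^4 * t\<^sup>2 / real N) / (\<epsilon> / 2)"
      using EV \<epsilon> by (intro add_mono divide_right_mono) auto
    also have "(8 * C^4 * t\<^sup>2 / real N) / (\<epsilon> / 2) = (16 * C^4 * t\<^sup>2 / \<epsilon>) / real N" by (simp add: mult_ac)
    also have "\<epsilon> / 2 + \<dots> \<le> \<epsilon>" using elim(1) by linarith
    finally show ?case unfolding V_def g_def c_def s_def by simp
  qed
qed

definition discretization_error :: "real \<Rightarrow> nat \<Rightarrow> 'w \<Rightarrow> 'a"
  where "discretization_error t N \<omega> = W t \<omega> - W 0 \<omega> - (\<Sum>k<N. ito_step (grid t N k) (grid t N (Suc k)) \<omega>) 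
      - (\<Sum>k<N. (t / real N) *\<^sub>R drift (W (grid t N k) \<omega>))"

lemma discretization_error_P: "0 \<le> t \<Longrightarrow> discretization_error t N \<in> borel_measurable P"
  unfolding discretization_error_def using grid_nonneg[of t]
  by (intro borel_measurable_diff borel_measurable_sum borel_measurable_scaleR borel_measurable_const ito_step_P W_P cont_P[OF drift_continuous]) auto

text \<open>The error splits into \<open>T\<close>, the defect of the trapezoidal sums;
  \<open>Q\<close>, the corrections minus their quadratic expressions in \<Delta>B; and half of the
  \<open>V i j\<close>, the fluctuations of the products of increments about their means. The mean t
  / N on the diagonal produces the drift.\<close>

lemma discretization_limit:
  assumes t: "0 < t" and \<epsilon>: "0 < \<epsilon>"
  shows "\<forall>\<^sub>F N in sequentially. epm (discretization_error t N) \<le> \<epsilon>"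
proof -
  define n where "n = real CARD('i)"
  have n: "1 \<le> n" unfolding n_def using zero_less_card_finite[where 'a='i] by (simp add: Suc_le_eq)
  define s where "s = grid t"
  define T where "T N \<omega> = W t \<omega> - W 0 \<omega> - 
    (\<Sum>k<N. ito_step (s N k) (s N (Suc k)) \<omega> + corr_step (s N k) (s N (Suc k)) \<omega>)" for N \<omega>
  define Y where "Y N \<omega> = (\<Sum>k<N. 
     (norm (W (s N (Suc k)) \<omega> - W (s N k) \<omega> - ito_step (s N k) (s N (Suc k)) \<omega>) 
       + (norm (W (s N (Suc k)) \<omega> - W (s N k) \<omega>))\<^sup>2) * 
     (\<Sum>i\<in>UNIV. \<bar>B i (s N (Suc k)) \<omega> - B i (s N k) \<omega>\<bar>))" for N \<omega>
  define V where "V i j N \<omega> = (\<Sum>k<N. ((B i (s N (Suc k)) \<omega> - B i (s N k) \<omega>) * (B j (s N (Suc k)) \<omega> - B j (s N k) \<omega>) 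
      - (if i = j then t / real N else 0)) *\<^sub>R S i (W (s N k) \<omega>) (\<sigma> j (W (s N k) \<omega>)))" for i j N \<omega>
  define Q where "Q N \<omega> = (\<Sum>k<N. corr_step (s N k) (s N (Suc k)) \<omega> - (1/2) *\<^sub>R (\<Sum>i\<in>UNIV. \<Sum>j\<in>UNIV. 
     ((B i (s N (Suc k)) \<omega> - B i (s N k) \<omega>) * (B j (s N (Suc k)) \<omega> - B j (s N k) \<omega>)) *\<^sub>R S i (W (s N k) \<omega>) (\<sigma> j (W (s N k) \<omega>))))" for N \<omega>
  have s0: "0 \<le> s N k" for N k using t by (simp add: s_def grid_nonneg)
  have [measurable]: "B i (s N k) \<in> borel_measurable P" "W (s N k) \<in> borel_measurable P" 
     "ito_step (s N k) (s N l) \<in> borel_measurable P" "corr_step (s N k) (s N l) \<in> borel_measurable P"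
     "(\<lambda>\<omega>. S i (W (s N k) \<omega>) (\<sigma> j (W (s N k) \<omega>))) \<in> borel_measurable P" 
     "W t \<in> borel_measurable P" "W 0 \<in> borel_measurable P" for i j k l N
    using B_meas W_P ito_step_P corr_step_P cont_P[OF S\<sigma>_continuous] s0 t by auto
  have meas: "T N \<in> borel_measurable P" "Y N \<in> borel_measurable P" "V i j N \<in> borel_measurable P" "Q N \<in> borel_measurable P" for i j N
    unfolding T_def Y_def V_def Q_def by measurable
  have decomp: "discretization_error t N \<omega> = T N \<omega> + Q N \<omega> + (\<Sum>i\<in>UNIV. \<Sum>j\<in>UNIV. (1/2) *\<^sub>R V i j N \<omega>)" for N \<omega>
  proof -
    define c where "c k = corr_step (s N k) (s N (Suc k)) \<omega>" for k
    define X where "X k i j = ((B i (s N (Suc k)) \<omega> - B i (s N k) \<omega>) * (B j (s N (Suc k)) \<omega> - B j (s N k) \<omega>)) *\<^sub>R S i (W (s N k) \<omega>) (\<sigma> j (W (s N k) \<omega>))" for k i j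
    define Z where "Z k i j = (if i = j then t / real N else 0) *\<^sub>R S i (W (s N k) \<omega>) (\<sigma> j (W (s N k) \<omega>))" for k i j
    have Q: "Q N \<omega> = (\<Sum>k<N. c k) - (\<Sum>k<N. (1/2) *\<^sub>R (\<Sum>i\<in>UNIV. \<Sum>j\<in>UNIV. X k i j))"
      unfolding Q_def c_def X_def sum_subtractf by simp
    have "V i j N \<omega> = (\<Sum>k<N. X k i j - Z k i j)" for i j
      unfolding V_def X_def Z_def scaleR_diff_left by simp
    then have "(\<Sum>i\<in>UNIV. \<Sum>j\<in>UNIV. (1/2) *\<^sub>R V i j N \<omega>) = (\<Sum>i\<in>UNIV. \<Sum>j\<in>UNIV. \<Sum>k<N. (1/2) *\<^sub>R (X k i j - Z k i j))"
      by (simp add: scaleR_sum_right)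
    also have "\<dots> = (\<Sum>i\<in>UNIV. \<Sum>k<N. \<Sum>j\<in>UNIV. (1/2) *\<^sub>R (X k i j - Z k i j))"
      by (intro sum.cong refl sum.swap)
    also have "\<dots> = (\<Sum>k<N. \<Sum>i\<in>UNIV. \<Sum>j\<in>UNIV. (1/2) *\<^sub>R (X k i j - Z k i j))"
      by (rule sum.swap)
    also have "\<dots> = (\<Sum>k<N. (1/2) *\<^sub>R (\<Sum>i\<in>UNIV. \<Sum>j\<in>UNIV. X k i j)) - (\<Sum>k<N. (1/2) *\<^sub>R (\<Sum>i\<in>UNIV. \<Sum>j\<in>UNIV. Z k i j))"
      by (simp add: scaleR_sum_right[symmetric] sum_subtractf scaleR_diff_right)
    also have "(\<Sum>k<N. (1/2) *\<^sub>R (\<Sum>i\<in>UNIV. \<Sum>j\<in>UNIV. Z k i j)) = (\<Sum>k<N. (t / real N) *\<^sub>R drift (W (s N k) \<omega>))"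
    proof (rule sum.cong[OF refl])
      fix k
      have "(\<Sum>j\<in>UNIV. Z k i j) = (t / real N) *\<^sub>R S i (W (s N k) \<omega>) (\<sigma> i (W (s N k) \<omega>))" for i
      proof -
        have "(\<Sum>j\<in>UNIV. Z k i j) = (\<Sum>j\<in>UNIV. if i = j then (t / real N) *\<^sub>R S i (W (s N k) \<omega>) (\<sigma> j (W (s N k) \<omega>)) else 0)"
          unfolding Z_def by (intro sum.cong) auto
        then show ?thesis by simp
      qed
      then show "(1/2) *\<^sub>R (\<Sum>i\<in>UNIV. \<Sum>j\<in>UNIV. Z k i j) = (t / real N) *\<^sub>R drift (W (s N k) \<omega>)"
        by (simp add: drift_def scaleR_sum_right mult.commute)
    qed
    finally have V: "(\<Sum>i\<in>UNIV. \<Sum>j\<in>UNIV. (1/2) *\<^sub>R V i j N \<omega>) = (\<Sum>k<N. (1/2) *\<^sub>R (\<Sum>i\<in>UNIV. \<Sum>j\<in>UNIV. X k i j)) - (\<Sum>k<N. (t / real N) *\<^sub>R drift (W (s N k) \<omega>))" .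
    have T: "T N \<omega> = W t \<omega> - W 0 \<omega> - (\<Sum>k<N. ito_step (s N k) (s N (Suc k)) \<omega>) - (\<Sum>k<N. c k)"
      unfolding T_def c_def sum.distrib by simp
    show ?thesis unfolding T Q V discretization_error_def s_def[symmetric] by simp
  qed
  have Qle: "epm (Q N) \<le> C * epm (Y N)" for N
  proof -
    have "epm (Q N) \<le> epm (\<lambda>\<omega>. C *\<^sub>R Y N \<omega>)"
    proof (rule epm_mono)
      show "AE \<omega> in P. norm (Q N \<omega>) \<le> norm (C *\<^sub>R Y N \<omega>)"
      proof (rule AE_I2)
        fix \<omega> assume \<omega>: "\<omega> \<in> space P"
        have "norm (Q N \<omega>) \<le> (\<Sum>k<N. C * ((norm (W (s N (Suc k)) \<omega> - W (s N k) \<omega> - ito_step (s N k) (s N (Suc k)) \<omega>) 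
           + (norm (W (s N (Suc k)) \<omega> - W (s N k) \<omega>))\<^sup>2) * (\<Sum>i\<in>UNIV. \<bar>B i (s N (Suc k)) \<omega> - B i (s N k) \<omega>\<bar>)))"
          unfolding Q_def by (intro sum_norm_le corr_step_expansion s0 \<omega>)
        also have "\<dots> = C *\<^sub>R Y N \<omega>" by (simp add: Y_def sum_distrib_left)
        also have "\<dots> \<le> norm (C *\<^sub>R Y N \<omega>)" by simp
        finally show "norm (Q N \<omega>) \<le> norm (C *\<^sub>R Y N \<omega>)" .
      qed
    qed (use meas in auto)
    also have "\<dots> \<le> C * epm (Y N)" by (rule epm_scale[OF meas(2) C])
    finally show ?thesis .
  qed
  have evY: "\<forall>\<^sub>F N in sequentially. epm (Y N) \<le> \<epsilon> / (3 * C)"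
    unfolding Y_def s_def by (rule remainder_limit[OF t]) (use \<epsilon> C in simp)
  have evT: "\<forall>\<^sub>F N in sequentially. epm (T N) \<le> \<epsilon> / 3"
    unfolding T_def s_def by (rule trapezoidal_limit[OF t]) (use \<epsilon> in simp)
  have "\<forall>\<^sub>F N in sequentially. epm (V i j N) \<le> \<epsilon> / (3 * n\<^sup>2)" for i j
    unfolding V_def s_def by (rule bracket_limit[OF t]) (use \<epsilon> n in simp)
  then have evV: "\<forall>\<^sub>F N in sequentially. \<forall>p\<in>UNIV. epm (V (fst p) (snd p) N) \<le> \<epsilon> / (3 * n\<^sup>2)"
    by (intro eventually_ball_finite) auto
  from evY evT evV show ?thesis
  proof eventually_elim
    case (elim N)
    have half: "epm (\<lambda>\<omega>. (1/2) *\<^sub>R V i j N \<omega>) \<le> \<epsilon> / (3 * n\<^sup>2)" for i j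
    proof -
      have "epm (\<lambda>\<omega>. (1/2) *\<^sub>R V i j N \<omega>) \<le> epm (V i j N)" by (rule epm_mono) (use meas in auto)
      also have "\<dots> \<le> \<epsilon> / (3 * n\<^sup>2)" using elim(3)[rule_format, of "(i, j)"] by simp
      finally show ?thesis .
    qed
    have Vs: "epm (\<lambda>\<omega>. \<Sum>i\<in>UNIV. \<Sum>j\<in>UNIV. (1/2) *\<^sub>R V i j N \<omega>) \<le> \<epsilon> / 3"
    proof -
      have "epm (\<lambda>\<omega>. \<Sum>i\<in>UNIV. \<Sum>j\<in>UNIV. (1/2) *\<^sub>R V i j N \<omega>) \<le> (\<Sum>i\<in>UNIV. epm (\<lambda>\<omega>. \<Sum>j\<in>UNIV. (1/2) *\<^sub>R V i j N \<omega>))"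
        by (rule epm_sum) (use meas in auto)
      also have "\<dots> \<le> (\<Sum>i\<in>UNIV. \<Sum>j\<in>UNIV. epm (\<lambda>\<omega>. (1/2) *\<^sub>R V i j N \<omega>))"
        by (intro sum_mono epm_sum) (use meas in auto)
      also have "\<dots> \<le> (\<Sum>i\<in>(UNIV::'i set). \<Sum>j\<in>(UNIV::'i set). \<epsilon> / (3 * n\<^sup>2))" by (intro sum_mono half)
      also have "\<dots> = \<epsilon> / 3" using n by (simp add: n_def[symmetric] power2_eq_square)
      finally show ?thesis .
    qed
    have "epm (discretization_error t N) = epm (\<lambda>\<omega>. (T N \<omega> + Q N \<omega>) + (\<Sum>i\<in>UNIV. \<Sum>j\<in>UNIV. (1/2) *\<^sub>R V i j N \<omega>))"
      by (rule arg_cong[where f=epm]) (rule ext, rule decomp)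
    also have "\<dots> \<le> epm (\<lambda>\<omega>. T N \<omega> + Q N \<omega>) + epm (\<lambda>\<omega>. \<Sum>i\<in>UNIV. \<Sum>j\<in>UNIV. (1/2) *\<^sub>R V i j N \<omega>)"
      by (rule epm_add) (use meas in auto)
    also have "epm (\<lambda>\<omega>. T N \<omega> + Q N \<omega>) \<le> epm (T N) + epm (Q N)" by (rule epm_add) (use meas in auto)
    also have "epm (Q N) \<le> \<epsilon> / 3"
    proof -
      have "C * epm (Y N) \<le> C * (\<epsilon> / (3 * C))" using elim(1) C by (intro mult_left_mono) auto
      also have "\<dots> = \<epsilon> / 3" using C by simp
      finally show ?thesis using Qle[of N] by linarith
    qed
    finally show ?case using elim(2) Vs by linarith
  qed
qed

end

section \<open>The generator\<close>

context stratonovich_flow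
begin

text \<open>The left-point step over [0, t] with the coefficients at the deterministic point
  \<open>w0\<close>. Its moments follow from those of Brownian increments alone, and it differs from
  \<open>ito_step 0 t\<close> on a null set only.\<close>

definition frozen_step :: "real \<Rightarrow> 'w \<Rightarrow> 'a"
  where "frozen_step t \<omega> = (\<Sum>i\<in>UNIV. (B i t \<omega> - B i 0 \<omega>) *\<^sub>R \<sigma> i w0)"

lemma frozen_step_P: "0 \<le> t \<Longrightarrow> frozen_step t \<in> borel_measurable P"
  unfolding frozen_step_def by (intro borel_measurable_sum borel_measurable_scaleR borel_measurable_diff borel_measurable_const B_meas) auto

lemma frozen_step_ito: "AE \<omega> in P. ito_step 0 t \<omega> = frozen_step t \<omega>"
  using W_0 by eventually_elim (simp add: ito_step_def frozen_step_def)

lemma frozen_step_sq: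
  assumes t: "0 \<le> t"
  shows "integrable P (\<lambda>\<omega>. (norm (frozen_step t \<omega>))\<^sup>2)" 
    and "expectation (\<lambda>\<omega>. (norm (frozen_step t \<omega>))\<^sup>2) \<le> (real CARD('i))\<^sup>2 * C\<^sup>2 * t"
proof -
  have le: "(norm (frozen_step t \<omega>))\<^sup>2 \<le> real CARD('i) * (\<Sum>i\<in>UNIV. C\<^sup>2 * (B i t \<omega> - B i 0 \<omega>)\<^sup>2)" for \<omega>
  proof -
    have "(norm (frozen_step t \<omega>))\<^sup>2 \<le> real CARD('i) * (\<Sum>i\<in>UNIV. (norm ((B i t \<omega> - B i 0 \<omega>) *\<^sub>R \<sigma> i w0))\<^sup>2)"
      unfolding frozen_step_def by (rule norm_sum_power2_le)
    also have "\<dots> \<le> real CARD('i) * (\<Sum>i\<in>UNIV. C\<^sup>2 * (B i t \<omega> - B i 0 \<omega>)\<^sup>2)"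
    proof (intro mult_left_mono sum_mono)
      fix i
      have "(norm (\<sigma> i w0))\<^sup>2 \<le> C\<^sup>2" using \<sigma>_bound[OF w0] by (intro power_mono) auto
      from mult_left_mono[OF this zero_le_power2[of "B i t \<omega> - B i 0 \<omega>"]]
      show "(norm ((B i t \<omega> - B i 0 \<omega>) *\<^sub>R \<sigma> i w0))\<^sup>2 \<le> C\<^sup>2 * (B i t \<omega> - B i 0 \<omega>)\<^sup>2"
        by (simp only: norm_scaleR power_mult_distrib power2_abs real_norm_def mult.commute[of "C\<^sup>2"])
    qed simp
    finally show ?thesis .
  qed
  have i: "integrable P (\<lambda>\<omega>. real CARD('i) * (\<Sum>i\<in>UNIV. C\<^sup>2 * (B i t \<omega> - B i 0 \<omega>)\<^sup>2))"
    using incr_integrable_pow[of 0 t] t by auto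
  show int: "integrable P (\<lambda>\<omega>. (norm (frozen_step t \<omega>))\<^sup>2)"
    by (rule Bochner_Integration.integrable_bound[OF i]) (use le frozen_step_P[OF t] in \<open>auto intro!: AE_I2 simp: sum_nonneg\<close>)
  have "expectation (\<lambda>\<omega>. (norm (frozen_step t \<omega>))\<^sup>2) \<le> expectation (\<lambda>\<omega>. real CARD('i) * (\<Sum>i\<in>UNIV. C\<^sup>2 * (B i t \<omega> - B i 0 \<omega>)\<^sup>2))"
    by (rule integral_mono[OF int i le])
  also have "\<dots> = real CARD('i) * (\<Sum>i\<in>(UNIV::'i set). C\<^sup>2 * t)"
    using incr_integrable_pow[of 0 t] incr_expectation2[of 0 t] t by simp
  also have "\<dots> = (real CARD('i))\<^sup>2 * C\<^sup>2 * t" by (simp add: power2_eq_square)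
  finally show "expectation (\<lambda>\<omega>. (norm (frozen_step t \<omega>))\<^sup>2) \<le> (real CARD('i))\<^sup>2 * C\<^sup>2 * t" .
qed

text \<open>Cauchy-Schwarz over the motions, used twice, gives the third power of their number, and
  summing over them the fourth. The order \<open>t\<^sup>2\<close> will make the event of leaving a
  neighbourhood of \<open>w0\<close> negligible.\<close>

lemma frozen_step_fourth:
  assumes t: "0 \<le> t"
  shows "integrable P (\<lambda>\<omega>. (norm (frozen_step t \<omega>))^4)" 
    and "expectation (\<lambda>\<omega>. (norm (frozen_step t \<omega>))^4) \<le> 3 * (real CARD('i))^4 * C^4 * t\<^sup>2"
proof -
  let ?n = "real CARD('i)"
  have le: "(norm (frozen_step t \<omega>))^4 \<le> ?n^3 * (\<Sum>i\<in>UNIV. C^4 * (B i t \<omega> - B i 0 \<omega>)^4)" for \<omega>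
  proof -
    let ?v = "\<lambda>i. (B i t \<omega> - B i 0 \<omega>) *\<^sub>R \<sigma> i w0"
    have v: "(norm (?v i))^4 \<le> C^4 * (B i t \<omega> - B i 0 \<omega>)^4" for i
    proof -
      have "(norm (\<sigma> i w0))^4 \<le> C^4" using \<sigma>_bound[OF w0] by (intro power_mono) auto
      from mult_left_mono[OF this zero_le_even_power'[of "B i t \<omega> - B i 0 \<omega>" 2]]
      show ?thesis
        by (simp add: power_mult_distrib mult.commute[of "C^4"])
    qed
    have "(norm (frozen_step t \<omega>))^4 = ((norm (frozen_step t \<omega>))\<^sup>2)\<^sup>2" by simp
    also have "\<dots> \<le> (?n * (\<Sum>i\<in>UNIV. (norm (?v i))\<^sup>2))\<^sup>2"
      unfolding frozen_step_def by (rule power_mono[OF norm_sum_power2_le]) simp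
    also have "\<dots> = ?n\<^sup>2 * (norm (\<Sum>i\<in>UNIV. (norm (?v i))\<^sup>2))\<^sup>2" by (simp only: power_mult_distrib real_norm_def power2_abs)
    also have "\<dots> \<le> ?n\<^sup>2 * (?n * (\<Sum>i\<in>UNIV. (norm ((norm (?v i))\<^sup>2))\<^sup>2))"
      by (intro mult_left_mono norm_sum_power2_le) simp
    also have "\<dots> = ?n^3 * (\<Sum>i\<in>UNIV. (norm (?v i))^4)" by (simp add: power2_eq_square power3_eq_cube power4_eq_xxxx mult_ac)
    also have "\<dots> \<le> ?n^3 * (\<Sum>i\<in>UNIV. C^4 * (B i t \<omega> - B i 0 \<omega>)^4)"
      by (intro mult_left_mono sum_mono v) simp
    finally show ?thesis .
  qed
  have i: "integrable P (\<lambda>\<omega>. ?n^3 * (\<Sum>i\<in>UNIV. C^4 * (B i t \<omega> - B i 0 \<omega>)^4))"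
    using incr_integrable_pow[of 0 t] t by auto
  show int: "integrable P (\<lambda>\<omega>. (norm (frozen_step t \<omega>))^4)"
    by (rule Bochner_Integration.integrable_bound[OF i]) (use le frozen_step_P[OF t] in \<open>auto intro!: AE_I2 simp: sum_nonneg\<close>)
  have "expectation (\<lambda>\<omega>. (norm (frozen_step t \<omega>))^4) \<le> expectation (\<lambda>\<omega>. ?n^3 * (\<Sum>i\<in>UNIV. C^4 * (B i t \<omega> - B i 0 \<omega>)^4))"
    by (rule integral_mono[OF int i le])
  also have "\<dots> = ?n^3 * (\<Sum>i\<in>(UNIV::'i set). C^4 * (3 * t\<^sup>2))"
    using incr_integrable_pow[of 0 t] incr_expectation4[of 0 t] t by simp
  also have "\<dots> = 3 * ?n^4 * C^4 * t\<^sup>2" by (simp add: power3_eq_cube power4_eq_xxxx)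
  finally show "expectation (\<lambda>\<omega>. (norm (frozen_step t \<omega>))^4) \<le> 3 * ?n^4 * C^4 * t\<^sup>2" .
qed

lemma bounded_image_sq_integrable:
  fixes f :: "'a \<Rightarrow> 'b::euclidean_space"
  assumes f: "continuous_on M f" and a: "0 \<le> a" 
  shows "integrable P (\<lambda>\<omega>. f (W a \<omega>))"
proof -
  have "bounded (f ` M)" by (intro compact_imp_bounded compact_continuous_image f M_compact)
  then obtain K where K: "\<forall>y\<in>M. norm (f y) \<le> K" unfolding bounded_iff by auto
  show ?thesis
    by (rule integrable_const_bound[where B=K]) (use K W_M[OF a] cont_P[OF f a] in auto)
qed

section \<open>Mean and mean square of a short-time increment\<close>

lemma sum_grid_ito_mean:
  assumes t: "0 < t" and N: "0 < N"
  shows "integrable P (\<lambda>\<omega>. \<Sum>k<N. ito_step (grid t N k) (grid t N (Suc k)) \<omega>)"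
    and "expectation (\<lambda>\<omega>. \<Sum>k<N. ito_step (grid t N k) (grid t N (Suc k)) \<omega>) = 0"
proof -
  define s where "s = grid t N"
  have s: "0 \<le> s k" "s k \<le> s (Suc k)" for k using t by (auto simp: s_def grid_nonneg grid_mono)
  have eq: "(\<lambda>\<omega>. \<Sum>k<N. ito_step (s k) (s (Suc k)) \<omega>) = (\<lambda>\<omega>. \<Sum>i\<in>UNIV. \<Sum>k<N. incr (s k) (s (Suc k)) \<omega> $ i *\<^sub>R \<sigma> i (W (s k) \<omega>))"
    unfolding ito_step_def incr_nth by (rule ext, rule sum.swap)
  have *: "integrable P (\<lambda>\<omega>. \<Sum>k<N. incr (s k) (s (Suc k)) \<omega> $ i *\<^sub>R \<sigma> i (W (s k) \<omega>))"
     "expectation (\<lambda>\<omega>. \<Sum>k<N. incr (s k) (s (Suc k)) \<omega> $ i *\<^sub>R \<sigma> i (W (s k) \<omega>)) = 0" for i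
    using orthogonal_vsum_mean[where c="\<lambda>k \<omega>. \<sigma> i (W (s k) \<omega>)" and g="\<lambda>_ x. x $ i" and K=C and \<tau>=s and N=N]
      s \<sigma>_F[OF s(1)] \<sigma>_bound[OF W_M[OF s(1)]] incr_integrable_pow[OF s, of i] incr_expectation[OF s]
    by auto
  show "integrable P (\<lambda>\<omega>. \<Sum>k<N. ito_step (grid t N k) (grid t N (Suc k)) \<omega>)"
    "expectation (\<lambda>\<omega>. \<Sum>k<N. ito_step (grid t N k) (grid t N (Suc k)) \<omega>) = 0"
    unfolding s_def[symmetric] eq using * by auto
qed

text \<open>The interval [0, t] is a single coarse cell and the grid its refinement, so the estimate
  for refinements applies, with \<open>h\<close> bounding the displacement on the whole interval.
  The drift sum is bounded pathwise. The bound is independent of \<open>N\<close>.\<close>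

lemma
  assumes t: "0 < t" and N: "0 < N"
    and h: "\<And>s. 0 \<le> s \<Longrightarrow> s \<le> t \<Longrightarrow> expectation (\<lambda>\<omega>. (norm (W s \<omega> - W 0 \<omega>))\<^sup>2) \<le> h"
  defines "Y \<equiv> \<lambda>\<omega>. (\<Sum>k<N. ito_step (grid t N k) (grid t N (Suc k)) \<omega>) - ito_step 0 t \<omega>
      + (\<Sum>k<N. (t / real N) *\<^sub>R drift (W (grid t N k) \<omega>))"
  shows discretized_remainder_integrable: "integrable P (\<lambda>\<omega>. (norm (Y \<omega>))\<^sup>2)"
    and discretized_remainder_bound: 
      "expectation (\<lambda>\<omega>. (norm (Y \<omega>))\<^sup>2) \<le> 2 * ((real CARD('i))\<^sup>2 * C\<^sup>2 * h * t) + 2 * ((real CARD('i))\<^sup>2 * C^4 * t\<^sup>2)"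
proof -
  define D where "D \<omega> = (\<Sum>k<N. ito_step (grid t N k) (grid t N (Suc k)) \<omega>) - ito_step 0 t \<omega>" for \<omega>
  define A where "A \<omega> = (\<Sum>k<N. (t / real N) *\<^sub>R drift (W (grid t N k) \<omega>))" for \<omega>
  \<comment> \<open>\<open>1 * N\<close> and \<open>0 * N + l\<close> describe the refined grid of
    the one-cell grid in the form that \<open>ito_refinement\<close> expects.\<close>
  have h': "expectation (\<lambda>\<omega>. (norm (W (grid t (1 * N) (0 * N + l)) \<omega> - W (grid t 1 0) \<omega>))\<^sup>2) \<le> h" if "l < N" for l
    using h[of "grid t N l"] grid_nonneg[of t N l] grid_le[of t N l] t N that by simp
  have D: "integrable P (\<lambda>\<omega>. (norm (D \<omega>))\<^sup>2)" "expectation (\<lambda>\<omega>. (norm (D \<omega>))\<^sup>2) \<le> (real CARD('i))\<^sup>2 * C\<^sup>2 * h * t"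
    using ito_refinement_integrable[OF t zero_less_one N h'] ito_refinement[OF t zero_less_one N h'] 
      grid_refl[of 1 t] by (auto simp: D_def)
  have A: "(norm (A \<omega>))\<^sup>2 \<le> (real CARD('i))\<^sup>2 * C^4 * t\<^sup>2" if \<omega>: "\<omega> \<in> space P" for \<omega>
  proof -
    have "norm (A \<omega>) \<le> (\<Sum>k<N. (t / real N) * (real CARD('i) * C\<^sup>2))"
      unfolding A_def
    proof (rule sum_norm_le)
      fix k
      have "norm (drift (W (grid t N k) \<omega>)) \<le> real CARD('i) * C\<^sup>2"
        using drift_bound[OF W_M[OF _ \<omega>]] grid_nonneg[of t N k] t by simp
      then show "norm ((t / real N) *\<^sub>R drift (W (grid t N k) \<omega>)) \<le> (t / real N) * (real CARD('i) * C\<^sup>2)"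
        using t by (simp add: divide_right_mono mult_left_mono)
    qed
    also have "\<dots> = t * (real CARD('i) * C\<^sup>2)" using N by simp
    finally have "norm (A \<omega>) \<le> t * (real CARD('i) * C\<^sup>2)" .
    from power_mono[OF this norm_ge_zero, of 2] show ?thesis by (simp add: power_mult_distrib mult_ac)
  qed
  have Am: "A \<in> borel_measurable P" and Dm: "D \<in> borel_measurable P"
    unfolding A_def D_def using grid_nonneg[of t N] t
    by (auto intro!: borel_measurable_sum borel_measurable_scaleR borel_measurable_diff borel_measurable_const ito_step_P cont_P[OF drift_continuous])
  have Y: "Y = (\<lambda>\<omega>. D \<omega> + A \<omega>)" by (simp add: Y_def D_def A_def)
  let ?b = "\<lambda>\<omega>. 2 * (norm (D \<omega>))\<^sup>2 + 2 * ((real CARD('i))\<^sup>2 * C^4 * t\<^sup>2)"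
  have le: "(norm (Y \<omega>))\<^sup>2 \<le> ?b \<omega>" if "\<omega> \<in> space P" for \<omega>
  proof -
    have "(norm (x + y))\<^sup>2 \<le> 2 * (norm x)\<^sup>2 + 2 * (norm y)\<^sup>2" for x y :: 'a
    proof -
      have "(norm (x + y))\<^sup>2 \<le> (norm x + norm y)\<^sup>2" by (intro power_mono norm_triangle_ineq norm_ge_zero)
      also have "\<dots> \<le> 2 * (norm x)\<^sup>2 + 2 * (norm y)\<^sup>2"
        using zero_le_power2[of "norm x - norm y"] by (simp add: power2_eq_square algebra_simps)
      finally show ?thesis .
    qed
    from this[of "D \<omega>" "A \<omega>"] A[OF that] show ?thesis unfolding Y by linarith
  qed
  have i: "integrable P ?b" using D by auto
  show Yi: "integrable P (\<lambda>\<omega>. (norm (Y \<omega>))\<^sup>2)"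
  proof (rule Bochner_Integration.integrable_bound[OF i])
    show "AE \<omega> in P. norm ((norm (Y \<omega>))\<^sup>2) \<le> norm (?b \<omega>)"
    proof (rule AE_I2)
      fix \<omega> assume "\<omega> \<in> space P"
      then have "(norm (Y \<omega>))\<^sup>2 \<le> ?b \<omega>" by (rule le)
      then show "norm ((norm (Y \<omega>))\<^sup>2) \<le> norm (?b \<omega>)" by simp
    qed
  qed (use Am Dm Y in auto)
  have "expectation (\<lambda>\<omega>. (norm (Y \<omega>))\<^sup>2) \<le> expectation ?b"
    by (rule integral_mono[OF Yi i le])
  also have "\<dots> = 2 * expectation (\<lambda>\<omega>. (norm (D \<omega>))\<^sup>2) + 2 * ((real CARD('i))\<^sup>2 * C^4 * t\<^sup>2)"
    using D by (simp add: prob_space)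
  finally show "expectation (\<lambda>\<omega>. (norm (Y \<omega>))\<^sup>2) \<le> 2 * ((real CARD('i))\<^sup>2 * C\<^sup>2 * h * t) + 2 * ((real CARD('i))\<^sup>2 * C^4 * t\<^sup>2)"
    using D(2) by linarith
qed

lemma remainder_sq_integrable:
  assumes t: "0 \<le> t"
  shows "integrable P (\<lambda>\<omega>. (norm (W t \<omega> - w0 - frozen_step t \<omega>))\<^sup>2)"
proof (rule Bochner_Integration.integrable_bound)
  show "integrable P (\<lambda>\<omega>. 2 * (2 * C)\<^sup>2 + 2 * (norm (frozen_step t \<omega>))\<^sup>2)"
    using frozen_step_sq[OF t] by auto
  show "(\<lambda>\<omega>. (norm (W t \<omega> - w0 - frozen_step t \<omega>))\<^sup>2) \<in> borel_measurable P"
    using W_P[OF t] frozen_step_P[OF t] by auto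
  show "AE \<omega> in P. norm ((norm (W t \<omega> - w0 - frozen_step t \<omega>))\<^sup>2) \<le> norm (2 * (2 * C)\<^sup>2 + 2 * (norm (frozen_step t \<omega>))\<^sup>2)"
  proof (rule AE_I2)
    fix \<omega> assume \<omega>: "\<omega> \<in> space P"
    have 1: "norm (W t \<omega> - w0) \<le> 2 * C"
      using norm_triangle_ineq4[of "W t \<omega>" w0] M_bound[OF W_M[OF t \<omega>]] M_bound[OF w0] by linarith
    have 2: "norm (W t \<omega> - w0 - frozen_step t \<omega>) \<le> 2 * C + norm (frozen_step t \<omega>)"
      using norm_triangle_ineq4[of "W t \<omega> - w0" "frozen_step t \<omega>"] 1 by linarith
    have "(norm (W t \<omega> - w0 - frozen_step t \<omega>))\<^sup>2 \<le> (2 * C + norm (frozen_step t \<omega>))\<^sup>2"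
      by (rule power_mono[OF 2 norm_ge_zero])
    also have "\<dots> \<le> 2 * (2 * C)\<^sup>2 + 2 * (norm (frozen_step t \<omega>))\<^sup>2"
      using zero_le_power2[of "2 * C - norm (frozen_step t \<omega>)"] by (simp add: power2_eq_square algebra_simps)
    finally show "norm ((norm (W t \<omega> - w0 - frozen_step t \<omega>))\<^sup>2) \<le> norm (2 * (2 * C)\<^sup>2 + 2 * (norm (frozen_step t \<omega>))\<^sup>2)"
      by simp
  qed
qed

text \<open>The discretization error tends to 0 in probability only, so the second moment is first
  estimated for the norm truncated at \<open>A\<close>. There the error costs a multiple of its
  truncated mean, made smaller than any \<open>e\<close> by taking N large after \<open>A\<close>.
  The resulting bound is free of \<open>A\<close> and N, and \<open>A\<close> tends to infinity by
  dominated convergence. The factor 4 comes from squaring a sum of two terms twice.\<close>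

lemma remainder_sq_bound:
  assumes t: "0 < t"
    and h: "\<And>s. 0 \<le> s \<Longrightarrow> s \<le> t \<Longrightarrow> expectation (\<lambda>\<omega>. (norm (W s \<omega> - W 0 \<omega>))\<^sup>2) \<le> h"
  shows "expectation (\<lambda>\<omega>. (norm (W t \<omega> - w0 - frozen_step t \<omega>))\<^sup>2) \<le> 4 * (real CARD('i))\<^sup>2 * C^4 * (h + t) * t"
proof -
  let ?n = "real CARD('i)"
  define Z where "Z \<omega> = W t \<omega> - W 0 \<omega> - ito_step 0 t \<omega>" for \<omega>
  define K where "K = 4 * ?n\<^sup>2 * C^4 * (h + t) * t"
  have Zm: "Z \<in> borel_measurable P" unfolding Z_def using W_P ito_step_P t by (intro borel_measurable_diff) auto
  have AEZ: "AE \<omega> in P. Z \<omega> = W t \<omega> - w0 - frozen_step t \<omega>"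
    using W_0 frozen_step_ito[of t] by eventually_elim (simp add: Z_def)
  have h0: "0 \<le> h" using h[of 0] t by simp
  have trunc: "expectation (\<lambda>\<omega>. (min A (norm (Z \<omega>)))\<^sup>2) \<le> K" if A: "1 \<le> A" for A
  proof (rule field_le_epsilon)
    fix e :: real assume e: "0 < e"
    have "\<forall>\<^sub>F N in sequentially. epm (discretization_error t N) \<le> e / (2 * A\<^sup>2)"
      by (rule discretization_limit[OF t]) (use e A in simp)
    from eventually_happens'[OF sequentially_bot eventually_conj[OF eventually_gt_at_top[of 0] this]]
    obtain N where N: "0 < N" and eN: "epm (discretization_error t N) \<le> e / (2 * A\<^sup>2)"
      by blast
    define X where "X = discretization_error t N"
    define Y where "Y \<omega> = (\<Sum>k<N. ito_step (grid t N k) (grid t N (Suc k)) \<omega>) - ito_step 0 t \<omega>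
      + (\<Sum>k<N. (t / real N) *\<^sub>R drift (W (grid t N k) \<omega>))" for \<omega>
    have Xm: "X \<in> borel_measurable P" unfolding X_def using t by (intro discretization_error_P) simp
    have ZXY: "Z \<omega> = X \<omega> + Y \<omega>" for \<omega> by (simp add: Z_def X_def Y_def discretization_error_def)
    have Y: "integrable P (\<lambda>\<omega>. (norm (Y \<omega>))\<^sup>2)" "expectation (\<lambda>\<omega>. (norm (Y \<omega>))\<^sup>2) \<le> 2 * (?n\<^sup>2 * C\<^sup>2 * h * t) + 2 * (?n\<^sup>2 * C^4 * t\<^sup>2)"
      unfolding Y_def by (rule discretized_remainder_integrable[OF t N h]; assumption) (rule discretized_remainder_bound[OF t N h]; assumption)
    have pw: "(min A (norm (Z \<omega>)))\<^sup>2 \<le> 2 * A\<^sup>2 * min 1 (norm (X \<omega>)) + 2 * (norm (Y \<omega>))\<^sup>2" for \<omega>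
    proof -
      have "min A (norm (Z \<omega>)) \<le> min A (norm (X \<omega>)) + norm (Y \<omega>)"
        using norm_triangle_ineq[of "X \<omega>" "Y \<omega>"] norm_ge_zero[of "Y \<omega>"] unfolding ZXY by linarith
      then have "(min A (norm (Z \<omega>)))\<^sup>2 \<le> (min A (norm (X \<omega>)) + norm (Y \<omega>))\<^sup>2"
        using A by (intro power_mono) auto
      also have "\<dots> \<le> 2 * (min A (norm (X \<omega>)))\<^sup>2 + 2 * (norm (Y \<omega>))\<^sup>2"
        using zero_le_power2[of "min A (norm (X \<omega>)) - norm (Y \<omega>)"] by (simp add: power2_eq_square algebra_simps)
      \<comment> \<open>For norms up to 1 the square is at most the norm itself; above 1 the
        truncated square is at most \<open>A\<^sup>2\<close>. So it is bounded by a multiple of the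
        truncated norm.\<close>
      also have "(min A (norm (X \<omega>)))\<^sup>2 \<le> A\<^sup>2 * min 1 (norm (X \<omega>))"
      proof (cases "norm (X \<omega>) \<le> 1")
        case True
        then have "min A (norm (X \<omega>)) = norm (X \<omega>)" using A by simp
        then have "(min A (norm (X \<omega>)))\<^sup>2 = norm (X \<omega>) * norm (X \<omega>)" by (simp only: power2_eq_square)
        also have "\<dots> \<le> 1 * norm (X \<omega>)" using True by (intro mult_right_mono) auto
        also have "\<dots> \<le> A\<^sup>2 * norm (X \<omega>)" using A by (intro mult_right_mono) auto
        finally show ?thesis using True by (simp add: min_def)
      next
        case False
        then show ?thesis using A by (simp add: min_def power_mono)
      qed
      finally show ?thesis by simp
    qed
    have i: "integrable P (\<lambda>\<omega>. 2 * A\<^sup>2 * min 1 (norm (X \<omega>)) + 2 * (norm (Y \<omega>))\<^sup>2)"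
      using Y(1) epm_integrable[OF Xm] by auto
    have iA: "integrable P (\<lambda>\<omega>. (min A (norm (Z \<omega>)))\<^sup>2)"
      by (rule integrable_const_bound[where B="A\<^sup>2"]) (use A Zm in \<open>auto intro!: AE_I2 power_mono\<close>)
    have "expectation (\<lambda>\<omega>. (min A (norm (Z \<omega>)))\<^sup>2) \<le> expectation (\<lambda>\<omega>. 2 * A\<^sup>2 * min 1 (norm (X \<omega>)) + 2 * (norm (Y \<omega>))\<^sup>2)"
      by (rule integral_mono[OF iA i pw])
    also have "\<dots> = 2 * A\<^sup>2 * epm X + 2 * expectation (\<lambda>\<omega>. (norm (Y \<omega>))\<^sup>2)"
      using Y(1) epm_integrable[OF Xm] by (simp add: epm_def)
    also have "2 * A\<^sup>2 * epm X \<le> 2 * A\<^sup>2 * (e / (2 * A\<^sup>2))" unfolding X_def by (intro mult_left_mono eN) simp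
    also have "2 * A\<^sup>2 * (e / (2 * A\<^sup>2)) = e" using A by simp
    also have "e + 2 * expectation (\<lambda>\<omega>. (norm (Y \<omega>))\<^sup>2) \<le> K + e"
    proof -
      have "?n\<^sup>2 * C\<^sup>2 * h * t \<le> ?n\<^sup>2 * C^4 * h * t"
        using C h0 t power_increasing[of 2 4 C] by (intro mult_right_mono mult_left_mono) auto
      moreover have "K = 4 * (?n\<^sup>2 * C^4 * h * t) + 4 * (?n\<^sup>2 * C^4 * t\<^sup>2)"
        by (simp add: K_def algebra_simps power2_eq_square)
      ultimately show ?thesis using Y(2) by linarith
    qed
    finally show "expectation (\<lambda>\<omega>. (min A (norm (Z \<omega>)))\<^sup>2) \<le> K + e" by simp
  qed
  have Z2: "integrable P (\<lambda>\<omega>. (norm (Z \<omega>))\<^sup>2)"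
    using remainder_sq_integrable[of t] t Zm
    by (subst integrable_cong_AE[where g="\<lambda>\<omega>. (norm (W t \<omega> - w0 - frozen_step t \<omega>))\<^sup>2"]) 
       (use AEZ in \<open>auto elim!: eventually_mono dest: borel_measurable_integrable\<close>)
  have "(\<lambda>m. expectation (\<lambda>\<omega>. (min (real (Suc m)) (norm (Z \<omega>)))\<^sup>2)) \<longlonglongrightarrow> expectation (\<lambda>\<omega>. (norm (Z \<omega>))\<^sup>2)"
  proof (rule integral_dominated_convergence[OF _ _ Z2])
    show "AE \<omega> in P. (\<lambda>m. (min (real (Suc m)) (norm (Z \<omega>)))\<^sup>2) \<longlonglongrightarrow> (norm (Z \<omega>))\<^sup>2"
    proof (rule AE_I2, rule tendsto_eventually)
      fix \<omega>
      have "\<forall>\<^sub>F m in sequentially. norm (Z \<omega>) \<le> real m"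
        using eventually_ge_at_top[of "nat \<lceil>norm (Z \<omega>)\<rceil>"] by (rule eventually_mono) linarith
      then show "\<forall>\<^sub>F m in sequentially. (min (real (Suc m)) (norm (Z \<omega>)))\<^sup>2 = (norm (Z \<omega>))\<^sup>2"
        by (rule eventually_mono) (simp add: min_def)
    qed
    show "AE \<omega> in P. norm ((min (real (Suc m)) (norm (Z \<omega>)))\<^sup>2) \<le> (norm (Z \<omega>))\<^sup>2" for m
      by (rule AE_I2) (auto intro!: power_mono)
  qed (use Zm in auto)
  then have "expectation (\<lambda>\<omega>. (norm (Z \<omega>))\<^sup>2) \<le> K"
    by (rule LIMSEQ_le_const2) (use trunc in auto)
  moreover have "expectation (\<lambda>\<omega>. (norm (Z \<omega>))\<^sup>2) = expectation (\<lambda>\<omega>. (norm (W t \<omega> - w0 - frozen_step t \<omega>))\<^sup>2)"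
    using Zm remainder_sq_integrable[of t] t
    by (intro integral_cong_AE) (use AEZ in \<open>auto elim!: eventually_mono dest: borel_measurable_integrable\<close>)
  ultimately show ?thesis by (simp add: K_def)
qed

end

lemma norm_add_power2_le: "(norm (x + y))\<^sup>2 \<le> 2 * (norm x)\<^sup>2 + 2 * (norm y)\<^sup>2"
  for x y :: "'b::real_normed_vector"
proof -
  have "(norm (x + y))\<^sup>2 \<le> (norm x + norm y)\<^sup>2" by (intro power_mono norm_triangle_ineq norm_ge_zero)
  also have "\<dots> \<le> 2 * (norm x)\<^sup>2 + 2 * (norm y)\<^sup>2"
    using zero_le_power2[of "norm x - norm y"] by (simp add: power2_eq_square algebra_simps)
  finally show ?thesis .
qed

context prob_space
begin

text \<open>Convergence in probability with bounded second moments gives convergence in mean. In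
  quantitative form: \<open>A\<close> times the truncated norm covers values up to \<open>A\<close>,
  and beyond \<open>A\<close> the norm is at most its square divided by \<open>A\<close>.\<close>

lemma expectation_norm_le_epm:
  fixes X :: "'a \<Rightarrow> 'b::euclidean_space"
  assumes X: "X \<in> borel_measurable M" "integrable M (\<lambda>\<omega>. (norm (X \<omega>))\<^sup>2)" and A: "1 \<le> A"
  shows "integrable M X" and "expectation (\<lambda>\<omega>. norm (X \<omega>)) \<le> A * epm X + expectation (\<lambda>\<omega>. (norm (X \<omega>))\<^sup>2) / A"
proof -
  have pw: "norm (X \<omega>) \<le> A * min 1 (norm (X \<omega>)) + (norm (X \<omega>))\<^sup>2 / A" for \<omega>
  proof -
    have q: "0 \<le> (norm (X \<omega>))\<^sup>2 / A" using A by simp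
    consider "norm (X \<omega>) \<le> 1" | "1 < norm (X \<omega>)" "norm (X \<omega>) \<le> A" | "A < norm (X \<omega>)" by linarith
    then show ?thesis
    proof cases
      case 1
      then have "norm (X \<omega>) \<le> A * min 1 (norm (X \<omega>))" using A mult_right_mono[of 1 A "norm (X \<omega>)"] by simp
      then show ?thesis using q by linarith
    next
      case 2
      then have "norm (X \<omega>) \<le> A * min 1 (norm (X \<omega>))" by (simp add: min_def)
      then show ?thesis using q by linarith
    next
      case 3
      have "norm (X \<omega>) * A \<le> norm (X \<omega>) * norm (X \<omega>)" using 3 by (intro mult_left_mono) auto
      then have "norm (X \<omega>) \<le> (norm (X \<omega>))\<^sup>2 / A" using A by (simp add: field_simps power2_eq_square)
      moreover have "0 \<le> A * min 1 (norm (X \<omega>))" using A by simp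
      ultimately show ?thesis by linarith
    qed
  qed
  have i: "integrable M (\<lambda>\<omega>. A * min 1 (norm (X \<omega>)) + (norm (X \<omega>))\<^sup>2 / A)"
    using epm_integrable[OF X(1)] X(2) by auto
  show Xi: "integrable M X"
  proof (rule Bochner_Integration.integrable_bound[OF i X(1)], rule AE_I2)
    fix \<omega> show "norm (X \<omega>) \<le> norm (A * min 1 (norm (X \<omega>)) + (norm (X \<omega>))\<^sup>2 / A)"
      using pw[of \<omega>] by simp
  qed
  have "expectation (\<lambda>\<omega>. norm (X \<omega>)) \<le> expectation (\<lambda>\<omega>. A * min 1 (norm (X \<omega>)) + (norm (X \<omega>))\<^sup>2 / A)"
    by (rule integral_mono[OF integrable_norm[OF Xi] i pw])
  also have "\<dots> = A * epm X + expectation (\<lambda>\<omega>. (norm (X \<omega>))\<^sup>2) / A"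
    using epm_integrable[OF X(1)] X(2) by (simp add: epm_def)
  finally show "expectation (\<lambda>\<omega>. norm (X \<omega>)) \<le> A * epm X + expectation (\<lambda>\<omega>. (norm (X \<omega>))\<^sup>2) / A" .
qed

text \<open>Jensen's inequality, obtained pointwise from Young's inequality with weight
  \<open>e\<close>.\<close>

lemma expectation_norm_le_L2:
  fixes X :: "'a \<Rightarrow> 'b::euclidean_space"
  assumes X: "X \<in> borel_measurable M" "integrable M (\<lambda>\<omega>. (norm (X \<omega>))\<^sup>2)" 
    and e: "0 < e" "expectation (\<lambda>\<omega>. (norm (X \<omega>))\<^sup>2) \<le> e\<^sup>2"
  shows "expectation (\<lambda>\<omega>. norm (X \<omega>)) \<le> e"
proof -
  have Xi: "integrable M X" by (rule expectation_norm_le_epm(1)[OF X order_refl])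
  have pw: "norm (X \<omega>) \<le> ((norm (X \<omega>))\<^sup>2 / e + e) / 2" for \<omega>
    using mult_le_weighted_squares[OF e(1), of "norm (X \<omega>)" 1] by simp
  have "expectation (\<lambda>\<omega>. norm (X \<omega>)) \<le> expectation (\<lambda>\<omega>. ((norm (X \<omega>))\<^sup>2 / e + e) / 2)"
    by (rule integral_mono[OF integrable_norm[OF Xi] _ pw]) (use X in auto)
  also have "\<dots> = (expectation (\<lambda>\<omega>. (norm (X \<omega>))\<^sup>2) / e + e) / 2"
    using X by (simp add: prob_space)
  also have "\<dots> \<le> (e\<^sup>2 / e + e) / 2" using e by (intro divide_right_mono add_right_mono) auto
  also have "\<dots> = e" using e by (simp add: power2_eq_square)
  finally show ?thesis .
qed

end

context stratonovich_flow
begin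

text \<open>In the decomposition of \<open>W t - W 0\<close> the left-point sum has mean 0, the
  discretization error has arbitrarily small mean, and each value of the drift on the grid has mean
  within \<beta> of \<open>drift w0\<close>.\<close>

lemma mean_bound:
  assumes t: "0 < t" and \<beta>: "0 < \<beta>"
    and h: "\<And>s. 0 \<le> s \<Longrightarrow> s \<le> t \<Longrightarrow> expectation (\<lambda>\<omega>. (norm (drift (W s \<omega>) - drift (W 0 \<omega>)))\<^sup>2) \<le> \<beta>\<^sup>2"
  shows "norm (expectation (\<lambda>\<omega>. W t \<omega> - w0) - t *\<^sub>R drift w0) \<le> t * \<beta>"
proof (rule field_le_epsilon)
  fix e :: real assume e: "0 < e"
  let ?n = "real CARD('i)"
  define Z where "Z \<omega> = W t \<omega> - W 0 \<omega> - ito_step 0 t \<omega>" for \<omega>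
  have Zm: "Z \<in> borel_measurable P" unfolding Z_def using W_P ito_step_P t by (intro borel_measurable_diff) auto
  have AEZ: "AE \<omega> in P. (norm (Z \<omega>))\<^sup>2 = (norm (W t \<omega> - w0 - frozen_step t \<omega>))\<^sup>2"
    using W_0 frozen_step_ito[of t] by eventually_elim (simp add: Z_def)
  have Z2: "integrable P (\<lambda>\<omega>. (norm (Z \<omega>))\<^sup>2)"
    by (rule integrable_cong_AE_imp[OF remainder_sq_integrable[of t]]) (use t Zm AEZ in \<open>auto elim!: eventually_mono\<close>)
  have h2: "expectation (\<lambda>\<omega>. (norm (W s \<omega> - W 0 \<omega>))\<^sup>2) \<le> (2 * C)\<^sup>2" if s: "0 \<le> s" "s \<le> t" for s
  proof -
    have "expectation (\<lambda>\<omega>. (norm (W s \<omega> - W 0 \<omega>))\<^sup>2) \<le> expectation (\<lambda>_. (2 * C)\<^sup>2)"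
    proof (rule integral_mono[OF W_diff_sq_integrable])
      fix \<omega> assume \<omega>: "\<omega> \<in> space P"
      have "norm (W s \<omega> - W 0 \<omega>) \<le> 2 * C"
        using norm_triangle_ineq4[of "W s \<omega>" "W 0 \<omega>"] M_bound[OF W_M[OF s(1) \<omega>]] M_bound[OF W_M[OF order_refl \<omega>]] by linarith
      then show "(norm (W s \<omega> - W 0 \<omega>))\<^sup>2 \<le> (2 * C)\<^sup>2" by (intro power_mono) auto
    qed (use s in auto)
    then show ?thesis by (simp add: prob_space)
  qed
  \<comment> \<open>A bound for the second moment of the discretization error that holds for every
    N, from the crude bound 2 C for displacements. Hence \<open>A\<close> can be fixed first and N
    chosen afterwards.\<close>
  define K where "K = 2 * expectation (\<lambda>\<omega>. (norm (Z \<omega>))\<^sup>2) + 2 * (2 * (?n\<^sup>2 * C\<^sup>2 * (2 * C)\<^sup>2 * t) + 2 * (?n\<^sup>2 * C^4 * t\<^sup>2))"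
  have K0: "0 \<le> K" unfolding K_def using t by (intro add_nonneg_nonneg mult_nonneg_nonneg integral_nonneg_AE) auto
  define A where "A = max 1 (2 * K / e)"
  have A: "1 \<le> A" "K / A \<le> e / 2"
  proof -
    show "1 \<le> A" by (simp add: A_def)
    then have "2 * K / e \<le> A" "0 < A" by (auto simp: A_def)
    then show "K / A \<le> e / 2" using e by (simp add: field_simps)
  qed
  have "\<forall>\<^sub>F N in sequentially. epm (discretization_error t N) \<le> e / (2 * A)"
    by (rule discretization_limit[OF t]) (use e A in simp)
  from eventually_happens'[OF sequentially_bot eventually_conj[OF eventually_gt_at_top[of 0] this]]
  obtain N where N: "0 < N" and eN: "epm (discretization_error t N) \<le> e / (2 * A)"
    by blast
  define X where "X = discretization_error t N"
  define J where "J \<omega> = (\<Sum>k<N. ito_step (grid t N k) (grid t N (Suc k)) \<omega>)" for \<omega>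
  define d where "d k \<omega> = drift (W (grid t N k) \<omega>)" for k \<omega>
  define Y where "Y \<omega> = J \<omega> - ito_step 0 t \<omega> + (\<Sum>k<N. (t / real N) *\<^sub>R d k \<omega>)" for \<omega>
  have Xm: "X \<in> borel_measurable P" unfolding X_def using t by (intro discretization_error_P) simp
  have XZY: "X \<omega> = Z \<omega> + - Y \<omega>" for \<omega> by (simp add: Z_def X_def Y_def J_def d_def discretization_error_def)
  have Y2: "integrable P (\<lambda>\<omega>. (norm (Y \<omega>))\<^sup>2)"
    unfolding Y_def J_def d_def by (rule discretized_remainder_integrable[OF t N h2]; assumption)
  have Y2E: "expectation (\<lambda>\<omega>. (norm (Y \<omega>))\<^sup>2) \<le> 2 * (?n\<^sup>2 * C\<^sup>2 * (2 * C)\<^sup>2 * t) + 2 * (?n\<^sup>2 * C^4 * t\<^sup>2)"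
    unfolding Y_def J_def d_def by (rule discretized_remainder_bound[OF t N h2]; assumption)
  have Xpw: "(norm (X \<omega>))\<^sup>2 \<le> 2 * (norm (Z \<omega>))\<^sup>2 + 2 * (norm (Y \<omega>))\<^sup>2" for \<omega>
    using norm_add_power2_le[of "Z \<omega>" "- Y \<omega>"] unfolding XZY by simp
  have bi: "integrable P (\<lambda>\<omega>. 2 * (norm (Z \<omega>))\<^sup>2 + 2 * (norm (Y \<omega>))\<^sup>2)" using Z2 Y2 by auto
  have X2: "integrable P (\<lambda>\<omega>. (norm (X \<omega>))\<^sup>2)"
    by (rule Bochner_Integration.integrable_bound[OF bi]) (use Xm Xpw in \<open>auto intro!: AE_I2\<close>)
  have "expectation (\<lambda>\<omega>. (norm (X \<omega>))\<^sup>2) \<le> expectation (\<lambda>\<omega>. 2 * (norm (Z \<omega>))\<^sup>2 + 2 * (norm (Y \<omega>))\<^sup>2)"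
    by (rule integral_mono[OF X2 bi Xpw])
  also have "\<dots> \<le> K" using Z2 Y2 Y2E by (simp add: K_def)
  finally have XK: "expectation (\<lambda>\<omega>. (norm (X \<omega>))\<^sup>2) \<le> K" .
  have Xi: "integrable P X" by (rule expectation_norm_le_epm(1)[OF Xm X2 A(1)])
  have "expectation (\<lambda>\<omega>. norm (X \<omega>)) \<le> A * epm X + expectation (\<lambda>\<omega>. (norm (X \<omega>))\<^sup>2) / A"
    by (rule expectation_norm_le_epm(2)[OF Xm X2 A(1)])
  also have "\<dots> \<le> A * (e / (2 * A)) + K / A"
    using A eN XK unfolding X_def by (intro add_mono mult_left_mono divide_right_mono) auto
  also have "\<dots> \<le> e / 2 + e / 2" using A by (intro add_mono) auto
  finally have "expectation (\<lambda>\<omega>. norm (X \<omega>)) \<le> e" by simp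
  then have EX: "norm (expectation X) \<le> e" by (rule order_trans[OF integral_norm_bound])
  have g0: "0 \<le> grid t N k" "k < N \<Longrightarrow> grid t N k \<le> t" for k 
    using grid_nonneg[of t N k] grid_le[of t N k] t N by auto
  have di: "integrable P (d k)" for k unfolding d_def by (rule bounded_image_sq_integrable[OF drift_continuous g0(1)])
  have d0i: "integrable P (\<lambda>\<omega>. drift (W 0 \<omega>))" by (rule bounded_image_sq_integrable[OF drift_continuous order_refl])
  have Ji: "integrable P J" "expectation J = 0"
    using sum_grid_ito_mean[OF t N] unfolding J_def[abs_def] by auto
  have Wi: "integrable P (\<lambda>\<omega>. W t \<omega> - W 0 \<omega>)"
    using bounded_image_sq_integrable[OF continuous_on_id, of t] bounded_image_sq_integrable[OF continuous_on_id, of 0] t by auto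
  have dd: "norm (expectation (d k) - drift w0) \<le> \<beta>" if k: "k < N" for k
  proof -
    have "expectation (\<lambda>\<omega>. drift (W 0 \<omega>)) = expectation (\<lambda>\<omega>. drift w0)"
      by (intro integral_cong_AE) (use W_0 d0i in \<open>auto elim!: eventually_mono\<close>)
    then have "expectation (d k) - drift w0 = expectation (\<lambda>\<omega>. d k \<omega> - drift (W 0 \<omega>))"
      using di d0i by (simp add: prob_space)
    then have "norm (expectation (d k) - drift w0) \<le> expectation (\<lambda>\<omega>. norm (d k \<omega> - drift (W 0 \<omega>)))"
      using integral_norm_bound[of P "\<lambda>\<omega>. d k \<omega> - drift (W 0 \<omega>)"] by simp
    also have "\<dots> \<le> \<beta>"
    proof (rule expectation_norm_le_L2[OF _ _ \<beta>])
      show "(\<lambda>\<omega>. d k \<omega> - drift (W 0 \<omega>)) \<in> borel_measurable P" using di d0i by auto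
      show "expectation (\<lambda>\<omega>. (norm (d k \<omega> - drift (W 0 \<omega>)))\<^sup>2) \<le> \<beta>\<^sup>2"
        unfolding d_def by (rule h) (use g0 k in auto)
      show "integrable P (\<lambda>\<omega>. (norm (d k \<omega> - drift (W 0 \<omega>)))\<^sup>2)"
      proof (rule integrable_const_bound[where B="(2 * (?n * C\<^sup>2))\<^sup>2"])
        show "AE \<omega> in P. norm ((norm (d k \<omega> - drift (W 0 \<omega>)))\<^sup>2) \<le> (2 * (?n * C\<^sup>2))\<^sup>2"
        proof (rule AE_I2)
          fix \<omega> assume \<omega>: "\<omega> \<in> space P"
          have "norm (d k \<omega> - drift (W 0 \<omega>)) \<le> 2 * (?n * C\<^sup>2)"
            using norm_triangle_ineq4[of "d k \<omega>" "drift (W 0 \<omega>)"] drift_bound[OF W_M[OF g0(1) \<omega>, of k]] drift_bound[OF W_M[OF order_refl \<omega>]]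
            unfolding d_def by linarith
          from power_mono[OF this norm_ge_zero, of 2] show "norm ((norm (d k \<omega> - drift (W 0 \<omega>)))\<^sup>2) \<le> (2 * (?n * C\<^sup>2))\<^sup>2"
            by (simp only: real_norm_def abs_power2)
        qed
      qed (use di[of k] d0i in auto)
    qed
    finally show ?thesis .
  qed
  have "expectation (\<lambda>\<omega>. W t \<omega> - w0) = expectation (\<lambda>\<omega>. W t \<omega> - W 0 \<omega>)"
    by (intro integral_cong_AE) (use W_0 W_P[of t] W_P[of 0] t in \<open>auto elim!: eventually_mono\<close>)
  also have "(\<lambda>\<omega>. W t \<omega> - W 0 \<omega>) = (\<lambda>\<omega>. X \<omega> + J \<omega> + (\<Sum>k<N. (t / real N) *\<^sub>R d k \<omega>))"
    by (simp add: X_def J_def d_def discretization_error_def)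
  also have "expectation \<dots> = expectation X + (\<Sum>k<N. (t / real N) *\<^sub>R expectation (d k))"
    using Xi Ji di by simp
  finally have "expectation (\<lambda>\<omega>. W t \<omega> - w0) - t *\<^sub>R drift w0 = expectation X + (\<Sum>k<N. (t / real N) *\<^sub>R (expectation (d k) - drift w0))"
  proof -
    have "(\<Sum>k<N. (t / real N) *\<^sub>R drift w0) = t *\<^sub>R drift w0" using N by (simp add: sum_constant_scaleR)
    then show "expectation (\<lambda>\<omega>. W t \<omega> - w0) = expectation X + (\<Sum>k<N. (t / real N) *\<^sub>R expectation (d k)) \<Longrightarrow> ?thesis"
      by (simp add: scaleR_diff_right sum_subtractf)
  qed
  then have "norm (expectation (\<lambda>\<omega>. W t \<omega> - w0) - t *\<^sub>R drift w0) \<le> norm (expectation X) + norm (\<Sum>k<N. (t / real N) *\<^sub>R (expectation (d k) - drift w0))"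
    by (simp only: norm_triangle_ineq)
  also have "norm (\<Sum>k<N. (t / real N) *\<^sub>R (expectation (d k) - drift w0)) \<le> (\<Sum>k<N. (t / real N) * \<beta>)"
  proof (rule sum_norm_le)
    fix k assume "k \<in> {..<N}"
    then have "norm (expectation (d k) - drift w0) \<le> \<beta>" by (intro dd) simp
    then have "(t / real N) * norm (expectation (d k) - drift w0) \<le> (t / real N) * \<beta>" using t by (intro mult_left_mono) auto
    then show "norm ((t / real N) *\<^sub>R (expectation (d k) - drift w0)) \<le> (t / real N) * \<beta>" using t by simp
  qed
  also have "(\<Sum>k<N. (t / real N) * \<beta>) = t * \<beta>" using N by simp
  finally show "norm (expectation (\<lambda>\<omega>. W t \<omega> - w0) - t *\<^sub>R drift w0) \<le> t * \<beta> + e" using EX by linarith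
qed

lemma mean_limit: "((\<lambda>t. (1 / t) *\<^sub>R expectation (\<lambda>\<omega>. W t \<omega> - w0)) \<longlongrightarrow> drift w0) (at_right 0)"
proof (rule tendstoI)
  fix e :: real assume e: "0 < e"
  then have e2: "0 < (e / 2)\<^sup>2" by simp
  from mean_square_continuity[OF drift_continuous zero_le_one e2]
  obtain \<delta> where \<delta>: "0 < \<delta>" "\<And>a b. 0 \<le> a \<Longrightarrow> a \<le> 1 \<Longrightarrow> 0 \<le> b \<Longrightarrow> b \<le> 1 \<Longrightarrow> \<bar>b - a\<bar> < \<delta> \<Longrightarrow> 
      expectation (\<lambda>\<omega>. (norm (drift (W b \<omega>) - drift (W a \<omega>)))\<^sup>2) < (e / 2)\<^sup>2"
    by blast
  show "\<forall>\<^sub>F t in at_right 0. dist ((1 / t) *\<^sub>R expectation (\<lambda>\<omega>. W t \<omega> - w0)) (drift w0) < e"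
    unfolding eventually_at_right_field
  proof (intro exI[of _ "min 1 \<delta>"] conjI allI impI)
    show "0 < min 1 \<delta>" using \<delta> by simp
    fix t :: real assume t: "0 < t" "t < min 1 \<delta>"
    have "norm (expectation (\<lambda>\<omega>. W t \<omega> - w0) - t *\<^sub>R drift w0) \<le> t * (e / 2)"
    proof (rule mean_bound[OF t(1)])
      fix s assume s: "0 \<le> s" "s \<le> t"
      show "expectation (\<lambda>\<omega>. (norm (drift (W s \<omega>) - drift (W 0 \<omega>)))\<^sup>2) \<le> (e / 2)\<^sup>2"
        by (rule less_imp_le, rule \<delta>(2)) (use s t in auto)
    qed (use e in simp)
    moreover have "(1 / t) *\<^sub>R expectation (\<lambda>\<omega>. W t \<omega> - w0) - drift w0 = (1 / t) *\<^sub>R (expectation (\<lambda>\<omega>. W t \<omega> - w0) - t *\<^sub>R drift w0)"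
      using t by (simp add: scaleR_diff_right)
    ultimately have "dist ((1 / t) *\<^sub>R expectation (\<lambda>\<omega>. W t \<omega> - w0)) (drift w0) \<le> e / 2"
      using t by (simp add: dist_norm divide_le_eq mult.commute)
    then show "dist ((1 / t) *\<^sub>R expectation (\<lambda>\<omega>. W t \<omega> - w0)) (drift w0) < e" using e by linarith
  qed
qed

lemma remainder_sq_limit:
  "((\<lambda>t. expectation (\<lambda>\<omega>. (norm (W t \<omega> - w0 - frozen_step t \<omega>))\<^sup>2) / t) \<longlongrightarrow> 0) (at_right 0)"
proof (rule tendstoI)
  fix e :: real assume e: "0 < e"
  define K where "K = 4 * (real CARD('i))\<^sup>2 * C^4"
  have K: "0 < K" using C by (simp add: K_def)
  \<comment> \<open>For \<open>t < h\<close> the bound K (h + t) is at most 2 K h, which is e /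
    2.\<close>
  define h where "h = e / (4 * K)"
  have h: "0 < h" using e K by (simp add: h_def)
  from mean_square_continuity[OF continuous_on_id zero_le_one h]
  obtain \<delta> where \<delta>: "0 < \<delta>" "\<And>a b. 0 \<le> a \<Longrightarrow> a \<le> 1 \<Longrightarrow> 0 \<le> b \<Longrightarrow> b \<le> 1 \<Longrightarrow> \<bar>b - a\<bar> < \<delta> \<Longrightarrow> 
      expectation (\<lambda>\<omega>. (norm (W b \<omega> - W a \<omega>))\<^sup>2) < h"
    by blast
  show "\<forall>\<^sub>F t in at_right 0. dist (expectation (\<lambda>\<omega>. (norm (W t \<omega> - w0 - frozen_step t \<omega>))\<^sup>2) / t) 0 < e"
    unfolding eventually_at_right_field
  proof (intro exI[of _ "min 1 (min \<delta> h)"] conjI allI impI)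
    show "0 < min 1 (min \<delta> h)" using \<delta> h by simp
    fix t :: real assume t: "0 < t" "t < min 1 (min \<delta> h)"
    have "expectation (\<lambda>\<omega>. (norm (W t \<omega> - w0 - frozen_step t \<omega>))\<^sup>2) \<le> K * (h + t) * t"
      unfolding K_def
    proof (rule remainder_sq_bound[OF t(1)])
      fix s assume s: "0 \<le> s" "s \<le> t"
      show "expectation (\<lambda>\<omega>. (norm (W s \<omega> - W 0 \<omega>))\<^sup>2) \<le> h"
        by (rule less_imp_le, rule \<delta>(2)) (use s t in auto)
    qed
    then have "expectation (\<lambda>\<omega>. (norm (W t \<omega> - w0 - frozen_step t \<omega>))\<^sup>2) / t \<le> K * (h + t)"
      using t by (simp add: divide_le_eq)
    also have "\<dots> \<le> K * (h + h)" using t K by (intro mult_left_mono) auto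
    also have "\<dots> < e" using K e by (simp add: h_def)
    finally show "dist (expectation (\<lambda>\<omega>. (norm (W t \<omega> - w0 - frozen_step t \<omega>))\<^sup>2) / t) 0 < e"
      using t by (simp add: integral_nonneg_AE)
  qed
qed

end

section \<open>Second-order expansion of the generator\<close>

context stratonovich_flow
begin

lemma quadratic_limit:
  assumes H: "bounded_bilinear (H :: 'a \<Rightarrow> 'a \<Rightarrow> real)"
  shows "((\<lambda>t. expectation (\<lambda>\<omega>. H (W t \<omega> - w0) (W t \<omega> - w0)) / t) \<longlongrightarrow> (\<Sum>i\<in>UNIV. H (\<sigma> i w0) (\<sigma> i w0))) (at_right 0)"
proof (rule tendstoI)
  fix e :: real assume e: "0 < e"
  interpret H: bounded_bilinear H by (rule H)
  obtain K where K: "0 \<le> K" "\<And>x y. \<bar>H x y\<bar> \<le> norm x * norm y * K"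
    using H.nonneg_bounded by auto
  define c where "c = (real CARD('i))\<^sup>2 * C\<^sup>2"
  have c: "0 \<le> c" by (simp add: c_def)
  \<comment> \<open>The summand 1 keeps the denominator of \<kappa> positive when K c is 0.\<close>
  define q where "q = K * c + 1"
  define \<kappa> where "\<kappa> = e / (2 * q)"
  have Kc: "0 < q" using K c by (simp add: q_def add_nonneg_pos)
  have \<kappa>: "0 < \<kappa>" "K * \<kappa> * c < e / 2"
  proof -
    show "0 < \<kappa>" using Kc e by (simp add: \<kappa>_def)
    have "\<kappa> * (K * c) < \<kappa> * q" using \<open>0 < \<kappa>\<close> by (simp add: q_def)
    also have "\<dots> = e / 2" using Kc by (simp add: \<kappa>_def)
    finally show "K * \<kappa> * c < e / 2" by (simp add: mult_ac)
  qed
  define L where "L = K * (1 / \<kappa> + 1)"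
  have L: "0 \<le> L" using K \<kappa> by (simp add: L_def)
  define z where "z t = expectation (\<lambda>\<omega>. (norm (W t \<omega> - w0 - frozen_step t \<omega>))\<^sup>2) / t" for t
  have "((\<lambda>t. L * z t) \<longlongrightarrow> L * 0) (at_right 0)"
    unfolding z_def by (intro tendsto_mult_left remainder_sq_limit)
  then have "\<forall>\<^sub>F t in at_right 0. L * z t < e / 2"
    using e by (intro order_tendstoD(2)) auto
  moreover have "\<forall>\<^sub>F t in at_right (0::real). 0 < t" by (simp add: eventually_at_right_less)
  ultimately show "\<forall>\<^sub>F t in at_right 0. dist (expectation (\<lambda>\<omega>. H (W t \<omega> - w0) (W t \<omega> - w0)) / t) (\<Sum>i\<in>UNIV. H (\<sigma> i w0) (\<sigma> i w0)) < e"
  proof eventually_elim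
    case (elim t)
    note t = elim(2)
    then have t0: "0 \<le> t" by simp
    define G where "G = frozen_step t"
    define Z where "Z \<omega> = W t \<omega> - w0 - G \<omega>" for \<omega>
    have [measurable]: "G \<in> borel_measurable P" "W t \<in> borel_measurable P"
      unfolding G_def using frozen_step_P W_P t0 by auto
    have Zm[measurable]: "Z \<in> borel_measurable P" unfolding Z_def by measurable
    have GZ: "W t \<omega> - w0 = G \<omega> + Z \<omega>" for \<omega> by (simp add: Z_def)
    have G2: "integrable P (\<lambda>\<omega>. (norm (G \<omega>))\<^sup>2)" "expectation (\<lambda>\<omega>. (norm (G \<omega>))\<^sup>2) \<le> c * t"
      using frozen_step_sq[OF t0] by (auto simp: G_def c_def)
    have Z2: "integrable P (\<lambda>\<omega>. (norm (Z \<omega>))\<^sup>2)" "expectation (\<lambda>\<omega>. (norm (Z \<omega>))\<^sup>2) = z t * t"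
      using remainder_sq_integrable[OF t0] t by (auto simp: G_def Z_def z_def)
    have HGG: "H (G \<omega>) (G \<omega>) = (\<Sum>i\<in>UNIV. \<Sum>j\<in>UNIV. ((B i t \<omega> - B i 0 \<omega>) * (B j t \<omega> - B j 0 \<omega>)) * H (\<sigma> i w0) (\<sigma> j w0))" for \<omega>
      unfolding G_def frozen_step_def H.sum_left H.scaleR_left unfolding H.sum_right H.scaleR_right
      by (simp add: sum_distrib_left mult_ac)
    have HGi: "integrable P (\<lambda>\<omega>. H (G \<omega>) (G \<omega>))"
      unfolding HGG using incr_cross_integrable[OF order_refl t0] by auto
    have "expectation (\<lambda>\<omega>. H (G \<omega>) (G \<omega>)) = (\<Sum>i\<in>UNIV. \<Sum>j\<in>UNIV. (if i = j then t else 0) * H (\<sigma> i w0) (\<sigma> j w0))"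
      unfolding HGG using incr_cross_integrable[OF order_refl t0] incr_cross_expectation[OF order_refl t0] by (simp cong: if_cong)
    also have "\<dots> = t * (\<Sum>i\<in>UNIV. H (\<sigma> i w0) (\<sigma> i w0))"
    proof -
      have "(\<Sum>j\<in>UNIV. (if i = j then t else 0) * H (\<sigma> i w0) (\<sigma> j w0)) = t * H (\<sigma> i w0) (\<sigma> i w0)" for i
      proof -
        have "(\<Sum>j\<in>UNIV. (if i = j then t else 0) * H (\<sigma> i w0) (\<sigma> j w0)) = (\<Sum>j\<in>UNIV. if i = j then t * H (\<sigma> i w0) (\<sigma> j w0) else 0)"
          by (intro sum.cong) auto
        then show ?thesis by simp
      qed
      then show ?thesis by (simp add: sum_distrib_left)
    qed
    finally have HGE: "expectation (\<lambda>\<omega>. H (G \<omega>) (G \<omega>)) = t * (\<Sum>i\<in>UNIV. H (\<sigma> i w0) (\<sigma> i w0))" .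
    define R where "R \<omega> = H (W t \<omega> - w0) (W t \<omega> - w0) - H (G \<omega>) (G \<omega>)" for \<omega>
    have Hc: "continuous_on UNIV (\<lambda>x. H x x)" by (intro H.continuous_on continuous_on_id)
    have Hdi: "integrable P (\<lambda>\<omega>. H (W t \<omega> - w0) (W t \<omega> - w0))"
      using bounded_image_sq_integrable[OF continuous_on_compose2[OF Hc continuous_on_diff[OF continuous_on_id continuous_on_const]] t0, of w0] by simp
    have Ri: "integrable P R" unfolding R_def using Hdi HGi by auto
    have Rb: "norm (R \<omega>) \<le> K * \<kappa> * (norm (G \<omega>))\<^sup>2 + L * (norm (Z \<omega>))\<^sup>2" for \<omega>
    proof -
      have "R \<omega> = H (G \<omega>) (Z \<omega>) + H (Z \<omega>) (G \<omega>) + H (Z \<omega>) (Z \<omega>)"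
        unfolding R_def GZ by (simp add: H.add_left H.add_right)
      then have "\<bar>R \<omega>\<bar> \<le> \<bar>H (G \<omega>) (Z \<omega>)\<bar> + \<bar>H (Z \<omega>) (G \<omega>)\<bar> + \<bar>H (Z \<omega>) (Z \<omega>)\<bar>" by linarith
      also have "\<dots> \<le> norm (G \<omega>) * norm (Z \<omega>) * K + norm (Z \<omega>) * norm (G \<omega>) * K + norm (Z \<omega>) * norm (Z \<omega>) * K"
        by (intro add_mono K)
      also have "\<dots> = K * (2 * (norm (Z \<omega>) * norm (G \<omega>)) + (norm (Z \<omega>))\<^sup>2)" by (simp add: power2_eq_square algebra_simps)
      also have "\<dots> \<le> K * (((norm (Z \<omega>))\<^sup>2 / \<kappa> + \<kappa> * (norm (G \<omega>))\<^sup>2) + (norm (Z \<omega>))\<^sup>2)"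
        using mult_le_weighted_squares[OF \<kappa>(1), of "norm (Z \<omega>)" "norm (G \<omega>)"] K(1) by (intro mult_left_mono add_right_mono) auto
      also have "\<dots> = K * \<kappa> * (norm (G \<omega>))\<^sup>2 + L * (norm (Z \<omega>))\<^sup>2" by (simp add: L_def algebra_simps)
      finally show ?thesis by simp
    qed
    have "\<bar>expectation R\<bar> \<le> expectation (\<lambda>\<omega>. norm (R \<omega>))" using integral_norm_bound[of P R] by simp
    also have "\<dots> \<le> expectation (\<lambda>\<omega>. K * \<kappa> * (norm (G \<omega>))\<^sup>2 + L * (norm (Z \<omega>))\<^sup>2)"
      by (rule integral_mono[OF integrable_norm[OF Ri] _ Rb]) (use G2 Z2 in auto)
    also have "\<dots> = K * \<kappa> * expectation (\<lambda>\<omega>. (norm (G \<omega>))\<^sup>2) + L * (z t * t)"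
      using G2 Z2 by simp
    also have "\<dots> \<le> K * \<kappa> * (c * t) + L * (z t * t)"
      using G2 K \<kappa> by (intro add_right_mono mult_left_mono) auto
    also have "\<dots> = (K * \<kappa> * c + L * z t) * t" by (simp add: algebra_simps)
    finally have "\<bar>expectation R\<bar> / t \<le> K * \<kappa> * c + L * z t" using t by (simp add: divide_le_eq)
    also have "\<dots> < e" using \<kappa>(2) elim(1) by linarith
    finally have "\<bar>expectation R\<bar> / t < e" .
    moreover have "expectation (\<lambda>\<omega>. H (W t \<omega> - w0) (W t \<omega> - w0)) / t - (\<Sum>i\<in>UNIV. H (\<sigma> i w0) (\<sigma> i w0)) = expectation R / t"
      unfolding R_def using Hdi HGi HGE t by (simp add: diff_divide_distrib)
    ultimately show ?case using t by (simp add: dist_real_def)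
  qed
qed

theorem generator_limit:
  fixes \<phi> :: "'a \<Rightarrow> real"
  assumes \<phi>: "continuous_on M \<phi>" and A: "bounded_linear A" and H: "bounded_bilinear H"
    and taylor: "\<And>e. 0 < e \<Longrightarrow> \<exists>\<delta>>0. \<forall>y\<in>M. norm (y - w0) < \<delta> \<longrightarrow>
       \<bar>\<phi> y - \<phi> w0 - A (y - w0) - (1/2) * H (y - w0) (y - w0)\<bar> \<le> e * (norm (y - w0))\<^sup>2"
  shows "((\<lambda>t. (expectation (\<lambda>\<omega>. \<phi> (W t \<omega>)) - \<phi> w0) / t) \<longlongrightarrow> 
     A (drift w0) + (1/2) * (\<Sum>i\<in>UNIV. H (\<sigma> i w0) (\<sigma> i w0))) (at_right 0)"
proof -
  interpret A: bounded_linear A by (rule A)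
  interpret H: bounded_bilinear H by (rule H)
  define \<rho> where "\<rho> y = \<phi> y - \<phi> w0 - A (y - w0) - (1/2) * H (y - w0) (y - w0)" for y
  have Ac: "continuous_on M (\<lambda>y. A (y - w0))" by (intro A.continuous_on continuous_intros)
  have Hc: "continuous_on M (\<lambda>y. H (y - w0) (y - w0))" by (intro H.continuous_on continuous_intros)
  have \<rho>c: "continuous_on M \<rho>" unfolding \<rho>_def by (intro continuous_intros \<phi> Ac Hc)
  have "bounded (\<rho> ` M)" by (intro compact_imp_bounded compact_continuous_image \<rho>c M_compact)
  then obtain K where K: "\<forall>y\<in>M. \<bar>\<rho> y\<bar> \<le> K" unfolding bounded_iff by auto
  have K0: "0 \<le> K" using K w0 by fastforce
  define c where "c = (real CARD('i))\<^sup>2 * C\<^sup>2"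
  define c' where "c' = 3 * (real CARD('i))^4 * C^4"
  have c: "0 \<le> c" "0 \<le> c'" using C by (auto simp: c_def c'_def)
  define z where "z t = expectation (\<lambda>\<omega>. (norm (W t \<omega> - w0 - frozen_step t \<omega>))\<^sup>2) / t" for t
  have \<rho>_limit: "((\<lambda>t. expectation (\<lambda>\<omega>. \<rho> (W t \<omega>)) / t) \<longlongrightarrow> 0) (at_right 0)"
  proof (rule tendstoI)
    fix e :: real assume e: "0 < e"
    define \<epsilon> where "\<epsilon> = e / (4 * (c + 1))"
    have \<epsilon>: "0 < \<epsilon>" "2 * \<epsilon> * c < e / 2"
    proof -
      show "0 < \<epsilon>" using e c by (simp add: \<epsilon>_def)
      then have "2 * \<epsilon> * c < 2 * \<epsilon> * (c + 1)" by simp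
      also have "\<dots> = e / 2" using c by (simp add: \<epsilon>_def field_simps)
      finally show "2 * \<epsilon> * c < e / 2" .
    qed
    obtain \<delta> where \<delta>: "0 < \<delta>" "\<forall>y\<in>M. norm (y - w0) < \<delta> \<longrightarrow> \<bar>\<rho> y\<bar> \<le> \<epsilon> * (norm (y - w0))\<^sup>2"
      using taylor[OF \<epsilon>(1)] unfolding \<rho>_def by blast
    \<comment> \<open>One of two summands carries at least half of \<delta>: the 4 is the square of
      2, and the 16 in \<open>L'\<close> its fourth power. The term 2 \<epsilon> belongs to the
      region near \<open>w0\<close>.\<close>
    define L where "L = 2 * \<epsilon> + 4 * (K / \<delta>\<^sup>2)"
    define L' where "L' = 16 * (K / \<delta>^4) * c'"
    have "((\<lambda>t. L * z t + L' * t) \<longlongrightarrow> L * 0 + L' * 0) (at_right 0)"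
      unfolding z_def by (intro tendsto_intros remainder_sq_limit)
    then have "\<forall>\<^sub>F t in at_right 0. L * z t + L' * t < e / 2"
      using e by (intro order_tendstoD(2)) auto
    moreover have "\<forall>\<^sub>F t in at_right (0::real). 0 < t" by (simp add: eventually_at_right_less)
    ultimately show "\<forall>\<^sub>F t in at_right 0. dist (expectation (\<lambda>\<omega>. \<rho> (W t \<omega>)) / t) 0 < e"
    proof eventually_elim
      case (elim t)
      note t = elim(2)
      then have t0: "0 \<le> t" by simp
      define G where "G = frozen_step t"
      define Z where "Z \<omega> = W t \<omega> - w0 - G \<omega>" for \<omega>
      have GZ: "W t \<omega> - w0 = G \<omega> + Z \<omega>" for \<omega> by (simp add: Z_def)
      have G2: "integrable P (\<lambda>\<omega>. (norm (G \<omega>))\<^sup>2)" "expectation (\<lambda>\<omega>. (norm (G \<omega>))\<^sup>2) \<le> c * t"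
        using frozen_step_sq[OF t0] by (auto simp: G_def c_def)
      have G4: "integrable P (\<lambda>\<omega>. (norm (G \<omega>))^4)" "expectation (\<lambda>\<omega>. (norm (G \<omega>))^4) \<le> c' * t\<^sup>2"
        using frozen_step_fourth[OF t0] by (auto simp: G_def c'_def)
      have Z2: "integrable P (\<lambda>\<omega>. (norm (Z \<omega>))\<^sup>2)" "expectation (\<lambda>\<omega>. (norm (Z \<omega>))\<^sup>2) = z t * t"
        using remainder_sq_integrable[OF t0] t by (auto simp: G_def Z_def z_def)
      have \<rho>i: "integrable P (\<lambda>\<omega>. \<rho> (W t \<omega>))" by (rule bounded_image_sq_integrable[OF \<rho>c t0])
      let ?b = "\<lambda>\<omega>. 2 * \<epsilon> * (norm (G \<omega>))\<^sup>2 + L * (norm (Z \<omega>))\<^sup>2 + 16 * (K / \<delta>^4) * (norm (G \<omega>))^4"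
      have pw: "norm (\<rho> (W t \<omega>)) \<le> ?b \<omega>" if \<omega>: "\<omega> \<in> space P" for \<omega>
      proof (cases "norm (W t \<omega> - w0) < \<delta>")
        case True
        have "\<bar>\<rho> (W t \<omega>)\<bar> \<le> \<epsilon> * (norm (W t \<omega> - w0))\<^sup>2" using \<delta>(2) W_M[OF t0 \<omega>] True by blast
        also have "\<dots> \<le> \<epsilon> * (2 * (norm (G \<omega>))\<^sup>2 + 2 * (norm (Z \<omega>))\<^sup>2)"
          unfolding GZ using \<epsilon>(1) by (intro mult_left_mono norm_add_power2_le) auto
        also have "\<dots> \<le> ?b \<omega>"
          using K0 by (simp add: L_def algebra_simps)
        finally show ?thesis by simp
      next
        case False
        have tri: "norm (W t \<omega> - w0) \<le> norm (G \<omega>) + norm (Z \<omega>)" unfolding GZ by (rule norm_triangle_ineq)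
        have b0: "0 \<le> 2 * \<epsilon> * (norm (G \<omega>))\<^sup>2" "0 \<le> 2 * \<epsilon> * (norm (Z \<omega>))\<^sup>2" 
           "0 \<le> 16 * (K / \<delta>^4) * (norm (G \<omega>))^4" "0 \<le> 4 * (K / \<delta>\<^sup>2) * (norm (Z \<omega>))\<^sup>2"
          using \<epsilon> K0 \<delta>(1) by auto
        have b: "?b \<omega> = 2 * \<epsilon> * (norm (G \<omega>))\<^sup>2 + 2 * \<epsilon> * (norm (Z \<omega>))\<^sup>2 + 4 * (K / \<delta>\<^sup>2) * (norm (Z \<omega>))\<^sup>2 + 16 * (K / \<delta>^4) * (norm (G \<omega>))^4"
          by (simp add: L_def algebra_simps)
        have "K \<le> 4 * (K / \<delta>\<^sup>2) * (norm (Z \<omega>))\<^sup>2 \<or> K \<le> 16 * (K / \<delta>^4) * (norm (G \<omega>))^4"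
        proof (cases "norm (G \<omega>) \<le> norm (Z \<omega>)")
          case True
          then have "\<delta> \<le> 2 * norm (Z \<omega>)" using tri False by linarith
          then have "\<delta>\<^sup>2 \<le> (2 * norm (Z \<omega>))\<^sup>2" using \<delta>(1) by (intro power_mono) auto
          then have "K * \<delta>\<^sup>2 \<le> K * (4 * (norm (Z \<omega>))\<^sup>2)" using K0 by (intro mult_left_mono) (auto simp: power_mult_distrib)
          then show ?thesis using \<delta>(1) by (simp add: field_simps)
        next
          case False2: False
          then have "\<delta> \<le> 2 * norm (G \<omega>)" using tri False by linarith
          then have "\<delta>^4 \<le> (2 * norm (G \<omega>))^4" using \<delta>(1) by (intro power_mono) auto
          then have "K * \<delta>^4 \<le> K * (16 * (norm (G \<omega>))^4)" using K0 by (intro mult_left_mono) (auto simp: power_mult_distrib)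
          then show ?thesis using \<delta>(1) by (simp add: field_simps)
        qed
        moreover have "norm (\<rho> (W t \<omega>)) \<le> K" using K W_M[OF t0 \<omega>] by auto
        ultimately show ?thesis unfolding b using b0 by linarith
      qed
      have "\<bar>expectation (\<lambda>\<omega>. \<rho> (W t \<omega>))\<bar> \<le> expectation (\<lambda>\<omega>. norm (\<rho> (W t \<omega>)))"
        using integral_norm_bound[of P "\<lambda>\<omega>. \<rho> (W t \<omega>)"] by simp
      also have "\<dots> \<le> expectation ?b"
        by (rule integral_mono[OF integrable_norm[OF \<rho>i] _ pw]) (use G2 G4 Z2 in auto)
      also have "\<dots> = 2 * \<epsilon> * expectation (\<lambda>\<omega>. (norm (G \<omega>))\<^sup>2) + L * (z t * t) + 16 * (K / \<delta>^4) * expectation (\<lambda>\<omega>. (norm (G \<omega>))^4)"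
        using G2 G4 Z2 by simp
      also have "\<dots> \<le> 2 * \<epsilon> * (c * t) + L * (z t * t) + 16 * (K / \<delta>^4) * (c' * t\<^sup>2)"
        using G2 G4 \<epsilon>(1) K0 \<delta>(1) by (intro add_mono mult_left_mono order_refl) auto
      also have "\<dots> = (2 * \<epsilon> * c + (L * z t + L' * t)) * t" by (simp add: L'_def power2_eq_square algebra_simps)
      finally have "\<bar>expectation (\<lambda>\<omega>. \<rho> (W t \<omega>))\<bar> / t \<le> 2 * \<epsilon> * c + (L * z t + L' * t)" using t by (simp add: divide_le_eq)
      also have "\<dots> < e" using \<epsilon>(2) elim(1) by linarith
      finally show ?case using t by (simp add: dist_real_def)
    qed
  qed
  have lim: "((\<lambda>t. A ((1 / t) *\<^sub>R expectation (\<lambda>\<omega>. W t \<omega> - w0)) + (1/2) * (expectation (\<lambda>\<omega>. H (W t \<omega> - w0) (W t \<omega> - w0)) / t)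
        + expectation (\<lambda>\<omega>. \<rho> (W t \<omega>)) / t) \<longlongrightarrow> A (drift w0) + (1/2) * (\<Sum>i\<in>UNIV. H (\<sigma> i w0) (\<sigma> i w0)) + 0) (at_right 0)"
    by (intro tendsto_add tendsto_mult_left A.tendsto mean_limit quadratic_limit H \<rho>_limit)
  moreover have "\<forall>\<^sub>F t in at_right 0. A ((1 / t) *\<^sub>R expectation (\<lambda>\<omega>. W t \<omega> - w0)) + (1/2) * (expectation (\<lambda>\<omega>. H (W t \<omega> - w0) (W t \<omega> - w0)) / t)
        + expectation (\<lambda>\<omega>. \<rho> (W t \<omega>)) / t = (expectation (\<lambda>\<omega>. \<phi> (W t \<omega>)) - \<phi> w0) / t"
    using eventually_at_right_less[of "0::real"]
  proof eventually_elim
    case (elim t)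
    then have t0: "0 \<le> t" by simp
    have Wi: "integrable P (\<lambda>\<omega>. W t \<omega> - w0)"
      by (rule bounded_image_sq_integrable[of "\<lambda>y. y - w0", OF _ t0]) (intro continuous_intros)
    have Ai: "integrable P (\<lambda>\<omega>. A (W t \<omega> - w0))" by (rule bounded_image_sq_integrable[OF Ac t0])
    have Hi: "integrable P (\<lambda>\<omega>. H (W t \<omega> - w0) (W t \<omega> - w0))" by (rule bounded_image_sq_integrable[OF Hc t0])
    have \<phi>i: "integrable P (\<lambda>\<omega>. \<phi> (W t \<omega>))" by (rule bounded_image_sq_integrable[OF \<phi> t0])
    have "expectation (\<lambda>\<omega>. \<rho> (W t \<omega>)) = expectation (\<lambda>\<omega>. \<phi> (W t \<omega>)) - \<phi> w0 - expectation (\<lambda>\<omega>. A (W t \<omega> - w0))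
       - (1/2) * expectation (\<lambda>\<omega>. H (W t \<omega> - w0) (W t \<omega> - w0))"
      unfolding \<rho>_def using Ai Hi \<phi>i by (simp add: prob_space)
    moreover have "expectation (\<lambda>\<omega>. A (W t \<omega> - w0)) = A (expectation (\<lambda>\<omega>. W t \<omega> - w0))"
      by (rule integral_bounded_linear[OF A Wi])
    ultimately show ?case by (simp add: A.scaleR add_divide_distrib diff_divide_distrib)
  qed
  ultimately show ?thesis by (simp add: tendsto_cong)
qed

end

section \<open>Smooth functions on submanifolds\<close>

lemma Ck_on_cong:
  assumes "open U" "\<And>x. x \<in> U \<Longrightarrow> f x = g x" "Ck_on k U f"
  shows "Ck_on k U g"
  using assms
proof (induction k arbitrary: f g)
  case 0 then show ?case by (auto cong: continuous_on_cong_simp)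
next
  case (Suc k)
  have d: "(f has_derivative D) (at x) \<longleftrightarrow> (g has_derivative D) (at x)" if "x \<in> U" for x D
    using has_derivative_transform_within_open[OF _ Suc.prems(1) that] Suc.prems(2) by metis
  then have fd: "frechet_derivative f (at x) = frechet_derivative g (at x)" if "x \<in> U" for x
    using that by (simp add: frechet_derivative_def)
  show ?case
  proof (simp, intro conjI ballI allI)
    fix x assume "x \<in> U"
    then show "g differentiable (at x)" using Suc.prems(3) d by (auto simp: differentiable_def)
  next
    fix v show "Ck_on k U (\<lambda>x. frechet_derivative g (at x) v)"
      by (rule Suc.IH[OF Suc.prems(1), of "\<lambda>x. frechet_derivative f (at x) v"]) (use Suc.prems(3) fd in auto)
  qed
qed

lemma Ck_on_Suc_imp: "Ck_on (Suc k) U f \<Longrightarrow> Ck_on k U f"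
proof (induction k arbitrary: f)
  case 0
  then show ?case
    by (auto intro!: differentiable_imp_continuous_on differentiable_at_imp_differentiable_on)
qed auto

lemma Ck_on_subset: "Ck_on k U f \<Longrightarrow> V \<subseteq> U \<Longrightarrow> Ck_on k V f"
  by (induction k arbitrary: f) (auto intro: continuous_on_subset)

lemma Ck_on_const: "Ck_on k U (\<lambda>_. c)"
  by (induction k arbitrary: c) auto

text \<open>Lets any explicit derivative take the place of \<open>frechet_derivative\<close>, so
  that higher orders follow by induction from the rules of differentiation.\<close>

lemma Ck_on_SucI:
  assumes "open U" "\<And>x. x \<in> U \<Longrightarrow> (f has_derivative f' x) (at x)" "\<And>v. Ck_on k U (\<lambda>x. f' x v)"
  shows "Ck_on (Suc k) U f"
proof (simp, intro conjI ballI allI)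
  fix x assume "x \<in> U" then show "f differentiable (at x)" using assms(2) by (auto simp: differentiable_def)
next
  fix v show "Ck_on k U (\<lambda>x. frechet_derivative f (at x) v)"
    by (rule Ck_on_cong[OF assms(1) _ assms(3)[of v]]) (use frechet_derivative_at[OF assms(2)] in auto)
qed

lemma Ck_on_SucD:
  assumes "Ck_on (Suc k) U f"
  shows "x \<in> U \<Longrightarrow> (f has_derivative frechet_derivative f (at x)) (at x)"
    and "Ck_on k U (\<lambda>x. frechet_derivative f (at x) v)"
  using assms by (auto simp: frechet_derivative_works)

lemma Ck_on_bounded_linear:
  assumes U: "open U" and L: "bounded_linear L"
  shows "Ck_on k U f \<Longrightarrow> Ck_on k U (\<lambda>x. L (f x))"
proof (induction k arbitrary: f)
  case 0
  interpret bounded_linear L by (rule L)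
  from 0 show ?case by (auto intro: continuous_on)
next
  case (Suc k)
  show ?case
    by (rule Ck_on_SucI[OF U bounded_linear.has_derivative[OF L Ck_on_SucD(1)[OF Suc.prems]] Suc.IH[OF Ck_on_SucD(2)[OF Suc.prems]]])
qed

lemma Ck_on_ident: assumes U: "open U" shows "Ck_on k U (\<lambda>x. x)"
proof (cases k)
  case (Suc m)
  show ?thesis unfolding Suc
    by (rule Ck_on_SucI[OF U has_derivative_ident]) (rule Ck_on_const)
qed simp

lemma Ck_on_add:
  assumes U: "open U"
  shows "Ck_on k U f \<Longrightarrow> Ck_on k U g \<Longrightarrow> Ck_on k U (\<lambda>x. f x + g x)"
proof (induction k arbitrary: f g)
  case 0 then show ?case by (auto intro: continuous_on_add)
next
  case (Suc k)
  show ?case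
    by (rule Ck_on_SucI[OF U has_derivative_add[OF Ck_on_SucD(1)[OF Suc.prems(1)] Ck_on_SucD(1)[OF Suc.prems(2)]]
           Suc.IH[OF Ck_on_SucD(2)[OF Suc.prems(1)] Ck_on_SucD(2)[OF Suc.prems(2)]]])
qed

text \<open>The product rule yields two products with one factor differentiated; the other factor is
  used with one order less than it has.\<close>

lemma Ck_on_bilinear:
  assumes U: "open U" and P: "bounded_bilinear P"
  shows "Ck_on k U f \<Longrightarrow> Ck_on k U g \<Longrightarrow> Ck_on k U (\<lambda>x. P (f x) (g x))"
proof (induction k arbitrary: f g)
  case 0
  interpret bounded_bilinear P by (rule P)
  from 0 show ?case by (auto intro: continuous_on)
next
  case (Suc k)
  note f = Suc.prems(1) and g = Suc.prems(2)
  show ?case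
    by (rule Ck_on_SucI[OF U bounded_bilinear.FDERIV[OF P Ck_on_SucD(1)[OF f] Ck_on_SucD(1)[OF g]]])
       (assumption+, intro Ck_on_add[OF U] Suc.IH Ck_on_SucD(2)[OF f] Ck_on_SucD(2)[OF g] Ck_on_Suc_imp[OF f] Ck_on_Suc_imp[OF g])
qed

lemma Ck_on_sum:
  assumes U: "open U" and "finite I" "\<And>i. i \<in> I \<Longrightarrow> Ck_on k U (f i)"
  shows "Ck_on k U (\<lambda>x. \<Sum>i\<in>I. f i x)"
  using assms(2,3) by (induction I) (auto intro: Ck_on_const Ck_on_add[OF U])

lemma frechet_derivative_expansion:
  fixes f :: "'a::euclidean_space \<Rightarrow> 'b::real_normed_vector"
  assumes "f differentiable (at x)"
  shows "frechet_derivative f (at x) v = (\<Sum>b\<in>Basis. (v \<bullet> b) *\<^sub>R frechet_derivative f (at x) b)"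
proof -
  have L: "linear (frechet_derivative f (at x))" using assms by (rule linear_frechet_derivative)
  have "frechet_derivative f (at x) v = frechet_derivative f (at x) (\<Sum>b\<in>Basis. (v \<bullet> b) *\<^sub>R b)"
    by (simp add: euclidean_representation)
  then show ?thesis by (simp only: linear_sum[OF L] linear_cmul[OF L])
qed

text \<open>\<open>Ck_on\<close> differentiates in fixed directions. A variable direction is
  expanded in the basis, which leaves products of its coordinates with derivatives in fixed
  directions.\<close>

lemma Ck_on_directional:
  fixes f :: "'a::euclidean_space \<Rightarrow> 'b::real_normed_vector"
  assumes U: "open U" and f: "Ck_on (Suc k) U f" and X: "Ck_on k U X"
  shows "Ck_on k U (\<lambda>x. frechet_derivative f (at x) (X x))"
proof (rule Ck_on_cong[OF U])
  show "Ck_on k U (\<lambda>x. \<Sum>b\<in>Basis. (X x \<bullet> b) *\<^sub>R frechet_derivative f (at x) b)"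
    by (intro Ck_on_sum[OF U] finite_Basis Ck_on_bilinear[OF U bounded_bilinear_scaleR] Ck_on_SucD(2)[OF f]
         Ck_on_bounded_linear[OF U bounded_linear_inner_left X])
  show "(\<Sum>b\<in>Basis. (X x \<bullet> b) *\<^sub>R frechet_derivative f (at x) b) = frechet_derivative f (at x) (X x)" if "x \<in> U" for x
    using f that by (intro frechet_derivative_expansion[symmetric]) auto
qed

lemma smooth_onD: "smooth_on U f \<Longrightarrow> Ck_on k U f" by (simp add: smooth_on_def)

lemma smooth_on_has_derivative: "smooth_on U f \<Longrightarrow> x \<in> U \<Longrightarrow> (f has_derivative frechet_derivative f (at x)) (at x)"
  using Ck_on_SucD(1)[of 0 U f] smooth_onD by blast

lemma smooth_on_derivative: "smooth_on U f \<Longrightarrow> smooth_on U (\<lambda>x. frechet_derivative f (at x) v)"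
  unfolding smooth_on_def by (metis Ck_on_SucD(2))

lemma smooth_on_subset: "smooth_on U f \<Longrightarrow> V \<subseteq> U \<Longrightarrow> smooth_on V f"
  unfolding smooth_on_def using Ck_on_subset by blast

lemma smooth_on_const: "smooth_on U (\<lambda>_. c)" by (simp add: smooth_on_def Ck_on_const)

lemma smooth_on_ident: "open U \<Longrightarrow> smooth_on U (\<lambda>x. x)" by (simp add: smooth_on_def Ck_on_ident)

lemma smooth_on_bounded_linear: "open U \<Longrightarrow> bounded_linear L \<Longrightarrow> smooth_on U f \<Longrightarrow> smooth_on U (\<lambda>x. L (f x))"
  unfolding smooth_on_def using Ck_on_bounded_linear by blast

lemma smooth_on_add: "open U \<Longrightarrow> smooth_on U f \<Longrightarrow> smooth_on U g \<Longrightarrow> smooth_on U (\<lambda>x. f x + g x)"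
  unfolding smooth_on_def using Ck_on_add by blast

lemma smooth_on_bilinear: "open U \<Longrightarrow> bounded_bilinear P \<Longrightarrow> smooth_on U f \<Longrightarrow> smooth_on U g \<Longrightarrow> smooth_on U (\<lambda>x. P (f x) (g x))"
  unfolding smooth_on_def using Ck_on_bilinear by blast

lemma smooth_on_directional:
  fixes f :: "'a::euclidean_space \<Rightarrow> 'b::real_normed_vector"
  shows "open U \<Longrightarrow> smooth_on U f \<Longrightarrow> smooth_on U X \<Longrightarrow> smooth_on U (\<lambda>x. frechet_derivative f (at x) (X x))"
  unfolding smooth_on_def using Ck_on_directional by blast

lemma smooth_on_submanifoldI: "open U \<Longrightarrow> M \<subseteq> U \<Longrightarrow> smooth_on U f \<Longrightarrow> smooth_on_submanifold M f"
  unfolding smooth_on_submanifold_def by blast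

lemma smooth_on_submanifoldE:
  assumes "smooth_on_submanifold M f" "x \<in> M"
  obtains U h where "open U" "x \<in> U" "smooth_on U h" "\<forall>y\<in>U \<inter> M. h y = f y"
  using assms unfolding smooth_on_submanifold_def by blast

lemma smooth_on_submanifold_local:
  assumes "\<And>x. x \<in> M \<Longrightarrow> \<exists>U h. open U \<and> x \<in> U \<and> smooth_on U h \<and> (\<forall>y\<in>U \<inter> M. h y = f y)"
  shows "smooth_on_submanifold M f"
  using assms unfolding smooth_on_submanifold_def by blast

lemma smooth_on_submanifold_pair:
  assumes f: "smooth_on_submanifold M f" and g: "smooth_on_submanifold M g" and x: "x \<in> M"
  obtains U f' g' where "open U" "x \<in> U" "smooth_on U f'" "smooth_on U g'" 
    "\<forall>y\<in>U \<inter> M. f' y = f y" "\<forall>y\<in>U \<inter> M. g' y = g y"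
proof -
  obtain U f' where U: "open U" "x \<in> U" "smooth_on U f'" "\<forall>y\<in>U \<inter> M. f' y = f y"
    using smooth_on_submanifoldE[OF f x] by blast
  obtain V g' where V: "open V" "x \<in> V" "smooth_on V g'" "\<forall>y\<in>V \<inter> M. g' y = g y"
    using smooth_on_submanifoldE[OF g x] by blast
  show thesis
    by (rule that[of "U \<inter> V" f' g']) (use U V in \<open>auto intro: smooth_on_subset\<close>)
qed

lemma smooth_on_submanifold_has_derivative:
  assumes "open U" "x \<in> U" "x \<in> M" "smooth_on U h" "\<forall>y\<in>U \<inter> M. h y = f y"
  shows "(f has_derivative frechet_derivative h (at x)) (at x within M)"
proof -
  have 1: "(h has_derivative frechet_derivative h (at x)) (at x within M)"
    using smooth_on_has_derivative[OF assms(4,2)] by (rule has_derivative_at_withinI)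
  have "\<forall>\<^sub>F y in at x within M. h y = f y"
    using assms(1,2,5) unfolding eventually_at_topological by blast
  with 1 show ?thesis using assms by (auto intro: has_derivative_transform_eventually)
qed

lemma smooth_on_submanifold_continuous:
  assumes "smooth_on_submanifold M f" shows "continuous_on M f"
  unfolding continuous_on_eq_continuous_within
proof
  fix x assume x: "x \<in> M"
  from smooth_on_submanifoldE[OF assms this] 
  obtain U f' where U: "open U" "x \<in> U" "smooth_on U f'" "\<forall>y\<in>U \<inter> M. f' y = f y" by blast
  show "continuous (at x within M) f"
    using has_derivative_continuous[OF smooth_on_submanifold_has_derivative[OF U(1,2) x U(3,4)]] .
qed

text \<open>Linearity in the second slot is that of a derivative. In the first slot \<open>u\<close>
  sits inside the function to be differentiated, so the expansion has to hold on a neighbourhood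
  before the derivative is taken. Finitely many entries \<open>H b b'\<close> then control the whole
  form.\<close>

lemma second_derivative_expansion:
  fixes h :: "'a::euclidean_space \<Rightarrow> real"
  assumes U: "open U" and h: "smooth_on U h" and x: "x \<in> U"
  defines "H \<equiv> \<lambda>u v. frechet_derivative (\<lambda>y. frechet_derivative h (at y) u) (at x) v"
  shows "H u v = (\<Sum>b\<in>Basis. \<Sum>b'\<in>Basis. (u \<bullet> b) * (v \<bullet> b') * H b b')"
proof -
  have d: "(\<lambda>y. frechet_derivative h (at y) w) differentiable (at x)" for w
    using smooth_on_has_derivative[OF smooth_on_derivative[OF h] x] by (auto simp: differentiable_def)
  have eq: "frechet_derivative h (at y) u = (\<Sum>b\<in>Basis. (u \<bullet> b) *\<^sub>R frechet_derivative h (at y) b)" if "y \<in> U" for y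
    using smooth_on_has_derivative[OF h that] by (intro frechet_derivative_expansion) (auto simp: differentiable_def)
  have "((\<lambda>y. \<Sum>b\<in>Basis. (u \<bullet> b) *\<^sub>R frechet_derivative h (at y) b) has_derivative (\<lambda>v. \<Sum>b\<in>Basis. (u \<bullet> b) *\<^sub>R H b v)) (at x)"
    unfolding H_def by (intro derivative_intros) (use smooth_on_has_derivative[OF smooth_on_derivative[OF h] x] in auto)
  then have "((\<lambda>y. frechet_derivative h (at y) u) has_derivative (\<lambda>v. \<Sum>b\<in>Basis. (u \<bullet> b) *\<^sub>R H b v)) (at x)"
    by (rule has_derivative_transform_within_open[OF _ U x]) (simp add: eq)
  then have "H u = (\<lambda>v. \<Sum>b\<in>Basis. (u \<bullet> b) *\<^sub>R H b v)"
    unfolding H_def by (rule frechet_derivative_at[symmetric])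
  then have "H u v = (\<Sum>b\<in>Basis. (u \<bullet> b) * H b v)" by simp
  also have "\<dots> = (\<Sum>b\<in>Basis. (u \<bullet> b) * (\<Sum>b'\<in>Basis. (v \<bullet> b') * H b b'))"
  proof (intro sum.cong refl)
    fix b :: 'a
    show "(u \<bullet> b) * H b v = (u \<bullet> b) * (\<Sum>b'\<in>Basis. (v \<bullet> b') * H b b')"
      using frechet_derivative_expansion[OF d, of b v] unfolding H_def by simp
  qed
  finally show ?thesis by (simp add: sum_distrib_left mult_ac)
qed

text \<open>Taylor's formula with an intermediate point on the segment; the Hessian there is
  compared with the one at \<open>x0\<close> entry by entry. As there are
  \<open>(DIM('a))\<^sup>2\<close> entries, each may be off by \<open>m\<close>.\<close>

lemma second_order_taylor:
  fixes h :: "'a::euclidean_space \<Rightarrow> real"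
  assumes U: "open U" "x0 \<in> U" and h: "smooth_on U h" and e: "0 < e"
  defines "H \<equiv> \<lambda>x u v. frechet_derivative (\<lambda>y. frechet_derivative h (at y) u) (at x) v"
  shows "\<exists>\<delta>>0. \<forall>y. norm (y - x0) < \<delta> \<longrightarrow>
    \<bar>h y - h x0 - frechet_derivative h (at x0) (y - x0) - (1/2) * H x0 (y - x0) (y - x0)\<bar> \<le> e * (norm (y - x0))\<^sup>2"
proof -
  define m where "m = e / (real DIM('a))\<^sup>2"
  have m: "0 < m" using e by (simp add: m_def)
  have H_expand: "H x u v = (\<Sum>b\<in>Basis. \<Sum>b'\<in>Basis. (u \<bullet> b) * (v \<bullet> b') * H x b b')" if "x \<in> U" for x u v
    unfolding H_def by (rule second_derivative_expansion[OF U(1) h that])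
  have "\<exists>\<delta>>0. \<forall>y. norm (y - x0) < \<delta> \<longrightarrow> \<bar>H y b b' - H x0 b b'\<bar> < m" for b b'
  proof -
    have "continuous_on U (\<lambda>x. H x b b')"
      using smooth_onD[OF smooth_on_derivative[OF smooth_on_derivative[OF h]], of 0] by (simp add: H_def)
    then have "isCont (\<lambda>x. H x b b') x0" using U by (simp add: continuous_on_eq_continuous_at)
    then show ?thesis using m unfolding continuous_at_eps_delta by (simp add: dist_norm)
  qed
  then obtain d where d: "\<And>b b'. d b b' > 0" "\<And>b b' y. norm (y - x0) < d b b' \<Longrightarrow> \<bar>H y b b' - H x0 b b'\<bar> < m"
    by metis
  obtain r where r: "0 < r" "ball x0 r \<subseteq> U" using U open_contains_ball by blast
  \<comment> \<open>The finitely many radii for the entries, and \<open>r\<close>, which keeps the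
    segment inside \<open>U\<close>.\<close>
  define T where "T = insert r ((\<lambda>(b, b'). d b b') ` ((Basis :: 'a set) \<times> (Basis :: 'a set)))"
  define \<delta> where "\<delta> = Min T"
  have T: "finite T" "T \<noteq> {}" by (auto simp: T_def)
  have \<delta>: "0 < \<delta>" "\<delta> \<le> r" "\<And>b b'. b \<in> Basis \<Longrightarrow> b' \<in> Basis \<Longrightarrow> \<delta> \<le> d b b'"
  proof -
    show "0 < \<delta>" unfolding \<delta>_def Min_gr_iff[OF T] using r d by (auto simp: T_def)
    show "\<delta> \<le> r" unfolding \<delta>_def by (rule Min_le[OF T(1)]) (simp add: T_def)
    show "\<delta> \<le> d b b'" if "b \<in> Basis" "b' \<in> Basis" for b b'
      unfolding \<delta>_def by (rule Min_le[OF T(1)]) (use that in \<open>auto simp: T_def\<close>)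
  qed
  show ?thesis
  proof (intro exI[of _ \<delta>] conjI allI impI)
    show "0 < \<delta>" by (rule \<delta>)
    fix y assume y: "norm (y - x0) < \<delta>"
    define v where "v = y - x0"
    have seg: "norm (x0 + s *\<^sub>R v - x0) < \<delta>" if "0 \<le> s" "s \<le> 1" for s
    proof -
      have "norm (x0 + s *\<^sub>R v - x0) = s * norm v" using that by simp
      also have "\<dots> \<le> 1 * norm v" using that by (intro mult_right_mono) auto
      finally show ?thesis using y by (simp add: v_def)
    qed
    have segU: "x0 + s *\<^sub>R v \<in> U" if "0 \<le> s" "s \<le> 1" for s
    proof -
      have "norm (s *\<^sub>R v) < r" using seg[OF that] \<delta>(2) by simp
      then show ?thesis using r(2) by (auto simp: dist_norm subset_iff)
    qed
    \<comment> \<open>The successive derivatives of \<open>h\<close> along the segment, in the form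
      required by \<open>Maclaurin\<close>; the last branch is meant for
      \<open>k = 2\<close>.\<close>
    define D where "D k s = (if k = 0 then h (x0 + s *\<^sub>R v) else if k = 1 then frechet_derivative h (at (x0 + s *\<^sub>R v)) v
        else H (x0 + s *\<^sub>R v) v v)" for k :: nat and s
    have line: "((\<lambda>s. x0 + s *\<^sub>R v) has_derivative (\<lambda>t. t *\<^sub>R v)) (at s)" for s by (auto intro!: derivative_eq_intros)
    have chain: "DERIV (\<lambda>s. f (x0 + s *\<^sub>R v)) s :> f' v" if "(f has_derivative f') (at (x0 + s *\<^sub>R v))" for f f' s
    proof -
      have "((\<lambda>s. f (x0 + s *\<^sub>R v)) has_derivative (\<lambda>t. f' (t *\<^sub>R v))) (at s)"
        using has_derivative_compose[OF line that] .
      moreover have "f' (t *\<^sub>R v) = f' v * t" for t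
        using linear_cmul[OF has_derivative_linear[OF that]] by simp
      ultimately show ?thesis by (simp add: has_field_derivative_def)
    qed
    have "\<exists>t>0. t < 1 \<and> D 0 1 = (\<Sum>k<2. D k 0 / fact k * 1 ^ k) + D 2 t / fact 2 * 1 ^ 2"
    proof (rule Maclaurin)
      show "\<forall>m t. m < 2 \<and> 0 \<le> t \<and> t \<le> 1 \<longrightarrow> DERIV (D m) t :> D (Suc m) t"
      proof (intro allI impI)
        fix k :: nat and t :: real assume k: "k < 2 \<and> 0 \<le> t \<and> t \<le> 1"
        then consider "k = 0" | "k = 1" by linarith
        then show "DERIV (D k) t :> D (Suc k) t"
        proof cases
          case 1
          then show ?thesis using chain[OF smooth_on_has_derivative[OF h segU]] k by (simp add: D_def[abs_def])
        next
          case 2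
          then show ?thesis using chain[OF smooth_on_has_derivative[OF smooth_on_derivative[OF h] segU]] k 
            by (simp add: D_def[abs_def] H_def)
        qed
      qed
    qed auto
    then obtain t where t: "0 < t" "t < 1" and eq: "D 0 1 = (\<Sum>k<2. D k 0 / fact k * 1 ^ k) + D 2 t / fact 2 * 1 ^ 2" by blast
    have "h y - h x0 - frechet_derivative h (at x0) v - (1/2) * H x0 v v = (1/2) * (H (x0 + t *\<^sub>R v) v v - H x0 v v)"
      using eq by (simp add: D_def eval_nat_numeral v_def)
    also have "H (x0 + t *\<^sub>R v) v v - H x0 v v = (\<Sum>b\<in>Basis. \<Sum>b'\<in>Basis. (v \<bullet> b) * (v \<bullet> b') * (H (x0 + t *\<^sub>R v) b b' - H x0 b b'))"
    proof -
      have "x0 + t *\<^sub>R v \<in> U" using segU t by simp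
      note expand = H_expand[OF this, of v v] H_expand[OF U(2), of v v]
      show ?thesis unfolding expand by (simp only: sum_subtractf right_diff_distrib)
    qed
    finally have rem: "h y - h x0 - frechet_derivative h (at x0) v - (1/2) * H x0 v v =
       (1/2) * (\<Sum>b\<in>Basis. \<Sum>b'\<in>Basis. (v \<bullet> b) * (v \<bullet> b') * (H (x0 + t *\<^sub>R v) b b' - H x0 b b'))" .
    have "\<bar>h y - h x0 - frechet_derivative h (at x0) v - (1/2) * H x0 v v\<bar> =
       (1/2) * \<bar>\<Sum>b\<in>Basis. \<Sum>b'\<in>Basis. (v \<bullet> b) * (v \<bullet> b') * (H (x0 + t *\<^sub>R v) b b' - H x0 b b')\<bar>"
      unfolding rem by (simp only: abs_mult abs_divide abs_one abs_numeral)
    also have "\<dots> \<le> (1/2) * (\<Sum>b\<in>(Basis::'a set). \<Sum>b'\<in>(Basis::'a set). norm v * norm v * m)"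
    proof (intro mult_left_mono order_trans[OF sum_abs] sum_mono)
      fix b b' :: 'a assume b: "b \<in> Basis" "b' \<in> Basis"
      have "\<bar>H (x0 + t *\<^sub>R v) b b' - H x0 b b'\<bar> \<le> m"
        using d(2)[of "x0 + t *\<^sub>R v" b b'] seg[of t] \<delta>(3)[OF b] t by fastforce
      then show "\<bar>(v \<bullet> b) * (v \<bullet> b') * (H (x0 + t *\<^sub>R v) b b' - H x0 b b')\<bar> \<le> norm v * norm v * m"
        unfolding abs_mult using Basis_le_norm[OF b(1), of v] Basis_le_norm[OF b(2), of v] by (intro mult_mono) auto
    qed auto
    also have "\<dots> = (1/2) * (e * (norm v)\<^sup>2)" by (simp add: m_def power2_eq_square)
    also have "\<dots> \<le> e * (norm v)\<^sup>2" using e by simp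
    finally show "\<bar>h y - h x0 - frechet_derivative h (at x0) (y - x0) - (1/2) * H x0 (y - x0) (y - x0)\<bar> \<le> e * (norm (y - x0))\<^sup>2"
      unfolding v_def .
  qed
qed

lemma bounded_bilinear_second_derivative:
  fixes h :: "'a::euclidean_space \<Rightarrow> real"
  assumes "open U" "smooth_on U h" "x \<in> U"
  shows "bounded_bilinear (\<lambda>u v. frechet_derivative (\<lambda>y. frechet_derivative h (at y) u) (at x) v)"
proof -
  let ?H = "\<lambda>u v. frechet_derivative (\<lambda>y. frechet_derivative h (at y) u) (at x) v"
  have "bilinear (\<lambda>u v :: 'a. \<Sum>b\<in>Basis. \<Sum>b'\<in>Basis. (u \<bullet> b) * (v \<bullet> b') * c b b' :: real)" for c
    unfolding bilinear_def
    by (auto intro!: linearI simp: inner_add_left algebra_simps sum.distrib sum_distrib_left)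
  then have "bounded_bilinear (\<lambda>u v :: 'a. \<Sum>b\<in>Basis. \<Sum>b'\<in>Basis. (u \<bullet> b) * (v \<bullet> b') * c b b' :: real)" for c
    by (simp add: bilinear_conv_bounded_bilinear)
  moreover have "?H = (\<lambda>u v. \<Sum>b\<in>Basis. \<Sum>b'\<in>Basis. (u \<bullet> b) * (v \<bullet> b') * ?H b b')"
    by (intro ext) (rule second_derivative_expansion[OF assms])
  ultimately show ?thesis by (rule ssubst[where P=bounded_bilinear, rotated])
qed

section \<open>Algebra of the canonical metric\<close>

lemma bounded_bilinear_matrix_mult:
  "bounded_bilinear ((**) :: real^'m^'n \<Rightarrow> real^'k^'m \<Rightarrow> real^'k^'n)"
proof -
  have "bilinear ((**) :: real^'m^'n \<Rightarrow> real^'k^'m \<Rightarrow> real^'k^'n)"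
    unfolding bilinear_def
    by (auto intro!: linearI simp: vec_eq_iff matrix_matrix_mult_def sum.distrib algebra_simps sum_distrib_left)
  then show ?thesis by (simp add: bilinear_conv_bounded_bilinear)
qed

lemma bounded_linear_transpose: "bounded_linear (transpose :: real^'m^'n \<Rightarrow> real^'n^'m)"
proof -
  have "linear (transpose :: real^'m^'n \<Rightarrow> real^'n^'m)"
    by (auto intro!: linearI simp: vec_eq_iff transpose_def)
  then show ?thesis by (simp add: linear_conv_bounded_linear)
qed

lemmas matrix_mult_simps =
  bounded_bilinear.add_left[OF bounded_bilinear_matrix_mult]
  bounded_bilinear.add_right[OF bounded_bilinear_matrix_mult]
  bounded_bilinear.diff_left[OF bounded_bilinear_matrix_mult]
  bounded_bilinear.diff_right[OF bounded_bilinear_matrix_mult]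
  bounded_bilinear.minus_left[OF bounded_bilinear_matrix_mult]
  bounded_bilinear.minus_right[OF bounded_bilinear_matrix_mult]
  bounded_bilinear.scaleR_left[OF bounded_bilinear_matrix_mult]
  bounded_bilinear.scaleR_right[OF bounded_bilinear_matrix_mult]
  bounded_bilinear.zero_left[OF bounded_bilinear_matrix_mult]
  bounded_bilinear.zero_right[OF bounded_bilinear_matrix_mult]

lemmas transpose_simps =
  linear_add[OF bounded_linear.linear[OF bounded_linear_transpose]]
  linear_diff[OF bounded_linear.linear[OF bounded_linear_transpose]]
  linear_neg[OF bounded_linear.linear[OF bounded_linear_transpose]]
  linear_cmul[OF bounded_linear.linear[OF bounded_linear_transpose]]
  linear_0[OF bounded_linear.linear[OF bounded_linear_transpose]]

lemma inner_matrix: "A \<bullet> B = (\<Sum>i\<in>UNIV. \<Sum>j\<in>UNIV. A $ i $ j * B $ i $ j)" for A B :: "real^'m^'n"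
  by (simp add: inner_vec_def)

lemma inner_transpose: "transpose A \<bullet> transpose B = A \<bullet> B" for A B :: "real^'m^'n"
  unfolding inner_matrix transpose_def by simp (rule sum.swap)

lemma inner_matrix_mult_left: "(A ** B) \<bullet> C = B \<bullet> (transpose A ** C)" for A :: "real^'m^'n" and B :: "real^'k^'m"
proof -
  have "(A ** B) \<bullet> C = (\<Sum>i\<in>UNIV. \<Sum>j\<in>UNIV. \<Sum>k\<in>UNIV. A $ i $ k * B $ k $ j * C $ i $ j)"
    by (simp add: inner_matrix matrix_matrix_mult_def sum_distrib_right)
  also have "\<dots> = (\<Sum>i\<in>UNIV. \<Sum>k\<in>UNIV. \<Sum>j\<in>UNIV. A $ i $ k * B $ k $ j * C $ i $ j)"
    by (intro sum.cong refl sum.swap)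
  also have "\<dots> = (\<Sum>k\<in>UNIV. \<Sum>i\<in>UNIV. \<Sum>j\<in>UNIV. A $ i $ k * B $ k $ j * C $ i $ j)"
    by (rule sum.swap)
  also have "\<dots> = (\<Sum>k\<in>UNIV. \<Sum>j\<in>UNIV. \<Sum>i\<in>UNIV. A $ i $ k * B $ k $ j * C $ i $ j)"
    by (intro sum.cong refl sum.swap)
  also have "\<dots> = B \<bullet> (transpose A ** C)"
    by (simp add: inner_matrix matrix_matrix_mult_def transpose_def sum_distrib_left mult_ac)
  finally show ?thesis .
qed


lemma trace_transpose_mult: "trace (transpose A ** B) = A \<bullet> B" for A B :: "real^'m^'n"
  unfolding trace_def inner_matrix matrix_matrix_mult_def transpose_def by simp (rule sum.swap)

text \<open>For a tangent \<open>U\<close> the matrix \<open>transpose X ** U\<close> is skew.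
  Writing the metric through such products reduces later identities to pairings of symmetric and
  skew matrices.\<close>

lemma canonical_metric_eq:
  "canonical_metric X U V = U \<bullet> V - (1/2) * ((transpose X ** U) \<bullet> (transpose X ** V))"
proof -
  have "canonical_metric X U V = U \<bullet> ((mat 1 - (1/2) *\<^sub>R (X ** transpose X)) ** V)"
    unfolding canonical_metric_def matrix_mul_assoc[symmetric] by (rule trace_transpose_mult)
  also have "\<dots> = U \<bullet> V - (1/2) * (U \<bullet> (X ** (transpose X ** V)))"
    by (simp add: matrix_mult_simps inner_diff_right matrix_mul_assoc)
  also have "U \<bullet> (X ** (transpose X ** V)) = (transpose X ** U) \<bullet> (transpose X ** V)"
    by (metis inner_commute inner_matrix_mult_left)
  finally show ?thesis .
qed

lemma inner_sym_skew: "transpose A = A \<Longrightarrow> transpose B = - B \<Longrightarrow> A \<bullet> B = 0" for A B :: "real^'n^'n"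
  using inner_transpose[of A B] by simp

lemma matrix_unit_inner: "matrix_unit u v \<bullet> A = A $ u $ v" for A :: "real^'p^'n"
proof -
  have "matrix_unit u v \<bullet> A = (\<Sum>i\<in>UNIV. \<Sum>j\<in>UNIV. if i = u then if j = v then A $ i $ j else 0 else 0)"
    unfolding inner_matrix matrix_unit_def by (intro sum.cong refl) auto
  also have "\<dots> = (\<Sum>i\<in>UNIV. if i = u then A $ i $ v else 0)"
    by (intro sum.cong refl) auto
  finally show ?thesis by simp
qed

lemma sum_matrix_unit_inner: "(\<Sum>(u, v)\<in>UNIV. (matrix_unit u v \<bullet> A) * (matrix_unit u v \<bullet> B)) = A \<bullet> B" for A B :: "real^'p^'n"
  unfolding matrix_unit_inner unfolding inner_matrix sum.cartesian_product by simp

lemma matrix_unit_sandwich_nth: "(matrix_unit u v ** A ** matrix_unit u v) $ i $ j = (if i = u \<and> j = v then A $ v $ u else 0)"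
  for A :: "real^'n^'p"
proof -
  have 1: "(matrix_unit u v ** A) $ i $ k = (if i = u then A $ v $ k else 0)" for k
    by (simp add: matrix_matrix_mult_def matrix_unit_def if_distrib[of "\<lambda>x. x * _"] cong: if_cong)
  show ?thesis
    unfolding matrix_matrix_mult_def[of "matrix_unit u v ** A"]
    by (simp add: 1) (simp add: matrix_unit_def if_distrib[of "\<lambda>x. _ * x"] cong: if_cong)
qed

text \<open>Multiplication by a matrix unit on both sides moves the entry (v, u) of \<open>A\<close>
  to the place (u, v) and deletes the rest. This identity is what evaluates the sum of the
  accelerations.\<close>

lemma sum_matrix_unit_sandwich: "(\<Sum>(u, v)\<in>UNIV. matrix_unit u v ** A ** matrix_unit u v) = transpose A" for A :: "real^'n^'p"
proof -
  have "(\<Sum>(u, v)\<in>UNIV. matrix_unit u v ** A ** matrix_unit u v) $ i $ j = A $ j $ i" for i j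
  proof -
    have "(\<Sum>(u, v)\<in>UNIV. matrix_unit u v ** A ** matrix_unit u v) $ i $ j = (\<Sum>p\<in>UNIV. (matrix_unit (fst p) (snd p) ** A ** matrix_unit (fst p) (snd p)) $ i $ j)"
      by (simp add: case_prod_unfold)
    also have "\<dots> = (\<Sum>p\<in>UNIV. if p = (i, j) then A $ j $ i else 0)"
      unfolding matrix_unit_sandwich_nth by (intro sum.cong refl) auto
    finally show ?thesis by simp
  qed
  then show ?thesis by (simp add: vec_eq_iff transpose_def)
qed

lemma stiefelD: "x \<in> stiefel \<Longrightarrow> transpose x ** x = mat 1" by (simp add: stiefel_def)

lemma stiefel_cancel: "x \<in> stiefel \<Longrightarrow> transpose x ** (x ** A) = A"
  by (simp add: matrix_mul_assoc stiefelD)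

lemma stiefel_tangent_iff: "Z \<in> stiefel_tangent X \<longleftrightarrow> transpose (transpose X ** Z) = - (transpose X ** Z)"
  unfolding stiefel_tangent_def by (simp add: matrix_transpose_mul eq_neg_iff_add_eq_0)

lemma stiefel_tangentD: 
  assumes "Z \<in> stiefel_tangent X"
  shows "transpose Z ** X = - (transpose X ** Z)" "transpose X ** Z = - (transpose Z ** X)"
  using assms unfolding stiefel_tangent_def by (auto simp: eq_neg_iff_add_eq_0 add.commute)

lemma subspace_stiefel_tangent: "subspace (stiefel_tangent X)"
  by (rule subspaceI) (simp_all add: stiefel_tangent_iff matrix_mult_simps transpose_simps)

lemma bounded_stiefel: "x \<in> stiefel \<Longrightarrow> norm x = sqrt (real CARD('p))" for x :: "real^'p^'n"
proof -
  assume "x \<in> stiefel"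
  then have "x \<bullet> x = trace (mat 1 :: real^'p^'p)" by (simp add: trace_transpose_mult[symmetric] stiefelD)
  also have "\<dots> = real CARD('p)" by (simp add: trace_def mat_def)
  finally show ?thesis by (simp add: norm_eq_sqrt_inner)
qed

lemma compact_stiefel: "compact (stiefel :: (real^'p^'n) set)"
proof -
  have eq: "stiefel = (\<lambda>X. transpose X ** X) -` {mat 1 :: real^'p^'p}" by (auto simp: stiefel_def)
  have cont: "continuous_on UNIV (\<lambda>X :: real^'p^'n. transpose X ** X)"
    by (intro bounded_bilinear.continuous_on[OF bounded_bilinear_matrix_mult] bounded_linear.continuous_on[OF bounded_linear_transpose] continuous_on_id)
  have "closed (stiefel :: (real^'p^'n) set)"
    unfolding eq by (rule closed_vimage[OF closed_singleton cont])
  moreover have "bounded (stiefel :: (real^'p^'n) set)"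
    unfolding bounded_iff using bounded_stiefel by (metis order_refl)
  ultimately show ?thesis by (simp add: compact_eq_bounded_closed)
qed

lemma stiefel_alpha_beta: "stiefel_beta = 1 - stiefel_alpha" "stiefel_alpha * stiefel_alpha = 1/2"
  by (auto simp: stiefel_alpha_def stiefel_beta_def)

text \<open>The coefficient of the first term is 1 - \<beta>, which equals \<alpha>; so the two
  terms combine to a skew matrix, and the field is tangent.\<close>

lemma stiefel_field_tangent_part:
  assumes "x \<in> stiefel"
  shows "transpose x ** stiefel_field (u, v) x = stiefel_alpha *\<^sub>R (transpose x ** matrix_unit u v - transpose (transpose x ** matrix_unit u v))"
  unfolding stiefel_field_def
  by (simp add: matrix_mult_simps matrix_mul_assoc[symmetric] stiefel_cancel[OF assms] matrix_transpose_mul stiefel_alpha_beta algebra_simps)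

lemma stiefel_field_tangent: "x \<in> stiefel \<Longrightarrow> stiefel_field i x \<in> stiefel_tangent x"
  unfolding stiefel_tangent_iff by (cases i) (simp add: stiefel_field_tangent_part transpose_simps algebra_simps)

text \<open>A square root of the metric tensor: \<open>(I - \<beta> x x\<^sup>T)\<^sup>2 = I - (1/2) x x\<^sup>T\<close> on the Stiefel manifold.\<close>

definition metric_root :: "real^'p^'n \<Rightarrow> real^'p^'n \<Rightarrow> real^'p^'n"
  where "metric_root x e = e - stiefel_beta *\<^sub>R (x ** (transpose x ** e))"

lemma linear_metric_root: "linear (metric_root x)"
  by (rule linearI) (simp_all add: metric_root_def matrix_mult_simps algebra_simps)

lemma metric_root_inner:
  assumes x: "x \<in> stiefel"
  shows "metric_root x e \<bullet> metric_root x e' = canonical_metric x e e'"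
proof -
  have xe: "(x ** A) \<bullet> e = A \<bullet> (transpose x ** e)" "e \<bullet> (x ** A) = A \<bullet> (transpose x ** e)" for A e
    by (metis inner_commute inner_matrix_mult_left)+
  have "metric_root x e \<bullet> metric_root x e' = e \<bullet> e' - (2 * stiefel_beta - stiefel_beta * stiefel_beta) * ((transpose x ** e) \<bullet> (transpose x ** e'))"
    unfolding metric_root_def
    by (simp add: inner_diff_left inner_diff_right xe stiefel_cancel[OF x] inner_commute algebra_simps)
  also have "2 * stiefel_beta - stiefel_beta * stiefel_beta = 1/2"
  proof -
    have "2 * stiefel_beta - stiefel_beta * stiefel_beta = 1 - stiefel_alpha * stiefel_alpha"
      by (simp add: stiefel_alpha_beta(1) algebra_simps)
    then show ?thesis by (simp add: stiefel_alpha_beta(2))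
  qed
  finally show ?thesis by (simp add: canonical_metric_eq)
qed

text \<open>Along the columns of \<open>x\<close> the map \<open>metric_root x\<close> is
  multiplication by \<alpha>, which is not 0. Once \<open>transpose x ** e\<close> vanishes,
  \<open>metric_root x e\<close> is \<open>e\<close> itself.\<close>

lemma metric_root_eq_0:
  assumes x: "x \<in> stiefel" and "metric_root x e = 0"
  shows "e = 0"
proof -
  have "transpose x ** metric_root x e = stiefel_alpha *\<^sub>R (transpose x ** e)"
    unfolding metric_root_def by (simp add: matrix_mult_simps stiefel_cancel[OF x] stiefel_alpha_beta algebra_simps)
  then have "transpose x ** e = 0" using assms(2) by (simp add: matrix_mult_simps stiefel_alpha_def)
  then show ?thesis using assms(2) by (simp add: metric_root_def matrix_mult_simps)
qed

lemma canonical_metric_pos: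
  assumes x: "x \<in> stiefel" and "canonical_metric x e e = 0" shows "e = 0"
  using metric_root_eq_0[OF x] metric_root_inner[OF x, of e e] assms(2) by simp

text \<open>The fields are dual to the matrix units: the metric product with a tangent
  \<open>e\<close> is an entry of \<open>metric_root x e\<close>. The pairing of \<open>?F\<close>
  with \<open>?k\<close> gets the coefficient (\<alpha> - \<beta>) - \<alpha>, that is -\<beta>, as
  in \<open>metric_root\<close>.\<close>

lemma canonical_metric_field:
  assumes x: "x \<in> stiefel" and e: "e \<in> stiefel_tangent x"
  shows "canonical_metric x (stiefel_field (u, v) x) e = matrix_unit u v \<bullet> metric_root x e"
proof -
  let ?E = "matrix_unit u v :: real^'a^'b" and ?k = "transpose x ** e"
  let ?F = "transpose x ** ?E"
  have k: "transpose ?k = - ?k" using e by (simp add: stiefel_tangent_iff)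
  have Fk: "transpose ?F \<bullet> ?k = - (?F \<bullet> ?k)" using inner_transpose[of ?F ?k] k by simp
  have xe: "(x ** A) \<bullet> e = A \<bullet> ?k" for A by (simp add: inner_matrix_mult_left)
  have 1: "stiefel_field (u, v) x \<bullet> e = ?E \<bullet> e + (stiefel_alpha - stiefel_beta) * (?F \<bullet> ?k)"
  proof -
    have eq: "stiefel_field (u, v) x = ?E - stiefel_alpha *\<^sub>R (x ** transpose ?F) - stiefel_beta *\<^sub>R (x ** ?F)"
      by (simp add: stiefel_field_def matrix_transpose_mul matrix_mul_assoc)
    show ?thesis unfolding eq by (simp add: inner_diff_left xe Fk algebra_simps)
  qed
  have 2: "(transpose x ** stiefel_field (u, v) x) \<bullet> ?k = 2 * stiefel_alpha * (?F \<bullet> ?k)"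
    unfolding stiefel_field_tangent_part[OF x] by (simp add: inner_diff_left Fk)
  have 3: "?E \<bullet> metric_root x e = ?E \<bullet> e - stiefel_beta * (?F \<bullet> ?k)"
  proof -
    have "?E \<bullet> (x ** ?k) = ?F \<bullet> ?k" by (metis inner_commute inner_matrix_mult_left)
    then show ?thesis by (simp add: metric_root_def inner_diff_right)
  qed
  show ?thesis unfolding canonical_metric_eq 1 2 3 by (simp add: algebra_simps)
qed

text \<open>Parseval's identity for the matrix units, carried over by \<open>metric_root\<close>.
  There are more fields than the dimension of the manifold, yet in traces they act like an
  orthonormal basis.\<close>

lemma sum_canonical_metric_field:
  assumes x: "x \<in> stiefel" and e: "e \<in> stiefel_tangent x" "e' \<in> stiefel_tangent x"
  shows "(\<Sum>i\<in>UNIV. canonical_metric x (stiefel_field i x) e * canonical_metric x (stiefel_field i x) e') = canonical_metric x e e'"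
proof -
  have "(\<Sum>i\<in>UNIV. canonical_metric x (stiefel_field i x) e * canonical_metric x (stiefel_field i x) e') =
     (\<Sum>(u, v)\<in>UNIV. (matrix_unit u v \<bullet> metric_root x e) * (matrix_unit u v \<bullet> metric_root x e'))"
    by (intro sum.cong refl) (auto simp: canonical_metric_field[OF x] e)
  then show ?thesis unfolding sum_matrix_unit_inner metric_root_inner[OF x] .
qed

text \<open>The derivative of the field at \<open>x\<close> in direction \<open>z\<close>. The field
  is a constant plus a quadratic term, so this is bilinear in the point and the direction.\<close>

definition field_derivative :: "'n \<times> 'p \<Rightarrow> real^'p^'n \<Rightarrow> real^'p^'n \<Rightarrow> real^'p^'n"
  where "field_derivative = (\<lambda>(u, v) x z. 
    - stiefel_alpha *\<^sub>R (z ** transpose (matrix_unit u v) ** x + x ** transpose (matrix_unit u v) ** z)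
    - stiefel_beta *\<^sub>R (z ** transpose x ** matrix_unit u v + x ** transpose z ** matrix_unit u v))"

text \<open>The polarization of the geodesic equation
  \<open>Y'' + Y' Y'\<^sup>T Y + Y ((Y\<^sup>T Y')\<^sup>2 + Y'\<^sup>T Y') = 0\<close> of the canonical metric (Edelman, Arias, Smith).\<close>

definition christoffel :: "real^'p^'n \<Rightarrow> real^'p^'n \<Rightarrow> real^'p^'n \<Rightarrow> real^'p^'n"
  where "christoffel x u v = (1/2) *\<^sub>R ((u ** transpose v + v ** transpose u) ** x)
    + (1/2) *\<^sub>R (x ** (transpose u ** x ** (transpose v ** x) + transpose v ** x ** (transpose u ** x) + transpose u ** v + transpose v ** u))"

lemma christoffel_commute: "christoffel x u v = christoffel x v u"
  by (simp add: christoffel_def add_ac)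

text \<open>Exactly the component that offsets the derivative of the tangency condition of a vector
  field; it keeps the connection tangent.\<close>

lemma transpose_mult_christoffel:
  assumes x: "x \<in> stiefel" and u: "u \<in> stiefel_tangent x" and v: "v \<in> stiefel_tangent x"
  shows "transpose x ** christoffel x u v = (1/2) *\<^sub>R (transpose u ** v + transpose v ** u)"
proof -
  have 1: "transpose u ** x = - (transpose x ** u)" "transpose v ** x = - (transpose x ** v)" 
    using stiefel_tangentD u v by auto
  show ?thesis unfolding christoffel_def
    by (simp add: matrix_mult_simps matrix_mul_assoc[symmetric] stiefel_cancel[OF x])
       (simp add: 1 matrix_mult_simps matrix_mul_assoc algebra_simps)
qed

text \<open>Against a tangent \<open>z\<close> every symmetric contribution drops out, because
  \<open>transpose x ** z\<close> is skew. What remains comes from the first bracket of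
  \<open>christoffel\<close>.\<close>

lemma canonical_metric_christoffel:
  assumes x: "x \<in> stiefel" and u: "u \<in> stiefel_tangent x" and v: "v \<in> stiefel_tangent x" and z: "z \<in> stiefel_tangent x"
  shows "canonical_metric x (christoffel x u v) z = 
    - (1/2) * ((transpose x ** v) \<bullet> (transpose u ** z) + (transpose x ** u) \<bullet> (transpose v ** z))"
proof -
  have skew: "transpose (transpose x ** z) = - (transpose x ** z)" using z by (simp add: stiefel_tangent_iff)
  let ?S = "transpose u ** x ** (transpose v ** x) + transpose v ** x ** (transpose u ** x) + transpose u ** v + transpose v ** u"
  have S: "transpose ?S = ?S"
  proof -
    have a: "transpose (transpose u ** x) = - (transpose u ** x)" "transpose (transpose v ** x) = - (transpose v ** x)"
      using stiefel_tangentD[OF u] stiefel_tangentD[OF v] by (simp_all add: matrix_transpose_mul)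
    have b: "transpose (transpose u ** x ** (transpose v ** x)) = transpose v ** x ** (transpose u ** x)"
      "transpose (transpose v ** x ** (transpose u ** x)) = transpose u ** x ** (transpose v ** x)"
      unfolding matrix_transpose_mul[of "transpose u ** x"] matrix_transpose_mul[of "transpose v ** x"] a by (simp_all add: matrix_mult_simps)
    show ?thesis unfolding transpose_simps b by (simp add: matrix_transpose_mul add_ac)
  qed
  have 1: "(x ** ?S) \<bullet> z = 0"
    unfolding inner_matrix_mult_left by (rule inner_sym_skew[OF S skew])
  have 2: "(transpose x ** christoffel x u v) \<bullet> (transpose x ** z) = 0"
    unfolding transpose_mult_christoffel[OF x u v]
    by (rule inner_sym_skew[OF _ skew]) (simp add: transpose_simps matrix_transpose_mul add.commute)
  have 3: "(u ** transpose v ** x) \<bullet> z = - ((transpose x ** v) \<bullet> (transpose u ** z))" if "v \<in> stiefel_tangent x" for u v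
    unfolding matrix_mul_assoc[symmetric] inner_matrix_mult_left[of u] using stiefel_tangentD(1)[OF that] by simp
  have 4: "(u ** transpose v + v ** transpose u) ** x = u ** transpose v ** x + v ** transpose u ** x"
    by (simp add: matrix_mult_simps)
  have 5: "canonical_metric x (christoffel x u v) z = (1/2) * ((u ** transpose v ** x) \<bullet> z + (v ** transpose u ** x) \<bullet> z)"
    unfolding canonical_metric_eq 2 unfolding christoffel_def inner_add_left inner_scaleR_left 1 4 by simp
  show ?thesis unfolding 5 3[OF u] 3[OF v] by (simp add: add_divide_distrib)
qed

text \<open>The right-hand side is the derivative of the metric in its base point along
  \<open>v\<close>. The two terms with \<open>transpose x ** v\<close> cancel since this matrix is
  skew.\<close>

lemma christoffel_metric:
  assumes x: "x \<in> stiefel" and v: "v \<in> stiefel_tangent x" and y: "y \<in> stiefel_tangent x" and z: "z \<in> stiefel_tangent x"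
  shows "canonical_metric x (christoffel x v y) z + canonical_metric x y (christoffel x v z) =
     - (1/2) * ((transpose v ** y) \<bullet> (transpose x ** z) + (transpose x ** y) \<bullet> (transpose v ** z))"
proof -
  have sym: "canonical_metric x a b = canonical_metric x b a" for a b by (simp add: canonical_metric_eq inner_commute)
  have "(transpose x ** v) \<bullet> (transpose z ** y) = transpose (transpose x ** v) \<bullet> transpose (transpose z ** y)" by (simp only: inner_transpose)
  also have "\<dots> = - ((transpose x ** v) \<bullet> (transpose y ** z))"
    by (simp add: matrix_transpose_mul stiefel_tangentD(1)[OF v])
  finally have "(transpose x ** v) \<bullet> (transpose z ** y) = - ((transpose x ** v) \<bullet> (transpose y ** z))" .
  then show ?thesis
    unfolding sym[of y] canonical_metric_christoffel[OF x v y z] canonical_metric_christoffel[OF x v z y] 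
    by (simp add: inner_commute add_divide_distrib diff_divide_distrib)
qed

text \<open>By the sandwich identity the right-hand side sums to zero over the matrix units: both \<open>F F\<close>
  and its transpose sum to the identity, and \<open>E F\<close> sums to \<open>x\<close>.\<close>

lemma field_acceleration:
  fixes x :: "real^'p^'n" and u :: 'n and v :: 'p
  assumes x: "x \<in> stiefel"
  defines "F \<equiv> transpose x ** matrix_unit u v"
  shows "field_derivative (u, v) x (stiefel_field (u, v) x) + christoffel x (stiefel_field (u, v) x) (stiefel_field (u, v) x) =
     - ((matrix_unit u v - x ** F) ** F) - (1/2) *\<^sub>R (x ** (F ** F - transpose (F ** F)))"
proof -
  define E :: "real^'p^'n" where "E = matrix_unit u v"
  \<comment> \<open>The part of \<open>E\<close> orthogonal to the columns of \<open>x\<close>, so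
    that \<open>E = q + x ** F\<close>. The field has the same part \<open>q\<close> and a skew
    coefficient \<open>K\<close> along \<open>x\<close>, and all products reduce to words in q, F
    and K.\<close>
  define q where "q = E - x ** F"
  define K where "K = stiefel_alpha *\<^sub>R (F - transpose F)"
  define s where "s = stiefel_field (u, v) x"
  have F: "transpose x ** E = F" by (simp add: E_def F_def)
  have F': "transpose E ** x = transpose F" by (simp add: F[symmetric] matrix_transpose_mul)
  have K: "transpose K = - K" by (simp add: K_def transpose_simps algebra_simps)
  have xq: "transpose x ** q = 0" by (simp add: q_def matrix_mult_simps stiefel_cancel[OF x] F)
  have qx: "transpose q ** x = 0"
    using arg_cong[OF xq, of transpose] by (simp add: matrix_transpose_mul transpose_simps)
  have E: "E = q + x ** F" by (simp add: q_def)
  have "s = E - stiefel_alpha *\<^sub>R (x ** transpose F) - stiefel_beta *\<^sub>R (x ** F)"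
    unfolding s_def stiefel_field_def F_def E_def by (simp add: matrix_transpose_mul matrix_mul_assoc)
  then have s: "s = q + x ** K"
    by (simp add: q_def K_def matrix_mult_simps stiefel_alpha_beta algebra_simps)
  have xs: "transpose x ** s = K" by (simp add: s matrix_mult_simps xq stiefel_cancel[OF x])
  have sx: "transpose s ** x = - K"
    using arg_cong[OF xs, of transpose] by (simp add: matrix_transpose_mul K)
  have st: "transpose s = transpose q - K ** transpose x"
    by (simp add: s transpose_simps matrix_transpose_mul K matrix_mult_simps)
  have Et: "transpose E = transpose q + transpose F ** transpose x"
    unfolding E transpose_simps matrix_transpose_mul ..
  have Es: "transpose E ** s = transpose q ** q + transpose F ** K"
    unfolding Et matrix_mult_simps matrix_mul_assoc[symmetric] xs
    by (simp add: s matrix_mult_simps matrix_mul_assoc qx)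
  have sE: "transpose s ** E = transpose q ** q - K ** F"
    unfolding st matrix_mult_simps matrix_mul_assoc[symmetric] F
    by (simp add: E matrix_mult_simps matrix_mul_assoc qx)
  have ss: "transpose s ** s = transpose q ** q - K ** K"
    unfolding st matrix_mult_simps matrix_mul_assoc[symmetric] xs
    by (simp add: s matrix_mult_simps matrix_mul_assoc qx)
  have fd: "field_derivative (u, v) x s = - stiefel_alpha *\<^sub>R (s ** transpose F + x ** (transpose q ** q + transpose F ** K))
     - stiefel_beta *\<^sub>R (s ** F + x ** (transpose q ** q - K ** F))"
    by (simp add: field_derivative_def E_def[symmetric] matrix_mul_assoc[symmetric] F F' Es sE)
  have ch: "christoffel x s s = - (s ** K) + x ** (K ** K + (transpose q ** q - K ** K))"
  proof -
    have "christoffel x s s = (1/2) *\<^sub>R (s ** transpose s ** x + s ** transpose s ** x) + 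
       (1/2) *\<^sub>R (x ** (transpose s ** x ** (transpose s ** x) + transpose s ** s) + x ** (transpose s ** x ** (transpose s ** x) + transpose s ** s))"
      by (simp only: christoffel_def matrix_mult_simps add_ac)
    also have "\<dots> = s ** (transpose s ** x) + x ** (transpose s ** x ** (transpose s ** x) + transpose s ** s)"
      by (simp only: scaleR_half_double matrix_mul_assoc)
    also have "\<dots> = - (s ** K) + x ** (K ** K + (transpose q ** q - K ** K))"
      unfolding sx ss by (simp add: matrix_mult_simps)
    finally show ?thesis .
  qed
  have "field_derivative (u, v) x s + christoffel x s s = 
     - (stiefel_alpha *\<^sub>R (q ** transpose F) + stiefel_beta *\<^sub>R (q ** F) + q ** K) - 
     x ** (stiefel_alpha *\<^sub>R (K ** transpose F) + stiefel_alpha *\<^sub>R (transpose F ** K) + K ** K)"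
    unfolding fd ch by (simp add: s matrix_mult_simps matrix_mul_assoc stiefel_alpha_beta algebra_simps)
  \<comment> \<open>The terms with the transpose of \<open>F\<close> cancel, and \<alpha> + \<beta>
    = 1.\<close>
  also have "stiefel_alpha *\<^sub>R (q ** transpose F) + stiefel_beta *\<^sub>R (q ** F) + q ** K = q ** F"
    by (simp add: K_def matrix_mult_simps stiefel_alpha_beta algebra_simps)
  \<comment> \<open>All three products carry the factor \<open>\<alpha>\<^sup>2\<close>, equal to
    1/2, and the mixed products of \<open>F\<close> with its transpose cancel.\<close>
  also have "stiefel_alpha *\<^sub>R (K ** transpose F) + stiefel_alpha *\<^sub>R (transpose F ** K) + K ** K = (1/2) *\<^sub>R (F ** F - transpose (F ** F))"
    by (simp add: K_def matrix_mult_simps matrix_transpose_mul stiefel_alpha_beta algebra_simps)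
  finally show ?thesis by (simp add: s_def q_def E_def matrix_mult_simps)
qed

lemma sum_field_acceleration:
  fixes x :: "real^'p^'n"
  assumes x: "x \<in> stiefel"
  shows "(\<Sum>i\<in>UNIV. field_derivative i x (stiefel_field i x) + christoffel x (stiefel_field i x) (stiefel_field i x)) = 0"
proof -
  let ?E = "\<lambda>i. matrix_unit (fst i) (snd i) :: real^'p^'n"
  let ?G = "\<lambda>i. ?E i ** transpose x ** ?E i"
  have sum: "(\<Sum>i\<in>UNIV. ?G i) = x"
    using sum_matrix_unit_sandwich[of "transpose x"] by (simp add: case_prod_unfold)
  have eq: "field_derivative i x (stiefel_field i x) + christoffel x (stiefel_field i x) (stiefel_field i x) =
     - (?G i) + x ** (transpose x ** ?G i) - (1/2) *\<^sub>R (x ** (transpose x ** ?G i - transpose (transpose x ** ?G i)))" for i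
    using field_acceleration[OF x, of "fst i" "snd i"] by (simp add: matrix_mult_simps matrix_mul_assoc)
  \<comment> \<open>Every acceleration is the same linear map applied to \<open>?G i\<close>, so the
    sum can be taken inside, where it is \<open>x\<close>. At \<open>x\<close> the map gives -x + x
    - 0.\<close>
  have lin: "linear (\<lambda>g. - g + x ** (transpose x ** g) - (1/2) *\<^sub>R (x ** (transpose x ** g - transpose (transpose x ** g))))"
    by (rule linearI) (simp_all add: matrix_mult_simps transpose_simps algebra_simps)
  show ?thesis unfolding eq linear_sum[OF lin, symmetric] sum by (simp add: stiefelD[OF x] matrix_mult_simps)
qed

section \<open>The Levi-Civita connection and the Laplacian\<close>

lemma smooth_on_matrix_mult: "open U \<Longrightarrow> smooth_on U f \<Longrightarrow> smooth_on U g \<Longrightarrow> smooth_on U (\<lambda>x. f x ** g x)"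
  for f :: "'a::real_normed_vector \<Rightarrow> real^'m^'n" and g :: "'a \<Rightarrow> real^'k^'m"
  by (rule smooth_on_bilinear[OF _ bounded_bilinear_matrix_mult])

lemma smooth_on_transpose: "open U \<Longrightarrow> smooth_on U f \<Longrightarrow> smooth_on U (\<lambda>x. transpose (f x))"
  for f :: "'a::real_normed_vector \<Rightarrow> real^'m^'n"
  by (rule smooth_on_bounded_linear[OF _ bounded_linear_transpose])

lemma smooth_on_scaleR_const: "open U \<Longrightarrow> smooth_on U f \<Longrightarrow> smooth_on U (\<lambda>x. c *\<^sub>R f x)"
  by (rule smooth_on_bounded_linear[OF _ bounded_linear_scaleR_right])

lemma smooth_on_diff: "open U \<Longrightarrow> smooth_on U f \<Longrightarrow> smooth_on U g \<Longrightarrow> smooth_on U (\<lambda>x. f x - g x)"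
  using smooth_on_add[of U f "\<lambda>x. (-1) *\<^sub>R g x"] smooth_on_scaleR_const[of U g "-1"] by simp

lemmas smooth_matrix_intros = smooth_on_matrix_mult smooth_on_transpose smooth_on_scaleR_const smooth_on_diff
  smooth_on_add smooth_on_const smooth_on_ident

lemmas has_derivative_matrix_mult = bounded_bilinear.FDERIV[OF bounded_bilinear_matrix_mult]
lemmas has_derivative_transpose = bounded_linear.has_derivative[OF bounded_linear_transpose]

text \<open>The curve is the Cayley transform of a skew matrix \<open>K\<close> with \<open>K x = v\<close>.\<close>

lemma stiefel_curve:
  fixes x v :: "real^'p^'n"
  assumes x: "x \<in> stiefel" and v: "v \<in> stiefel_tangent x"
  obtains \<gamma> where "\<gamma> 0 = x" "\<And>s. \<gamma> s \<in> stiefel" "(\<gamma> has_vector_derivative v) (at 0)"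
proof -
  \<comment> \<open>Half of the component of \<open>v\<close> along \<open>x\<close> is removed,
    because the second term of \<open>K\<close> puts the same half back: for a tangent
    \<open>v\<close> the matrix \<open>transpose x ** v\<close> is skew.\<close>
  define w where "w = v - (1/2) *\<^sub>R (x ** (transpose x ** v))"
  define K where "K = w ** transpose x - x ** transpose w"
  have K: "transpose K = - K" by (simp add: K_def transpose_simps matrix_transpose_mul)
  have wx: "transpose w ** x = (1/2) *\<^sub>R (transpose v ** x)"
  proof -
    have "transpose w ** x = transpose v ** x - (1/2) *\<^sub>R (transpose v ** x ** (transpose x ** x))"
      by (simp add: w_def transpose_simps matrix_mult_simps matrix_transpose_mul matrix_mul_assoc)
    also have "\<dots> = transpose v ** x - (1/2) *\<^sub>R (transpose v ** x)" by (simp add: stiefelD[OF x])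
    also have "\<dots> = (1/2) *\<^sub>R (transpose v ** x)" by (simp add: scaleR_left_diff_distrib[symmetric, of 1 "1/2", simplified])
    finally show ?thesis .
  qed
  have Kx: "K ** x = v"
  proof -
    have "K ** x = w ** (transpose x ** x) - x ** (transpose w ** x)"
      by (simp add: K_def matrix_mult_simps matrix_mul_assoc)
    also have "\<dots> = w + (1/2) *\<^sub>R (x ** (transpose x ** v))"
      unfolding wx stiefel_tangentD(1)[OF v] by (simp add: stiefelD[OF x] matrix_mult_simps)
    finally show ?thesis by (simp add: w_def)
  qed
  have Kinner: "(K ** y) \<bullet> y = 0" for y :: "real^'p^'n"
    using inner_matrix_mult_left[of K y y] by (simp add: K matrix_mult_simps inner_commute)
  \<comment> \<open>The linear map on the left is injective, since for a skew \<open>K\<close> the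
    matrix \<open>K ** y\<close> is orthogonal to \<open>y\<close>, and hence surjective in finite
    dimension.\<close>
  have ex: "\<exists>y. y - c *\<^sub>R (K ** y) = x + c *\<^sub>R (K ** x)" for c
  proof -
    have lin: "linear (\<lambda>y :: real^'p^'n. y - c *\<^sub>R (K ** y))"
      by (rule linearI) (simp_all add: matrix_mult_simps algebra_simps)
    have "inj (\<lambda>y :: real^'p^'n. y - c *\<^sub>R (K ** y))"
      unfolding linear_injective_0[OF lin]
    proof (intro allI impI)
      fix y :: "real^'p^'n" assume "y - c *\<^sub>R (K ** y) = 0"
      then have "y \<bullet> y = (c *\<^sub>R (K ** y)) \<bullet> y" by simp
      also have "\<dots> = 0" by (simp add: Kinner)
      finally show "y = 0" by simp
    qed
    then have "surj (\<lambda>y :: real^'p^'n. y - c *\<^sub>R (K ** y))"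
      using lin by (simp add: linear_injective_imp_surjective)
    from surjD[OF this, of "x + c *\<^sub>R (K ** x)"] show ?thesis by (auto intro: sym)
  qed
  define \<gamma> where "\<gamma> s = (if s = 0 then x else (SOME y. y - (s / 2) *\<^sub>R (K ** y) = x + (s / 2) *\<^sub>R (K ** x)))" for s :: real
  have \<gamma>0: "\<gamma> 0 = x" by (simp add: \<gamma>_def)
  have \<gamma>_eq: "\<gamma> s - x = (s / 2) *\<^sub>R (K ** (\<gamma> s + x))" for s
  proof (cases "s = 0")
    case False
    have "\<gamma> s - (s / 2) *\<^sub>R (K ** \<gamma> s) = x + (s / 2) *\<^sub>R (K ** x)"
      using someI_ex[OF ex[of "s / 2"]] False by (simp add: \<gamma>_def)
    then show ?thesis by (simp add: matrix_mult_simps algebra_simps)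
  qed (simp add: \<gamma>0)
  \<comment> \<open>The implicit equation expresses the difference \<open>?D\<close> by the skew
    \<open>K\<close> and the sum \<open>?S\<close>, so their symmetrised product vanishes. That
    product is twice the difference of the Gram matrices of \<open>\<gamma> s\<close> and
    \<open>x\<close>.\<close>
  have \<gamma>M: "\<gamma> s \<in> stiefel" for s
  proof -
    let ?D = "\<gamma> s - x" and ?S = "\<gamma> s + x"
    have a: "transpose ?S ** ?D = (s / 2) *\<^sub>R (transpose ?S ** K ** ?S)"
      unfolding \<gamma>_eq by (simp add: matrix_mult_simps matrix_mul_assoc)
    have b: "transpose ?D ** ?S = - ((s / 2) *\<^sub>R (transpose ?S ** K ** ?S))"
      unfolding \<gamma>_eq transpose_simps(4) matrix_transpose_mul K by (simp add: matrix_mult_simps scaleR_add_right)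
    have "transpose ?D ** ?S + transpose ?S ** ?D = 0" unfolding a b by simp
    moreover have "transpose ?D ** ?S + transpose ?S ** ?D = 2 *\<^sub>R (transpose (\<gamma> s) ** \<gamma> s - transpose x ** x)"
      by (simp add: matrix_mult_simps transpose_simps scaleR_2 algebra_simps)
    ultimately have "transpose (\<gamma> s) ** \<gamma> s = transpose x ** x" by simp
    then show ?thesis using x by (simp add: stiefel_def)
  qed
  obtain L where L: "0 < L" "\<And>y :: real^'p^'n. norm (K ** y) \<le> norm y * L"
    using bounded_linear.pos_bounded[OF bounded_bilinear.bounded_linear_right[OF bounded_bilinear_matrix_mult, of K]] by blast
  \<comment> \<open>Both points have norm sqrt p, so the implicit equation bounds the displacement
    linearly in s. This gives continuity at 0; the equation divided by s then gives the
    derivative.\<close>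
  have bound: "norm (\<gamma> s - x) \<le> \<bar>s\<bar> * (sqrt (real CARD('p)) * L)" for s
  proof -
    have "norm (\<gamma> s - x) = (\<bar>s\<bar> / 2) * norm (K ** (\<gamma> s + x))" unfolding \<gamma>_eq by simp
    also have "\<dots> \<le> (\<bar>s\<bar> / 2) * ((sqrt (real CARD('p)) + sqrt (real CARD('p))) * L)"
    proof (rule mult_left_mono)
      have "norm (\<gamma> s + x) \<le> sqrt (real CARD('p)) + sqrt (real CARD('p))"
        using norm_triangle_ineq[of "\<gamma> s" x] bounded_stiefel[OF \<gamma>M, of s] bounded_stiefel[OF x] by simp
      then have "norm (\<gamma> s + x) * L \<le> (sqrt (real CARD('p)) + sqrt (real CARD('p))) * L" using L by (intro mult_right_mono) auto
      with L(2)[of "\<gamma> s + x"] show "norm (K ** (\<gamma> s + x)) \<le> (sqrt (real CARD('p)) + sqrt (real CARD('p))) * L" by linarith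
    qed simp
    also have "\<dots> = \<bar>s\<bar> * (sqrt (real CARD('p)) * L)" by (simp add: algebra_simps)
    finally show ?thesis .
  qed
  have lim: "(\<gamma> \<longlongrightarrow> x) (at 0)"
  proof (rule LIM_zero_cancel, rule tendsto_norm_zero_cancel, rule tendsto_sandwich[of "\<lambda>_. 0" _ _ "\<lambda>s. \<bar>s\<bar> * (sqrt (real CARD('p)) * L)"])
    show "((\<lambda>s. \<bar>s\<bar> * (sqrt (real CARD('p)) * L)) \<longlongrightarrow> 0) (at 0)"
      by (rule tendsto_eq_intros refl | simp)+
  qed (use bound in auto)
  have "((\<lambda>s. (1/2) *\<^sub>R (K ** (\<gamma> s + x))) \<longlongrightarrow> (1/2) *\<^sub>R (K ** (x + x))) (at 0)"
    by (intro tendsto_scaleR tendsto_const bounded_bilinear.tendsto[OF bounded_bilinear_matrix_mult] tendsto_add lim)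
  then have lim2: "((\<lambda>s. (1/2) *\<^sub>R (K ** (\<gamma> s + x))) \<longlongrightarrow> v) (at 0)"
    by (simp only: matrix_mult_simps Kx scaleR_half_double)
  have "(\<gamma> has_vector_derivative v) (at 0)"
    unfolding has_vector_derivative_def has_derivative_at
  proof (intro conjI bounded_linear_scaleR_left)
    have "((\<lambda>s. norm ((1/2) *\<^sub>R (K ** (\<gamma> s + x)) - v)) \<longlongrightarrow> 0) (at 0)"
      using lim2 by (intro tendsto_norm_zero) (simp add: LIM_zero_iff)
    then show "(\<lambda>h. norm (\<gamma> (0 + h) - \<gamma> 0 - h *\<^sub>R v) / norm h) \<midarrow>0\<rightarrow> 0"
    proof (rule Lim_transform_eventually)
      show "\<forall>\<^sub>F s in at 0. norm ((1/2) *\<^sub>R (K ** (\<gamma> s + x)) - v) = norm (\<gamma> (0 + s) - \<gamma> 0 - s *\<^sub>R v) / norm s"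
        unfolding eventually_at_filter
      proof (rule always_eventually, intro allI impI)
        fix s :: real assume s: "s \<noteq> 0"
        have "\<gamma> (0 + s) - \<gamma> 0 - s *\<^sub>R v = s *\<^sub>R ((1/2) *\<^sub>R (K ** (\<gamma> s + x)) - v)"
          using \<gamma>_eq[of s] by (simp add: \<gamma>0 scaleR_diff_right)
        then show "norm ((1/2) *\<^sub>R (K ** (\<gamma> s + x)) - v) = norm (\<gamma> (0 + s) - \<gamma> 0 - s *\<^sub>R v) / norm s"
          using s by (simp only: norm_scaleR real_norm_def) simp
      qed
    qed
  qed
  then show thesis using that \<gamma>0 \<gamma>M by blast
qed

text \<open>Composition with a curve in the manifold that has velocity \<open>v\<close> reduces the
  claim to uniqueness of a derivative in one variable.\<close>

lemma tangent_derivative_unique: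
  fixes f :: "real^'p^'n \<Rightarrow> 'b::real_normed_vector"
  assumes x: "x \<in> stiefel" and v: "v \<in> stiefel_tangent x"
    and 1: "(f has_derivative f') (at x within stiefel)" and 2: "(f has_derivative f'') (at x within stiefel)"
  shows "f' v = f'' v"
proof -
  obtain \<gamma> where \<gamma>: "\<gamma> 0 = x" "\<And>s. \<gamma> s \<in> stiefel" "(\<gamma> has_vector_derivative v) (at 0)"
    using stiefel_curve[OF x v] by blast
  have comp: "((\<lambda>s. f (\<gamma> s)) has_derivative (\<lambda>t. d (t *\<^sub>R v))) (at 0)" if "(f has_derivative d) (at x within stiefel)" for d
  proof -
    have "(\<gamma> has_derivative (\<lambda>t. t *\<^sub>R v)) (at 0)" using \<gamma>(3) by (simp add: has_vector_derivative_def)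
    moreover have "(f has_derivative d) (at (\<gamma> 0) within range \<gamma>)"
      unfolding \<gamma>(1) by (rule has_derivative_subset[OF that]) (use \<gamma>(2) in auto)
    ultimately show ?thesis by (rule has_derivative_in_compose)
  qed
  have "(\<lambda>t. f' (t *\<^sub>R v)) = (\<lambda>t. f'' (t *\<^sub>R v))"
    by (rule has_derivative_unique[OF comp[OF 1] comp[OF 2]])
  from fun_cong[OF this, of 1] show ?thesis by simp
qed

text \<open>Frees computations from the choice made in \<open>frechet_derivative\<close>: on tangent
  vectors any derivative within the manifold will do.\<close>

lemma mderiv_eq:
  fixes f :: "real^'p^'n \<Rightarrow> 'b::real_normed_vector"
  assumes "x \<in> stiefel" "v \<in> stiefel_tangent x" "(f has_derivative f') (at x within stiefel)"
  shows "mderiv stiefel f x v = f' v"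
proof -
  have "(f has_derivative frechet_derivative f (at x within stiefel)) (at x within stiefel)"
    using assms(3) frechet_derivative_works differentiable_def by blast
  from tangent_derivative_unique[OF assms(1,2) this assms(3)] show ?thesis by (simp add: mderiv_def)
qed

lemma smooth_has_mderiv:
  assumes "smooth_on_submanifold stiefel f" "x \<in> stiefel"
  shows "(f has_derivative mderiv stiefel f x) (at x within stiefel)"
proof -
  obtain U h where "open U" "x \<in> U" "smooth_on U h" "\<forall>y\<in>U \<inter> stiefel. h y = f y"
    using smooth_on_submanifoldE[OF assms] by blast
  then have "(f has_derivative frechet_derivative h (at x)) (at x within stiefel)"
    using assms(2) by (intro smooth_on_submanifold_has_derivative) auto
  then have "f differentiable (at x within stiefel)" by (auto simp: differentiable_def)
  then have "(f has_derivative frechet_derivative f (at x within stiefel)) (at x within stiefel)"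
    by (simp add: frechet_derivative_works)
  then show ?thesis by (simp add: mderiv_def[abs_def])
qed

lemma mderiv_local:
  fixes f :: "real^'p^'n \<Rightarrow> 'b::real_normed_vector"
  assumes "open U" "x \<in> U" "smooth_on U h" "\<forall>y\<in>U \<inter> stiefel. h y = f y" "x \<in> stiefel" "v \<in> stiefel_tangent x"
  shows "mderiv stiefel f x v = frechet_derivative h (at x) v"
  by (rule mderiv_eq[OF assms(5,6) smooth_on_submanifold_has_derivative[OF assms(1,2,5,3)]]) (use assms(4) in auto)

section \<open>Smooth vector fields on the Stiefel manifold\<close>

lemma svf_tangent: "smooth_vector_field stiefel stiefel_tangent X \<Longrightarrow> x \<in> stiefel \<Longrightarrow> X x \<in> stiefel_tangent x"
  by (simp add: smooth_vector_field_def)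

lemma svf_smooth: "smooth_vector_field stiefel stiefel_tangent X \<Longrightarrow> smooth_on_submanifold stiefel X"
  by (simp add: smooth_vector_field_def)

lemma stiefel_field_has_derivative:
  "(stiefel_field i has_derivative field_derivative i x) (at x within M)"
proof -
  obtain u v where i: "i = (u, v)" by (cases i)
  show ?thesis
    unfolding i stiefel_field_def field_derivative_def prod.case
    by (rule has_derivative_eq_rhs, (rule has_derivative_diff has_derivative_const has_derivative_scaleR_right
          has_derivative_matrix_mult has_derivative_transpose has_derivative_ident)+)
       (auto simp: matrix_mult_simps transpose_simps algebra_simps)
qed

lemma stiefel_field_smooth: "smooth_on UNIV (stiefel_field i)"
proof -
  obtain u v where i: "i = (u, v)" by (cases i)
  show ?thesis unfolding i stiefel_field_def prod.case by (intro smooth_matrix_intros open_UNIV)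
qed

lemma stiefel_field_svf: "smooth_vector_field stiefel stiefel_tangent (stiefel_field i)"
  unfolding smooth_vector_field_def
  using smooth_on_submanifoldI[OF open_UNIV _ stiefel_field_smooth] stiefel_field_tangent by blast

text \<open>At a point \<open>x\<close> of the manifold this is the Euclidean orthogonal projection
  onto the tangent space. Its purpose is to extend a single tangent vector \<open>z\<close> to a
  smooth vector field on the whole manifold.\<close>

definition tangent_projection :: "real^'p^'n \<Rightarrow> real^'p^'n \<Rightarrow> real^'p^'n"
  where "tangent_projection x z = z - (1/2) *\<^sub>R (x ** (transpose x ** z + transpose z ** x))"

lemma tangent_projection_id: "z \<in> stiefel_tangent x \<Longrightarrow> tangent_projection x z = z"
  by (simp add: tangent_projection_def stiefel_tangentD(1) matrix_mult_simps)

lemma tangent_projection_svf: "smooth_vector_field stiefel stiefel_tangent (\<lambda>x. tangent_projection x z)"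
  unfolding smooth_vector_field_def
proof (intro conjI ballI)
  have "smooth_on UNIV (\<lambda>x. tangent_projection x z)"
    unfolding tangent_projection_def by (intro smooth_matrix_intros open_UNIV)
  then show "smooth_on_submanifold stiefel (\<lambda>x. tangent_projection x z)"
    by (intro smooth_on_submanifoldI[OF open_UNIV]) auto
  fix x :: "real^'a^'b" assume x: "x \<in> stiefel"
  have eq: "transpose x ** tangent_projection x z = (1/2) *\<^sub>R (transpose x ** z - transpose z ** x)"
  proof -
    have "transpose x ** tangent_projection x z = transpose x ** z - (1/2) *\<^sub>R (transpose x ** z + transpose z ** x)"
      by (simp add: tangent_projection_def matrix_mult_simps stiefel_cancel[OF x])
    also have "transpose x ** z = (1/2) *\<^sub>R (transpose x ** z + transpose x ** z)" by (simp only: scaleR_half_double)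
    finally show ?thesis by (simp add: scaleR_diff_right scaleR_add_right)
  qed
  show "tangent_projection x z \<in> stiefel_tangent x"
    unfolding stiefel_tangent_iff eq by (simp add: transpose_simps matrix_transpose_mul algebra_simps)
qed

section \<open>The connection of the canonical metric\<close>

definition stiefel_connection :: "real^'p^'n \<Rightarrow> real^'p^'n \<Rightarrow> (real^'p^'n \<Rightarrow> real^'p^'n) \<Rightarrow> real^'p^'n"
  where "stiefel_connection x v Y = mderiv stiefel Y x v + christoffel x v (Y x)"

lemma christoffel_linear1: "linear (\<lambda>u. christoffel x u v)"
  by (rule linearI) (simp_all add: christoffel_def matrix_mult_simps transpose_simps algebra_simps)

lemma christoffel_linear2: "linear (\<lambda>v. christoffel x u v)"
  by (rule linearI) (simp_all add: christoffel_def matrix_mult_simps transpose_simps algebra_simps)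

lemma linear_mderiv: "smooth_on_submanifold stiefel Y \<Longrightarrow> x \<in> stiefel \<Longrightarrow> linear (mderiv stiefel Y x)"
  using smooth_has_mderiv has_derivative_linear by blast

lemma linear_stiefel_connection:
  assumes "smooth_on_submanifold stiefel Y" "x \<in> stiefel"
  shows "linear (\<lambda>v. stiefel_connection x v Y)"
  unfolding stiefel_connection_def
  by (rule linear_compose_add[OF linear_mderiv[OF assms] christoffel_linear1])

lemma canonical_metric_bilinear:
  "canonical_metric x (a + b) c = canonical_metric x a c + canonical_metric x b c"
  "canonical_metric x (a - b) c = canonical_metric x a c - canonical_metric x b c"
  "canonical_metric x (r *\<^sub>R a) c = r * canonical_metric x a c"
  "canonical_metric x c (a + b) = canonical_metric x c a + canonical_metric x c b"
  "canonical_metric x c (a - b) = canonical_metric x c a - canonical_metric x c b"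
  "canonical_metric x c (r *\<^sub>R a) = r * canonical_metric x c a"
  by (simp_all add: canonical_metric_eq matrix_mult_simps inner_add_left inner_add_right inner_diff_left inner_diff_right algebra_simps)

lemma canonical_metric_commute: "canonical_metric x a b = canonical_metric x b a"
  by (simp add: canonical_metric_eq inner_commute)

text \<open>Differentiate the tangency condition of \<open>Y\<close> along \<open>v\<close>. The
  symmetric defect of the ambient derivative is the negative of
  \<open>transpose v ** Y x + transpose (Y x) ** v\<close>, and the Christoffel term contributes
  this sum, one half from each of two transposed copies.\<close>

lemma stiefel_connection_tangent:
  assumes Y: "smooth_vector_field stiefel stiefel_tangent Y" and x: "x \<in> stiefel" and v: "v \<in> stiefel_tangent x"
  shows "stiefel_connection x v Y \<in> stiefel_tangent x"
proof -
  let ?D = "mderiv stiefel Y x"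
  let ?c = "\<lambda>y. transpose (Y y) ** y + transpose y ** Y y"
  have DY: "(Y has_derivative ?D) (at x within stiefel)" by (rule smooth_has_mderiv[OF svf_smooth[OF Y] x])
  have 1: "(?c has_derivative (\<lambda>h. (transpose (Y x) ** h + transpose (?D h) ** x) + (transpose x ** ?D h + transpose h ** Y x))) (at x within stiefel)"
    by (intro has_derivative_add has_derivative_matrix_mult has_derivative_transpose has_derivative_ident DY)
  have 2: "(?c has_derivative (\<lambda>_. 0)) (at x within stiefel)"
  proof (rule has_derivative_transform[OF x])
    show "?c y = 0" if "y \<in> stiefel" for y using svf_tangent[OF Y that] by (simp add: stiefel_tangent_def)
  qed (rule has_derivative_const)
  have "(transpose (Y x) ** v + transpose (?D v) ** x) + (transpose x ** ?D v + transpose v ** Y x) = 0"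
    using tangent_derivative_unique[OF x v 1 2] .
  then have D: "transpose (?D v) ** x + transpose x ** ?D v = - (transpose v ** Y x + transpose (Y x) ** v)"
    by (subst eq_neg_iff_add_eq_0) (simp add: add_ac)
  let ?G = "christoffel x v (Y x)"
  have G: "transpose x ** ?G = (1/2) *\<^sub>R (transpose v ** Y x + transpose (Y x) ** v)"
    by (rule transpose_mult_christoffel[OF x v svf_tangent[OF Y x]])
  have "transpose ?G ** x = transpose (transpose x ** ?G)" by (simp add: matrix_transpose_mul)
  also have "\<dots> = (1/2) *\<^sub>R (transpose v ** Y x + transpose (Y x) ** v)"
    unfolding G by (simp add: transpose_simps matrix_transpose_mul add.commute)
  finally have "transpose ?G ** x + transpose x ** ?G = transpose v ** Y x + transpose (Y x) ** v"
    unfolding G by (simp flip: scaleR_add_left)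
  then have "(transpose (?D v) ** x + transpose x ** ?D v) + (transpose ?G ** x + transpose x ** ?G) = 0"
    unfolding D by simp
  then show ?thesis
    unfolding stiefel_connection_def stiefel_tangent_def by (simp add: transpose_simps matrix_mult_simps add_ac)
qed

text \<open>On tangent directions the derivatives within the manifold agree with those of a local
  extension of \<open>Y\<close>, and the formula for the extensions is smooth in the ambient
  space.\<close>

lemma stiefel_connection_smooth:
  assumes X: "smooth_vector_field stiefel stiefel_tangent X" and Y: "smooth_vector_field stiefel stiefel_tangent Y"
  shows "smooth_vector_field stiefel stiefel_tangent (\<lambda>x. stiefel_connection x (X x) Y)"
  unfolding smooth_vector_field_def
proof (intro conjI ballI)
  show "smooth_on_submanifold stiefel (\<lambda>x. stiefel_connection x (X x) Y)"
  proof (rule smooth_on_submanifold_local)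
    fix x :: "real^'a^'b" assume x: "x \<in> stiefel"
    obtain U X' Y' where U: "open U" "x \<in> U" "smooth_on U X'" "smooth_on U Y'" "\<forall>y\<in>U \<inter> stiefel. X' y = X y" "\<forall>y\<in>U \<inter> stiefel. Y' y = Y y"
      using smooth_on_submanifold_pair[OF svf_smooth[OF X] svf_smooth[OF Y] x] by blast
    let ?h = "\<lambda>y. frechet_derivative Y' (at y) (X' y) + christoffel y (X' y) (Y' y)"
    have "smooth_on U (\<lambda>y. christoffel y (X' y) (Y' y))"
      unfolding christoffel_def by (intro smooth_matrix_intros U)
    then have "smooth_on U ?h"
      by (rule smooth_on_add[OF U(1) smooth_on_directional[OF U(1,4,3)]])
    moreover have "?h y = stiefel_connection y (X y) Y" if "y \<in> U \<inter> stiefel" for y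
      using mderiv_local[OF U(1) _ U(4,6), of y "X y"] that svf_tangent[OF X, of y] U(5,6)
      by (simp add: stiefel_connection_def)
    ultimately show "\<exists>U h. open U \<and> x \<in> U \<and> smooth_on U h \<and> (\<forall>y\<in>U \<inter> stiefel. h y = stiefel_connection y (X y) Y)"
      using U(1,2) by blast
  qed
qed (rule stiefel_connection_tangent[OF Y _ svf_tangent[OF X]])

text \<open>Besides \<open>Y\<close> and \<open>Z\<close> the product rule differentiates the base
  point of the metric; by \<open>christoffel_metric\<close> the Christoffel terms account for
  precisely this.\<close>

lemma stiefel_connection_metric:
  assumes Y: "smooth_vector_field stiefel stiefel_tangent Y" and Z: "smooth_vector_field stiefel stiefel_tangent Z"
    and x: "x \<in> stiefel" and v: "v \<in> stiefel_tangent x"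
  shows "mderiv stiefel (\<lambda>y. canonical_metric y (Y y) (Z y)) x v =
    canonical_metric x (stiefel_connection x v Y) (Z x) + canonical_metric x (Y x) (stiefel_connection x v Z)"
proof -
  let ?DY = "mderiv stiefel Y x" and ?DZ = "mderiv stiefel Z x"
  have DY: "(Y has_derivative ?DY) (at x within stiefel)" by (rule smooth_has_mderiv[OF svf_smooth[OF Y] x])
  have DZ: "(Z has_derivative ?DZ) (at x within stiefel)" by (rule smooth_has_mderiv[OF svf_smooth[OF Z] x])
  have "((\<lambda>y. canonical_metric y (Y y) (Z y)) has_derivative (\<lambda>h. (Y x \<bullet> ?DZ h + ?DY h \<bullet> Z x) - (1/2) * 
     ((transpose x ** Y x) \<bullet> (transpose x ** ?DZ h + transpose h ** Z x) + (transpose x ** ?DY h + transpose h ** Y x) \<bullet> (transpose x ** Z x)))) (at x within stiefel)"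
    unfolding canonical_metric_eq
    by (intro has_derivative_diff has_derivative_inner has_derivative_mult_right has_derivative_matrix_mult has_derivative_transpose has_derivative_ident DY DZ)
  from mderiv_eq[OF x v this]
  have "mderiv stiefel (\<lambda>y. canonical_metric y (Y y) (Z y)) x v = canonical_metric x (?DY v) (Z x) + canonical_metric x (Y x) (?DZ v)
     - (1/2) * ((transpose v ** Y x) \<bullet> (transpose x ** Z x) + (transpose x ** Y x) \<bullet> (transpose v ** Z x))"
    by (simp add: canonical_metric_eq inner_add_left inner_add_right add_divide_distrib)
  also have "\<dots> = canonical_metric x (?DY v) (Z x) + canonical_metric x (Y x) (?DZ v) + 
     (canonical_metric x (christoffel x v (Y x)) (Z x) + canonical_metric x (Y x) (christoffel x v (Z x)))"
    unfolding christoffel_metric[OF x v svf_tangent[OF Y x] svf_tangent[OF Z x]] by simp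
  finally show ?thesis by (simp add: stiefel_connection_def canonical_metric_bilinear)
qed

lemma stiefel_connection_levi_civita:
  "is_levi_civita stiefel stiefel_tangent canonical_metric
     (stiefel_connection :: real^'p^'n \<Rightarrow> real^'p^'n \<Rightarrow> (real^'p^'n \<Rightarrow> real^'p^'n) \<Rightarrow> real^'p^'n)"
  unfolding is_levi_civita_def affine_connection_def
proof (intro conjI allI impI ballI)
  fix X Y :: "real^'p^'n \<Rightarrow> real^'p^'n"
  assume X: "smooth_vector_field stiefel stiefel_tangent X" and Y: "smooth_vector_field stiefel stiefel_tangent Y"
  show "smooth_vector_field stiefel stiefel_tangent (\<lambda>x. stiefel_connection x (X x) Y)"
    by (rule stiefel_connection_smooth[OF X Y])
  fix x :: "real^'p^'n" assume x: "x \<in> stiefel"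
  show "stiefel_connection x (X x) Y - stiefel_connection x (Y x) X = lie_bracket stiefel X Y x"
    by (simp add: stiefel_connection_def lie_bracket_def christoffel_commute[of x "Y x"])
next
  fix Y :: "real^'p^'n \<Rightarrow> real^'p^'n" and x u v :: "real^'p^'n" and a b :: real
  assume Y: "smooth_vector_field stiefel stiefel_tangent Y" and x: "x \<in> stiefel"
  note L = linear_stiefel_connection[OF svf_smooth[OF Y] x]
  show "stiefel_connection x (a *\<^sub>R u + b *\<^sub>R v) Y = a *\<^sub>R stiefel_connection x u Y + b *\<^sub>R stiefel_connection x v Y"
    by (simp add: linear_add[OF L] linear_cmul[OF L])
next
  fix Y Z :: "real^'p^'n \<Rightarrow> real^'p^'n" and x v :: "real^'p^'n"
  assume Y: "smooth_vector_field stiefel stiefel_tangent Y" and Z: "smooth_vector_field stiefel stiefel_tangent Z" 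
    and x: "x \<in> stiefel" and v: "v \<in> stiefel_tangent x"
  have "mderiv stiefel (\<lambda>y. Y y + Z y) x v = mderiv stiefel Y x v + mderiv stiefel Z x v"
    by (rule mderiv_eq[OF x v has_derivative_add[OF smooth_has_mderiv[OF svf_smooth[OF Y] x] smooth_has_mderiv[OF svf_smooth[OF Z] x]]])
  then show "stiefel_connection x v (\<lambda>y. Y y + Z y) = stiefel_connection x v Y + stiefel_connection x v Z"
    by (simp add: stiefel_connection_def linear_add[OF christoffel_linear2])
  show "mderiv stiefel (\<lambda>y. canonical_metric y (Y y) (Z y)) x v =
    canonical_metric x (stiefel_connection x v Y) (Z x) + canonical_metric x (Y x) (stiefel_connection x v Z)"
    by (rule stiefel_connection_metric[OF Y Z x v])
next
  fix f :: "real^'p^'n \<Rightarrow> real" and Y :: "real^'p^'n \<Rightarrow> real^'p^'n" and x v :: "real^'p^'n"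
  assume f: "smooth_on_submanifold stiefel f" and Y: "smooth_vector_field stiefel stiefel_tangent Y"
    and x: "x \<in> stiefel" and v: "v \<in> stiefel_tangent x"
  have "mderiv stiefel (\<lambda>y. f y *\<^sub>R Y y) x v = f x *\<^sub>R mderiv stiefel Y x v + mderiv stiefel f x v *\<^sub>R Y x"
    by (rule mderiv_eq[OF x v has_derivative_scaleR[OF smooth_has_mderiv[OF f x] smooth_has_mderiv[OF svf_smooth[OF Y] x]]])
  then show "stiefel_connection x v (\<lambda>y. f y *\<^sub>R Y y) = mderiv stiefel f x v *\<^sub>R Y x + f x *\<^sub>R stiefel_connection x v Y"
    by (simp add: stiefel_connection_def linear_cmul[OF christoffel_linear2] scaleR_add_right)
qed

section \<open>Uniqueness of the Levi-Civita connection\<close>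

lemma is_levi_civita_smooth:
  "is_levi_civita M T g D \<Longrightarrow> smooth_vector_field M T X \<Longrightarrow> smooth_vector_field M T Y \<Longrightarrow>
    smooth_vector_field M T (\<lambda>x. D x (X x) Y)"
  by (simp add: is_levi_civita_def affine_connection_def)

lemma is_levi_civita_torsion:
  "is_levi_civita M T g D \<Longrightarrow> smooth_vector_field M T X \<Longrightarrow> smooth_vector_field M T Y \<Longrightarrow> x \<in> M \<Longrightarrow>
    D x (X x) Y - D x (Y x) X = lie_bracket M X Y x"
  by (simp add: is_levi_civita_def)

lemma is_levi_civita_metric:
  "is_levi_civita M T g D \<Longrightarrow> smooth_vector_field M T Y \<Longrightarrow> smooth_vector_field M T Z \<Longrightarrow> x \<in> M \<Longrightarrow> v \<in> T x \<Longrightarrow>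
    mderiv M (\<lambda>y. g y (Y y) (Z y)) x v = g x (D x v Y) (Z x) + g x (Y x) (D x v Z)"
  by (simp add: is_levi_civita_def)

text \<open>The difference of the two connections is symmetric in its two fields because the
  torsions agree, and its metric product with a third field is skew in the last two because both are
  metric. An expression in three fields with these symmetries is its own negative; it is tested on
  fields through the given vectors.\<close>

lemma levi_civita_unique:
  fixes D1 D2 :: "real^'p^'n \<Rightarrow> real^'p^'n \<Rightarrow> (real^'p^'n \<Rightarrow> real^'p^'n) \<Rightarrow> real^'p^'n"
  assumes D1: "is_levi_civita stiefel stiefel_tangent canonical_metric D1"
    and D2: "is_levi_civita stiefel stiefel_tangent canonical_metric D2"
    and Y: "smooth_vector_field stiefel stiefel_tangent Y" and x: "x \<in> stiefel" and v: "v \<in> stiefel_tangent x"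
  shows "D1 x v Y = D2 x v Y"
proof -
  define S where "S a Y = D1 x a Y - D2 x a Y" for a Y
  define t where "t X Y Z = canonical_metric x (S (X x) Y) (Z x)" for X Y Z
  let ?svf = "smooth_vector_field stiefel stiefel_tangent :: (real^'p^'n \<Rightarrow> real^'p^'n) \<Rightarrow> bool"
  \<comment> \<open>The axioms give tangency for derivatives along vector fields; the single vector
    \<open>a\<close> is therefore extended by \<open>tangent_projection\<close>.\<close>
  have S_tangent: "S a Y \<in> stiefel_tangent x" if "?svf Y" "a \<in> stiefel_tangent x" for a Y
  proof -
    have "?svf (\<lambda>y. D y (tangent_projection y a) Y)" if "is_levi_civita stiefel stiefel_tangent canonical_metric D" for D
      by (rule is_levi_civita_smooth[OF that tangent_projection_svf]) fact
    from svf_tangent[OF this[OF D1] x] svf_tangent[OF this[OF D2] x] show ?thesis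
      unfolding S_def by (simp add: subspace_diff[OF subspace_stiefel_tangent] tangent_projection_id[OF that(2)])
  qed
  have sym: "t X Y Z = t Y X Z" if "?svf X" "?svf Y" for X Y Z
  proof -
    have "D1 x (X x) Y - D1 x (Y x) X = D2 x (X x) Y - D2 x (Y x) X"
      by (simp only: is_levi_civita_torsion[OF D1 that x] is_levi_civita_torsion[OF D2 that x])
    then have "S (X x) Y = S (Y x) X" by (simp add: S_def algebra_simps)
    then show ?thesis by (simp add: t_def)
  qed
  have skew: "t X Y Z = - t X Z Y" if "?svf X" "?svf Y" "?svf Z" for X Y Z
  proof -
    have "mderiv stiefel (\<lambda>y. canonical_metric y (Y y) (Z y)) x (X x) = canonical_metric x (D x (X x) Y) (Z x) + canonical_metric x (Y x) (D x (X x) Z)"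
      if "is_levi_civita stiefel stiefel_tangent canonical_metric D" for D
      by (rule is_levi_civita_metric[OF that _ _ x svf_tangent[OF _ x]]) fact+
    from this[OF D1] this[OF D2] have "canonical_metric x (S (X x) Y) (Z x) + canonical_metric x (Y x) (S (X x) Z) = 0"
      by (simp add: S_def canonical_metric_bilinear)
    then show ?thesis by (simp add: t_def canonical_metric_commute[of x "Y x"])
  qed
  have zero: "t X Y Z = 0" if "?svf X" "?svf Y" "?svf Z" for X Y Z
  proof -
    \<comment> \<open>Three exchanges of each kind bring the fields back to their order with the
      sign reversed.\<close>
    have "t X Y Z = t Y X Z" by (rule sym) fact+
    also have "\<dots> = - t Y Z X" by (rule skew) fact+
    also have "t Y Z X = t Z Y X" by (rule sym) fact+
    also have "t Z Y X = - t Z X Y" by (rule skew) fact+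
    also have "t Z X Y = t X Z Y" by (rule sym) fact+
    also have "t X Z Y = - t X Y Z" by (rule skew) fact+
    finally show ?thesis by simp
  qed
  let ?X = "\<lambda>y. tangent_projection y v" and ?Z = "\<lambda>y. tangent_projection y (S v Y)"
  have "t ?X Y ?Z = 0" by (rule zero[OF tangent_projection_svf Y tangent_projection_svf])
  then have "canonical_metric x (S v Y) (S v Y) = 0"
    by (simp add: t_def tangent_projection_id[OF v] tangent_projection_id[OF S_tangent[OF Y v]])
  then have "S v Y = 0" by (rule canonical_metric_pos[OF x])
  then show ?thesis by (simp add: S_def)
qed

text \<open>The choice in \<open>levi_civita\<close> is harmless: a connection with the property
  exists, and any two agree on smooth fields and tangent vectors.\<close>

lemma levi_civita_stiefel:
  assumes "smooth_vector_field stiefel stiefel_tangent Y" "x \<in> stiefel" "v \<in> stiefel_tangent x"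
  shows "levi_civita stiefel stiefel_tangent canonical_metric x v Y = stiefel_connection x v Y"
proof (rule levi_civita_unique[OF _ stiefel_connection_levi_civita assms])
  show "is_levi_civita stiefel stiefel_tangent canonical_metric (levi_civita stiefel stiefel_tangent canonical_metric :: real^'a^'b \<Rightarrow> _)"
    unfolding levi_civita_def
    by (rule someI[of "is_levi_civita stiefel stiefel_tangent canonical_metric", OF stiefel_connection_levi_civita])
qed

text \<open>\<open>metric_root x\<close> is injective and carries the canonical metric to the
  Euclidean one, so an orthonormal basis of the image of the tangent space can be pulled
  back.\<close>

lemma orthonormal_basis_exists:
  assumes x: "x \<in> stiefel"
  shows "\<exists>E. orthonormal_basis (stiefel_tangent x) (canonical_metric x) E"
proof -
  let ?R = "metric_root x" and ?T = "stiefel_tangent x"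
  have inj: "inj ?R"
    unfolding linear_injective_0[OF linear_metric_root] using metric_root_eq_0[OF x] by blast
  have sub: "subspace (?R ` ?T)" by (rule linear_subspace_image[OF linear_metric_root subspace_stiefel_tangent])
  obtain B where B: "B \<subseteq> ?R ` ?T" "pairwise orthogonal B" "\<And>b. b \<in> B \<Longrightarrow> norm b = 1" "independent B" "span B = ?R ` ?T"
    using orthonormal_basis_subspace[OF sub] by metis
  obtain E where E: "E \<subseteq> ?T" "B = ?R ` E" using B(1) by (auto simp: subset_image_iff)
  have "finite E" using independent_imp_finite[OF B(4)] E(2) inj finite_image_iff inj_on_subset by (metis subset_UNIV)
  moreover have "span E = ?T"
  proof -
    have "?R ` span E = ?R ` ?T" using linear_span_image[OF linear_metric_root, of x E] B(5) E(2) by simp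
    then show ?thesis using inj by (simp add: inj_image_eq_iff)
  qed
  moreover have "canonical_metric x e e' = (if e = e' then 1 else 0)" if "e \<in> E" "e' \<in> E" for e e'
  proof -
    have "?R e \<in> B" "?R e' \<in> B" using that E by auto
    moreover have "?R e = ?R e' \<longleftrightarrow> e = e'" using inj by (auto dest: injD)
    ultimately show ?thesis unfolding metric_root_inner[OF x, symmetric]
      using B(2,3) by (auto simp: pairwise_def orthogonal_def dot_square_norm)
  qed
  ultimately show ?thesis unfolding orthonormal_basis_def by blast
qed

section \<open>Divergence, gradient and Laplacian\<close>

lemma orthonormal_expansion:
  assumes E: "orthonormal_basis (stiefel_tangent x) (canonical_metric x) E" and v: "v \<in> stiefel_tangent x"
  shows "v = (\<Sum>e\<in>E. canonical_metric x v e *\<^sub>R e)"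
proof -
  have fin: "finite E" and sp: "span E = stiefel_tangent x" 
    and on: "\<And>e e'. e \<in> E \<Longrightarrow> e' \<in> E \<Longrightarrow> canonical_metric x e e' = (if e = e' then 1 else 0)"
    using E unfolding orthonormal_basis_def by auto
  obtain c where c: "v = (\<Sum>e\<in>E. c e *\<^sub>R e)" using v unfolding sp[symmetric] span_finite[OF fin] by auto
  have lin: "linear (\<lambda>w. canonical_metric x w e)" for e by (rule linearI) (simp_all add: canonical_metric_bilinear)
  have "canonical_metric x v e' = c e'" if e': "e' \<in> E" for e'
  proof -
    have "canonical_metric x v e' = (\<Sum>e\<in>E. c e * canonical_metric x e e')"
      unfolding c linear_sum[OF lin] canonical_metric_bilinear(3) ..
    also have "\<dots> = (\<Sum>e\<in>E. if e = e' then c e else 0)" by (intro sum.cong refl) (auto simp: on e')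
    finally show ?thesis using fin e' by simp
  qed
  then show ?thesis using c by simp
qed

text \<open>Expand each field in the chosen basis; by \<open>sum_canonical_metric_field\<close> the
  sum over the fields turns the coefficients into the Gram matrix of the basis. The trace may thus
  be taken over the diffusion fields.\<close>

lemma divergence_stiefel:
  assumes Y: "smooth_vector_field stiefel stiefel_tangent Y" and x: "x \<in> stiefel"
  shows "riemannian_divergence stiefel stiefel_tangent canonical_metric Y x =
     (\<Sum>i\<in>UNIV. canonical_metric x (stiefel_connection x (stiefel_field i x) Y) (stiefel_field i x))"
proof -
  define E where "E = (SOME E. orthonormal_basis (stiefel_tangent x) (canonical_metric x) E)"
  have E: "orthonormal_basis (stiefel_tangent x) (canonical_metric x) E"
    unfolding E_def by (rule someI_ex[OF orthonormal_basis_exists[OF x]])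
  have fin: "finite E" and ET: "\<And>e. e \<in> E \<Longrightarrow> e \<in> stiefel_tangent x"
    and on: "\<And>e e'. e \<in> E \<Longrightarrow> e' \<in> E \<Longrightarrow> canonical_metric x e e' = (if e = e' then 1 else 0)"
    using E span_base unfolding orthonormal_basis_def by auto
  let ?g = "canonical_metric x" and ?s = "\<lambda>i. stiefel_field i x"
  define b where "b u = stiefel_connection x u Y" for u
  have b: "linear b" unfolding b_def by (rule linear_stiefel_connection[OF svf_smooth[OF Y] x])
  have gl: "linear (\<lambda>w. ?g w c)" and gr: "linear (\<lambda>w. ?g c w)" for c
    by (rule linearI; simp add: canonical_metric_bilinear)+
  have "?g (b (?s i)) (?s i) = (\<Sum>e\<in>E. \<Sum>e'\<in>E. ?g (?s i) e * ?g (?s i) e' * ?g (b e) e')" for i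
  proof -
    have "?g (b (?s i)) (?s i) = ?g (b (\<Sum>e\<in>E. ?g (?s i) e *\<^sub>R e)) (\<Sum>e\<in>E. ?g (?s i) e *\<^sub>R e)"
      using orthonormal_expansion[OF E stiefel_field_tangent[OF x, of i]] by simp
    also have "\<dots> = (\<Sum>e\<in>E. \<Sum>e'\<in>E. ?g (?s i) e * (?g (?s i) e' * ?g (b e) e'))"
      unfolding linear_sum[OF b] linear_cmul[OF b] linear_sum[OF gl] canonical_metric_bilinear(3) linear_sum[OF gr] canonical_metric_bilinear(6) sum_distrib_left
      by (subst sum.swap) (simp add: mult_ac)
    finally show ?thesis by (simp only: mult.assoc)
  qed
  then have "(\<Sum>i\<in>UNIV. ?g (b (?s i)) (?s i)) = (\<Sum>i\<in>UNIV. \<Sum>e\<in>E. \<Sum>e'\<in>E. ?g (?s i) e * ?g (?s i) e' * ?g (b e) e')"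
    by simp
  also have "\<dots> = (\<Sum>e\<in>E. \<Sum>i\<in>UNIV. \<Sum>e'\<in>E. ?g (?s i) e * ?g (?s i) e' * ?g (b e) e')"
    by (rule sum.swap)
  also have "\<dots> = (\<Sum>e\<in>E. \<Sum>e'\<in>E. \<Sum>i\<in>UNIV. ?g (?s i) e * ?g (?s i) e' * ?g (b e) e')"
    by (intro sum.cong refl sum.swap)
  also have "\<dots> = (\<Sum>e\<in>E. \<Sum>e'\<in>E. ?g e e' * ?g (b e) e')"
    unfolding sum_distrib_right[symmetric] by (intro sum.cong refl) (simp add: sum_canonical_metric_field[OF x] ET)
  also have "\<dots> = (\<Sum>e\<in>E. \<Sum>e'\<in>E. if e = e' then ?g (b e) e' else 0)"
    by (intro sum.cong refl) (auto simp: on)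
  also have "\<dots> = (\<Sum>e\<in>E. ?g (b e) e)" using fin by (intro sum.cong refl) simp
  also have "\<dots> = riemannian_divergence stiefel stiefel_tangent canonical_metric Y x"
    unfolding riemannian_divergence_def E_def[symmetric] by (intro sum.cong refl) (simp add: levi_civita_stiefel[OF Y x ET] b_def)
  finally show ?thesis by (simp add: b_def)
qed

definition euclidean_gradient :: "('a::euclidean_space \<Rightarrow> real) \<Rightarrow> 'a \<Rightarrow> 'a"
  where "euclidean_gradient h x = (\<Sum>b\<in>Basis. frechet_derivative h (at x) b *\<^sub>R b)"

lemma euclidean_gradient_inner:
  assumes "h differentiable (at x)" shows "euclidean_gradient h x \<bullet> v = frechet_derivative h (at x) v"
  unfolding euclidean_gradient_def frechet_derivative_expansion[OF assms, of v]
  by (simp add: inner_sum_left inner_commute[of v] mult.commute)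

text \<open>The correction \<open>x ** transpose G ** x\<close> makes the vector tangent, and in the
  metric product with a tangent \<open>u\<close> it cancels against the term subtracted in the
  metric, leaving \<open>G \<bullet> u\<close>. Definiteness of the metric gives uniqueness.\<close>

lemma gradient_stiefel_local:
  assumes U: "open U" "x \<in> U" "smooth_on U h" "\<forall>y\<in>U \<inter> stiefel. h y = \<phi> y" and x: "x \<in> stiefel"
  defines "G \<equiv> euclidean_gradient h x"
  shows "riemannian_gradient stiefel stiefel_tangent canonical_metric \<phi> x = G - x ** transpose G ** x"
    and "G - x ** transpose G ** x \<in> stiefel_tangent x"
    and "u \<in> stiefel_tangent x \<Longrightarrow> canonical_metric x (G - x ** transpose G ** x) u = mderiv stiefel \<phi> x u"
proof -
  let ?v = "G - x ** transpose G ** x"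
  have xv: "transpose x ** ?v = transpose x ** G - transpose G ** x"
    by (simp add: matrix_mult_simps matrix_mul_assoc[symmetric] stiefel_cancel[OF x])
  show tan: "?v \<in> stiefel_tangent x"
    unfolding stiefel_tangent_iff xv by (simp add: transpose_simps matrix_transpose_mul)
  have dh: "h differentiable (at x)" using smooth_on_has_derivative[OF U(3,2)] by (auto simp: differentiable_def)
  have g: "canonical_metric x ?v u = mderiv stiefel \<phi> x u" if u: "u \<in> stiefel_tangent x" for u
  proof -
    let ?k = "transpose x ** u"
    have k: "transpose ?k = - ?k" using u by (simp add: stiefel_tangent_iff)
    have 1: "(transpose G ** x) \<bullet> ?k = - ((transpose x ** G) \<bullet> ?k)"
      using inner_transpose[of "transpose G ** x" ?k] by (simp add: matrix_transpose_mul[of "transpose G"] k)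
    have 2: "(x ** transpose G ** x) \<bullet> u = (transpose G ** x) \<bullet> ?k"
      unfolding matrix_mul_assoc[symmetric] by (rule inner_matrix_mult_left)
    have "canonical_metric x ?v u = G \<bullet> u"
      unfolding canonical_metric_eq xv by (simp add: inner_diff_left 1 2)
    also have "\<dots> = mderiv stiefel \<phi> x u"
      unfolding G_def euclidean_gradient_inner[OF dh] by (rule mderiv_local[OF U x u, symmetric])
    finally show ?thesis .
  qed
  show "canonical_metric x ?v u = mderiv stiefel \<phi> x u" if "u \<in> stiefel_tangent x" using g that .
  show "riemannian_gradient stiefel stiefel_tangent canonical_metric \<phi> x = ?v"
    unfolding riemannian_gradient_def
  proof (rule the_equality)
    show "?v \<in> stiefel_tangent x \<and> (\<forall>u\<in>stiefel_tangent x. canonical_metric x ?v u = mderiv stiefel \<phi> x u)"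
      using tan g by blast
    fix w assume w: "w \<in> stiefel_tangent x \<and> (\<forall>u\<in>stiefel_tangent x. canonical_metric x w u = mderiv stiefel \<phi> x u)"
    then have "w - ?v \<in> stiefel_tangent x" using tan subspace_diff[OF subspace_stiefel_tangent] by blast
    then have "canonical_metric x (w - ?v) (w - ?v) = 0"
      using w g by (simp add: canonical_metric_bilinear(2))
    then have "w - ?v = 0" by (rule canonical_metric_pos[OF x])
    then show "w = ?v" by simp
  qed
qed

text \<open>The gradient is defined pointwise by a unique description; the formula in terms of a
  local extension shows that it is smooth.\<close>

lemma gradient_stiefel:
  assumes \<phi>: "smooth_on_submanifold stiefel \<phi>"
  defines "grad \<equiv> riemannian_gradient stiefel stiefel_tangent canonical_metric \<phi>"
  shows "smooth_vector_field stiefel stiefel_tangent grad"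
    and "x \<in> stiefel \<Longrightarrow> u \<in> stiefel_tangent x \<Longrightarrow> canonical_metric x (grad x) u = mderiv stiefel \<phi> x u"
proof -
  show "smooth_vector_field stiefel stiefel_tangent grad"
    unfolding smooth_vector_field_def
  proof (intro conjI ballI)
    show "smooth_on_submanifold stiefel grad"
    proof (rule smooth_on_submanifold_local)
      fix x :: "real^'a^'b" assume x: "x \<in> stiefel"
      obtain U h where U: "open U" "x \<in> U" "smooth_on U h" "\<forall>y\<in>U \<inter> stiefel. h y = \<phi> y"
        using smooth_on_submanifoldE[OF \<phi> x] by blast
      have "smooth_on U (euclidean_gradient h)"
        unfolding euclidean_gradient_def smooth_on_def
        by (intro allI Ck_on_sum U(1) finite_Basis Ck_on_bilinear[OF U(1) bounded_bilinear_scaleR] Ck_on_const smooth_onD[OF smooth_on_derivative[OF U(3)]])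
      then have "smooth_on U (\<lambda>y. euclidean_gradient h y - y ** transpose (euclidean_gradient h y) ** y)"
        by (intro smooth_matrix_intros U(1))
      moreover have "\<forall>y\<in>U \<inter> stiefel. euclidean_gradient h y - y ** transpose (euclidean_gradient h y) ** y = grad y"
        unfolding grad_def using gradient_stiefel_local(1)[OF U(1) _ U(3,4)] by simp
      ultimately show "\<exists>U h. open U \<and> x \<in> U \<and> smooth_on U h \<and> (\<forall>y\<in>U \<inter> stiefel. h y = grad y)"
        using U(1,2) by blast
    qed
    fix x :: "real^'a^'b" assume x: "x \<in> stiefel"
    obtain U h where U: "open U" "x \<in> U" "smooth_on U h" "\<forall>y\<in>U \<inter> stiefel. h y = \<phi> y"
      using smooth_on_submanifoldE[OF \<phi> x] by blast
    show "grad x \<in> stiefel_tangent x"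
      unfolding grad_def gradient_stiefel_local(1)[OF U x] by (rule gradient_stiefel_local(2)[OF U x])
  qed
  show "canonical_metric x (grad x) u = mderiv stiefel \<phi> x u" if x: "x \<in> stiefel" and u: "u \<in> stiefel_tangent x"
  proof -
    obtain U h where U: "open U" "x \<in> U" "smooth_on U h" "\<forall>y\<in>U \<inter> stiefel. h y = \<phi> y"
      using smooth_on_submanifoldE[OF \<phi> x] by blast
    show ?thesis
      unfolding grad_def gradient_stiefel_local(1)[OF U x] by (rule gradient_stiefel_local(3)[OF U x u])
  qed
qed

lemma mderiv_cong:
  assumes "\<And>y. y \<in> stiefel \<Longrightarrow> f y = g y" "x \<in> stiefel"
  shows "mderiv stiefel f x = mderiv stiefel g x"
proof -
  have "(f has_derivative D) (at x within stiefel) \<longleftrightarrow> (g has_derivative D) (at x within stiefel)" for D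
    using has_derivative_transform[OF assms(2)] assms(1) by (metis (no_types, lifting))
  then show ?thesis by (simp add: mderiv_def[abs_def] frechet_derivative_def)
qed

theorem laplace_beltrami_stiefel:
  assumes \<phi>: "smooth_on_submanifold stiefel \<phi>" and x: "x \<in> stiefel"
  shows "laplace_beltrami stiefel stiefel_tangent canonical_metric \<phi> x =
    (\<Sum>i\<in>UNIV. mderiv stiefel (\<lambda>y. mderiv stiefel \<phi> y (stiefel_field i y)) x (stiefel_field i x))"
proof -
  let ?grad = "riemannian_gradient stiefel stiefel_tangent canonical_metric \<phi>"
  let ?s = "\<lambda>i. stiefel_field i"
  have grad: "smooth_vector_field stiefel stiefel_tangent ?grad" by (rule gradient_stiefel(1)[OF \<phi>])
  have conn: "stiefel_connection x (?s i x) (?s i) = field_derivative i x (?s i x) + christoffel x (?s i x) (?s i x)" for i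
    unfolding stiefel_connection_def mderiv_eq[OF x stiefel_field_tangent[OF x] stiefel_field_has_derivative] ..
  have gr: "linear (\<lambda>w. canonical_metric x c w)" for c by (rule linearI; simp add: canonical_metric_bilinear)
  have "laplace_beltrami stiefel stiefel_tangent canonical_metric \<phi> x =
     (\<Sum>i\<in>UNIV. canonical_metric x (stiefel_connection x (?s i x) ?grad) (?s i x))"
    unfolding laplace_beltrami_def by (rule divergence_stiefel[OF grad x])
  \<comment> \<open>Compatibility with the metric: the derivative of the product of the gradient
    with a field, minus the term in which the field itself is differentiated.\<close>
  also have "\<dots> = (\<Sum>i\<in>UNIV. mderiv stiefel (\<lambda>y. canonical_metric y (?grad y) (?s i y)) x (?s i x)
      - canonical_metric x (?grad x) (stiefel_connection x (?s i x) (?s i)))"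
    by (intro sum.cong refl) (simp add: stiefel_connection_metric[OF grad stiefel_field_svf x stiefel_field_tangent[OF x]])
  also have "\<dots> = (\<Sum>i\<in>UNIV. mderiv stiefel (\<lambda>y. canonical_metric y (?grad y) (?s i y)) x (?s i x))
      - canonical_metric x (?grad x) (\<Sum>i\<in>UNIV. stiefel_connection x (?s i x) (?s i))"
    by (simp add: sum_subtractf linear_sum[OF gr])
  also have "(\<Sum>i\<in>UNIV. stiefel_connection x (?s i x) (?s i)) = 0"
    unfolding conn by (rule sum_field_acceleration[OF x])
  also have "canonical_metric x (?grad x) 0 = 0" by (rule linear_0[OF gr])
  finally have "laplace_beltrami stiefel stiefel_tangent canonical_metric \<phi> x =
    (\<Sum>i\<in>UNIV. mderiv stiefel (\<lambda>y. canonical_metric y (?grad y) (?s i y)) x (?s i x))" by simp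
  \<comment> \<open>On the manifold the metric product with the gradient is the derivative of
    \<phi>, and \<open>mderiv\<close> depends on the values there only.\<close>
  moreover have "mderiv stiefel (\<lambda>y. canonical_metric y (?grad y) (?s i y)) x = mderiv stiefel (\<lambda>y. mderiv stiefel \<phi> y (?s i y)) x" for i
    by (rule mderiv_cong[OF gradient_stiefel(2)[OF \<phi>] x]) (auto intro: stiefel_field_tangent)
  ultimately show ?thesis by simp
qed

text \<open>Translates the intrinsic second derivative into the ambient first and second derivatives
  that enter \<open>generator_limit\<close>. The field varies with the point, whence the term with
  \<open>field_derivative\<close>.\<close>

lemma second_derivative_along_field:
  fixes h \<phi> :: "real^'p^'n \<Rightarrow> real"
  assumes U: "open U" "x \<in> U" "smooth_on U h" "\<forall>y\<in>U \<inter> stiefel. h y = \<phi> y" and x: "x \<in> stiefel"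
  shows "mderiv stiefel (\<lambda>y. mderiv stiefel \<phi> y (stiefel_field i y)) x (stiefel_field i x) =
    frechet_derivative h (at x) (field_derivative i x (stiefel_field i x)) +
    frechet_derivative (\<lambda>y. frechet_derivative h (at y) (stiefel_field i x)) (at x) (stiefel_field i x)"
proof -
  let ?s = "stiefel_field i" and ?D = "\<lambda>y. frechet_derivative h (at y)"
  have s_smooth: "smooth_on U ?s" by (rule smooth_on_subset[OF stiefel_field_smooth]) simp
  have eq: "\<forall>y\<in>U \<inter> stiefel. ?D y (?s y) = mderiv stiefel \<phi> y (?s y)"
    by (auto intro!: mderiv_local[OF U(1) _ U(3,4), symmetric] stiefel_field_tangent)
  have "mderiv stiefel (\<lambda>y. mderiv stiefel \<phi> y (?s y)) x (?s x) = frechet_derivative (\<lambda>y. ?D y (?s y)) (at x) (?s x)"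
    by (rule mderiv_local[OF U(1,2) smooth_on_directional[OF U(1,3) s_smooth] eq x stiefel_field_tangent[OF x]])
  moreover have "((\<lambda>y. ?D y (?s y)) has_derivative (\<lambda>v. ?D x (field_derivative i x v) + frechet_derivative (\<lambda>y. ?D y (?s x)) (at x) v)) (at x)"
  proof -
    have d: "((\<lambda>y. ?D y b) has_derivative frechet_derivative (\<lambda>y. ?D y b) (at x)) (at x)" for b
      by (rule smooth_on_has_derivative[OF smooth_on_derivative[OF U(3)] U(2)])
    have dh: "h differentiable (at y)" if "y \<in> U" for y
      using smooth_on_has_derivative[OF U(3) that] by (auto simp: differentiable_def)
    have expand: "?D y w = (\<Sum>b\<in>Basis. (w \<bullet> b) * ?D y b)" if "y \<in> U" for y w
      using frechet_derivative_expansion[OF dh[OF that], of w] by simp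
    \<comment> \<open>In coordinates the varying direction becomes a family of scalar factors, so
      that the product rule applies to each term.\<close>
    have s1: "((\<lambda>y. \<Sum>b\<in>Basis. (?s y \<bullet> b) * ?D y b) has_derivative
       (\<lambda>v. \<Sum>b\<in>Basis. (?s x \<bullet> b) * frechet_derivative (\<lambda>y. ?D y b) (at x) v + (field_derivative i x v \<bullet> b) * ?D x b)) (at x)"
      by (intro has_derivative_sum has_derivative_mult has_derivative_inner_left stiefel_field_has_derivative d)
    have s2: "((\<lambda>y. \<Sum>b\<in>Basis. (?s x \<bullet> b) * ?D y b) has_derivative
       (\<lambda>v. \<Sum>b\<in>Basis. (?s x \<bullet> b) * frechet_derivative (\<lambda>y. ?D y b) (at x) v)) (at x)"
      by (intro has_derivative_sum has_derivative_mult_right d)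
    have "((\<lambda>y. ?D y (?s x)) has_derivative (\<lambda>v. \<Sum>b\<in>Basis. (?s x \<bullet> b) * frechet_derivative (\<lambda>y. ?D y b) (at x) v)) (at x)"
      by (rule has_derivative_transform_within_open[OF s2 U(1,2)]) (rule expand[symmetric])
    then have fd: "frechet_derivative (\<lambda>y. ?D y (?s x)) (at x) = (\<lambda>v. \<Sum>b\<in>Basis. (?s x \<bullet> b) * frechet_derivative (\<lambda>y. ?D y b) (at x) v)"
      by (rule frechet_derivative_at[symmetric])
    have "((\<lambda>y. ?D y (?s y)) has_derivative
       (\<lambda>v. \<Sum>b\<in>Basis. (?s x \<bullet> b) * frechet_derivative (\<lambda>y. ?D y b) (at x) v + (field_derivative i x v \<bullet> b) * ?D x b)) (at x)"
      by (rule has_derivative_transform_within_open[OF s1 U(1,2)]) (rule expand[symmetric])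
    then show ?thesis
      unfolding fd expand[OF U(2), of "field_derivative i x _"] by (simp add: sum.distrib add.commute)
  qed
  then have "frechet_derivative (\<lambda>y. ?D y (?s y)) (at x) = (\<lambda>v. ?D x (field_derivative i x v) + frechet_derivative (\<lambda>y. ?D y (?s x)) (at x) v)"
    by (rule frechet_derivative_at[symmetric])
  ultimately show ?thesis by simp
qed

section \<open>The Stiefel diffusion\<close>

lemma field_derivative_bilinear: "bounded_bilinear (field_derivative i :: real^'p^'n \<Rightarrow> _)"
proof -
  obtain u v where i: "i = (u, v)" by (cases i)
  have "bilinear (field_derivative i :: real^'p^'n \<Rightarrow> _)"
    unfolding bilinear_def i field_derivative_def prod.case
    by (auto intro!: linearI simp: matrix_mult_simps transpose_simps algebra_simps)
  then show ?thesis by (simp add: bilinear_conv_bounded_bilinear)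
qed

text \<open>The field is quadratic up to a constant, so the second-order Taylor formula is
  exact.\<close>

lemma stiefel_field_expansion:
  "stiefel_field i y - stiefel_field i x = field_derivative i x (y - x) + (1/2) *\<^sub>R field_derivative i (y - x) (y - x)"
proof -
  obtain u v where i: "i = (u, v)" by (cases i)
  define E where "E = (matrix_unit u v :: real^'a^'b)"
  have half: "(1/2) *\<^sub>R field_derivative i d d = - stiefel_alpha *\<^sub>R (d ** transpose E ** d) - stiefel_beta *\<^sub>R (d ** transpose d ** E)" for d
  proof -
    have "field_derivative i d d = (- stiefel_alpha *\<^sub>R (d ** transpose E ** d) - stiefel_beta *\<^sub>R (d ** transpose d ** E)) +
       (- stiefel_alpha *\<^sub>R (d ** transpose E ** d) - stiefel_beta *\<^sub>R (d ** transpose d ** E))"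
      by (simp add: i field_derivative_def E_def algebra_simps)
    then show ?thesis by (simp only: scaleR_half_double)
  qed
  show ?thesis
    unfolding half unfolding i stiefel_field_def field_derivative_def prod.case E_def
    by (simp add: matrix_mult_simps transpose_simps algebra_simps)
qed

text \<open>The estimates that the abstract equation asks for, with a common constant. They follow
  from compactness of the manifold and bilinearity of \<open>field_derivative\<close>.\<close>

lemma stiefel_constants:
  obtains C where "1 \<le> C" "\<And>x :: real^'p^'n. x \<in> stiefel \<Longrightarrow> norm x \<le> C"
    "\<And>i x :: real^'p^'n. x \<in> stiefel \<Longrightarrow> norm (stiefel_field i x) \<le> C"
    "\<And>i (x :: real^'p^'n) v. x \<in> stiefel \<Longrightarrow> norm (field_derivative i x v) \<le> C * norm v"
    "\<And>i x y :: real^'p^'n. x \<in> stiefel \<Longrightarrow> y \<in> stiefel \<Longrightarrow> norm (stiefel_field i y - stiefel_field i x) \<le> C * norm (y - x)"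
    "\<And>i x y :: real^'p^'n. x \<in> stiefel \<Longrightarrow> y \<in> stiefel \<Longrightarrow> 
       norm (stiefel_field i y - stiefel_field i x - field_derivative i x (y - x)) \<le> C * (norm (y - x))\<^sup>2"
proof -
  define q where "q = sqrt (real CARD('p))"
  have q: "0 \<le> q" by (simp add: q_def)
  have "\<exists>K\<ge>0. \<forall>x z :: real^'p^'n. norm (field_derivative i x z) \<le> norm x * norm z * K" for i
    using bounded_bilinear.nonneg_bounded[OF field_derivative_bilinear[of i]] by blast
  then obtain k where k: "\<And>i. 0 \<le> k i" "\<And>i (x :: real^'p^'n) z. norm (field_derivative i x z) \<le> norm x * norm z * k i" by metis
  define K where "K = (\<Sum>i\<in>UNIV. k i)"
  have kK: "k i \<le> K" for i unfolding K_def by (rule member_le_sum) (use k in auto)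
  have K: "0 \<le> K" unfolding K_def by (intro sum_nonneg k)
  have D: "norm (field_derivative i x z) \<le> norm x * norm z * K" for i and x z :: "real^'p^'n"
    by (rule order_trans[OF k(2)]) (intro mult_left_mono kK mult_nonneg_nonneg norm_ge_zero)
  have "\<exists>b. \<forall>x\<in>stiefel. norm (stiefel_field i x) \<le> b" for i :: "'n \<times> 'p"
  proof -
    have "continuous_on stiefel (stiefel_field i)"
      using smooth_on_submanifold_continuous[OF svf_smooth[OF stiefel_field_svf]] .
    then have "bounded (stiefel_field i ` stiefel)"
      by (intro compact_imp_bounded compact_continuous_image compact_stiefel)
    then show ?thesis unfolding bounded_iff by auto
  qed
  then obtain b where b: "\<And>i x :: real^'p^'n. x \<in> stiefel \<Longrightarrow> norm (stiefel_field i x) \<le> b i" by metis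
  define s where "s = (\<Sum>i\<in>UNIV. \<bar>b i\<bar>)"
  have bs: "b i \<le> s" for i
    using member_le_sum[of i UNIV "\<lambda>i. \<bar>b i\<bar>"] by (simp add: s_def)
  have s: "0 \<le> s" unfolding s_def by (intro sum_nonneg) auto
  \<comment> \<open>The last summand is for the Lipschitz estimate: q K from the linear part, and 2
    q K from the quadratic one because two points are at distance at most 2 q.\<close>
  define C where "C = 1 + q + s + K + 3 * (q * K)"
  have qK: "0 \<le> q * K" using q K by simp
  have taylor: "norm (stiefel_field i y - stiefel_field i x - field_derivative i x (y - x)) \<le> K * (norm (y - x))\<^sup>2" for i and x y :: "real^'p^'n"
  proof -
    have "norm (stiefel_field i y - stiefel_field i x - field_derivative i x (y - x)) = (1/2) * norm (field_derivative i (y - x) (y - x))"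
      unfolding stiefel_field_expansion by simp
    also have "\<dots> \<le> norm (field_derivative i (y - x) (y - x))" by simp
    also have "\<dots> \<le> norm (y - x) * norm (y - x) * K" by (rule D)
    finally show ?thesis by (simp add: power2_eq_square mult_ac)
  qed
  show thesis
  proof (rule that[of C])
    show "1 \<le> C" using q s K qK by (simp add: C_def)
    fix x :: "real^'p^'n" assume x: "x \<in> stiefel"
    have nx: "norm x = q" using bounded_stiefel[OF x] by (simp add: q_def)
    show "norm x \<le> C" using nx q s K qK by (simp add: C_def)
    fix i :: "'n \<times> 'p"
    show "norm (stiefel_field i x) \<le> C" using b[OF x, of i] bs[of i] q K qK unfolding C_def by linarith
    have Dx: "norm (field_derivative i x v) \<le> (q * K) * norm v" for v using D[of i x v] by (simp add: nx mult_ac)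
    show "norm (field_derivative i x v) \<le> C * norm v" for v
      by (rule order_trans[OF Dx], rule mult_right_mono) (use q s K qK in \<open>auto simp: C_def\<close>)
    fix y :: "real^'p^'n" assume y: "y \<in> stiefel"
    have "K * (norm (y - x))\<^sup>2 \<le> C * (norm (y - x))\<^sup>2" using q s K qK by (intro mult_right_mono) (auto simp: C_def)
    with taylor[of i y x] show "norm (stiefel_field i y - stiefel_field i x - field_derivative i x (y - x)) \<le> C * (norm (y - x))\<^sup>2"
      by linarith
    have ny: "norm y = q" using bounded_stiefel[OF y] by (simp add: q_def)
    have "norm (y - x) \<le> 2 * q" using norm_triangle_ineq4[of y x] nx ny by linarith
    then have "K * norm (y - x) * norm (y - x) \<le> K * (2 * q) * norm (y - x)"
      using K by (intro mult_right_mono mult_left_mono) auto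
    moreover have "norm (stiefel_field i y - stiefel_field i x) \<le>
        norm (stiefel_field i y - stiefel_field i x - field_derivative i x (y - x)) + norm (field_derivative i x (y - x))"
      using norm_triangle_ineq[of "stiefel_field i y - stiefel_field i x - field_derivative i x (y - x)" "field_derivative i x (y - x)"]
      by simp
    moreover have "K * (2 * q) * norm (y - x) + (q * K) * norm (y - x) = (3 * (q * K)) * norm (y - x)"
      by (simp add: algebra_simps)
    moreover have "(3 * (q * K)) * norm (y - x) \<le> C * norm (y - x)"
      using q s K qK by (intro mult_right_mono) (auto simp: C_def)
    ultimately show "norm (stiefel_field i y - stiefel_field i x) \<le> C * norm (y - x)"
      using taylor[of i y x] Dx[of "y - x"] unfolding power2_eq_square mult.assoc by linarith
  qed
qed

theorem theorem2p7:
  fixes P :: "'w measure"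
    and F :: "real \<Rightarrow> 'w measure"
    and B :: "'n::finite \<times> 'p::finite \<Rightarrow> real \<Rightarrow> 'w \<Rightarrow> real"
    and W :: "real \<Rightarrow> 'w \<Rightarrow> real^'p^'n"
    and \<phi> :: "real^'p^'n \<Rightarrow> real"
    and w0 :: "real^'p^'n"
  assumes "CARD('p) \<le> CARD('n)"
    and "prob_space P"
    and "filtration (space P) F"
    and "\<And>t. subalgebra P (F t)"
    and "independent_brownian_motions P F B"
    and "stratonovich_solution P F B stiefel_field W"
    and "\<And>t \<omega>. 0 \<le> t \<Longrightarrow> \<omega> \<in> space P \<Longrightarrow> W t \<omega> \<in> stiefel"
    and "w0 \<in> stiefel"
    and "AE \<omega> in P. W 0 \<omega> = w0"
    and "smooth_on_submanifold stiefel \<phi>"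
  shows "((\<lambda>t. (prob_space.expectation P (\<lambda>\<omega>. \<phi> (W t \<omega>)) - \<phi> w0) / t) \<longlongrightarrow>
           1/2 * laplace_beltrami stiefel stiefel_tangent canonical_metric \<phi> w0) (at_right 0)"
proof -
  obtain C where C: "1 \<le> C" "\<And>x :: real^'p^'n. x \<in> stiefel \<Longrightarrow> norm x \<le> C"
    "\<And>i x :: real^'p^'n. x \<in> stiefel \<Longrightarrow> norm (stiefel_field i x) \<le> C"
    "\<And>i (x :: real^'p^'n) v. x \<in> stiefel \<Longrightarrow> norm (field_derivative i x v) \<le> C * norm v"
    "\<And>i x y :: real^'p^'n. x \<in> stiefel \<Longrightarrow> y \<in> stiefel \<Longrightarrow> norm (stiefel_field i y - stiefel_field i x) \<le> C * norm (y - x)"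
    "\<And>i x y :: real^'p^'n. x \<in> stiefel \<Longrightarrow> y \<in> stiefel \<Longrightarrow> 
       norm (stiefel_field i y - stiefel_field i x - field_derivative i x (y - x)) \<le> C * (norm (y - x))\<^sup>2"
    by (rule stiefel_constants, rule that)
  interpret prob_space P by fact
  interpret filtration "space P" F by fact
  \<comment> \<open>The abstract derivative \<open>S\<close> is \<open>field_derivative\<close>,
    with the estimates from \<open>stiefel_constants\<close>.\<close>
  interpret stratonovich_flow P F B W stiefel_field field_derivative stiefel C w0
  proof (intro stratonovich_flow.intro brownian_family.intro filtered_prob_space.intro filtered_prob_space_axioms.intro
      brownian_family_axioms.intro stratonovich_flow_axioms.intro)
    show "linear (field_derivative i x)" for i and x :: "real^'p^'n"
      using bounded_bilinear.bounded_linear_right[OF field_derivative_bilinear] bounded_linear.linear by blast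
    show "continuous_on stiefel (\<lambda>x :: real^'p^'n. field_derivative i x (stiefel_field j x))" for i j
      by (intro bounded_bilinear.continuous_on[OF field_derivative_bilinear] continuous_on_id
          smooth_on_submanifold_continuous[OF svf_smooth[OF stiefel_field_svf]])
  qed (use assms C compact_stiefel in auto)
  \<comment> \<open>An extension near \<open>w0\<close> is enough: the Taylor hypothesis of
    \<open>generator_limit\<close> is local, and elsewhere \<phi> enters by its continuity on the
    manifold.\<close>
  obtain U h where U: "open U" "w0 \<in> U" "smooth_on U h" "\<forall>y\<in>U \<inter> stiefel. h y = \<phi> y"
    using smooth_on_submanifoldE[OF \<open>smooth_on_submanifold stiefel \<phi>\<close> \<open>w0 \<in> stiefel\<close>] by blast
  define A where "A = frechet_derivative h (at w0)"
  define H where "H u v = frechet_derivative (\<lambda>y. frechet_derivative h (at y) u) (at w0) v" for u v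
  have A: "bounded_linear A"
    unfolding A_def using smooth_on_has_derivative[OF U(3,2)] has_derivative_bounded_linear by blast
  have H: "bounded_bilinear H"
    unfolding H_def[abs_def] by (rule bounded_bilinear_second_derivative[OF U(1,3,2)])
  have "((\<lambda>t. (expectation (\<lambda>\<omega>. \<phi> (W t \<omega>)) - \<phi> w0) / t) \<longlongrightarrow>
     A (drift w0) + (1/2) * (\<Sum>i\<in>UNIV. H (stiefel_field i w0) (stiefel_field i w0))) (at_right 0)"
  proof (rule generator_limit[OF smooth_on_submanifold_continuous[OF \<open>smooth_on_submanifold stiefel \<phi>\<close>] A H])
    fix e :: real assume e: "0 < e"
    obtain \<delta> where \<delta>: "0 < \<delta>" "\<forall>y. norm (y - w0) < \<delta> \<longrightarrow>
        \<bar>h y - h w0 - A (y - w0) - (1/2) * H (y - w0) (y - w0)\<bar> \<le> e * (norm (y - w0))\<^sup>2"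
      using second_order_taylor[OF U(1,2,3) e] unfolding A_def H_def by blast
    obtain r where r: "0 < r" "ball w0 r \<subseteq> U" using U(1,2) open_contains_ball by blast
    have h: "h y = \<phi> y" if "y \<in> stiefel" "norm (y - w0) < r" for y
    proof -
      have "y \<in> ball w0 r" using that(2) by (simp add: dist_norm norm_minus_commute)
      then show ?thesis using r(2) U(4) that(1) by blast
    qed
    show "\<exists>\<delta>>0. \<forall>y\<in>stiefel. norm (y - w0) < \<delta> \<longrightarrow>
       \<bar>\<phi> y - \<phi> w0 - A (y - w0) - (1/2) * H (y - w0) (y - w0)\<bar> \<le> e * (norm (y - w0))\<^sup>2"
    proof (intro exI[of _ "min \<delta> r"] conjI ballI impI)
      show "0 < min \<delta> r" using \<delta> r by simp
      fix y :: "real^'p^'n" assume y: "y \<in> stiefel" "norm (y - w0) < min \<delta> r"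
      have "h y = \<phi> y" using h y by simp
      moreover have "h w0 = \<phi> w0" using h[OF \<open>w0 \<in> stiefel\<close>] r by simp
      ultimately show "\<bar>\<phi> y - \<phi> w0 - A (y - w0) - (1/2) * H (y - w0) (y - w0)\<bar> \<le> e * (norm (y - w0))\<^sup>2"
        using \<delta>(2)[rule_format, of y] y by simp
    qed
  qed
  \<comment> \<open>\<open>drift\<close> carries the factor 1/2, so for each field its contribution
    and half of the Hessian term add up to half of the second derivative of \<phi> along that
    field.\<close>
  also have "A (drift w0) + (1/2) * (\<Sum>i\<in>UNIV. H (stiefel_field i w0) (stiefel_field i w0)) =
     1/2 * laplace_beltrami stiefel stiefel_tangent canonical_metric \<phi> w0"
  proof -
    interpret A: bounded_linear A by (rule A)
    have "laplace_beltrami stiefel stiefel_tangent canonical_metric \<phi> w0 =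
       (\<Sum>i\<in>UNIV. A (field_derivative i w0 (stiefel_field i w0)) + H (stiefel_field i w0) (stiefel_field i w0))"
      unfolding laplace_beltrami_stiefel[OF \<open>smooth_on_submanifold stiefel \<phi>\<close> \<open>w0 \<in> stiefel\<close>] A_def H_def
      by (intro sum.cong refl second_derivative_along_field[OF U \<open>w0 \<in> stiefel\<close>])
    then show ?thesis by (simp add: drift_def A.scaleR A.sum sum.distrib)
  qed
  finally show ?thesis .
qed

end
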